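(* Let $G$ be a countable group with a non-elementary action by isometries on a geodesic hyperbolic metric space $X$, such that at least one element of $G$ is WPD for this action. Let $\mu$ be a generating probability measure on $G$ with finite entropy. Let $\partial X$ be the hyperbolic (Gromov) boundary of $X$, and let $\nu$ be the hitting measure on $\partial X$ of the random walk driven by $\mu$. Then $(\partial X,\nu)$ is the Poisson boundary of $(G,\mu)$.
   Context: An element $g$ is loxodromic if $\lim_{n\to\infty} d(g^n o,o)/n>0$ for a (any) base point $o\in X$. The action (or a semigroup of isometries) is non-elementary if it contains two loxodromic elements with disjoint fixed point sets in $\partial X$. For $K>0$ and $x,y\in X$, $\mathrm{Stab}_K(x,y)=\{g\in G: d(x,gx)\le K,\ d(y,gy)\le K\}$. An element $g\in G$ is WPD if it is loxodromic and for any $x\in X$ and any $K\ge0$ there exists $P\ge1$ such that $\mathrm{Stab}_K(x,g^Px)$ is finite. A measure $\mu$ is generating if the semigroup generated by its support is $G$; finite entropy means $-\sum_g\mu(g)\log\mu(g)<\infty$. The random walk is $w_n=g_1\cdots g_n$ with $g_i$ i.i.d. of law $\mu$; for $o\in X$, $w_no$ converges almost surely to a point of $\partial X$, and $\nu(A)=\mathbb{P}(\lim_n w_no\in A)$. The Poisson boundary of $(G,\mu)$ is the maximal $\mu$-boundary (space of ergodic components of the shift-tail equivalence relation on sample paths with the image of the path measure); the claim is that $(\partial X,\nu)$ with the limit-point map is isomorphic to it as a measure $G$-space. *)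

theory Defs
  imports "HOL-Probability.Probability" "HOL-Algebra.Group"
begin

definition gprod :: "'x::metric_space \<Rightarrow> 'x \<Rightarrow> 'x \<Rightarrow> real" where
  "gprod w x y = (dist w x + dist w y - dist x y) / 2"

definition geodesic_space :: "'x::metric_space set \<Rightarrow> bool" where
  "geodesic_space X \<longleftrightarrow> (\<forall>x\<in>X. \<forall>y\<in>X. \<exists>\<gamma>::real \<Rightarrow> 'x.
      \<gamma> 0 = x \<and> \<gamma> (dist x y) = y \<and> \<gamma> ` {0..dist x y} \<subseteq> X \<and>
      (\<forall>s\<in>{0..dist x y}. \<forall>t\<in>{0..dist x y}. dist (\<gamma> s) (\<gamma> t) = \<bar>s - t\<bar>))"

definition gromov_hyperbolic :: "'x::metric_space set \<Rightarrow> bool" where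
  "gromov_hyperbolic X \<longleftrightarrow> (\<exists>\<delta>\<ge>0. \<forall>x\<in>X. \<forall>y\<in>X. \<forall>z\<in>X. \<forall>w\<in>X.
      gprod w x z \<ge> min (gprod w x y) (gprod w y z) - \<delta>)"

definition conv_inf :: "'x::metric_space \<Rightarrow> (nat \<Rightarrow> 'x) \<Rightarrow> bool" where
  "conv_inf x0 xs \<longleftrightarrow> (\<forall>R. \<exists>N. \<forall>i\<ge>N. \<forall>j\<ge>N. gprod x0 (xs i) (xs j) \<ge> R)"

definition equiv_inf :: "'x::metric_space \<Rightarrow> (nat \<Rightarrow> 'x) \<Rightarrow> (nat \<Rightarrow> 'x) \<Rightarrow> bool" where
  "equiv_inf x0 xs ys \<longleftrightarrow> (\<forall>R. \<exists>N. \<forall>i\<ge>N. \<forall>j\<ge>N. gprod x0 (xs i) (ys j) \<ge> R)"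

definition bclass :: "'x::metric_space \<Rightarrow> (nat \<Rightarrow> 'x) \<Rightarrow> (nat \<Rightarrow> 'x) set" where
  "bclass x0 xs = {ys. conv_inf x0 ys \<and> equiv_inf x0 xs ys}"

definition gbd :: "'x::metric_space \<Rightarrow> (nat \<Rightarrow> 'x) set set" where
  "gbd x0 = {bclass x0 xs | xs. conv_inf x0 xs}"

definition converges_to :: "'x::metric_space \<Rightarrow> (nat \<Rightarrow> 'x) \<Rightarrow> (nat \<Rightarrow> 'x) set \<Rightarrow> bool" where
  "converges_to x0 xs \<xi> \<longleftrightarrow> conv_inf x0 xs \<and> bclass x0 xs = \<xi>"

definition bnbhd :: "'x::metric_space \<Rightarrow> (nat \<Rightarrow> 'x) set \<Rightarrow> real \<Rightarrow> (nat \<Rightarrow> 'x) set set" where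
  "bnbhd x0 \<xi> r = {\<eta> \<in> gbd x0. \<exists>xs ys. converges_to x0 xs \<xi> \<and> converges_to x0 ys \<eta> \<and>
      (\<exists>N. \<forall>i\<ge>N. \<forall>j\<ge>N. gprod x0 (xs i) (ys j) \<ge> r)}"

definition bopen :: "'x::metric_space \<Rightarrow> (nat \<Rightarrow> 'x) set set \<Rightarrow> bool" where
  "bopen x0 U \<longleftrightarrow> U \<subseteq> gbd x0 \<and> (\<forall>\<xi>\<in>U. \<exists>r. bnbhd x0 \<xi> r \<subseteq> U)"

definition bborel :: "'x::metric_space \<Rightarrow> (nat \<Rightarrow> 'x) set measure" where
  "bborel x0 = sigma (gbd x0) {U. bopen x0 U}"

definition isometric_action :: "('g, 'b) monoid_scheme \<Rightarrow> ('g \<Rightarrow> 'x::metric_space \<Rightarrow> 'x) \<Rightarrow> bool" where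
  "isometric_action G \<phi> \<longleftrightarrow>
     (\<forall>g\<in>carrier G. bij (\<phi> g) \<and> (\<forall>x y. dist (\<phi> g x) (\<phi> g y) = dist x y)) \<and>
     \<phi> \<one>\<^bsub>G\<^esub> = id \<and>
     (\<forall>g\<in>carrier G. \<forall>h\<in>carrier G. \<phi> (g \<otimes>\<^bsub>G\<^esub> h) = \<phi> g \<circ> \<phi> h)"

definition bact :: "('g \<Rightarrow> 'x \<Rightarrow> 'x) \<Rightarrow> 'g \<Rightarrow> (nat \<Rightarrow> 'x) set \<Rightarrow> (nat \<Rightarrow> 'x) set" where
  "bact \<phi> g \<xi> = (\<lambda>xs. \<phi> g \<circ> xs) ` \<xi>"

definition bfix :: "'x::metric_space \<Rightarrow> ('g \<Rightarrow> 'x \<Rightarrow> 'x) \<Rightarrow> 'g \<Rightarrow> (nat \<Rightarrow> 'x) set set" where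
  "bfix x0 \<phi> g = {\<xi> \<in> gbd x0. bact \<phi> g \<xi> = \<xi>}"

definition loxodromic :: "('g, 'b) monoid_scheme \<Rightarrow> ('g \<Rightarrow> 'x::metric_space \<Rightarrow> 'x) \<Rightarrow> 'g \<Rightarrow> bool" where
  "loxodromic G \<phi> g \<longleftrightarrow> g \<in> carrier G \<and>
     (\<exists>x L. L > 0 \<and> (\<lambda>n::nat. dist (\<phi> (g [^]\<^bsub>G\<^esub> n) x) x / real n) \<longlonglongrightarrow> L)"

definition non_elementary :: "('g, 'b) monoid_scheme \<Rightarrow> ('g \<Rightarrow> 'x::metric_space \<Rightarrow> 'x) \<Rightarrow> 'x \<Rightarrow> bool" where
  "non_elementary G \<phi> x0 \<longleftrightarrow> (\<exists>g h. loxodromic G \<phi> g \<and> loxodromic G \<phi> h \<and>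
      bfix x0 \<phi> g \<inter> bfix x0 \<phi> h = {})"

definition stabK :: "('g, 'b) monoid_scheme \<Rightarrow> ('g \<Rightarrow> 'x::metric_space \<Rightarrow> 'x) \<Rightarrow> real \<Rightarrow> 'x \<Rightarrow> 'x \<Rightarrow> 'g set" where
  "stabK G \<phi> K x y = {g \<in> carrier G. dist x (\<phi> g x) \<le> K \<and> dist y (\<phi> g y) \<le> K}"

definition WPD :: "('g, 'b) monoid_scheme \<Rightarrow> ('g \<Rightarrow> 'x::metric_space \<Rightarrow> 'x) \<Rightarrow> 'g \<Rightarrow> bool" where
  "WPD G \<phi> g \<longleftrightarrow> loxodromic G \<phi> g \<and>
     (\<forall>x. \<forall>K\<ge>0. \<exists>P::nat. P \<ge> 1 \<and> finite (stabK G \<phi> K x (\<phi> (g [^]\<^bsub>G\<^esub> P) x)))"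

inductive_set sgen :: "('g, 'b) monoid_scheme \<Rightarrow> 'g set \<Rightarrow> 'g set" for G S where
  base: "x \<in> S \<Longrightarrow> x \<in> sgen G S"
| mult: "x \<in> sgen G S \<Longrightarrow> y \<in> sgen G S \<Longrightarrow> x \<otimes>\<^bsub>G\<^esub> y \<in> sgen G S"

definition generating :: "('g, 'b) monoid_scheme \<Rightarrow> 'g pmf \<Rightarrow> bool" where
  "generating G \<mu> \<longleftrightarrow> sgen G (set_pmf \<mu>) = carrier G"

definition finite_entropy :: "'g pmf \<Rightarrow> bool" where
  "finite_entropy \<mu> \<longleftrightarrow> (\<lambda>g. - (pmf \<mu> g * ln (pmf \<mu> g))) summable_on UNIV"

fun rw :: "('g, 'b) monoid_scheme \<Rightarrow> (nat \<Rightarrow> 'g) \<Rightarrow> nat \<Rightarrow> 'g" where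
  "rw G \<omega> 0 = \<one>\<^bsub>G\<^esub>"
| "rw G \<omega> (Suc n) = rw G \<omega> n \<otimes>\<^bsub>G\<^esub> \<omega> n"

definition path_measure :: "('g, 'b) monoid_scheme \<Rightarrow> 'g pmf \<Rightarrow> (nat \<Rightarrow> 'g) measure" where
  "path_measure G \<mu> = distr (PiM UNIV (\<lambda>_. measure_pmf \<mu>)) (PiM UNIV (\<lambda>_. count_space UNIV)) (rw G)"

text \<open>The boundary map bnd (the limit-point map) exhibits (gbd, distr P bnd) as the
  Poisson boundary: it is the a.s. limit of w_n x0, it is measurable, and it generates the
  sigma-algebra of shift-invariant events (= unions of shift-tail classes) modulo null sets.\<close>
definition poisson_limit_map ::
  "('g, 'b) monoid_scheme \<Rightarrow> ('g \<Rightarrow> 'x::metric_space \<Rightarrow> 'x) \<Rightarrow> 'g pmf \<Rightarrow> 'x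
     \<Rightarrow> ((nat \<Rightarrow> 'g) \<Rightarrow> (nat \<Rightarrow> 'x) set) \<Rightarrow> bool" where
  "poisson_limit_map G \<phi> \<mu> x0 bnd \<longleftrightarrow>
     (let P = path_measure G \<mu> in
       bnd \<in> completion P \<rightarrow>\<^sub>M bborel x0 \<and>
       (AE w in P. converges_to x0 (\<lambda>n. \<phi> (w n) x0) (bnd w)) \<and>
       (\<forall>A \<in> sets P. (\<lambda>w. w \<circ> Suc) -` A = A \<longrightarrow>
          (\<exists>B \<in> sets (bborel x0).
             emeasure (completion P) ((A - bnd -` B) \<union> ((bnd -` B \<inter> space P) - A)) = 0)))"

end

theory Submission
  imports Defs
begin

text \<open>By Kaimanovich's entropy criterion it suffices that, given the limit point \<open>\<xi>\<close>, the position \<open>w\<^sub>n\<close> can be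
  encoded with \<open>o(n)\<close> nats on average. Call \<open>t\<close> pivotal if the walk after time \<open>t\<close> never backtracks by more than
  \<open>D\<close> from \<open>w\<^sub>t o\<close> towards \<open>o\<close>. For large \<open>D\<close> and \<open>R\<close>, times that are not pivotal or carry a jump longer than \<open>R\<close>
  are rare, so by finite entropy it costs at most \<open>\<epsilon>n\<close> nats to record the increments at these times. Between recorded
  increments the walk progresses along a quasi-geodesic, so the record determines \<open>d(o, w\<^sub>n o)\<close> up to an error
  linear in \<open>n\<close>. If \<open>n\<close> and \<open>n + m\<close> are pivotal, then \<open>w\<^sub>n o\<close> and \<open>w\<^bsub>n+m\<^esub> o\<close> lie near the ray from \<open>o\<close> to \<open>\<xi>\<close>; since the
  WPD element makes the coarse stabilizer of \<open>(o, w\<^sub>m o)\<close> finite with high probability, only \<open>O(n\<^sup>2)\<close> positions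
  \<open>w\<^sub>n\<close> are compatible with \<open>\<xi>\<close> and the record. On the remaining event of small probability \<open>w\<^sub>n\<close> is encoded by its
  law. No moment condition is needed because the uniform bounds on backtracking come from a concentration
  argument: a family of shadows with many disjoint translates has small mass for all the laws of the walk.\<close>

section \<open>Gromov products and loxodromic isometries\<close>

text \<open>X need not be proper: a ball, or a neighbourhood of a geodesic, may contain infinitely
  many orbit points. Only the coarse stabilizer of a pair of points is finite, which is why two
  positions, at times n and n + m with m fixed, are localized together. An error linear in n in the
  distance is harmless: it leaves polynomially many pairs of integer distances, and their logarithm
  is o(n). As the boundary need not be compact, no stationary measure on it is available at the
  start; the estimates are made for the laws of the walk at fixed times, uniformly in the time and
  in the point looked at. A maximal inequality of Ottaviani type carries them over to the whole
  future of the walk, which gives both the convergence to the boundary and the pivotal times. The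
  entropy criterion is proved without an ergodic theorem: the mean information of the first n
  increments, given the boundary data or given all invariant events, is exactly n times a one-step
  value; the code makes the two values equal, and the equality case of Gibbs' inequality identifies
  the conditional laws.\<close>

lemma gprod_commute: "gprod w x y = gprod w y x"
  by (simp add: gprod_def dist_commute)

lemma gprod_nonneg: "0 \<le> gprod w x y"
  by (simp add: gprod_def) (metis dist_commute dist_triangle2)

lemma gprod_le_dist1: "gprod w x y \<le> dist w x"
  using dist_triangle[of w y x] by (simp add: gprod_def)

lemma gprod_le_dist2: "gprod w x y \<le> dist w y"
  using gprod_le_dist1[of w y x] by (simp add: gprod_commute)

text \<open>The two products at the ends of the side from \<open>w\<close> to \<open>x\<close> add
  up to its length: lying in a deep shadow as seen from \<open>w\<close> is the same as not
  backtracking as seen from \<open>x\<close>.\<close>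

lemma gprod_swap: "gprod w x y = dist w x - gprod x w y"
  by (simp add: gprod_def dist_commute field_simps)

lemma gprod_base_change: "gprod w x y \<le> gprod w' x y + dist w w'"
proof -
  have "dist w x \<le> dist w w' + dist w' x" "dist w y \<le> dist w w' + dist w' y"
    by (rule dist_triangle)+
  then show ?thesis unfolding gprod_def by argo
qed

lemma gprod_isometry:
  assumes "\<And>x y. dist (f x) (f y) = dist x y"
  shows "gprod (f w) (f x) (f y) = gprod w x y"
  by (simp add: gprod_def assms)

lemma funpow_isometry:
  fixes f :: "'a::metric_space \<Rightarrow> 'a"
  assumes "\<And>x y. dist (f x) (f y) = dist x y"
  shows "dist ((f ^^ n) x) ((f ^^ n) y) = dist x y"
  by (induction n) (simp_all add: assms)

lemma gprod_isometry_base: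
  assumes "\<And>x y. dist (f x) (f y) = dist x y"
  shows "\<bar>gprod w (f x) (f y) - gprod w x y\<bar> \<le> dist w (f w)"
  using gprod_base_change[of w "f x" "f y" "f w"] gprod_base_change[of "f w" "f x" "f y" w]
  by (simp add: gprod_isometry[OF assms] dist_commute abs_le_iff)

section \<open>Coarse geometry of a Gromov hyperbolic space\<close>

locale hyp_space =
  fixes \<delta> :: real and x0 :: "'x::metric_space"
  assumes delta_nonneg: "0 \<le> \<delta>"
    and hyp: "min (gprod w x y) (gprod w y z) - \<delta> \<le> gprod w (x::'x) z"
begin

lemma hyp3: "min (gprod w x y) (min (gprod w y z) (gprod w z (u::'x))) - 2 * \<delta> \<le> gprod w x u"
  using hyp[of w x y u] hyp[of w y z u] delta_nonneg by linarith

text \<open>Twice \<open>hyp\<close>, with the distances to the base point cancelled; in this form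
  no point is distinguished, and the inequality applies directly to orbit points.\<close>

lemma four_point:
  "dist x z + dist y (w::'x) \<le> max (dist x y + dist z w) (dist x w + dist y z) + 2 * \<delta>"
proof -
  have g: "2 * gprod w u v = dist u w + dist v w - dist u v" for u v
    by (simp add: gprod_def dist_commute)
  have "gprod w x y - \<delta> \<le> gprod w x z \<or> gprod w y z - \<delta> \<le> gprod w x z"
    using hyp[of w x y z] by (simp add: min_def split: if_splits)
  then show ?thesis
    using g[of x y] g[of x z] g[of y z] by (auto simp: max_def)
qed

text \<open>A small product \<open>gprod p x y\<close> is the working substitute for lying near a
  geodesic from \<open>x\<close> to \<open>y\<close>. By \<open>four_point\<close>, such a point is
  determined up to a bounded error by its distance from \<open>x\<close>.\<close>

lemma dist_near_geodesic:
  fixes x y p q :: 'x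
  assumes "gprod p x y \<le> D" "gprod q x y \<le> D" "\<bar>dist x p - dist x q\<bar> \<le> E"
  shows "dist p q \<le> E + 2 * D + 2 * \<delta>"
  using four_point[of p q x y] assms unfolding gprod_def dist_commute[of p x] dist_commute[of q x] dist_commute[of q p]
  unfolding max_def by (auto split: if_splits)

text \<open>The point \<open>f p\<close> is again near the segment from \<open>x\<close> to
  \<open>y\<close>: its product exceeds that of \<open>p\<close> by at most \<open>K\<close>, and
  its distance from \<open>x\<close> differs by at most \<open>K\<close>. Then
  \<open>dist_near_geodesic\<close> with \<open>D + K\<close> and error \<open>K\<close> gives the
  constant.\<close>

lemma gprod_displacement:
  fixes f :: "'x \<Rightarrow> 'x"
  assumes iso: "\<And>x y. dist (f x) (f y) = dist x y"
    and "dist x (f x) \<le> K" "dist y (f y) \<le> K" "gprod p x y \<le> D"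
  shows "dist p (f p) \<le> 3 * K + 2 * D + 2 * \<delta>"
proof -
  have 1: "dist (f p) x \<le> dist p x + K"
    using dist_triangle[of "f p" x "f x"] iso[of p x] assms(2) by (simp add: dist_commute)
  have 3: "dist p x \<le> dist (f p) x + K"
    using dist_triangle[of "f p" "f x" "x"] iso[of p x] assms(2) by (simp add: dist_commute)
  have 2: "dist (f p) y \<le> dist p y + K"
    using dist_triangle[of "f p" y "f y"] iso[of p y] assms(3) by (simp add: dist_commute)
  have "gprod (f p) x y \<le> D + K"
    using 1 2 assms(4) by (simp add: gprod_def field_simps)
  moreover have "0 \<le> K" using assms(2) zero_le_dist[of x "f x"] by linarith
  ultimately have "dist p (f p) \<le> K + 2 * (D + K) + 2 * \<delta>"
    using 1 3 assms(4)
    by (intro dist_near_geodesic[where x = x and y = y]) (auto simp: dist_commute)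
  then show ?thesis by simp
qed

text \<open>One large product between late terms spreads to all later pairs by \<open>hyp3\<close>,
  and early terms only have products bounded by their distance from \<open>x0\<close>. So the
  products of sequences with different limits are bounded over all indices, not only
  eventually.\<close>

lemma bounded_or_equiv:
  assumes x: "conv_inf x0 x" and y: "conv_inf x0 y" and n: "\<not> equiv_inf x0 x y"
  shows "\<exists>C. \<forall>i j. gprod x0 (x i) (y j) \<le> C"
proof (rule ccontr)
  assume "\<not> ?thesis"
  then have unb: "\<And>C. \<exists>i j. gprod x0 (x i) (y j) > C" by (force simp: not_le)
  have "equiv_inf x0 x y" unfolding equiv_inf_def
  proof
    fix R
    obtain N1 where N1: "\<And>i j. i \<ge> N1 \<Longrightarrow> j \<ge> N1 \<Longrightarrow> gprod x0 (x i) (x j) \<ge> R + 2 * \<delta>"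
      using x[unfolded conv_inf_def, rule_format, of "R + 2 * \<delta>"] by blast
    obtain N2 where N2: "\<And>i j. i \<ge> N2 \<Longrightarrow> j \<ge> N2 \<Longrightarrow> gprod x0 (y i) (y j) \<ge> R + 2 * \<delta>"
      using y[unfolded conv_inf_def, rule_format, of "R + 2 * \<delta>"] by blast
    \<comment> \<open>\<open>C\<close> exceeds all distances of early terms, so a pair whose product
      is above \<open>C\<close> consists of late terms on both sides.\<close>
    define C where "C = \<bar>R\<bar> + 2 * \<delta> + (\<Sum>i<N1. dist x0 (x i)) + (\<Sum>i<N2. dist x0 (y i))"
    obtain i j where ij: "gprod x0 (x i) (y j) > C" using unb by blast
    have p1: "0 \<le> (\<Sum>i<N1. dist x0 (x i))" "0 \<le> (\<Sum>i<N2. dist x0 (y i))"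
      by (simp_all add: sum_nonneg)
    have "i \<ge> N1"
    proof (rule ccontr)
      assume "\<not> i \<ge> N1"
      then have "dist x0 (x i) \<le> (\<Sum>i<N1. dist x0 (x i))"
        by (intro member_le_sum) auto
      then show False using ij gprod_le_dist1[of x0 "x i" "y j"] p1 delta_nonneg
        unfolding C_def by linarith
    qed
    moreover have "j \<ge> N2"
    proof (rule ccontr)
      assume "\<not> j \<ge> N2"
      then have "dist x0 (y j) \<le> (\<Sum>i<N2. dist x0 (y i))"
        by (intro member_le_sum) auto
      then show False using ij gprod_le_dist2[of x0 "x i" "y j"] p1 delta_nonneg
        unfolding C_def by linarith
    qed
    moreover have "gprod x0 (x i) (y j) \<ge> R + 2 * \<delta>"
      using ij p1 unfolding C_def by linarith
    ultimately have "i \<ge> N1" "j \<ge> N2" "gprod x0 (x i) (y j) \<ge> R + 2 * \<delta>" by auto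
    have "gprod x0 (x i') (y j') \<ge> R" if "i' \<ge> max N1 N2" "j' \<ge> max N1 N2" for i' j'
    proof -
      have "R + 2 * \<delta> \<le> gprod x0 (x i') (x i)" using N1[of i' i] that \<open>i \<ge> N1\<close> by simp
      moreover have "R + 2 * \<delta> \<le> gprod x0 (y j) (y j')" using N2[of j j'] that \<open>j \<ge> N2\<close> by simp
      ultimately show ?thesis
        using hyp3[of x0 "x i'" "x i" "y j" "y j'"] \<open>gprod x0 (x i) (y j) \<ge> R + 2 * \<delta>\<close> by linarith
    qed
    then show "\<exists>N. \<forall>i\<ge>N. \<forall>j\<ge>N. R \<le> gprod x0 (x i) (y j)" by blast
  qed
  then show False using n by simp
qed

lemma equiv_inf_trans:
  assumes "equiv_inf x0 x y" "equiv_inf x0 y z"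
  shows "equiv_inf x0 x z"
  unfolding equiv_inf_def
proof
  fix R
  obtain N1 where N1: "\<And>i j. i \<ge> N1 \<Longrightarrow> j \<ge> N1 \<Longrightarrow> gprod x0 (x i) (y j) \<ge> R + \<delta>"
    using assms(1)[unfolded equiv_inf_def, rule_format, of "R + \<delta>"] by blast
  obtain N2 where N2: "\<And>i j. i \<ge> N2 \<Longrightarrow> j \<ge> N2 \<Longrightarrow> gprod x0 (y i) (z j) \<ge> R + \<delta>"
    using assms(2)[unfolded equiv_inf_def, rule_format, of "R + \<delta>"] by blast
  have "R \<le> gprod x0 (x i) (z j)" if "i \<ge> max N1 N2" "j \<ge> max N1 N2" for i j
  proof -
    have "R + \<delta> \<le> gprod x0 (x i) (y (max N1 N2))" using N1[of i "max N1 N2"] that by simp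
    moreover have "R + \<delta> \<le> gprod x0 (y (max N1 N2)) (z j)" using N2[of "max N1 N2" j] that by simp
    ultimately show ?thesis using hyp[of x0 "x i" "y (max N1 N2)" "z j"] by linarith
  qed
  then show "\<exists>N. \<forall>i\<ge>N. \<forall>j\<ge>N. R \<le> gprod x0 (x i) (z j)" by blast
qed

lemma equiv_inf_sym: "equiv_inf x0 x y \<Longrightarrow> equiv_inf x0 y x"
  unfolding equiv_inf_def by (subst gprod_commute) blast

lemma equiv_inf_refl: "conv_inf x0 x \<Longrightarrow> equiv_inf x0 x x"
  by (simp add: conv_inf_def equiv_inf_def)

lemma bclass_eq_iff:
  assumes "conv_inf x0 x" "conv_inf x0 y"
  shows "bclass x0 x = bclass x0 y \<longleftrightarrow> equiv_inf x0 x y"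
proof
  assume "bclass x0 x = bclass x0 y"
  moreover have "y \<in> bclass x0 y" using assms equiv_inf_refl by (simp add: bclass_def)
  ultimately show "equiv_inf x0 x y" by (auto simp: bclass_def)
next
  assume "equiv_inf x0 x y"
  then show "bclass x0 x = bclass x0 y"
    unfolding bclass_def using equiv_inf_trans equiv_inf_sym by blast
qed

lemma equiv_inf_isometry:
  assumes iso: "\<And>x y::'x. dist (f x) (f y) = dist x y" and e: "equiv_inf x0 x y"
  shows "equiv_inf x0 (f \<circ> x) (f \<circ> y)"
  unfolding equiv_inf_def
proof
  fix R
  obtain N1 where N1: "\<And>i j. i \<ge> N1 \<Longrightarrow> j \<ge> N1 \<Longrightarrow> gprod x0 (x i) (y j) \<ge> R + dist x0 (f x0)"
    using e[unfolded equiv_inf_def, rule_format, of "R + dist x0 (f x0)"] by blast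
  have "R \<le> gprod x0 ((f \<circ> x) i) ((f \<circ> y) j)" if "i \<ge> N1" "j \<ge> N1" for i j
    using gprod_isometry_base[OF iso, of x0 "x i" "y j"] N1[OF that] by (simp add: abs_le_iff)
  then show "\<exists>N. \<forall>i\<ge>N. \<forall>j\<ge>N. R \<le> gprod x0 ((f \<circ> x) i) ((f \<circ> y) j)" by blast
qed

lemma conv_inf_isometry:
  assumes iso: "\<And>x y::'x. dist (f x) (f y) = dist x y" and "conv_inf x0 x"
  shows "conv_inf x0 (f \<circ> x)"
  using equiv_inf_isometry[OF iso, of x x] assms(2) by (simp add: conv_inf_def equiv_inf_def)

lemma equiv_inf_bounded:
  assumes "conv_inf x0 x" and "\<And>i. dist (x i) (y i) \<le> C"
  shows "conv_inf x0 y \<and> equiv_inf x0 x y"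
proof -
  have g: "\<bar>gprod x0 a b - gprod x0 a' b\<bar> \<le> dist a a'" for a a' b :: 'x
    using dist_triangle[of x0 a a'] dist_triangle[of x0 a' a] dist_triangle[of a b a'] dist_triangle[of a' b a]
    by (simp add: gprod_def dist_commute abs_le_iff field_simps)
  have g1: "gprod x0 (x i) (x j) - C \<le> gprod x0 (x i) (y j)" for i j
    using g[of "x j" "x i" "y j"] assms(2)[of j] by (simp add: gprod_commute[of x0 "x i"] abs_le_iff)
  have g2: "gprod x0 (x i) (x j) - 2 * C \<le> gprod x0 (y i) (y j)" for i j
    using g[of "x i" "y j" "y i"] g1[of i j] assms(2)[of i] by (simp add: abs_le_iff)
  have C0: "0 \<le> C" using assms(2)[of 0] zero_le_dist order_trans by blast
  have "\<exists>N. \<forall>i\<ge>N. \<forall>j\<ge>N. R \<le> gprod x0 (x i) (y j) \<and> R \<le> gprod x0 (y i) (y j)" for R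
  proof -
    obtain N where N: "\<And>i j. i \<ge> N \<Longrightarrow> j \<ge> N \<Longrightarrow> gprod x0 (x i) (x j) \<ge> R + 2 * C"
      using assms(1)[unfolded conv_inf_def, rule_format, of "R + 2 * C"] by blast
    have "R \<le> gprod x0 (x i) (y j) \<and> R \<le> gprod x0 (y i) (y j)" if "i \<ge> N" "j \<ge> N" for i j
      using N[OF that] g1[of i j] g2[of i j] C0 by linarith
    then show ?thesis by blast
  qed
  then show ?thesis unfolding conv_inf_def equiv_inf_def by meson
qed

text \<open>Positive translation length only says that distances grow linearly in the mean. If
  doubling the exponent never gained \<open>2 * \<delta> + 1\<close>, the displacements of the
  powers \<open>2 ^ k\<close> would be at most linear in \<open>k\<close>; so some \<open>p\<close>
  gains that much, and \<open>four_point\<close> then propagates the gain to every further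
  step.\<close>

lemma loxodromic_growth:
  fixes A :: "'x \<Rightarrow> 'x"
  assumes iso: "\<And>x y. dist (A x) (A y) = dist x y"
    and lim: "(\<lambda>n. dist ((A ^^ n) x) x / real n) \<longlonglongrightarrow> L" and L: "0 < L"
  shows "\<exists>p\<ge>1. \<forall>n. dist x0 ((A ^^ (n * p)) x0) + 1 \<le> dist x0 ((A ^^ (Suc n * p)) x0)"
proof -
  define l where "l n = dist x0 ((A ^^ n) x0)" for n
  define B where "B = 2 * \<delta> + 1"
  have Bpos: "B > 0" using delta_nonneg by (simp add: B_def)
  have isoN: "dist ((A ^^ n) u) ((A ^^ n) v) = dist u v" for n u v
    by (rule funpow_isometry[OF iso])
  have dl: "dist ((A ^^ m) x0) ((A ^^ n) x0) = l (n - m)" if "m \<le> n" for m n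
  proof -
    have "(A ^^ n) x0 = (A ^^ m) ((A ^^ (n - m)) x0)"
      using funpow_add[of m "n - m" A] that by simp
    then show ?thesis using isoN by (simp add: l_def)
  qed
  have lge: "dist ((A ^^ n) x) x \<le> l n + 2 * dist x0 x" for n
    using dist_triangle[of "(A ^^ n) x" x "(A ^^ n) x0"] dist_triangle[of "(A ^^ n) x0" x x0] isoN[of n x x0]
    by (simp add: l_def dist_commute)
  have "\<exists>p\<ge>1. l p + B \<le> l (2 * p)"
  proof (rule ccontr)
    assume nt: "\<not> ?thesis"
    have step: "l (2 * p) < l p + B" if "p \<ge> 1" for p
      using nt that not_le[of "l p + B" "l (2 * p)"] by blast
    have pw: "l (2 ^ k) \<le> l 1 + real k * B" for k :: nat
    proof (induction k)
      case (Suc k)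
      show ?case using step[of "2 ^ k"] Suc by (simp add: algebra_simps)
    qed simp
    have "(\<lambda>k. dist ((A ^^ (2 ^ k)) x) x / real (2 ^ k)) \<longlonglongrightarrow> L"
      using LIMSEQ_subseq_LIMSEQ[OF lim, of "\<lambda>k. 2 ^ k"] by (simp only: comp_def) (simp add: strict_mono_def)
    moreover have "(\<lambda>k. (l 1 + real k * B + 2 * dist x0 x) / 2 ^ k) \<longlonglongrightarrow> 0"
    proof -
      have "(\<lambda>k. (l 1 + 2 * dist x0 x) * (1/2) ^ k) \<longlonglongrightarrow> 0"
        using tendsto_mult_right_zero[OF LIMSEQ_power_zero[of "1/2::real"]] by simp
      moreover have "(\<lambda>k. B * (real k * (1/2) ^ k)) \<longlonglongrightarrow> 0"
        by (rule tendsto_mult_right_zero) (rule powser_times_n_limit_0, simp)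
      ultimately have "(\<lambda>k. (l 1 + 2 * dist x0 x) * (1/2) ^ k + B * (real k * (1/2) ^ k)) \<longlonglongrightarrow> 0 + 0"
        by (rule tendsto_add)
      moreover have "(l 1 + 2 * dist x0 x) * (1/2) ^ k + B * (real k * (1/2) ^ k)
          = (l 1 + real k * B + 2 * dist x0 x) / 2 ^ k" for k
        by (simp add: power_one_over field_simps)
      ultimately show ?thesis by simp
    qed
    moreover have "dist ((A ^^ (2 ^ k)) x) x / real (2 ^ k) \<le> (l 1 + real k * B + 2 * dist x0 x) / 2 ^ k" for k
      using lge[of "2 ^ k"] pw[of k] by (simp add: divide_right_mono)
    ultimately have "L \<le> 0" by (intro LIMSEQ_le) auto
    then show False using L by simp
  qed
  then obtain p where p: "p \<ge> 1" "l p + B \<le> l (2 * p)" by blast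
  have "l (n * p) + 1 \<le> l (Suc n * p)" for n
  proof (induction n)
    case 0
    have "l (2 * p) \<le> 2 * l p"
      using dist_triangle[of x0 "(A ^^ (2 * p)) x0" "(A ^^ p) x0"] dl[of p "2 * p"] by (simp add: l_def)
    moreover have "l 0 = 0" by (simp add: l_def)
    ultimately show ?case using p Bpos unfolding B_def using delta_nonneg by simp
  next
    case (Suc n)
    let ?P = "\<lambda>k. (A ^^ (k * p)) x0"
    have d: "dist (?P i) (?P j) = l ((j - i) * p)" if "i \<le> j" for i j
      using dl[of "i * p" "j * p"] that by (simp add: diff_mult_distrib)
    \<comment> \<open>Applied to the orbit points with exponents 0, p, 2p and (n+2)p. The first
      alternative would make the orbit come closer again, against the induction hypothesis; the
      second is the next step, as the slack \<open>B\<close> pays for \<open>2 * \<delta>\<close>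
      and leaves 1.\<close>
    have fp: "dist (?P 0) (?P 2) + dist (?P 1) (?P (Suc (Suc n)))
        \<le> max (dist (?P 0) (?P 1) + dist (?P 2) (?P (Suc (Suc n))))
              (dist (?P 0) (?P (Suc (Suc n))) + dist (?P 1) (?P 2)) + 2 * \<delta>"
      by (rule four_point)
    have e0: "dist (?P 0) (?P 2) = l (2 * p)" using d[of 0 2] by simp
    have e1: "dist (?P 1) (?P (Suc (Suc n))) = l (Suc n * p)" using d[of 1 "Suc (Suc n)"] by simp
    have e2: "dist (?P 0) (?P 1) = l p" using d[of 0 1] by simp
    have e3: "dist (?P 2) (?P (Suc (Suc n))) = l (n * p)" using d[of 2 "Suc (Suc n)"] by simp
    have e4: "dist (?P 0) (?P (Suc (Suc n))) = l (Suc (Suc n) * p)" using d[of 0 "Suc (Suc n)"] by simp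
    have e5: "dist (?P 1) (?P 2) = l p" using d[of 1 2] by simp
    have "l (2 * p) + l (Suc n * p) \<le> max (l p + l (n * p)) (l (Suc (Suc n) * p) + l p) + 2 * \<delta>"
      using fp unfolding e0 e1 e2 e3 e4 e5 .
    then have "l (2 * p) + l (Suc n * p) \<le> l p + l (n * p) + 2 * \<delta> \<or>
        l (2 * p) + l (Suc n * p) \<le> l (Suc (Suc n) * p) + l p + 2 * \<delta>"
      by (auto simp only: max_def split: if_splits)
    then show ?case using Suc p(2) unfolding B_def by linarith
  qed
  then show ?thesis using p(1) unfolding l_def by blast
qed

text \<open>Both \<open>l m\<close> and \<open>l n - l (n - m)\<close> are at least
  \<open>m\<close>, and their sum is twice the product.\<close>

lemma growth_gprod:
  fixes A :: "'x \<Rightarrow> 'x"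
  assumes iso: "\<And>x y. dist (A x) (A y) = dist x y"
    and gr: "\<And>n. dist x0 ((A ^^ n) x0) + 1 \<le> dist x0 ((A ^^ Suc n) x0)"
  shows "m \<le> n \<Longrightarrow> real m \<le> gprod x0 ((A ^^ m) x0) ((A ^^ n) x0)"
proof -
  define l where "l n = dist x0 ((A ^^ n) x0)" for n
  assume mn: "m \<le> n"
  have inc: "l i + real k \<le> l (i + k)" for i k
  proof (induction k)
    case (Suc k)
    then show ?case using gr[of "i + k"] by (simp add: l_def)
  qed simp
  have "(A ^^ n) x0 = (A ^^ m) ((A ^^ (n - m)) x0)"
    using funpow_add[of m "n - m" A] mn by simp
  then have "dist ((A ^^ m) x0) ((A ^^ n) x0) = l (n - m)"
    using funpow_isometry[OF iso] by (simp add: l_def)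
  then show ?thesis
    using inc[of 0 m] inc[of "n - m" m] mn by (simp add: gprod_def l_def[symmetric]) (simp add: l_def)
qed

lemma growth_conv_inf:
  assumes iso: "\<And>x y::'x. dist (A x) (A y) = dist x y"
    and gr: "\<And>n. dist x0 ((A ^^ n) x0) + 1 \<le> dist x0 ((A ^^ Suc n) x0)"
  shows "conv_inf x0 (\<lambda>n. (A ^^ n) x0)"
  unfolding conv_inf_def
proof
  fix R :: real
  obtain N :: nat where N: "R \<le> real N" using real_arch_simple by blast
  have "R \<le> gprod x0 ((A ^^ i) x0) ((A ^^ j) x0)" if "i \<ge> N" "j \<ge> N" for i j
    using growth_gprod[OF iso gr, of i j] growth_gprod[OF iso gr, of j i] that N
    by (cases "i \<le> j") (auto simp: gprod_commute)
  then show "\<exists>N. \<forall>i\<ge>N. \<forall>j\<ge>N. R \<le> gprod x0 ((A ^^ i) x0) ((A ^^ j) x0)" by blast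
qed

lemma growth_dist:
  assumes gr: "\<And>n. dist x0 ((A ^^ n) x0) + 1 \<le> dist x0 ((A ^^ Suc n) x0)"
  shows "real n \<le> dist x0 ((A ^^ n) x0)"
proof (induction n)
  case (Suc n)
  then show ?case using gr[of n] by simp
qed simp

text \<open>If some power of \<open>A\<close> fixed the limit of the orbit of \<open>B\<close>, then
  \<open>A ^^ m\<close> would fix it for arbitrarily large \<open>m\<close>. But
  \<open>A ^^ m\<close> carries that orbit into the direction of \<open>(A ^^ m) x0\<close>, from
  which it is separated by \<open>bd\<close>.\<close>

lemma independent_translates_bounded:
  fixes A B A' :: "'x \<Rightarrow> 'x"
  assumes isoA: "\<And>x y. dist (A x) (A y) = dist x y" and inv: "\<And>x. A (A' x) = x"
    and isoB: "\<And>x y. dist (B x) (B y) = dist x y"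
    and grA: "\<And>n. dist x0 ((A ^^ n) x0) + 1 \<le> dist x0 ((A ^^ Suc n) x0)"
    and grB: "\<And>n. dist x0 ((B ^^ n) x0) + 1 \<le> dist x0 ((B ^^ Suc n) x0)"
    and bd: "\<And>n m. gprod x0 ((B ^^ n) x0) ((A ^^ m) x0) \<le> C" "\<And>n m. gprod x0 ((B ^^ n) x0) ((A' ^^ m) x0) \<le> C"
    and i: "i \<ge> 1"
  shows "\<exists>C2. \<forall>n m. gprod x0 ((B ^^ n) x0) ((A ^^ i) ((B ^^ m) x0)) \<le> C2"
proof -
  let ?b = "\<lambda>n. (B ^^ n) x0"
  have isoAn: "dist ((A ^^ k) u) ((A ^^ k) v) = dist u v" for k u v
    by (rule funpow_isometry[OF isoA])
  have invn: "(A ^^ k) ((A' ^^ k) u) = u" for k u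
  proof (induction k arbitrary: u)
    case (Suc k)
    have "(A ^^ Suc k) ((A' ^^ Suc k) u) = (A ^^ k) (A (A' ((A' ^^ k) u)))"
      by (simp add: funpow_swap1)
    then show ?case using Suc inv by simp
  qed simp
  have cb: "conv_inf x0 ?b" by (rule growth_conv_inf[OF isoB grB])
  have ca: "conv_inf x0 ((A ^^ i) \<circ> ?b)" by (rule conv_inf_isometry[OF isoAn cb])
  have "\<not> equiv_inf x0 ?b ((A ^^ i) \<circ> ?b)"
  proof
    assume e: "equiv_inf x0 ?b ((A ^^ i) \<circ> ?b)"
    have ek: "equiv_inf x0 ?b ((A ^^ (k * i)) \<circ> ?b)" for k
    proof (induction k)
      case 0
      show ?case using equiv_inf_refl[OF cb] by (simp add: comp_def)
    next
      case (Suc k)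
      have "equiv_inf x0 ((A ^^ i) \<circ> ?b) ((A ^^ i) \<circ> ((A ^^ (k * i)) \<circ> ?b))"
        by (rule equiv_inf_isometry[OF isoAn Suc])
      moreover have "(A ^^ i) \<circ> ((A ^^ (k * i)) \<circ> ?b) = (A ^^ (Suc k * i)) \<circ> ?b"
        by (simp add: fun_eq_iff funpow_add)
      ultimately show ?case using equiv_inf_trans[OF e] by metis
    qed
    obtain k :: nat where k: "2 * \<bar>C\<bar> + \<delta> + 1 \<le> real k" using real_arch_simple by blast
    define m where "m = k * i"
    have m: "2 * \<bar>C\<bar> + \<delta> + 1 \<le> real m"
    proof -
      have "k \<le> m" using i by (simp add: m_def)
      then show ?thesis using k by linarith
    qed
    obtain n where n: "real m \<le> gprod x0 (?b n) ((A ^^ m) (?b n))"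
      using ek[of k] unfolding equiv_inf_def m_def comp_def by (meson order_refl)
    \<comment> \<open>Moving by \<open>A ^^ m\<close> turns the upper bound on the products of the
      orbit with \<open>(A' ^^ m) x0\<close> into a lower bound \<open>real m - C\<close> for the
      products of the moved orbit with \<open>(A ^^ m) x0\<close>.\<close>
    have "gprod x0 ((A ^^ m) (?b n)) ((A ^^ m) x0) = dist x0 ((A ^^ m) x0) - gprod ((A ^^ m) x0) x0 ((A ^^ m) (?b n))"
      by (subst gprod_commute) (rule gprod_swap)
    also have "gprod ((A ^^ m) x0) x0 ((A ^^ m) (?b n)) = gprod x0 ((A' ^^ m) x0) (?b n)"
      using gprod_isometry[of "A ^^ m" x0 "(A' ^^ m) x0" "?b n"] isoAn invn by simp
    finally have "gprod x0 ((A ^^ m) (?b n)) ((A ^^ m) x0) \<ge> real m - C"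
      using growth_dist[of A m] grA bd(2)[of n m] by (simp add: gprod_commute)
    then have "real m - C - \<delta> \<le> gprod x0 (?b n) ((A ^^ m) x0) \<or> real m - \<delta> \<le> gprod x0 (?b n) ((A ^^ m) x0)"
      using hyp[of x0 "?b n" "(A ^^ m) (?b n)" "(A ^^ m) x0"] n by linarith
    then show False using bd(1)[of n m] m by linarith
  qed
  from bounded_or_equiv[OF cb ca this] show ?thesis by simp
qed

text \<open>A point \<open>z\<close> away from the repelling direction of \<open>B\<close> is
  brought close to the attracting one by a high power of \<open>B\<close>, and the images of that
  direction under distinct powers of \<open>A\<close> differ by \<open>bd\<close>. The exponents
  \<open>i\<close> and \<open>L - i\<close> add up to \<open>L\<close>, so that all the words have
  one length; \<open>C\<close> is fixed before \<open>R\<close>.\<close>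

lemma separated_orbit_points:
  fixes A B B' :: "'x \<Rightarrow> 'x"
  assumes isoA: "\<And>x y. dist (A x) (A y) = dist x y"
    and isoB: "\<And>x y. dist (B x) (B y) = dist x y" and invB: "\<And>x. B (B' x) = x"
    and grB: "\<And>n. dist x0 ((B ^^ n) x0) + 1 \<le> dist x0 ((B ^^ Suc n) x0)"
    and bd: "\<And>i. i \<ge> 1 \<Longrightarrow> \<exists>C2. \<forall>n m. gprod x0 ((B ^^ n) x0) ((A ^^ i) ((B ^^ m) x0)) \<le> C2"
  shows "\<exists>C. \<forall>R. \<exists>L0. \<forall>L\<ge>L0. \<forall>z. (\<forall>n. gprod x0 z ((B' ^^ n) x0) \<le> C1) \<longrightarrow>
     (\<forall>i<M. R \<le> dist x0 ((A ^^ i) ((B ^^ (L - i)) z))) \<and>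
     (\<forall>i<M. \<forall>j<M. i \<noteq> j \<longrightarrow> gprod x0 ((A ^^ i) ((B ^^ (L - i)) z)) ((A ^^ j) ((B ^^ (L - j)) z)) \<le> C)"
proof -
  have isoAn: "dist ((A ^^ k) u) ((A ^^ k) v) = dist u v" for k u v
    by (rule funpow_isometry[OF isoA])
  have isoBn: "dist ((B ^^ k) u) ((B ^^ k) v) = dist u v" for k u v
    by (rule funpow_isometry[OF isoB])
  have invn: "(B ^^ k) ((B' ^^ k) u) = u" for k u
  proof (induction k arbitrary: u)
    case (Suc k)
    have "(B ^^ Suc k) ((B' ^^ Suc k) u) = (B ^^ k) (B (B' ((B' ^^ k) u)))"
      by (simp add: funpow_swap1)
    then show ?case using Suc invB by simp
  qed simp
  obtain c where c: "\<And>i n m. i \<ge> 1 \<Longrightarrow> gprod x0 ((B ^^ n) x0) ((A ^^ i) ((B ^^ m) x0)) \<le> c i"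
    using bd by metis
  define C2 where "C2 = (\<Sum>i\<le>M. \<bar>c i\<bar>)"
  define D where "D = (\<Sum>i\<le>M. dist x0 ((A ^^ i) x0))"
  have C2: "gprod x0 ((B ^^ n) x0) ((A ^^ i) ((B ^^ m) x0)) \<le> C2" if "1 \<le> i" "i \<le> M" for i n m
  proof -
    have "\<bar>c i\<bar> \<le> C2" unfolding C2_def using that by (intro member_le_sum) auto
    then show ?thesis using c[OF that(1), of n m] by linarith
  qed
  have D: "dist x0 ((A ^^ i) x0) \<le> D" if "i \<le> M" for i
    unfolding D_def using that by (intro member_le_sum) auto
  \<comment> \<open>\<open>C2\<close> separates the reference points \<open>u i\<close> up to the
    base change \<open>D\<close> under \<open>A ^^ i\<close>; \<open>2 * \<delta>\<close> is the
    loss of \<open>hyp3\<close> in passing to the images of \<open>z\<close>.\<close>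
  define C where "C = C2 + D + 2 * \<delta>"
  have "\<exists>L0. \<forall>L\<ge>L0. \<forall>z. (\<forall>n. gprod x0 z ((B' ^^ n) x0) \<le> C1) \<longrightarrow>
     (\<forall>i<M. R \<le> dist x0 ((A ^^ i) ((B ^^ (L - i)) z))) \<and>
     (\<forall>i<M. \<forall>j<M. i \<noteq> j \<longrightarrow> gprod x0 ((A ^^ i) ((B ^^ (L - i)) z)) ((A ^^ j) ((B ^^ (L - j)) z)) \<le> C)" for R
  proof -
    obtain L0 :: nat where L0: "real M + C1 + D + \<bar>R\<bar> + \<bar>C\<bar> + 1 \<le> real L0" 
      using real_arch_simple by blast
    have "(\<forall>i<M. R \<le> dist x0 ((A ^^ i) ((B ^^ (L - i)) z))) \<and>
      (\<forall>i<M. \<forall>j<M. i \<noteq> j \<longrightarrow> gprod x0 ((A ^^ i) ((B ^^ (L - i)) z)) ((A ^^ j) ((B ^^ (L - j)) z)) \<le> C)"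
      if L: "L \<ge> L0" and z: "\<And>n. gprod x0 z ((B' ^^ n) x0) \<le> C1" for L z
    proof -
      define y where "y i = (A ^^ i) ((B ^^ (L - i)) z)" for i
      define u where "u i = (A ^^ i) ((B ^^ (L - i)) x0)" for i
      have yu: "\<bar>R\<bar> + \<bar>C\<bar> + 1 \<le> gprod x0 (y i) (u i)" if i: "i < M" for i
      proof -
        have "gprod x0 ((B ^^ (L - i)) z) ((B ^^ (L - i)) x0)
           = dist x0 ((B ^^ (L - i)) x0) - gprod ((B ^^ (L - i)) x0) x0 ((B ^^ (L - i)) z)"
          by (subst gprod_commute) (rule gprod_swap)
        also have "gprod ((B ^^ (L - i)) x0) x0 ((B ^^ (L - i)) z) = gprod x0 ((B' ^^ (L - i)) x0) z"
          using gprod_isometry[of "B ^^ (L - i)" x0 "(B' ^^ (L - i)) x0" z] isoBn invn by simp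
        finally have "real (L - i) - C1 \<le> gprod x0 ((B ^^ (L - i)) z) ((B ^^ (L - i)) x0)"
          using growth_dist[of B "L - i"] grB z[of "L - i"] by (simp add: gprod_commute)
        moreover have "\<bar>gprod x0 (y i) (u i) - gprod x0 ((B ^^ (L - i)) z) ((B ^^ (L - i)) x0)\<bar> \<le> D"
          using gprod_isometry_base[OF isoAn, of x0 i "(B ^^ (L - i)) z" "(B ^^ (L - i)) x0"] D[of i] i
          unfolding y_def u_def by simp
        moreover have "real (L - i) \<ge> real L0 - real M" using i L by linarith
        ultimately show ?thesis using L0 by linarith
      qed
      have uu: "gprod x0 (u i) (u j) \<le> C2 + D" if ij: "i < j" "j < M" for i j
      proof -
        have "u j = (A ^^ i) ((A ^^ (j - i)) ((B ^^ (L - j)) x0))"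
          unfolding u_def using funpow_add[of i "j - i" A] ij by simp
        then have "\<bar>gprod x0 (u i) (u j) - gprod x0 ((B ^^ (L - i)) x0) ((A ^^ (j - i)) ((B ^^ (L - j)) x0))\<bar> \<le> D"
          using gprod_isometry_base[OF isoAn, of x0 i "(B ^^ (L - i)) x0" "(A ^^ (j - i)) ((B ^^ (L - j)) x0)"] D[of i] ij
          unfolding u_def by simp
        moreover have "1 \<le> j - i" "j - i \<le> M" using ij by linarith+
        ultimately show ?thesis using C2[of "j - i" "L - i" "L - j"] by linarith
      qed
      have yy: "gprod x0 (y i) (y j) \<le> C" if ij: "i < j" "j < M" for i j
      proof (rule ccontr)
        assume "\<not> gprod x0 (y i) (y j) \<le> C"
        then have "C2 + D < gprod x0 (u i) (u j)"
          using hyp3[of x0 "u i" "y i" "y j" "u j"] yu[of i] yu[of j] ij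
          by (simp add: gprod_commute[of x0 "u i" "y i"] C_def min_def split: if_splits)
        then show False using uu[OF ij] by simp
      qed
      have "R \<le> dist x0 (y i)" if "i < M" for i
        using yu[OF that] gprod_le_dist1[of x0 "y i" "u i"] by linarith
      moreover have "gprod x0 (y i) (y j) \<le> C" if "i < M" "j < M" "i \<noteq> j" for i j
        using yy[of i j] yy[of j i] that by (cases "i < j") (auto simp: gprod_commute)
      ultimately show ?thesis unfolding y_def by blast
    qed
    then show ?thesis by blast
  qed
  then show ?thesis by blast
qed

end

section \<open>Concentration for convolution families of isometries\<close>

locale hyp_action = hyp_space \<delta> x0 + group G
  for \<delta> :: real and x0 :: "'x::metric_space" and G :: "('g::countable, 'b) monoid_scheme" (structure) +
  fixes \<phi> :: "'g \<Rightarrow> 'x \<Rightarrow> 'x"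
  assumes act: "isometric_action G \<phi>"
begin

lemma act_isometry: "g \<in> carrier G \<Longrightarrow> dist (\<phi> g x) (\<phi> g y) = dist x y"
  using act by (simp add: isometric_action_def)

lemma act_mult: "g \<in> carrier G \<Longrightarrow> h \<in> carrier G \<Longrightarrow> \<phi> (g \<otimes> h) x = \<phi> g (\<phi> h x)"
  using act by (simp add: isometric_action_def)

lemma act_one: "\<phi> \<one> x = x"
  using act by (simp add: isometric_action_def)

lemma act_inv1: "g \<in> carrier G \<Longrightarrow> \<phi> (inv g) (\<phi> g x) = x"
  by (simp add: act_mult[symmetric] act_one)

lemma act_inv2: "g \<in> carrier G \<Longrightarrow> \<phi> g (\<phi> (inv g) x) = x"
  by (simp add: act_mult[symmetric] act_one)

lemma act_pow: "g \<in> carrier G \<Longrightarrow> \<phi> (g [^] (n::nat)) x = (\<phi> g ^^ n) x"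
proof (induction n arbitrary: x)
  case (Suc n)
  then show ?case by (simp add: act_mult funpow_swap1)
qed (simp add: act_one)

lemma dist_act_inv: "g \<in> carrier G \<Longrightarrow> dist (\<phi> g x) y = dist x (\<phi> (inv g) y)"
  using act_isometry[of g x "\<phi> (inv g) y"] by (simp add: act_inv2)

lemma gprod_act: "g \<in> carrier G \<Longrightarrow> gprod (\<phi> g w) (\<phi> g x) (\<phi> g y) = gprod w x y"
  by (rule gprod_isometry) (rule act_isometry)

lemma gprod_act_inv: "g \<in> carrier G \<Longrightarrow> gprod (\<phi> g w) x y = gprod w (\<phi> (inv g) x) (\<phi> (inv g) y)"
  using gprod_act[of g w "\<phi> (inv g) x" "\<phi> (inv g) y"] by (simp add: act_inv2)

text \<open>\<open>bact\<close> is the image of a set of sequences, so it must be checked that the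
  image is a full class; the second inclusion moves a sequence back by \<open>inv g\<close>.\<close>

lemma bact_bclass:
  assumes g: "g \<in> carrier G" and x: "conv_inf x0 x"
  shows "bact \<phi> g (bclass x0 x) = bclass x0 (\<phi> g \<circ> x)"
proof
  show "bact \<phi> g (bclass x0 x) \<subseteq> bclass x0 (\<phi> g \<circ> x)"
    unfolding bact_def bclass_def
    using equiv_inf_isometry[OF act_isometry[OF g]] conv_inf_isometry[OF act_isometry[OF g]] by auto
  show "bclass x0 (\<phi> g \<circ> x) \<subseteq> bact \<phi> g (bclass x0 x)"
  proof
    fix z assume z: "z \<in> bclass x0 (\<phi> g \<circ> x)"
    have ig: "inv g \<in> carrier G" using g by simp
    have e1: "\<phi> (inv g) \<circ> (\<phi> g \<circ> x) = x" using act_inv1[OF g] by (simp add: fun_eq_iff)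
    have "\<phi> (inv g) \<circ> z \<in> bclass x0 x"
      using z equiv_inf_isometry[OF act_isometry[OF ig], of "\<phi> g \<circ> x" z]
        conv_inf_isometry[OF act_isometry[OF ig], of z] by (simp add: bclass_def e1)
    moreover have "z = \<phi> g \<circ> (\<phi> (inv g) \<circ> z)" using act_inv2[OF g] by (simp add: fun_eq_iff)
    ultimately show "z \<in> bact \<phi> g (bclass x0 x)" unfolding bact_def by blast
  qed
qed

text \<open>A quantitative form of loxodromic at the base point, inherited by powers and inverses,
  in which estimates for orbits can be stated without limits.\<close>

definition growing :: "'g \<Rightarrow> bool" where
  "growing c \<longleftrightarrow> (\<forall>n. dist x0 ((\<phi> c ^^ n) x0) + 1 \<le> dist x0 ((\<phi> c ^^ Suc n) x0))"

lemma growing_pow: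
  assumes c: "c \<in> carrier G" and gr: "growing c" and q: "(q::nat) \<ge> 1"
  shows "growing (c [^] q)"
proof -
  have mono: "dist x0 ((\<phi> c ^^ m) x0) + real k \<le> dist x0 ((\<phi> c ^^ (m + k)) x0)" for m k
  proof (induction k)
    case (Suc k)
    then show ?case using gr[unfolded growing_def, rule_format, of "m + k"] by simp
  qed simp
  have p: "(\<phi> (c [^] q) ^^ n) x = (\<phi> c ^^ (n * q)) x" for n x
  proof -
    have "\<phi> (c [^] q) = \<phi> c ^^ q" using act_pow[OF c] by (simp add: fun_eq_iff)
    then show ?thesis by (simp add: funpow_mult mult.commute)
  qed
  show ?thesis unfolding growing_def p
    using mono[of "n * q" q for n] q by (smt (verit) add.commute mult_Suc of_nat_1 of_nat_mono)
qed

lemma growing_inv: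
  assumes c: "c \<in> carrier G" and gr: "growing c"
  shows "growing (inv c)"
proof -
  have "dist x0 ((\<phi> (inv c) ^^ n) x0) = dist x0 ((\<phi> c ^^ n) x0)" for n
  proof -
    have "dist x0 (\<phi> (inv (c [^] n)) x0) = dist (\<phi> (c [^] n) x0) x0"
      using dist_act_inv[of "c [^] n" x0 x0] c by simp
    moreover have "inv (c [^] n) = inv c [^] n" using c by (simp add: nat_pow_inv)
    ultimately show ?thesis using c by (simp add: act_pow dist_commute)
  qed
  then show ?thesis using gr by (simp add: growing_def del: funpow.simps)
qed

text \<open>An element commuting with \<open>c\<close> moves every orbit point of \<open>c\<close>
  by the same distance, so the orbit and its image have the same limit. With \<open>c\<close> a
  power of \<open>g\<close> or the inverse of one, this links the orbits to the disjointness of the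
  sets \<open>bfix\<close>.\<close>

lemma growing_class_fixed:
  assumes g: "g \<in> carrier G" and c: "c \<in> carrier G" and com: "g \<otimes> c = c \<otimes> g" and gr: "growing c"
  shows "conv_inf x0 (\<lambda>n. (\<phi> c ^^ n) x0)" "bclass x0 (\<lambda>n. (\<phi> c ^^ n) x0) \<in> bfix x0 \<phi> g"
proof -
  let ?x = "\<lambda>n. (\<phi> c ^^ n) x0"
  show cx: "conv_inf x0 ?x"
    using growth_conv_inf[of "\<phi> c"] act_isometry[OF c] gr by (simp add: growing_def)
  have "dist (?x n) ((\<phi> g \<circ> ?x) n) = dist x0 (\<phi> g x0)" for n
  proof -
    have "\<phi> g ((\<phi> c ^^ n) x0) = (\<phi> c ^^ n) (\<phi> g x0)"
    proof (induction n)
      case (Suc n)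
      have "\<phi> g (\<phi> c y) = \<phi> c (\<phi> g y)" for y
        using act_mult[OF g c, of y] act_mult[OF c g, of y] com by simp
      then show ?case using Suc by simp
    qed simp
    then show ?thesis using funpow_isometry[of "\<phi> c" n x0 "\<phi> g x0"] act_isometry[OF c] by simp
  qed
  then have e: "conv_inf x0 (\<phi> g \<circ> ?x) \<and> equiv_inf x0 ?x (\<phi> g \<circ> ?x)"
    using equiv_inf_bounded[OF cx, of "\<phi> g \<circ> ?x" "dist x0 (\<phi> g x0)"] by simp
  then have "bclass x0 (\<phi> g \<circ> ?x) = bclass x0 ?x"
    using bclass_eq_iff[OF cx] by blast
  then show "bclass x0 ?x \<in> bfix x0 \<phi> g"
    using bact_bclass[OF g cx] cx unfolding bfix_def gbd_def by auto
qed

lemma loxodromic_growing_pow: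
  assumes "loxodromic G \<phi> g"
  shows "g \<in> carrier G \<and> (\<exists>p::nat. p \<ge> 1 \<and> growing (g [^] p))"
proof -
  have g: "g \<in> carrier G" using assms by (simp add: loxodromic_def)
  obtain x L where xL: "L > 0" "(\<lambda>n::nat. dist (\<phi> (g [^] n) x) x / real n) \<longlonglongrightarrow> L"
    using assms unfolding loxodromic_def by blast
  obtain p where p: "p \<ge> 1" "\<And>n. dist x0 ((\<phi> g ^^ (n * p)) x0) + 1 \<le> dist x0 ((\<phi> g ^^ (Suc n * p)) x0)"
    using loxodromic_growth[of "\<phi> g" x L] act_isometry[OF g] xL act_pow[OF g] by auto
  have "(\<phi> (g [^] p) ^^ n) x = (\<phi> g ^^ (n * p)) x" for n x
  proof -
    have "\<phi> (g [^] p) = \<phi> g ^^ p" using act_pow[OF g] by (simp add: fun_eq_iff)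
    then show ?thesis by (simp add: funpow_mult mult.commute)
  qed
  then have "growing (g [^] p)" using p(2) unfolding growing_def by (simp del: funpow.simps mult_Suc)
  then show ?thesis using g p(1) by blast
qed


end

section \<open>Convolution families and the concentration principle\<close>

lemma prob_bind_pmf:
  "measure_pmf.prob (bind_pmf p q) S = (\<integral>x. measure_pmf.prob (q x) S \<partial>measure_pmf p)"
proof -
  have "(\<integral>x. measure_pmf.prob (q x) S \<partial>measure_pmf p) = enn2real (\<integral>\<^sup>+x. ennreal (measure_pmf.prob (q x) S) \<partial>measure_pmf p)"
    by (rule integral_eq_nn_integral) auto
  then show ?thesis
    by (simp add: measure_pmf.emeasure_eq_measure[symmetric]) (simp add: measure_def)
qed

lemma pmf_tail:
  fixes f :: "'a \<Rightarrow> real"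
  assumes "\<eta> > 0"
  shows "\<exists>r\<ge>r0. measure_pmf.prob p {g. f g > r} \<le> \<eta>"
proof -
  have "(\<lambda>i. measure_pmf.prob p {g. f g > real i}) \<longlonglongrightarrow> measure_pmf.prob p (\<Inter>i. {g. f g > real i})"
    by (rule measure_pmf.finite_Lim_measure_decseq) (auto simp: decseq_def)
  moreover have "(\<Inter>i. {g. f g > real i}) = {}"
  proof -
    have "g \<notin> (\<Inter>i. {g. f g > real i})" for g
    proof -
      obtain i where "f g \<le> real i" using real_arch_simple by blast
      then show ?thesis by (auto simp: not_less)
    qed
    then show ?thesis by blast
  qed
  ultimately have "(\<lambda>i. measure_pmf.prob p {g. f g > real i}) \<longlonglongrightarrow> 0" by simp
  then have "\<forall>\<^sub>F i in sequentially. measure_pmf.prob p {g. f g > real i} < \<eta>"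
    using assms by (rule order_tendstoD)
  moreover have "\<forall>\<^sub>F i in sequentially. r0 \<le> real i"
  proof -
    obtain i0 where i0: "r0 \<le> real i0" using real_arch_simple by blast
    show ?thesis by (rule eventually_sequentiallyI[of i0]) (use i0 in linarith)
  qed
  ultimately have "\<forall>\<^sub>F i in sequentially. measure_pmf.prob p {g. f g > real i} < \<eta> \<and> r0 \<le> real i"
    by (rule eventually_conj)
  then show ?thesis by (auto simp: eventually_sequentially intro: less_imp_le)
qed

text \<open>Only a convolution semigroup of laws is assumed, so that the results apply to the laws
  of the walk and to those of its inverses alike; the latter describe the past seen from the present
  position.\<close>

locale walk_family = hyp_action \<delta> x0 G \<phi>
  for \<delta> :: real and x0 :: "'x::metric_space" and G :: "('g::countable, 'b) monoid_scheme" (structure) and \<phi> +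
  fixes W :: "nat \<Rightarrow> 'g pmf"
  assumes W_carrier: "set_pmf (W n) \<subseteq> carrier G"
    and W_add: "W (k + n) = bind_pmf (W k) (\<lambda>g. map_pmf (\<lambda>h. g \<otimes> h) (W n))"
    and W_reach: "g \<in> carrier G \<Longrightarrow> \<exists>n\<ge>1. g \<in> set_pmf (W n)"
    and nonelem: "non_elementary G \<phi> x0"
begin

lemma prob_carrier: "measure_pmf.prob (W n) S = measure_pmf.prob (W n) {h\<in>carrier G. h \<in> S}"
proof -
  have "measure_pmf.prob (W n) S = measure_pmf.prob (W n) (S \<inter> set_pmf (W n))"
    by (simp add: measure_Int_set_pmf)
  also have "S \<inter> set_pmf (W n) = {h\<in>carrier G. h \<in> S} \<inter> set_pmf (W n)" using W_carrier by auto
  finally show ?thesis by (simp add: measure_Int_set_pmf)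
qed

lemma prob_add:
  "measure_pmf.prob (W (k + n)) S = (\<integral>g. measure_pmf.prob (W n) {h\<in>carrier G. g \<otimes> h \<in> S} \<partial>measure_pmf (W k))"
proof -
  have "measure_pmf.prob (map_pmf (\<lambda>h. g \<otimes> h) (W n)) S = measure_pmf.prob (W n) {h\<in>carrier G. g \<otimes> h \<in> S}" for g
    using prob_carrier[of n "(\<lambda>h. g \<otimes> h) -` S"] by (simp add: measure_map_pmf)
  then show ?thesis by (simp add: W_add prob_bind_pmf)
qed

lemma set_pmf_mult:
  assumes "g \<in> set_pmf (W k)" "h \<in> set_pmf (W n)"
  shows "g \<otimes> h \<in> set_pmf (W (k + n))"
  using assms by (auto simp: W_add)

lemma set_pmf_pow:
  assumes "g \<in> set_pmf (W k)" "m \<ge> 1"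
  shows "g [^] (m::nat) \<in> set_pmf (W (m * k))"
  using assms(2)
proof (induction m rule: nat_induct_at_least)
  case base
  then show ?case using assms(1) W_carrier[of k] by (auto simp: subset_iff)
next
  case (Suc m)
  then show ?case using set_pmf_mult[of "g [^] m" "m * k" g k] assms(1) by (simp add: add.commute)
qed

text \<open>A translate-invariant family of sets has small mass if any of its members can be moved to
  many disjoint sets by increments of the same length: the supremum of the masses at a late time
  is nearly attained, hence nearly attained by all the disjoint translates simultaneously.\<close>

lemma concentration:
  fixes Fam :: "real \<Rightarrow> 'g set set" and c :: "'g \<Rightarrow> real"
  assumes anti: "\<And>D D'. D \<le> D' \<Longrightarrow> Fam D' \<subseteq> Fam D"
    and shift: "\<And>g S D. g \<in> carrier G \<Longrightarrow> S \<in> Fam D \<Longrightarrow> {h\<in>carrier G. g \<otimes> h \<in> S} \<in> Fam (D - c g)"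
    and sep: "\<And>M::nat. M \<ge> 1 \<Longrightarrow> \<exists>k D0 F. finite F \<and> F \<subseteq> set_pmf (W k) \<and>
       (\<forall>S\<in>Fam D0. \<exists>\<gamma>. \<gamma> ` {..<M} \<subseteq> F \<and> (\<forall>i<M. \<forall>j<M. i \<noteq> j \<longrightarrow>
          {h\<in>carrier G. \<gamma> i \<otimes> h \<in> S} \<inter> {h\<in>carrier G. \<gamma> j \<otimes> h \<in> S} = {}))"
    and eps: "\<epsilon> > 0"
  shows "\<exists>D N. \<forall>n\<ge>N. \<forall>S\<in>Fam D. measure_pmf.prob (W n) S \<le> \<epsilon>"
proof -
  obtain M :: nat where M: "3 / \<epsilon> \<le> real M" "M \<ge> 1"
  proof -
    obtain M :: nat where "3 / \<epsilon> \<le> real M" using real_arch_simple by blast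
    then show ?thesis using that[of "max M 1"] by (simp add: max_def)
  qed
  have M': "1 / real M \<le> \<epsilon> / 3" using M eps by (simp add: field_simps)
  obtain k D0 F where F: "finite F" "F \<subseteq> set_pmf (W k)"
    and sepF: "\<And>S. S \<in> Fam D0 \<Longrightarrow> \<exists>\<gamma>. \<gamma> ` {..<M} \<subseteq> F \<and> (\<forall>i<M. \<forall>j<M. i \<noteq> j \<longrightarrow>
          {h\<in>carrier G. \<gamma> i \<otimes> h \<in> S} \<inter> {h\<in>carrier G. \<gamma> j \<otimes> h \<in> S} = {})"
    using sep[OF M(2)] by (elim exE conjE) blast
  \<comment> \<open>Every increment in \<open>F\<close> has at least this mass, whichever of them
    the pigeonhole argument selects.\<close>
  define \<alpha> where "\<alpha> = Min (insert 1 (pmf (W k) ` F))"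
  have a0: "0 < \<alpha>" unfolding \<alpha>_def using F by (auto simp: pmf_positive)
  have a1: "\<alpha> \<le> 1" unfolding \<alpha>_def using F by simp
  have aF: "\<alpha> \<le> pmf (W k) g" if "g \<in> F" for g unfolding \<alpha>_def using F that by simp
  define \<eta> where "\<eta> = \<alpha> * \<epsilon> / 3"
  have eta: "\<eta> > 0" using a0 eps by (simp add: \<eta>_def)
  obtain r where r: "r \<ge> 0" "measure_pmf.prob (W k) {g. c g > r} \<le> \<eta>"
    using pmf_tail[OF eta, of 0 "W k" c] by blast
  \<comment> \<open>The solution of t(j+1) = \<eta> + t(j) - (t(j) - 1/M) \<alpha>: the fixed point
    \<open>1 / real M + \<eta> / \<alpha>\<close> plus a term contracting by
    \<open>1 - \<alpha>\<close>. Each of the three summands ends up at most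
    \<open>\<epsilon> / 3\<close>.\<close>
  define t where "t j = 1 / real M + \<eta> / \<alpha> + (1 - \<alpha>) ^ j" for j :: nat
  have tM: "1 / real M \<le> t j" for j
    using a0 a1 eta by (simp add: t_def)
  have t0: "0 \<le> t j" for j using tM[of j] by (rule order_trans[rotated]) simp
  have step: "\<forall>n \<ge> N + k. \<forall>S\<in>Fam (D + r). measure_pmf.prob (W n) S \<le> t (Suc j)"
    if D: "D \<ge> D0" and IH: "\<forall>n \<ge> N. \<forall>S\<in>Fam D. measure_pmf.prob (W n) S \<le> t j" for D N j
  proof (intro allI impI ballI)
    fix n S assume n: "N + k \<le> n" and S: "S \<in> Fam (D + r)"
    define m where "m = n - k"
    have nm: "n = k + m" "m \<ge> N" using n by (auto simp: m_def)
    define f where "f g = measure_pmf.prob (W m) {h\<in>carrier G. g \<otimes> h \<in> S}" for g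
    have f1: "f g \<le> 1" "0 \<le> f g" for g by (simp_all add: f_def)
    have "S \<in> Fam D0" using anti[of D0 "D + r"] S D r(1) by auto
    then obtain \<gamma> where g: "\<gamma> ` {..<M} \<subseteq> F" and dis: "\<And>i j. i < M \<Longrightarrow> j < M \<Longrightarrow> i \<noteq> j \<Longrightarrow>
          {h\<in>carrier G. \<gamma> i \<otimes> h \<in> S} \<inter> {h\<in>carrier G. \<gamma> j \<otimes> h \<in> S} = {}"
      using sepF by meson
    have "(\<Sum>i<M. f (\<gamma> i)) = measure_pmf.prob (W m) (\<Union>i<M. {h\<in>carrier G. \<gamma> i \<otimes> h \<in> S})"
      unfolding f_def
      by (rule measure_pmf.finite_measure_finite_Union[symmetric])
         (auto simp: disjoint_family_on_def dest: dis)
    also have "\<dots> \<le> 1" by simp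
    finally have sum1: "(\<Sum>i<M. f (\<gamma> i)) \<le> 1" .
    \<comment> \<open>Pigeonhole: the masses of \<open>M\<close> disjoint sets sum to at most
      1.\<close>
    have "\<exists>i<M. f (\<gamma> i) \<le> 1 / real M"
    proof (rule ccontr)
      assume "\<not> ?thesis"
      then have "(\<Sum>i<M. 1 / real M) < (\<Sum>i<M. f (\<gamma> i))"
        using M(2) by (intro sum_strict_mono) (auto simp: not_le lessThan_empty_iff)
      then show False using sum1 M(2) by simp
    qed
    then obtain i where i: "i < M" "f (\<gamma> i) \<le> 1 / real M" by blast
    define g0 where "g0 = \<gamma> i"
    have g0: "g0 \<in> F" "f g0 \<le> 1 / real M" using i g by (auto simp: g0_def)
    \<comment> \<open>An increment with cost above \<open>r\<close> is charged the trivial bound 1,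
      \<open>g0\<close> the bound \<open>1 / real M\<close>, and every other one the inductive bound
      \<open>t j\<close>.\<close>
    have bound: "f g \<le> indicator {g. c g > r} g + (t j - (t j - 1 / real M) * indicator {g0} g)"
      if "g \<in> set_pmf (W k)" for g
    proof (cases "g = g0")
      case True
      then show ?thesis using g0 by (simp add: indicator_def)
    next
      case False
      show ?thesis
      proof (cases "c g > r")
        case True
        then show ?thesis using False f1(1)[of g] tM[of j] t0[of j] by (simp add: indicator_def)
      next
        case c: False
        have "{h\<in>carrier G. g \<otimes> h \<in> S} \<in> Fam (D + r - c g)"
          using that W_carrier S by (intro shift) auto
        then have "{h\<in>carrier G. g \<otimes> h \<in> S} \<in> Fam D"
          using anti[of D "D + r - c g"] c by auto
        then show ?thesis using IH nm False c unfolding f_def by (simp add: indicator_def)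
      qed
    qed
    have intf: "integrable (measure_pmf (W k)) f"
      using f1 by (intro measure_pmf.integrable_const_bound[where B = 1]) auto
    have inti: "integrable (measure_pmf (W k)) (indicator A :: 'g \<Rightarrow> real)" for A
      by (intro measure_pmf.integrable_const_bound[where B = 1]) (auto simp: indicator_def)
    have "measure_pmf.prob (W n) S = (\<integral>g. f g \<partial>measure_pmf (W k))"
      unfolding nm(1) f_def by (rule prob_add)
    also have "\<dots> \<le> (\<integral>g. indicator {g. c g > r} g + (t j - (t j - 1 / real M) * indicator {g0} g) \<partial>measure_pmf (W k))"
      using bound
      by (intro integral_mono_AE intf Bochner_Integration.integrable_add Bochner_Integration.integrable_diff
            Bochner_Integration.integrable_mult_right inti) (auto simp: AE_measure_pmf_iff)
    also have "\<dots> = measure_pmf.prob (W k) {g. c g > r} + (t j - (t j - 1 / real M) * measure_pmf.prob (W k) {g0})"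
      using inti by simp
    also have "\<dots> \<le> \<eta> + (t j - (t j - 1 / real M) * \<alpha>)"
    proof -
      have "(t j - 1 / real M) * \<alpha> \<le> (t j - 1 / real M) * measure_pmf.prob (W k) {g0}"
        using tM[of j] aF[OF g0(1)] by (intro mult_left_mono) (auto simp: measure_pmf_single)
      then show ?thesis using r(2) by linarith
    qed
    also have "\<dots> = t (Suc j)"
      using a0 by (simp add: t_def field_simps)
    finally show "measure_pmf.prob (W n) S \<le> t (Suc j)" .
  qed
  \<comment> \<open>Each round costs \<open>k\<close> units of time and \<open>r\<close> of the
    parameter \<open>D\<close>; only finitely many rounds are made, so both stay finite.\<close>
  have main: "\<forall>n \<ge> j * k. \<forall>S\<in>Fam (D0 + real j * r). measure_pmf.prob (W n) S \<le> t j" for j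
  proof (induction j)
    case 0
    have "1 \<le> t 0" using a0 eta by (simp add: t_def)
    then show ?case by (auto intro: order_trans[OF measure_pmf.prob_le_1])
  next
    case (Suc j)
    have "D0 \<le> D0 + real j * r" using r(1) by simp
    from step[OF this Suc] show ?case by (simp add: algebra_simps)
  qed
  have "(\<lambda>j. (1 - \<alpha>) ^ j) \<longlonglongrightarrow> 0" using a0 a1 by (intro LIMSEQ_power_zero) simp
  then have "\<forall>\<^sub>F j in sequentially. (1 - \<alpha>) ^ j < \<epsilon> / 3" using eps by (intro order_tendstoD) auto
  then obtain j where "(1 - \<alpha>) ^ j < \<epsilon> / 3" by (auto simp: eventually_sequentially)
  moreover have "\<eta> / \<alpha> = \<epsilon> / 3" using a0 by (simp add: \<eta>_def)
  ultimately have "t j \<le> \<epsilon>" using M' unfolding t_def by linarith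
  then show ?thesis using main[of j] by (meson order_trans)
qed

text \<open>Disjoint fixed sets keep the forward and backward orbits of the two loxodromics apart.
  Raising each to a power given by the time at which the other one is reached puts both into the
  support of the same \<open>W k\<close>.\<close>

lemma loxodromic_pair:
  "\<exists>a b k. a \<in> carrier G \<and> b \<in> carrier G \<and> k \<ge> 1 \<and> a \<in> set_pmf (W k) \<and> b \<in> set_pmf (W k) \<and>
     growing a \<and> growing b \<and>
     (\<exists>C. \<forall>a'\<in>{a, inv a}. \<forall>b'\<in>{b, inv b}. \<forall>n m. gprod x0 ((\<phi> a' ^^ n) x0) ((\<phi> b' ^^ m) x0) \<le> C)"
proof -
  obtain g h where gh: "loxodromic G \<phi> g" "loxodromic G \<phi> h" "bfix x0 \<phi> g \<inter> bfix x0 \<phi> h = {}"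
    using nonelem unfolding non_elementary_def by blast
  obtain p where p: "g \<in> carrier G" "p \<ge> 1" "growing (g [^] (p::nat))"
    using loxodromic_growing_pow[OF gh(1)] by blast
  obtain q where q: "h \<in> carrier G" "q \<ge> 1" "growing (h [^] (q::nat))"
    using loxodromic_growing_pow[OF gh(2)] by blast
  obtain i where i: "i \<ge> 1" "g [^] p \<in> set_pmf (W i)" using W_reach[of "g [^] p"] p by auto
  obtain j where j: "j \<ge> 1" "h [^] q \<in> set_pmf (W j)" using W_reach[of "h [^] q"] q by auto
  define a where "a = g [^] (p * j)"
  define b where "b = h [^] (q * i)"
  have a': "a = (g [^] p) [^] j" and b': "b = (h [^] q) [^] i"
    using p q by (simp_all add: a_def b_def nat_pow_pow)
  have ac: "a \<in> carrier G" "b \<in> carrier G" using p q by (simp_all add: a_def b_def)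
  have ga: "growing a" unfolding a' by (rule growing_pow[OF _ p(3) j(1)]) (use p in simp)
  have gb: "growing b" unfolding b' by (rule growing_pow[OF _ q(3) i(1)]) (use q in simp)
  have sa: "a \<in> set_pmf (W (j * i))" unfolding a' using i j by (intro set_pmf_pow) auto
  have sb: "b \<in> set_pmf (W (j * i))" unfolding b' using set_pmf_pow[OF j(2) i(1)] by (simp add: mult.commute)
  have com: "g \<otimes> a = a \<otimes> g" "h \<otimes> b = b \<otimes> h"
    using p q nat_pow_Suc2[of g "p * j"] nat_pow_Suc2[of h "q * i"] unfolding a_def b_def by simp_all
  have com_inv: "x \<otimes> inv y = inv y \<otimes> x" if "x \<otimes> y = y \<otimes> x" "x \<in> carrier G" "y \<in> carrier G" for x y
  proof -
    have "inv y \<otimes> (x \<otimes> y) \<otimes> inv y = inv y \<otimes> x" using that(2,3) by (simp add: m_assoc)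
    moreover have "inv y \<otimes> (y \<otimes> x) \<otimes> inv y = x \<otimes> inv y" using that(2,3) by (simp add: m_assoc[symmetric])
    ultimately show ?thesis using that(1) by simp
  qed
  have bd: "\<exists>C. \<forall>n m. gprod x0 ((\<phi> a' ^^ n) x0) ((\<phi> b' ^^ m) x0) \<le> C"
    if "a' \<in> {a, inv a}" "b' \<in> {b, inv b}" for a' b'
  proof -
    have A: "a' \<in> carrier G" "g \<otimes> a' = a' \<otimes> g" "growing a'"
      using that(1) ac com com_inv[OF com(1)] p ga growing_inv by auto
    have B: "b' \<in> carrier G" "h \<otimes> b' = b' \<otimes> h" "growing b'"
      using that(2) ac com com_inv[OF com(2)] q gb growing_inv by auto
    note fa = growing_class_fixed[OF p(1) A] and fb = growing_class_fixed[OF q(1) B]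
    have "\<not> equiv_inf x0 (\<lambda>n. (\<phi> a' ^^ n) x0) (\<lambda>n. (\<phi> b' ^^ n) x0)"
      using bclass_eq_iff[OF fa(1) fb(1)] fa(2) fb(2) gh(3) by auto
    from bounded_or_equiv[OF fa(1) fb(1) this] show ?thesis .
  qed
  obtain C1 C2 C3 C4 where
    "\<And>n m. gprod x0 ((\<phi> a ^^ n) x0) ((\<phi> b ^^ m) x0) \<le> C1"
    "\<And>n m. gprod x0 ((\<phi> a ^^ n) x0) ((\<phi> (inv b) ^^ m) x0) \<le> C2"
    "\<And>n m. gprod x0 ((\<phi> (inv a) ^^ n) x0) ((\<phi> b ^^ m) x0) \<le> C3"
    "\<And>n m. gprod x0 ((\<phi> (inv a) ^^ n) x0) ((\<phi> (inv b) ^^ m) x0) \<le> C4"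
    using bd[of a b] bd[of a "inv b"] bd[of "inv a" b] bd[of "inv a" "inv b"] by auto
  then have "\<forall>a'\<in>{a, inv a}. \<forall>b'\<in>{b, inv b}. \<forall>n m.
      gprod x0 ((\<phi> a' ^^ n) x0) ((\<phi> b' ^^ m) x0) \<le> max (max C1 C2) (max C3 C4)"
    by (auto simp: le_max_iff_disj)
  moreover have "j * i \<ge> 1" using i j by simp
  ultimately show ?thesis using ac ga gb sa sb by blast
qed

text \<open>Inverses occur since \<open>{h. \<gamma> \<otimes> h \<in> S}\<close> is
  \<open>S\<close> moved by \<open>inv \<gamma>\<close>: a shadow of \<open>z\<close> becomes a
  shadow of \<open>\<phi> (inv \<gamma>) z\<close>. Points with bounded products have disjoint deep
  shadows and, if they are also far from \<open>x0\<close>, disjoint balls around them.\<close>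

definition separating :: "nat \<Rightarrow> 'g set \<Rightarrow> real \<Rightarrow> real \<Rightarrow> bool" where
  "separating M F R C \<longleftrightarrow> (\<forall>z. \<exists>\<gamma>. \<gamma> ` {..<M} \<subseteq> F \<and>
     (\<forall>i<M. R \<le> dist x0 (\<phi> (inv (\<gamma> i)) z)) \<and>
     (\<forall>i<M. \<forall>j<M. i \<noteq> j \<longrightarrow> gprod x0 (\<phi> (inv (\<gamma> i)) z) (\<phi> (inv (\<gamma> j)) z) \<le> C))"

text \<open>The orbits of \<open>a\<close> and \<open>b\<close> are apart, so every \<open>z\<close>
  is away from one of them. If it is away from that of \<open>b\<close>, the inverses of the words
  \<open>b [^] (L - i) \<otimes> a [^] i\<close> first contract it towards the opposite direction of
  \<open>b\<close> and then spread it by powers of \<open>inv a\<close>; otherwise the letters are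
  exchanged.\<close>

lemma separated_translates:
  "\<exists>C. \<forall>R. \<exists>k F. finite F \<and> F \<subseteq> set_pmf (W k) \<and> separating M F R C"
proof -
  obtain a b k C0 where ab: "a \<in> carrier G" "b \<in> carrier G" "k \<ge> 1" "a \<in> set_pmf (W k)" "b \<in> set_pmf (W k)"
     "growing a" "growing b"
     and C0: "\<forall>a'\<in>{a, inv a}. \<forall>b'\<in>{b, inv b}. \<forall>n m. gprod x0 ((\<phi> a' ^^ n) x0) ((\<phi> b' ^^ m) x0) \<le> C0"
    using loxodromic_pair by blast
  have C0': "\<forall>b'\<in>{b, inv b}. \<forall>a'\<in>{a, inv a}. \<forall>n m. gprod x0 ((\<phi> b' ^^ n) x0) ((\<phi> a' ^^ m) x0) \<le> C0"
    using C0 gprod_commute by metis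
  have half: "\<exists>C. \<forall>R. \<exists>L0. \<forall>L\<ge>L0. \<forall>z. (\<forall>n. gprod x0 z ((\<phi> v ^^ n) x0) \<le> C0 + \<delta>) \<longrightarrow>
     (\<forall>i<M. R \<le> dist x0 ((\<phi> (inv u) ^^ i) ((\<phi> (inv v) ^^ (L - i)) z))) \<and>
     (\<forall>i<M. \<forall>j<M. i \<noteq> j \<longrightarrow> gprod x0 ((\<phi> (inv u) ^^ i) ((\<phi> (inv v) ^^ (L - i)) z)) ((\<phi> (inv u) ^^ j) ((\<phi> (inv v) ^^ (L - j)) z)) \<le> C)"
    if uv: "u \<in> carrier G" "v \<in> carrier G" "growing u" "growing v"
      and C: "\<forall>v'\<in>{v, inv v}. \<forall>u'\<in>{u, inv u}. \<forall>n m. gprod x0 ((\<phi> v' ^^ n) x0) ((\<phi> u' ^^ m) x0) \<le> C0" for u v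
  proof -
    have gr: "growing (inv u)" "growing (inv v)" using growing_inv uv by auto
    have iso: "dist (\<phi> (inv u) x) (\<phi> (inv u) y) = dist x y" "dist (\<phi> (inv v) x) (\<phi> (inv v) y) = dist x y" for x y
      using act_isometry uv by auto
    have i1: "\<phi> (inv u) (\<phi> u x) = x" "\<phi> (inv v) (\<phi> v x) = x" for x
      using act_inv1 uv by auto
    have "\<exists>C2. \<forall>n m. gprod x0 ((\<phi> (inv v) ^^ n) x0) ((\<phi> (inv u) ^^ i) ((\<phi> (inv v) ^^ m) x0)) \<le> C2" if "i \<ge> 1" for i
      by (rule independent_translates_bounded[where A' = "\<phi> u" and C = C0])
         (use iso i1 gr C that in \<open>auto simp: growing_def\<close>)
    then show ?thesis
      by (intro separated_orbit_points) (use iso i1 gr in \<open>auto simp: growing_def\<close>)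
  qed
  obtain Ca where Ca: "\<And>R. \<exists>L0. \<forall>L\<ge>L0. \<forall>z. (\<forall>n. gprod x0 z ((\<phi> b ^^ n) x0) \<le> C0 + \<delta>) \<longrightarrow>
     (\<forall>i<M. R \<le> dist x0 ((\<phi> (inv a) ^^ i) ((\<phi> (inv b) ^^ (L - i)) z))) \<and>
     (\<forall>i<M. \<forall>j<M. i \<noteq> j \<longrightarrow> gprod x0 ((\<phi> (inv a) ^^ i) ((\<phi> (inv b) ^^ (L - i)) z)) ((\<phi> (inv a) ^^ j) ((\<phi> (inv b) ^^ (L - j)) z)) \<le> Ca)"
    using half[OF ab(1,2,6,7) C0'] by (elim exE) blast
  obtain Cb where Cb: "\<And>R. \<exists>L0. \<forall>L\<ge>L0. \<forall>z. (\<forall>n. gprod x0 z ((\<phi> a ^^ n) x0) \<le> C0 + \<delta>) \<longrightarrow>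
     (\<forall>i<M. R \<le> dist x0 ((\<phi> (inv b) ^^ i) ((\<phi> (inv a) ^^ (L - i)) z))) \<and>
     (\<forall>i<M. \<forall>j<M. i \<noteq> j \<longrightarrow> gprod x0 ((\<phi> (inv b) ^^ i) ((\<phi> (inv a) ^^ (L - i)) z)) ((\<phi> (inv b) ^^ j) ((\<phi> (inv a) ^^ (L - j)) z)) \<le> Cb)"
    using half[OF ab(2,1,7,6) C0] by (elim exE) blast
  have word: "v [^] (L - i) \<otimes> u [^] i \<in> set_pmf (W (L * k))" "v [^] (L - i) \<otimes> u [^] i \<in> carrier G"
    "\<phi> (inv (v [^] (L - i) \<otimes> u [^] i)) z = (\<phi> (inv u) ^^ i) ((\<phi> (inv v) ^^ (L - i)) z)"
    if "u \<in> {a, b}" "v \<in> {a, b}" "i < L" for u v i L z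
  proof -
    have uv: "u \<in> carrier G" "v \<in> carrier G" "u \<in> set_pmf (W k)" "v \<in> set_pmf (W k)" using that ab by auto
    show "v [^] (L - i) \<otimes> u [^] i \<in> carrier G" using uv by simp
    show "v [^] (L - i) \<otimes> u [^] i \<in> set_pmf (W (L * k))"
    proof (cases "i = 0")
      case True
      then show ?thesis using set_pmf_pow[OF uv(4), of L] that uv by simp
    next
      case False
      have "L - i + i = L" using that by simp
      then have "(L - i) * k + i * k = L * k" by (metis add_mult_distrib)
      then show ?thesis
        using set_pmf_mult[OF set_pmf_pow[OF uv(4), of "L - i"] set_pmf_pow[OF uv(3), of i]] that False by simp
    qed
    have "inv (v [^] (L - i) \<otimes> u [^] i) = (inv u) [^] i \<otimes> (inv v) [^] (L - i)"
      using uv by (simp add: inv_mult_group nat_pow_inv)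
    then show "\<phi> (inv (v [^] (L - i) \<otimes> u [^] i)) z = (\<phi> (inv u) ^^ i) ((\<phi> (inv v) ^^ (L - i)) z)"
      using uv by (simp add: act_mult act_pow)
  qed
  have "\<exists>k F. finite F \<and> F \<subseteq> set_pmf (W k) \<and> separating M F R (max Ca Cb)" for R
  proof -
    obtain L1 where L1: "\<forall>L\<ge>L1. \<forall>z. (\<forall>n. gprod x0 z ((\<phi> b ^^ n) x0) \<le> C0 + \<delta>) \<longrightarrow>
     (\<forall>i<M. R \<le> dist x0 ((\<phi> (inv a) ^^ i) ((\<phi> (inv b) ^^ (L - i)) z))) \<and>
     (\<forall>i<M. \<forall>j<M. i \<noteq> j \<longrightarrow> gprod x0 ((\<phi> (inv a) ^^ i) ((\<phi> (inv b) ^^ (L - i)) z)) ((\<phi> (inv a) ^^ j) ((\<phi> (inv b) ^^ (L - j)) z)) \<le> Ca)"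
      using Ca[of R] by (elim exE) (rule that)
    obtain L2 where L2: "\<forall>L\<ge>L2. \<forall>z. (\<forall>n. gprod x0 z ((\<phi> a ^^ n) x0) \<le> C0 + \<delta>) \<longrightarrow>
     (\<forall>i<M. R \<le> dist x0 ((\<phi> (inv b) ^^ i) ((\<phi> (inv a) ^^ (L - i)) z))) \<and>
     (\<forall>i<M. \<forall>j<M. i \<noteq> j \<longrightarrow> gprod x0 ((\<phi> (inv b) ^^ i) ((\<phi> (inv a) ^^ (L - i)) z)) ((\<phi> (inv b) ^^ j) ((\<phi> (inv a) ^^ (L - j)) z)) \<le> Cb)"
      using Cb[of R] by (elim exE) (rule that)
    define L where "L = L1 + L2 + M + 1"
    define F where "F = (\<lambda>i. b [^] (L - i) \<otimes> a [^] i) ` {..<M} \<union> (\<lambda>i. a [^] (L - i) \<otimes> b [^] i) ` {..<M}"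
    have LL: "L1 \<le> L" "L2 \<le> L" by (auto simp: L_def)
    have iL: "i < L" if "i < M" for i using that by (simp add: L_def)
    have F: "finite F" "F \<subseteq> set_pmf (W (L * k))"
      unfolding F_def using word(1)[of a b] word(1)[of b a] iL by auto
    have "\<exists>\<gamma>. \<gamma> ` {..<M} \<subseteq> F \<and> (\<forall>i<M. R \<le> dist x0 (\<phi> (inv (\<gamma> i)) z)) \<and>
      (\<forall>i<M. \<forall>j<M. i \<noteq> j \<longrightarrow> gprod x0 (\<phi> (inv (\<gamma> i)) z) (\<phi> (inv (\<gamma> j)) z) \<le> max Ca Cb)" for z
    proof (cases "\<forall>n. gprod x0 z ((\<phi> b ^^ n) x0) \<le> C0 + \<delta>")
      case True
      show ?thesis
        by (rule exI[of _ "\<lambda>i. b [^] (L - i) \<otimes> a [^] i"])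
           (use L1[THEN spec[of _ L], THEN mp, OF LL(1), THEN spec[of _ z], THEN mp, OF True] word(3)[of a b] iL in \<open>auto simp: F_def le_max_iff_disj\<close>)
    next
      case False
      then obtain n where n: "C0 + \<delta> < gprod x0 z ((\<phi> b ^^ n) x0)" by (auto simp: not_le)
      have "gprod x0 z ((\<phi> a ^^ m) x0) \<le> C0 + \<delta>" for m
      proof (rule ccontr)
        assume "\<not> gprod x0 z ((\<phi> a ^^ m) x0) \<le> C0 + \<delta>"
        then have "C0 < gprod x0 ((\<phi> a ^^ m) x0) ((\<phi> b ^^ n) x0)"
          using hyp[of x0 "(\<phi> a ^^ m) x0" z "(\<phi> b ^^ n) x0"] n by (simp add: gprod_commute[of x0 _ z])
        moreover have "gprod x0 ((\<phi> a ^^ m) x0) ((\<phi> b ^^ n) x0) \<le> C0" using C0 by simp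
        ultimately show False by simp
      qed
      then have z: "\<forall>n. gprod x0 z ((\<phi> a ^^ n) x0) \<le> C0 + \<delta>" by simp
      show ?thesis
        by (rule exI[of _ "\<lambda>i. a [^] (L - i) \<otimes> b [^] i"])
           (use L2[THEN spec[of _ L], THEN mp, OF LL(2), THEN spec[of _ z], THEN mp, OF z] word(3)[of b a] iL in \<open>auto simp: F_def le_max_iff_disj\<close>)
    qed
    then have "separating M F R (max Ca Cb)" unfolding separating_def by blast
    then show ?thesis using F by blast
  qed
  then show ?thesis by blast
qed

text \<open>Obtained from \<open>concentration\<close> with the displacement as cost, since moving
  the base point changes a product by at most that. The translates of a deep shadow are shadows of
  points whose products are at most \<open>C\<close>, still deeper than \<open>C + \<delta>\<close>;
  a common element would violate \<open>hyp\<close>.\<close>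

lemma shadow_small_eventually:
  assumes eps: "\<epsilon> > 0"
  shows "\<exists>D N. \<forall>n\<ge>N. \<forall>z. measure_pmf.prob (W n) {h\<in>carrier G. D \<le> gprod x0 z (\<phi> h x0)} \<le> \<epsilon>"
proof -
  define Fam where "Fam D = {S. \<exists>z. S \<subseteq> {h\<in>carrier G. D \<le> gprod x0 z (\<phi> h x0)}}" for D
  have "\<exists>D N. \<forall>n\<ge>N. \<forall>S\<in>Fam D. measure_pmf.prob (W n) S \<le> \<epsilon>"
  proof (rule concentration[where c = "\<lambda>g. dist x0 (\<phi> (inv g) x0)", OF _ _ _ eps])
    fix D D' :: real assume D: "D \<le> D'"
    show "Fam D' \<subseteq> Fam D"
    proof
      fix S assume "S \<in> Fam D'"
      then obtain z where "S \<subseteq> {h\<in>carrier G. D' \<le> gprod x0 z (\<phi> h x0)}" by (auto simp: Fam_def)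
      then have "S \<subseteq> {h\<in>carrier G. D \<le> gprod x0 z (\<phi> h x0)}" using D by force
      then show "S \<in> Fam D" by (auto simp: Fam_def)
    qed
  next
    fix g S D assume g: "g \<in> carrier G" and "S \<in> Fam D"
    then obtain z where z: "S \<subseteq> {h\<in>carrier G. D \<le> gprod x0 z (\<phi> h x0)}" by (auto simp: Fam_def)
    have "D - dist x0 (\<phi> (inv g) x0) \<le> gprod x0 (\<phi> (inv g) z) (\<phi> h x0)" if "h \<in> carrier G" "g \<otimes> h \<in> S" for h
    proof -
      have "D \<le> gprod x0 z (\<phi> g (\<phi> h x0))" using z that g by (auto simp: act_mult)
      also have "\<dots> = gprod (\<phi> (inv g) x0) (\<phi> (inv g) z) (\<phi> h x0)"
        using gprod_act_inv[of "inv g" x0 "\<phi> (inv g) z" "\<phi> h x0"] g by (simp add: act_inv2)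
      also have "\<dots> \<le> gprod x0 (\<phi> (inv g) z) (\<phi> h x0) + dist x0 (\<phi> (inv g) x0)"
        by (subst dist_commute) (rule gprod_base_change)
      finally show ?thesis by simp
    qed
    then show "{h \<in> carrier G. g \<otimes> h \<in> S} \<in> Fam (D - dist x0 (\<phi> (inv g) x0))"
      unfolding Fam_def by blast
  next
    fix M :: nat assume "M \<ge> 1"
    obtain C where C: "\<And>R. \<exists>k F. finite F \<and> F \<subseteq> set_pmf (W k) \<and> separating M F R C"
      using separated_translates[of M] by blast
    obtain k F where F: "finite F" "F \<subseteq> set_pmf (W k)" and sep: "separating M F 0 C"
      using C[of 0] by blast
    define r where "r = (\<Sum>g\<in>F. dist x0 (\<phi> (inv g) x0))"
    have r: "dist x0 (\<phi> (inv g) x0) \<le> r" if "g \<in> F" for g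
      unfolding r_def using F that by (intro member_le_sum) auto
    have "\<exists>\<gamma>. \<gamma> ` {..<M} \<subseteq> F \<and> (\<forall>i<M. \<forall>j<M. i \<noteq> j \<longrightarrow>
          {h\<in>carrier G. \<gamma> i \<otimes> h \<in> S} \<inter> {h\<in>carrier G. \<gamma> j \<otimes> h \<in> S} = {})" if S: "S \<in> Fam (C + \<delta> + r + 1)" for S
    proof -
      obtain z where z: "S \<subseteq> {h\<in>carrier G. C + \<delta> + r + 1 \<le> gprod x0 z (\<phi> h x0)}" using S by (auto simp: Fam_def)
      obtain \<gamma> where g: "\<gamma> ` {..<M} \<subseteq> F" and gp: "\<forall>i<M. \<forall>j<M. i \<noteq> j \<longrightarrow> gprod x0 (\<phi> (inv (\<gamma> i)) z) (\<phi> (inv (\<gamma> j)) z) \<le> C"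
        using sep unfolding separating_def by blast
      have key: "C + \<delta> + 1 \<le> gprod x0 (\<phi> (inv (\<gamma> i)) z) (\<phi> h x0)" if "i < M" "h \<in> carrier G" "\<gamma> i \<otimes> h \<in> S" for i h
      proof -
        have gi: "\<gamma> i \<in> carrier G" "\<gamma> i \<in> F" using g that(1) F W_carrier[of k] by auto
        have "C + \<delta> + r + 1 \<le> gprod x0 z (\<phi> (\<gamma> i) (\<phi> h x0))" using z that gi by (auto simp: act_mult)
        also have "\<dots> = gprod (\<phi> (inv (\<gamma> i)) x0) (\<phi> (inv (\<gamma> i)) z) (\<phi> h x0)"
          using gprod_act_inv[of "inv (\<gamma> i)" x0 "\<phi> (inv (\<gamma> i)) z" "\<phi> h x0"] gi by (simp add: act_inv2)
        also have "\<dots> \<le> gprod x0 (\<phi> (inv (\<gamma> i)) z) (\<phi> h x0) + dist x0 (\<phi> (inv (\<gamma> i)) x0)"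
          by (subst dist_commute) (rule gprod_base_change)
        finally show ?thesis using r[OF gi(2)] by simp
      qed
      have "False" if ij: "i < M" "j < M" "i \<noteq> j" and h: "h \<in> carrier G" "\<gamma> i \<otimes> h \<in> S" "\<gamma> j \<otimes> h \<in> S" for i j h
      proof -
        have "C + 1 \<le> gprod x0 (\<phi> (inv (\<gamma> i)) z) (\<phi> (inv (\<gamma> j)) z)"
          using key[OF ij(1) h(1,2)] key[OF ij(2) h(1,3)] hyp[of x0 "\<phi> (inv (\<gamma> i)) z" "\<phi> h x0" "\<phi> (inv (\<gamma> j)) z"]
          by (simp add: gprod_commute[of x0 "\<phi> h x0"])
        then show False using gp ij by fastforce
      qed
      then show ?thesis using g by blast
    qed
    then show "\<exists>k D0 F. finite F \<and> F \<subseteq> set_pmf (W k) \<and>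
       (\<forall>S\<in>Fam D0. \<exists>\<gamma>. \<gamma> ` {..<M} \<subseteq> F \<and> (\<forall>i<M. \<forall>j<M. i \<noteq> j \<longrightarrow>
          {h\<in>carrier G. \<gamma> i \<otimes> h \<in> S} \<inter> {h\<in>carrier G. \<gamma> j \<otimes> h \<in> S} = {}))"
      using F by blast
  qed
  then obtain D N where DN: "\<And>n S. n \<ge> N \<Longrightarrow> S \<in> Fam D \<Longrightarrow> measure_pmf.prob (W n) S \<le> \<epsilon>" by blast
  have "{h\<in>carrier G. D \<le> gprod x0 z (\<phi> h x0)} \<in> Fam D" for z unfolding Fam_def by blast
  then show ?thesis using DN by blast
qed

text \<open>Before the time \<open>N\<close> there are finitely many laws, each tight, and a shadow
  deeper than the typical displacement is rarely reached.\<close>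

lemma shadow_small:
  assumes eps: "\<epsilon> > 0"
  shows "\<exists>D. \<forall>n z. measure_pmf.prob (W n) {h\<in>carrier G. D \<le> gprod x0 z (\<phi> h x0)} \<le> \<epsilon>"
proof -
  obtain D0 N where D0: "\<And>n z. n \<ge> N \<Longrightarrow> measure_pmf.prob (W n) {h\<in>carrier G. D0 \<le> gprod x0 z (\<phi> h x0)} \<le> \<epsilon>"
    using shadow_small_eventually[OF eps] by blast
  have "\<exists>r\<ge>0. measure_pmf.prob (W n) {h. dist x0 (\<phi> h x0) > r} \<le> \<epsilon>" for n
    by (rule pmf_tail[OF eps])
  then obtain r where r: "\<And>n. r n \<ge> 0" "\<And>n. measure_pmf.prob (W n) {h. dist x0 (\<phi> h x0) > r n} \<le> \<epsilon>" by metis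
  define D where "D = \<bar>D0\<bar> + (\<Sum>n<N. r n) + 1"
  have "measure_pmf.prob (W n) {h\<in>carrier G. D \<le> gprod x0 z (\<phi> h x0)} \<le> \<epsilon>" for n z
  proof (cases "n \<ge> N")
    case True
    have "D0 \<le> D" unfolding D_def using sum_nonneg[of "{..<N}" r] r(1) by auto
    then have "measure_pmf.prob (W n) {h\<in>carrier G. D \<le> gprod x0 z (\<phi> h x0)}
        \<le> measure_pmf.prob (W n) {h\<in>carrier G. D0 \<le> gprod x0 z (\<phi> h x0)}"
      by (intro measure_pmf.finite_measure_mono) auto
    then show ?thesis using D0[OF True, of z] by linarith
  next
    case False
    have "r n \<le> (\<Sum>n<N. r n)" using False r(1) by (intro member_le_sum) auto
    then have rD: "r n < D" unfolding D_def by simp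
    have "dist x0 (\<phi> h x0) > r n" if "D \<le> gprod x0 z (\<phi> h x0)" for h
      using gprod_le_dist2[of x0 z "\<phi> h x0"] that rD by linarith
    then have "measure_pmf.prob (W n) {h\<in>carrier G. D \<le> gprod x0 z (\<phi> h x0)}
        \<le> measure_pmf.prob (W n) {h. dist x0 (\<phi> h x0) > r n}"
      by (intro measure_pmf.finite_measure_mono) auto
    then show ?thesis using r(2)[of n] by linarith
  qed
  then show ?thesis by blast
qed

text \<open>Isometries preserve radii, hence the cost 0. Two points at distance at least
  \<open>R + C + 1\<close> from \<open>x0\<close> with product at most \<open>C\<close> are more
  than \<open>2 * R\<close> apart, so the translated balls are disjoint.\<close>

lemma ball_small:
  assumes eps: "\<epsilon> > 0"
  shows "\<exists>N. \<forall>n\<ge>N. \<forall>z. measure_pmf.prob (W n) {h\<in>carrier G. dist z (\<phi> h x0) \<le> R} \<le> \<epsilon>"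
proof -
  define Fam where "Fam D = {S. \<exists>z. S \<subseteq> {h\<in>carrier G. dist z (\<phi> h x0) \<le> R}}" for D :: real
  have "\<exists>D N. \<forall>n\<ge>N. \<forall>S\<in>Fam D. measure_pmf.prob (W n) S \<le> \<epsilon>"
  proof (rule concentration[where c = "\<lambda>g. 0", OF _ _ _ eps])
    fix D D' :: real
    show "Fam D' \<subseteq> Fam D" unfolding Fam_def by simp
  next
    fix g S D assume g: "g \<in> carrier G" and "S \<in> Fam D"
    then obtain z where z: "S \<subseteq> {h\<in>carrier G. dist z (\<phi> h x0) \<le> R}" by (auto simp: Fam_def)
    have "dist (\<phi> (inv g) z) (\<phi> h x0) \<le> R" if "h \<in> carrier G" "g \<otimes> h \<in> S" for h
    proof -
      have "dist z (\<phi> g (\<phi> h x0)) \<le> R" using z that g by (auto simp: act_mult)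
      then show ?thesis using dist_act_inv[OF g, of "\<phi> h x0" z] by (simp add: dist_commute)
    qed
    then show "{h \<in> carrier G. g \<otimes> h \<in> S} \<in> Fam (D - 0)"
      unfolding Fam_def by blast
  next
    fix M :: nat assume "M \<ge> 1"
    obtain C where C: "\<And>R. \<exists>k F. finite F \<and> F \<subseteq> set_pmf (W k) \<and> separating M F R C"
      using separated_translates[of M] by blast
    obtain k F where F: "finite F" "F \<subseteq> set_pmf (W k)" and sep: "separating M F (R + C + 1) C"
      using C[of "R + C + 1"] by blast
    have "\<exists>\<gamma>. \<gamma> ` {..<M} \<subseteq> F \<and> (\<forall>i<M. \<forall>j<M. i \<noteq> j \<longrightarrow>
          {h\<in>carrier G. \<gamma> i \<otimes> h \<in> S} \<inter> {h\<in>carrier G. \<gamma> j \<otimes> h \<in> S} = {})" if S: "S \<in> Fam 0" for S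
    proof -
      obtain z where z: "S \<subseteq> {h\<in>carrier G. dist z (\<phi> h x0) \<le> R}" using S by (auto simp: Fam_def)
      obtain \<gamma> where g: "\<gamma> ` {..<M} \<subseteq> F" and gd0: "\<forall>i<M. R + C + 1 \<le> dist x0 (\<phi> (inv (\<gamma> i)) z)"
        and gp0: "\<forall>i<M. \<forall>j<M. i \<noteq> j \<longrightarrow> gprod x0 (\<phi> (inv (\<gamma> i)) z) (\<phi> (inv (\<gamma> j)) z) \<le> C"
        using spec[OF sep[unfolded separating_def], of z] by (elim exE conjE) (rule that)
      have gd: "R + C + 1 \<le> dist x0 (\<phi> (inv (\<gamma> i)) z)" if "i < M" for i using gd0 that by blast
      have gp: "gprod x0 (\<phi> (inv (\<gamma> i)) z) (\<phi> (inv (\<gamma> j)) z) \<le> C" if "i < M" "j < M" "i \<noteq> j" for i j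
        using gp0 that by blast
      have key: "dist (\<phi> (inv (\<gamma> i)) z) (\<phi> h x0) \<le> R" if "i < M" "h \<in> carrier G" "\<gamma> i \<otimes> h \<in> S" for i h
      proof -
        have gi: "\<gamma> i \<in> carrier G" "\<gamma> i \<in> F" using g that(1) F W_carrier[of k] by auto
        have "dist z (\<phi> (\<gamma> i) (\<phi> h x0)) \<le> R" using z that gi by (auto simp: act_mult)
        then show ?thesis using dist_act_inv[OF gi(1), of "\<phi> h x0" z] by (simp add: dist_commute)
      qed
      have "False" if ij: "i < M" "j < M" "i \<noteq> j" and h: "h \<in> carrier G" "\<gamma> i \<otimes> h \<in> S" "\<gamma> j \<otimes> h \<in> S" for i j h
      proof -
        have "dist (\<phi> (inv (\<gamma> i)) z) (\<phi> (inv (\<gamma> j)) z) \<le> 2 * R"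
          using key[OF ij(1) h(1,2)] key[OF ij(2) h(1,3)] dist_triangle2[of "\<phi> (inv (\<gamma> i)) z" "\<phi> (inv (\<gamma> j)) z" "\<phi> h x0"]
          by simp
        then show False using gp[OF ij] gd[OF ij(1)] gd[OF ij(2)] by (simp add: gprod_def field_simps)
      qed
      then show ?thesis using g by blast
    qed
    then show "\<exists>k D0 F. finite F \<and> F \<subseteq> set_pmf (W k) \<and>
       (\<forall>S\<in>Fam D0. \<exists>\<gamma>. \<gamma> ` {..<M} \<subseteq> F \<and> (\<forall>i<M. \<forall>j<M. i \<noteq> j \<longrightarrow>
          {h\<in>carrier G. \<gamma> i \<otimes> h \<in> S} \<inter> {h\<in>carrier G. \<gamma> j \<otimes> h \<in> S} = {}))"
      using F by blast
  qed
  then obtain D N where DN: "\<And>n S. n \<ge> N \<Longrightarrow> S \<in> Fam D \<Longrightarrow> measure_pmf.prob (W n) S \<le> \<epsilon>" by blast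
  have "{h\<in>carrier G. dist z (\<phi> h x0) \<le> R} \<in> Fam D" for z unfolding Fam_def by blast
  then show ?thesis using DN by blast
qed

end

section \<open>The space of increments\<close>

definition iid :: "'a pmf \<Rightarrow> (nat \<Rightarrow> 'a) measure" where
  "iid \<mu> = PiM UNIV (\<lambda>_. measure_pmf \<mu>)"

definition shift :: "nat \<Rightarrow> (nat \<Rightarrow> 'a) \<Rightarrow> (nat \<Rightarrow> 'a)" where
  "shift n \<omega> = (\<lambda>i. \<omega> (n + i))"

definition prefix :: "nat \<Rightarrow> (nat \<Rightarrow> 'a) \<Rightarrow> 'a list" where
  "prefix n \<omega> = map \<omega> [0..<n]"

lemma prefix_eq_iff: "prefix n \<omega> = prefix n \<omega>' \<longleftrightarrow> (\<forall>i<n. \<omega> i = \<omega>' i)"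
  by (auto simp: prefix_def)

lemma prob_space_iid: "prob_space (iid \<mu>)"
  unfolding iid_def by (intro prob_space_PiM measure_pmf.prob_space_axioms)

lemma space_iid [simp]: "space (iid \<mu>) = UNIV"
  by (simp add: iid_def space_PiM PiE_def)

lemma sets_iid: "sets (iid \<mu>) = sets (PiM UNIV (\<lambda>_. count_space UNIV))"
  unfolding iid_def by (intro sets_PiM_cong) auto

lemma measurable_iid_coord [measurable]: "(\<lambda>\<omega>. \<omega> i) \<in> iid \<mu> \<rightarrow>\<^sub>M count_space UNIV"
  unfolding iid_def using measurable_component_singleton[of i UNIV "\<lambda>_. measure_pmf \<mu>"] by simp

lemma measurable_into_iid:
  assumes "\<And>i. (\<lambda>x. f x i) \<in> N \<rightarrow>\<^sub>M count_space UNIV"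
  shows "f \<in> N \<rightarrow>\<^sub>M iid \<mu>"
  unfolding iid_def
  by (rule measurable_PiM_single') (use assms in \<open>auto simp: PiE_def\<close>)

lemma measurable_shift [measurable]: "shift n \<in> iid \<mu> \<rightarrow>\<^sub>M iid \<mu>"
  by (rule measurable_into_iid) (simp add: shift_def)

lemma measurable_prefix [measurable]:
  "(prefix n :: (nat \<Rightarrow> 'a::countable) \<Rightarrow> 'a list) \<in> iid \<mu> \<rightarrow>\<^sub>M count_space UNIV"
proof (induction n)
  case 0
  then show ?case by (simp add: prefix_def)
next
  case (Suc n)
  have "(\<lambda>\<omega>. (\<lambda>(l, a). l @ [a]) (prefix n \<omega>, \<omega> n)) \<in> iid \<mu> \<rightarrow>\<^sub>M count_space UNIV"
    by (rule measurable_compose[where N = "count_space UNIV \<Otimes>\<^sub>M count_space UNIV"])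
       (use Suc in \<open>auto simp: pair_measure_countable\<close>)
  then show ?case by (simp add: prefix_def)
qed

text \<open>The first \<open>n\<close> coordinates form a list over a countable type, a discrete
  variable, so every function of them is measurable.\<close>

lemma measurable_finite_coords:
  fixes f :: "(nat \<Rightarrow> 'a::countable) \<Rightarrow> 'c"
  assumes "\<And>\<omega> \<omega>'. (\<And>i. i < n \<Longrightarrow> \<omega> i = \<omega>' i) \<Longrightarrow> f \<omega> = f \<omega>'" and "\<And>\<omega>. f \<omega> \<in> space N"
  shows "f \<in> iid \<mu> \<rightarrow>\<^sub>M N"
proof -
  define g where "g l = f (\<lambda>i. if i < n then l ! i else undefined)" for l
  have "f = (\<lambda>\<omega>. g (prefix n \<omega>))"
    unfolding g_def by (rule ext) (rule assms(1), simp add: prefix_def)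
  moreover have "g \<in> count_space UNIV \<rightarrow>\<^sub>M N" using assms(2) by (simp add: g_def)
  ultimately show ?thesis by (simp add: measurable_compose[OF measurable_prefix])
qed

lemma iid_split:
  assumes [measurable]: "f \<in> borel_measurable (iid \<mu>)"
  shows "(\<integral>\<^sup>+\<omega>. f \<omega> \<partial>iid \<mu>) = (\<integral>\<^sup>+\<omega>. \<integral>\<^sup>+\<omega>'. f (comb_seq n \<omega> \<omega>') \<partial>iid \<mu> \<partial>iid \<mu>)"
proof -
  interpret prob_space "measure_pmf \<mu>" by (rule measure_pmf.prob_space_axioms)
  interpret sequence_space "measure_pmf \<mu>" by standard
  interpret I: prob_space "iid \<mu>" by (rule prob_space_iid)
  have m: "(\<lambda>(\<omega>, \<omega>'). comb_seq n \<omega> \<omega>') \<in> iid \<mu> \<Otimes>\<^sub>M iid \<mu> \<rightarrow>\<^sub>M iid \<mu>"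
    unfolding iid_def by (rule measurable_comb_seq)
  have "iid \<mu> = distr (iid \<mu> \<Otimes>\<^sub>M iid \<mu>) (iid \<mu>) (\<lambda>(\<omega>, \<omega>'). comb_seq n \<omega> \<omega>')"
    unfolding iid_def by (rule PiM_comb_seq[symmetric])
  then have "(\<integral>\<^sup>+\<omega>. f \<omega> \<partial>iid \<mu>) = (\<integral>\<^sup>+\<omega>. f \<omega> \<partial>distr (iid \<mu> \<Otimes>\<^sub>M iid \<mu>) (iid \<mu>) (\<lambda>(\<omega>, \<omega>'). comb_seq n \<omega> \<omega>'))"
    by simp
  also have "\<dots> = (\<integral>\<^sup>+x. f ((\<lambda>(\<omega>, \<omega>'). comb_seq n \<omega> \<omega>') x) \<partial>(iid \<mu> \<Otimes>\<^sub>M iid \<mu>))"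
    by (rule nn_integral_distr[OF m]) measurable
  also have "\<dots> = (\<integral>\<^sup>+\<omega>. \<integral>\<^sup>+\<omega>'. f (comb_seq n \<omega> \<omega>') \<partial>iid \<mu> \<partial>iid \<mu>)"
    using m by (subst I.nn_integral_fst[symmetric]) (auto intro: measurable_compose[OF m])
  finally show ?thesis .
qed

text \<open>The increments from time \<open>n\<close> on are independent of the first
  \<open>n\<close> and have the same joint law. Since \<open>X\<close> has countable range,
  measurability of each \<open>F c\<close> is enough.\<close>

lemma markov:
  fixes X :: "(nat \<Rightarrow> 'a::countable) \<Rightarrow> 'c::countable"
  assumes X: "\<And>\<omega> \<omega>'. (\<And>i. i < n \<Longrightarrow> \<omega> i = \<omega>' i) \<Longrightarrow> X \<omega> = X \<omega>'"
    and F: "\<And>c. F c \<in> borel_measurable (iid \<mu>)"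
  shows "(\<integral>\<^sup>+\<omega>. F (X \<omega>) (shift n \<omega>) \<partial>iid \<mu>) = (\<integral>\<^sup>+\<omega>. \<integral>\<^sup>+\<omega>'. F (X \<omega>) \<omega>' \<partial>iid \<mu> \<partial>iid \<mu>)"
proof -
  have [measurable]: "X \<in> iid \<mu> \<rightarrow>\<^sub>M count_space UNIV" by (rule measurable_finite_coords[OF X]) auto
  have [measurable]: "(\<lambda>\<omega>. F (X \<omega>) (shift n \<omega>)) \<in> borel_measurable (iid \<mu>)"
    by (rule measurable_compose_countable[where f = "\<lambda>c \<omega>. F c (shift n \<omega>)"])
       (use F in \<open>auto intro: measurable_compose[OF measurable_shift]\<close>)
  have "X (comb_seq n \<omega> \<omega>') = X \<omega>" for \<omega> \<omega>' by (rule X) (simp add: comb_seq_def)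
  moreover have "shift n (comb_seq n \<omega> \<omega>') = \<omega>'" for \<omega> \<omega>' :: "nat \<Rightarrow> 'a"
    by (simp add: comb_seq_def shift_def fun_eq_iff)
  ultimately show ?thesis by (subst iid_split[of _ _ n]) auto
qed

lemma distr_shift: "distr (iid \<mu>) (iid \<mu>) (shift n) = iid \<mu>" for \<mu> :: "'a::countable pmf"
proof (rule measure_eqI)
  fix A assume "A \<in> sets (distr (iid \<mu>) (iid \<mu>) (shift n))"
  then have A: "A \<in> sets (iid \<mu>)" by simp
  interpret I: prob_space "iid \<mu>" by (rule prob_space_iid)
  have "emeasure (distr (iid \<mu>) (iid \<mu>) (shift n)) A = (\<integral>\<^sup>+\<omega>. indicator A (shift n \<omega>) \<partial>iid \<mu>)"
    using A by (simp add: nn_integral_distr flip: nn_integral_indicator)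
  also have "\<dots> = (\<integral>\<^sup>+\<omega>. \<integral>\<^sup>+\<omega>'. indicator A \<omega>' \<partial>iid \<mu> \<partial>iid \<mu>)"
    using markov[of n "\<lambda>_. ()" "\<lambda>_. indicator A" \<mu>] A by simp
  also have "\<dots> = emeasure (iid \<mu>) A" using A I.emeasure_space_1 by simp
  finally show "emeasure (distr (iid \<mu>) (iid \<mu>) (shift n)) A = emeasure (iid \<mu>) A" .
qed simp

lemma distr_coord: "distr (iid \<mu>) (count_space UNIV) (\<lambda>\<omega>. \<omega> i) = measure_pmf \<mu>"
proof -
  have "distr (PiM UNIV (\<lambda>_. measure_pmf \<mu>)) (measure_pmf \<mu>) (\<lambda>\<omega>. \<omega> i) = measure_pmf \<mu>"
    by (rule distr_PiM_component) (auto intro: measure_pmf.prob_space_axioms)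
  moreover have "distr (iid \<mu>) (count_space UNIV) (\<lambda>\<omega>. \<omega> i) = distr (iid \<mu>) (measure_pmf \<mu>) (\<lambda>\<omega>. \<omega> i)"
    by (rule distr_cong) auto
  ultimately show ?thesis by (simp add: iid_def)
qed

lemma nn_integral_coord: "(\<integral>\<^sup>+\<omega>. h (\<omega> i) \<partial>iid \<mu>) = (\<integral>\<^sup>+g. h g \<partial>measure_pmf \<mu>)"
  by (subst distr_coord[of \<mu> i, symmetric]) (simp add: nn_integral_distr)

lemma AE_iid_coords: "AE \<omega> in iid \<mu>. \<forall>i. \<omega> i \<in> set_pmf \<mu>"
proof -
  have "AE \<omega> in iid \<mu>. \<omega> i \<in> set_pmf \<mu>" for i
  proof -
    have "AE g in distr (iid \<mu>) (count_space UNIV) (\<lambda>\<omega>. \<omega> i). g \<in> set_pmf \<mu>"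
      unfolding distr_coord by (simp add: AE_measure_pmf)
    then show ?thesis by (subst (asm) AE_distr_iff) auto
  qed
  then show ?thesis by (simp add: AE_all_countable)
qed

section \<open>The random walk, its laws and the laws of its inverses\<close>

locale rand_walk = hyp_action \<delta> x0 G \<phi>
  for \<delta> :: real and x0 :: "'x::metric_space" and G :: "('g::countable, 'b) monoid_scheme" (structure) and \<phi> +
  fixes \<mu> :: "'g pmf"
  assumes mu_carrier: "set_pmf \<mu> \<subseteq> carrier G"
    and gen: "generating G \<mu>"
    and nonel: "non_elementary G \<phi> x0"
begin

text \<open>The recursion peels off the first increment, which suits conditioning on the first step;
  \<open>rw\<close> appends the last one, and \<open>W_add\<close> reconciles the two.\<close>

primrec W :: "nat \<Rightarrow> 'g pmf" where
  "W 0 = return_pmf \<one>"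
| "W (Suc n) = bind_pmf \<mu> (\<lambda>g. map_pmf (\<lambda>h. g \<otimes> h) (W n))"

lemma W_carrier: "set_pmf (W n) \<subseteq> carrier G"
  using mu_carrier by (induction n) (auto simp: subset_iff)

lemma W_add: "W (k + n) = bind_pmf (W k) (\<lambda>g. map_pmf (\<lambda>h. g \<otimes> h) (W n))"
proof (induction k)
  case 0
  have "map_pmf (\<lambda>h. \<one> \<otimes> h) (W n) = map_pmf (\<lambda>h. h) (W n)"
    using W_carrier[of n] by (intro map_pmf_cong) auto
  then show ?case by (simp add: bind_return_pmf map_pmf_ident)
next
  case (Suc k)
  have "W (Suc k + n) = bind_pmf \<mu> (\<lambda>g. map_pmf (\<lambda>h. g \<otimes> h) (bind_pmf (W k) (\<lambda>x. map_pmf (\<lambda>h. x \<otimes> h) (W n))))"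
    using Suc by simp
  also have "\<dots> = bind_pmf \<mu> (\<lambda>g. bind_pmf (W k) (\<lambda>x. map_pmf (\<lambda>h. (g \<otimes> x) \<otimes> h) (W n)))"
  proof (intro bind_pmf_cong refl)
    fix g assume g: "g \<in> set_pmf \<mu>"
    have "map_pmf (\<lambda>h. g \<otimes> h) (bind_pmf (W k) (\<lambda>x. map_pmf (\<lambda>h. x \<otimes> h) (W n)))
       = bind_pmf (W k) (\<lambda>x. map_pmf (\<lambda>h. g \<otimes> (x \<otimes> h)) (W n))"
      by (simp add: map_bind_pmf map_pmf_comp)
    also have "\<dots> = bind_pmf (W k) (\<lambda>x. map_pmf (\<lambda>h. (g \<otimes> x) \<otimes> h) (W n))"
      using W_carrier[of n] W_carrier[of k] g mu_carrier
      by (intro bind_pmf_cong refl map_pmf_cong) (auto simp: subset_iff m_assoc)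
    finally show "map_pmf (\<lambda>h. g \<otimes> h) (bind_pmf (W k) (\<lambda>x. map_pmf (\<lambda>h. x \<otimes> h) (W n)))
       = bind_pmf (W k) (\<lambda>x. map_pmf (\<lambda>h. (g \<otimes> x) \<otimes> h) (W n))" .
  qed
  also have "\<dots> = bind_pmf (W (Suc k)) (\<lambda>g. map_pmf (\<lambda>h. g \<otimes> h) (W n))"
    by (simp add: bind_assoc_pmf bind_map_pmf)
  finally show ?case .
qed

lemma W_1: "W 1 = \<mu>"
proof -
  have "W 1 = bind_pmf \<mu> (\<lambda>g. return_pmf (g \<otimes> \<one>))" by simp
  also have "\<dots> = bind_pmf \<mu> return_pmf"
    using mu_carrier by (intro bind_pmf_cong) auto
  finally show ?thesis by (simp add: bind_return_pmf')
qed

lemma W_reach: "g \<in> carrier G \<Longrightarrow> \<exists>n\<ge>1. g \<in> set_pmf (W n)"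
proof -
  assume "g \<in> carrier G"
  then have "g \<in> sgen G (set_pmf \<mu>)" using gen by (simp add: generating_def)
  then show ?thesis
  proof induction
    case (base x)
    then show ?case using W_1 by (intro exI[of _ 1]) simp
  next
    case (mult x y)
    then obtain n m where "n \<ge> 1" "x \<in> set_pmf (W n)" "m \<ge> 1" "y \<in> set_pmf (W m)" by blast
    then have "x \<otimes> y \<in> set_pmf (W (n + m))" "n + m \<ge> 1" by (auto simp: W_add)
    then show ?case by blast
  qed
qed

sublocale fwd: walk_family \<delta> x0 G \<phi> W
  by standard (use W_carrier W_add W_reach nonel in auto)

text \<open>Inversion reverses products, but independent factors may be drawn in either order. This
  instance controls the part of the path before a chosen segment.\<close>

sublocale bwd: walk_family \<delta> x0 G \<phi> "\<lambda>n. map_pmf (m_inv G) (W n)"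
proof
  fix k n
  show "set_pmf (map_pmf (m_inv G) (W n)) \<subseteq> carrier G" using W_carrier by auto
  have "map_pmf (m_inv G) (W (k + n)) = map_pmf (m_inv G) (W (n + k))" by (simp add: add.commute)
  also have "\<dots> = bind_pmf (W n) (\<lambda>x. bind_pmf (W k) (\<lambda>v. return_pmf (inv (x \<otimes> v))))"
    by (simp add: W_add map_bind_pmf map_pmf_comp) (simp add: map_pmf_def)
  also have "\<dots> = bind_pmf (W n) (\<lambda>x. bind_pmf (W k) (\<lambda>v. return_pmf (inv v \<otimes> inv x)))"
    using W_carrier[of n] W_carrier[of k]
    by (intro bind_pmf_cong refl) (auto simp: subset_iff inv_mult_group)
  also have "\<dots> = bind_pmf (W k) (\<lambda>v. bind_pmf (W n) (\<lambda>x. return_pmf (inv v \<otimes> inv x)))"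
    by (rule bind_commute_pmf)
  also have "\<dots> = bind_pmf (map_pmf (m_inv G) (W k)) (\<lambda>g. map_pmf (\<lambda>h. g \<otimes> h) (map_pmf (m_inv G) (W n)))"
    by (simp add: bind_map_pmf map_pmf_comp) (simp add: map_pmf_def)
  finally show "map_pmf (m_inv G) (W (k + n))
     = bind_pmf (map_pmf (m_inv G) (W k)) (\<lambda>g. map_pmf (\<lambda>h. g \<otimes> h) (map_pmf (m_inv G) (W n)))" .
next
  fix g assume g: "g \<in> carrier G"
  then obtain n where "n \<ge> 1" "inv g \<in> set_pmf (W n)" using W_reach[of "inv g"] by auto
  then show "\<exists>n\<ge>1. g \<in> set_pmf (map_pmf (m_inv G) (W n))"
    using g by (intro exI[of _ n]) (auto intro!: image_eqI[of _ _ "inv g"])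
qed (rule nonel)

abbreviation "M \<equiv> iid \<mu>"

lemma prob_space_M: "prob_space M" by (rule prob_space_iid)

lemma rw_cong: "(\<And>i. i < n \<Longrightarrow> \<omega> i = \<omega>' i) \<Longrightarrow> rw G \<omega> n = rw G \<omega>' n"
  by (induction n) auto

lemma measurable_rw [measurable]: "(\<lambda>\<omega>. rw G \<omega> n) \<in> M \<rightarrow>\<^sub>M count_space UNIV"
  by (rule measurable_finite_coords[of n]) (auto intro: rw_cong)

lemma pred_rw: "Measurable.pred M (\<lambda>\<omega>. P (rw G \<omega> n))"
proof (rule measurable_finite_coords[of n])
  fix \<omega> \<omega>' :: "nat \<Rightarrow> 'g" assume "\<And>i. i < n \<Longrightarrow> \<omega> i = \<omega>' i"
  then have "rw G \<omega> n = rw G \<omega>' n" by (rule rw_cong)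
  then show "P (rw G \<omega> n) = P (rw G \<omega>' n)" by simp
qed auto

lemma pred_rw2: "Measurable.pred M (\<lambda>\<omega>. P (rw G \<omega> m) (rw G \<omega> n))"
proof (rule measurable_finite_coords[of "max m n"])
  fix \<omega> \<omega>' :: "nat \<Rightarrow> 'g" assume "\<And>i. i < max m n \<Longrightarrow> \<omega> i = \<omega>' i"
  then have "rw G \<omega> m = rw G \<omega>' m" "rw G \<omega> n = rw G \<omega>' n" by (auto intro!: rw_cong)
  then show "P (rw G \<omega> m) (rw G \<omega> n) = P (rw G \<omega>' m) (rw G \<omega>' n)" by simp
qed auto

text \<open>The group laws are available on \<open>carrier G\<close> only, so identities between
  positions are proved on this event of probability one.\<close>

definition inC :: "(nat \<Rightarrow> 'g) \<Rightarrow> bool" where "inC \<omega> \<longleftrightarrow> (\<forall>i. \<omega> i \<in> carrier G)"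

lemma AE_inC: "AE \<omega> in M. inC \<omega>"
  using AE_iid_coords[of \<mu>] by eventually_elim (use mu_carrier in \<open>auto simp: inC_def\<close>)

lemma inC_shift: "inC \<omega> \<Longrightarrow> inC (shift n \<omega>)" by (simp add: inC_def shift_def)

lemma rw_carrier [simp]: "inC \<omega> \<Longrightarrow> rw G \<omega> n \<in> carrier G"
  by (induction n) (auto simp: inC_def)

lemma rw_add: "inC \<omega> \<Longrightarrow> rw G \<omega> (n + m) = rw G \<omega> n \<otimes> rw G (shift n \<omega>) m"
proof (induction m)
  case 0
  then show ?case by simp
next
  case (Suc m)
  moreover have "rw G (shift n \<omega>) m \<in> carrier G" using inC_shift Suc.prems by simp
  moreover have "\<omega> (n + m) \<in> carrier G" using Suc.prems by (simp add: inC_def)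
  ultimately show ?case by (simp add: m_assoc) (simp add: shift_def)
qed

lemma rw_Suc_shift: "inC \<omega> \<Longrightarrow> rw G \<omega> (Suc n) = \<omega> 0 \<otimes> rw G (shift 1 \<omega>) n"
  using rw_add[of \<omega> 1 n] by (simp add: inC_def)

lemma nn_integral_rw: "(\<integral>\<^sup>+\<omega>. h (rw G \<omega> n) \<partial>M) = (\<integral>\<^sup>+g. h g \<partial>measure_pmf (W n))"
proof (induction n arbitrary: h)
  case 0
  interpret prob_space M by (rule prob_space_M)
  show ?case by (simp add: emeasure_space_1[simplified])
next
  case (Suc n)
  have "(\<integral>\<^sup>+\<omega>. h (rw G \<omega> (Suc n)) \<partial>M) = (\<integral>\<^sup>+\<omega>. h (rw G \<omega> n \<otimes> shift n \<omega> 0) \<partial>M)"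
    by (simp add: shift_def)
  also have "\<dots> = (\<integral>\<^sup>+\<omega>. \<integral>\<^sup>+\<omega>'. h (rw G \<omega> n \<otimes> \<omega>' 0) \<partial>M \<partial>M)"
    by (rule markov) (auto intro: rw_cong measurable_compose[OF measurable_iid_coord])
  also have "\<dots> = (\<integral>\<^sup>+\<omega>. \<integral>\<^sup>+g. h (rw G \<omega> n \<otimes> g) \<partial>measure_pmf \<mu> \<partial>M)"
    using nn_integral_coord[where h = "\<lambda>g. h (x \<otimes> g)" and i = 0 for x] by simp
  also have "\<dots> = (\<integral>\<^sup>+x. \<integral>\<^sup>+g. h (x \<otimes> g) \<partial>measure_pmf \<mu> \<partial>measure_pmf (W n))"
    by (rule Suc)
  also have "\<dots> = (\<integral>\<^sup>+x. h x \<partial>measure_pmf (W (n + 1)))"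
    by (subst W_add, subst W_1) simp
  finally show ?case by simp
qed

lemma emeasure_rw: "emeasure M {\<omega>. rw G \<omega> n \<in> A} = emeasure (measure_pmf (W n)) A"
proof -
  have "emeasure M {\<omega>. rw G \<omega> n \<in> A} = (\<integral>\<^sup>+\<omega>. indicator A (rw G \<omega> n) \<partial>M)"
    using pred_rw[of "\<lambda>x. x \<in> A" n] by (simp add: pred_def flip: nn_integral_indicator) (simp add: indicator_def)
  then show ?thesis by (simp add: nn_integral_rw)
qed

lemma prob_rw: "measure M {\<omega>. rw G \<omega> n \<in> A} = measure_pmf.prob (W n) A"
  by (simp add: measure_def emeasure_rw)

end

lemma nn_integral_pmf_commute:
  "(\<integral>\<^sup>+x. \<integral>\<^sup>+y. f x y \<partial>measure_pmf B \<partial>measure_pmf A) = (\<integral>\<^sup>+y. \<integral>\<^sup>+x. f x y \<partial>measure_pmf A \<partial>measure_pmf B)"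
proof -
  have "(\<integral>\<^sup>+z. case_prod f z \<partial>measure_pmf (bind_pmf A (\<lambda>x. bind_pmf B (\<lambda>y. return_pmf (x, y)))))
      = (\<integral>\<^sup>+z. case_prod f z \<partial>measure_pmf (bind_pmf B (\<lambda>y. bind_pmf A (\<lambda>x. return_pmf (x, y)))))"
    by (subst bind_commute_pmf) simp
  then show ?thesis by simp
qed

section \<open>Shadows hit by the walk, and coarse stabilizers\<close>

text \<open>Chebyshev's inequality centred at \<open>real J * p\<close> instead of the true mean.
  Upper bounds for the pairwise intersections suffice, so the events may be independent ones from
  which small parts have been removed.\<close>

lemma (in prob_space) second_moment_hit:
  fixes A :: "nat \<Rightarrow> 'a set"
  assumes ev: "\<And>i. A i \<in> events" and p: "p > 0" and J: "J > 0"
    and lo: "\<And>i. i < J \<Longrightarrow> p * (1 - e) \<le> prob (A i)" and hi: "\<And>i. i < J \<Longrightarrow> prob (A i) \<le> p"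
    and pw: "\<And>i j. i < j \<Longrightarrow> j < J \<Longrightarrow> prob (A i \<inter> A j) \<le> p\<^sup>2"
  shows "prob (space M - (\<Union>i<J. A i)) \<le> 1 / (real J * p) + 2 * e"
proof -
  define c where "c = real J * p"
  have c: "c > 0" using p J by (simp add: c_def)
  have int: "integrable M (indicator B :: 'a \<Rightarrow> real)" if "B \<in> events" for B
    using that by (simp add: emeasure_eq_measure)
  have sp: "A i \<inter> space M = A i" "A i \<inter> A j \<inter> space M = A i \<inter> A j" for i j
    using sets.sets_into_space[OF ev[of i]] by auto
  define Z where "Z = space M - (\<Union>i<J. A i)"
  have Zev: "Z \<in> events" unfolding Z_def using ev by auto
  have AAev: "A i \<inter> A j \<in> events" for i j using ev by auto
  have pt: "c\<^sup>2 * indicator Z x \<le> (\<Sum>i<J. \<Sum>j<J. indicator (A i \<inter> A j) x) - 2 * c * (\<Sum>i<J. indicator (A i) x) + c\<^sup>2" for x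
  proof -
    define s where "s = (\<Sum>i<J. indicator (A i) x :: real)"
    have "(\<Sum>i<J. \<Sum>j<J. indicator (A i \<inter> A j) x) = s\<^sup>2"
      by (simp add: s_def power2_eq_square sum_product indicator_inter_arith)
    moreover have "s = 0" if "x \<in> Z" using that by (auto simp: s_def Z_def indicator_def)
    moreover have "0 \<le> (s - c)\<^sup>2" by simp
    ultimately show ?thesis
      unfolding s_def[symmetric] by (cases "x \<in> Z") (auto simp: power2_diff algebra_simps)
  qed
  have "c\<^sup>2 * prob Z = (\<integral>x. c\<^sup>2 * indicator Z x \<partial>M)" using Zev by simp
  also have "\<dots> \<le> (\<integral>x. (\<Sum>i<J. \<Sum>j<J. indicator (A i \<inter> A j) x) - 2 * c * (\<Sum>i<J. indicator (A i) x) + c\<^sup>2 \<partial>M)"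
    using pt
    by (intro integral_mono Bochner_Integration.integrable_add Bochner_Integration.integrable_diff
         Bochner_Integration.integrable_mult_right Bochner_Integration.integrable_sum int Zev AAev ev) auto
  also have "\<dots> = (\<Sum>i<J. \<Sum>j<J. prob (A i \<inter> A j)) - 2 * c * (\<Sum>i<J. prob (A i)) + c\<^sup>2"
  proof -
    have i1: "integrable M (\<lambda>x. \<Sum>i<J. \<Sum>j<J. indicator (A i \<inter> A j) x :: real)"
      by (intro Bochner_Integration.integrable_sum int AAev)
    have i2: "integrable M (\<lambda>x. 2 * c * (\<Sum>i<J. indicator (A i) x :: real))"
      by (intro Bochner_Integration.integrable_mult_right Bochner_Integration.integrable_sum int ev)
    have e1: "(\<integral>x. (\<Sum>i<J. \<Sum>j<J. indicator (A i \<inter> A j) x) \<partial>M) = (\<Sum>i<J. \<Sum>j<J. prob (A i \<inter> A j))"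
    proof -
      have "(\<integral>x. (\<Sum>i<J. \<Sum>j<J. indicator (A i \<inter> A j) x :: real) \<partial>M) = (\<Sum>i<J. (\<integral>x. (\<Sum>j<J. indicator (A i \<inter> A j) x) \<partial>M))"
        by (intro Bochner_Integration.integral_sum Bochner_Integration.integrable_sum int AAev)
      also have "\<dots> = (\<Sum>i<J. \<Sum>j<J. prob (A i \<inter> A j))"
        by (intro sum.cong refl, subst Bochner_Integration.integral_sum) (auto intro!: int AAev simp: sp)
      finally show ?thesis .
    qed
    have e2: "(\<integral>x. (\<Sum>i<J. indicator (A i) x) \<partial>M) = (\<Sum>i<J. prob (A i))"
      by (subst Bochner_Integration.integral_sum) (auto intro!: int ev simp: sp)
    show ?thesis
      using i1 i2 by (simp add: e1 e2 prob_space)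
  qed
  also have "\<dots> \<le> (c\<^sup>2 + c) - 2 * c * (c * (1 - e)) + c\<^sup>2"
  proof -
    have row: "(\<Sum>j<J. prob (A i \<inter> A j)) \<le> real J * p\<^sup>2 + p" if "i < J" for i
    proof -
      have "(\<Sum>j<J. prob (A i \<inter> A j)) \<le> (\<Sum>j<J. p\<^sup>2 + (if j = i then p else 0))"
      proof (rule sum_mono)
        fix j assume "j \<in> {..<J}"
        then have j: "j < J" by simp
        show "prob (A i \<inter> A j) \<le> p\<^sup>2 + (if j = i then p else 0)"
        proof (cases "i = j")
          case True
          then show ?thesis using hi[OF that] by (simp add: add_increasing)
        next
          case False
          then show ?thesis using pw[of i j] pw[of j i] j that by (cases "i < j") (auto simp: Int_commute)
        qed
      qed
      also have "\<dots> = real J * p\<^sup>2 + p" using that by (simp add: sum.distrib)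
      finally show ?thesis .
    qed
    have "(\<Sum>i<J. \<Sum>j<J. prob (A i \<inter> A j)) \<le> (\<Sum>i<J. real J * p\<^sup>2 + p)"
      using row by (intro sum_mono) simp
    also have "\<dots> = c\<^sup>2 + c" by (simp add: c_def algebra_simps power2_eq_square)
    finally have 1: "(\<Sum>i<J. \<Sum>j<J. prob (A i \<inter> A j)) \<le> c\<^sup>2 + c" .
    have "c * (1 - e) = (\<Sum>i<J. p * (1 - e))" by (simp add: c_def)
    also have "\<dots> \<le> (\<Sum>i<J. prob (A i))" using lo by (intro sum_mono) simp
    finally have "2 * c * (c * (1 - e)) \<le> 2 * c * (\<Sum>i<J. prob (A i))" using c by simp
    with 1 show ?thesis by linarith
  qed
  also have "\<dots> = c\<^sup>2 * (1 / c + 2 * e)" using c by (simp add: power2_eq_square field_simps)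
  finally show ?thesis using c unfolding Z_def[symmetric] c_def[symmetric] by simp
qed

section \<open>The maximal inequality and convergence to the boundary\<close>

context rand_walk
begin

lemma prob_compl_carrier:
  assumes "measure_pmf.prob (W k) {h\<in>carrier G. P h} \<le> e"
  shows "1 - e \<le> measure_pmf.prob (W k) {h\<in>carrier G. \<not> P h}"
proof -
  have "1 - e \<le> 1 - measure_pmf.prob (W k) {h\<in>carrier G. P h}" using assms by simp
  also have "\<dots> = measure_pmf.prob (W k) (- {h\<in>carrier G. P h})"
    by (subst measure_pmf.prob_compl[simplified, symmetric]) (auto simp: Compl_eq_Diff_UNIV)
  also have "\<dots> = measure_pmf.prob (W k) {h\<in>carrier G. \<not> P h}"
    by (subst fwd.prob_carrier) (auto intro!: arg_cong[of _ _ "measure_pmf.prob (W k)"])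
  finally show ?thesis .
qed

text \<open>From the first entrance into \<open>B\<close> the walk ends in \<open>B'\<close> at time
  \<open>n\<close> with probability at least 1/2. The induction peels off the first increment, with
  the starting point \<open>x\<close> variable, in place of a stopping time.\<close>

lemma ottaviani:
  assumes B: "\<And>y k. y \<in> carrier G \<Longrightarrow> y \<in> B \<Longrightarrow> 1 / 2 \<le> measure_pmf.prob (W k) {h\<in>carrier G. y \<otimes> h \<in> B'}"
  shows "x \<in> carrier G \<Longrightarrow>
    emeasure M {\<omega>. \<exists>k\<le>n. x \<otimes> rw G \<omega> k \<in> B} \<le> 2 * emeasure (measure_pmf (W n)) {h\<in>carrier G. x \<otimes> h \<in> B'}"
proof (induction n arbitrary: x)
  interpret P: prob_space M by (rule prob_space_M)
  have inB: "emeasure M S \<le> 2 * emeasure (measure_pmf (W n)) {h\<in>carrier G. x \<otimes> h \<in> B'}"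
    if "x \<in> carrier G" "x \<in> B" for S n x
  proof -
    have "emeasure M S \<le> 1" by (rule P.emeasure_le_1)
    also have "1 \<le> ennreal (2 * measure_pmf.prob (W n) {h\<in>carrier G. x \<otimes> h \<in> B'})"
      using B[OF that, of n] by (subst ennreal_1[symmetric], intro ennreal_leI) simp
    also have "\<dots> = 2 * emeasure (measure_pmf (W n)) {h\<in>carrier G. x \<otimes> h \<in> B'}"
      by (simp add: measure_pmf.emeasure_eq_measure ennreal_mult)
    finally show ?thesis .
  qed
  case 0
  show ?case
  proof (cases "x \<in> B")
    case False
    then show ?thesis using 0 by simp
  qed (use inB 0 in blast)
next
  interpret P: prob_space M by (rule prob_space_M)
  have inB: "emeasure M S \<le> 2 * emeasure (measure_pmf (W n)) {h\<in>carrier G. x \<otimes> h \<in> B'}"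
    if "x \<in> carrier G" "x \<in> B" for S n x
  proof -
    have "emeasure M S \<le> 1" by (rule P.emeasure_le_1)
    also have "1 \<le> ennreal (2 * measure_pmf.prob (W n) {h\<in>carrier G. x \<otimes> h \<in> B'})"
      using B[OF that, of n] by (subst ennreal_1[symmetric], intro ennreal_leI) simp
    also have "\<dots> = 2 * emeasure (measure_pmf (W n)) {h\<in>carrier G. x \<otimes> h \<in> B'}"
      by (simp add: measure_pmf.emeasure_eq_measure ennreal_mult)
    finally show ?thesis .
  qed
  case (Suc n)
  have ms: "{\<omega>. \<exists>k\<le>n. y \<otimes> rw G \<omega> k \<in> B} \<in> sets M" for y n
  proof -
    have "Measurable.pred M (\<lambda>\<omega>. \<exists>k\<in>{..n}. y \<otimes> rw G \<omega> k \<in> B)"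
      by (rule pred_intros_finite) (auto intro: pred_rw)
    then show ?thesis by (simp add: pred_def Bex_def)
  qed
  show ?case
  proof (cases "x \<in> B")
    case False
    have "emeasure M {\<omega>. \<exists>k\<le>Suc n. x \<otimes> rw G \<omega> k \<in> B} = (\<integral>\<^sup>+\<omega>. indicator {\<omega>. \<exists>k\<le>Suc n. x \<otimes> rw G \<omega> k \<in> B} \<omega> \<partial>M)"
      using ms by simp
    also have "\<dots> = (\<integral>\<^sup>+\<omega>. indicator {\<omega>'. \<exists>k\<le>n. (x \<otimes> \<omega> 0) \<otimes> rw G \<omega>' k \<in> B} (shift 1 \<omega>) \<partial>M)"
    proof (rule nn_integral_cong_AE, use AE_inC in eventually_elim)
      fix \<omega> assume w: "inC \<omega>"
      have "x \<otimes> rw G \<omega> (Suc k) = (x \<otimes> \<omega> 0) \<otimes> rw G (shift 1 \<omega>) k" for k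
        using rw_Suc_shift[OF w, of k] w Suc.prems rw_carrier[OF inC_shift[OF w], of 1 k]
        by (simp add: inC_def m_assoc)
      moreover have "x \<otimes> rw G \<omega> 0 \<notin> B" using False Suc.prems by simp
      ultimately have "(\<exists>k\<le>Suc n. x \<otimes> rw G \<omega> k \<in> B) \<longleftrightarrow> (\<exists>k\<le>n. (x \<otimes> \<omega> 0) \<otimes> rw G (shift 1 \<omega>) k \<in> B)"
        by (metis Suc_le_mono not0_implies_Suc)
      then show "indicator {\<omega>. \<exists>k\<le>Suc n. x \<otimes> rw G \<omega> k \<in> B} \<omega>
         = (indicator {\<omega>'. \<exists>k\<le>n. (x \<otimes> \<omega> 0) \<otimes> rw G \<omega>' k \<in> B} (shift 1 \<omega>) :: ennreal)"
        by (simp add: indicator_def)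
    qed
    also have "\<dots> = (\<integral>\<^sup>+\<omega>. \<integral>\<^sup>+\<omega>'. indicator {\<omega>'. \<exists>k\<le>n. (x \<otimes> \<omega> 0) \<otimes> rw G \<omega>' k \<in> B} \<omega>' \<partial>M \<partial>M)"
      by (rule markov[where X = "\<lambda>\<omega>. \<omega> 0" and F = "\<lambda>g. indicator {\<omega>'. \<exists>k\<le>n. (x \<otimes> g) \<otimes> rw G \<omega>' k \<in> B}"])
         (use ms in auto)
    also have "\<dots> = (\<integral>\<^sup>+\<omega>. emeasure M {\<omega>'. \<exists>k\<le>n. (x \<otimes> \<omega> 0) \<otimes> rw G \<omega>' k \<in> B} \<partial>M)"
      using ms by simp
    also have "\<dots> \<le> (\<integral>\<^sup>+\<omega>. 2 * emeasure (measure_pmf (W n)) {h\<in>carrier G. (x \<otimes> \<omega> 0) \<otimes> h \<in> B'} \<partial>M)"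
      by (rule nn_integral_mono_AE, use AE_inC in eventually_elim)
         (use Suc.IH Suc.prems in \<open>auto simp: inC_def\<close>)
    also have "\<dots> = (\<integral>\<^sup>+g. 2 * emeasure (measure_pmf (W n)) {h\<in>carrier G. (x \<otimes> g) \<otimes> h \<in> B'} \<partial>measure_pmf \<mu>)"
      by (rule nn_integral_coord)
    also have "\<dots> = 2 * (\<integral>\<^sup>+g. emeasure (measure_pmf (W n)) {h\<in>carrier G. (x \<otimes> g) \<otimes> h \<in> B'} \<partial>measure_pmf \<mu>)"
      by (rule nn_integral_cmult) simp
    also have "(\<integral>\<^sup>+g. emeasure (measure_pmf (W n)) {h\<in>carrier G. (x \<otimes> g) \<otimes> h \<in> B'} \<partial>measure_pmf \<mu>)
        = emeasure (measure_pmf (W (Suc n))) {h\<in>carrier G. x \<otimes> h \<in> B'}"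
      unfolding W.simps emeasure_bind_pmf
    proof (rule nn_integral_cong_AE, rule AE_pmfI)
      fix g assume g: "g \<in> set_pmf \<mu>"
      have "emeasure (measure_pmf (map_pmf (\<lambda>h. g \<otimes> h) (W n))) {h\<in>carrier G. x \<otimes> h \<in> B'}
          = emeasure (measure_pmf (W n)) ((\<lambda>h. g \<otimes> h) -` {h\<in>carrier G. x \<otimes> h \<in> B'})" by simp
      also have "\<dots> = emeasure (measure_pmf (W n)) {h\<in>carrier G. (x \<otimes> g) \<otimes> h \<in> B'}"
        by (rule emeasure_eq_AE)
           (use W_carrier[of n] mu_carrier g Suc.prems in \<open>auto intro!: AE_pmfI simp: m_assoc subset_iff\<close>)
      finally show "emeasure (measure_pmf (W n)) {h\<in>carrier G. (x \<otimes> g) \<otimes> h \<in> B'}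
         = emeasure (measure_pmf (map_pmf (\<lambda>h. g \<otimes> h) (W n))) {h\<in>carrier G. x \<otimes> h \<in> B'}" by simp
    qed
    finally show ?thesis .
  qed (use inB Suc.prems in blast)
qed

lemma ottaviani_infinite:
  assumes B: "\<And>y k. y \<in> carrier G \<Longrightarrow> y \<in> B \<Longrightarrow> 1 / 2 \<le> measure_pmf.prob (W k) {h\<in>carrier G. y \<otimes> h \<in> B'}"
    and x: "x \<in> carrier G" and e: "\<And>n. measure_pmf.prob (W n) {h\<in>carrier G. x \<otimes> h \<in> B'} \<le> e"
  shows "emeasure M {\<omega>. \<exists>k. x \<otimes> rw G \<omega> k \<in> B} \<le> ennreal (2 * e)"
proof -
  have ms: "{\<omega>. \<exists>k\<le>n. x \<otimes> rw G \<omega> k \<in> B} \<in> sets M" for n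
  proof -
    have "Measurable.pred M (\<lambda>\<omega>. \<exists>k\<in>{..n}. x \<otimes> rw G \<omega> k \<in> B)"
      by (rule pred_intros_finite) (auto intro: pred_rw)
    then show ?thesis by (simp add: pred_def Bex_def)
  qed
  have "(SUP n. emeasure M {\<omega>. \<exists>k\<le>n. x \<otimes> rw G \<omega> k \<in> B}) = emeasure M (\<Union>n. {\<omega>. \<exists>k\<le>n. x \<otimes> rw G \<omega> k \<in> B})"
    by (rule SUP_emeasure_incseq) (use ms in \<open>auto simp: incseq_def intro: order_trans\<close>)
  moreover have "(\<Union>n. {\<omega>. \<exists>k\<le>n. x \<otimes> rw G \<omega> k \<in> B}) = {\<omega>. \<exists>k. x \<otimes> rw G \<omega> k \<in> B}" by auto
  moreover have "emeasure M {\<omega>. \<exists>k\<le>n. x \<otimes> rw G \<omega> k \<in> B} \<le> ennreal (2 * e)" for n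
  proof -
    have "emeasure M {\<omega>. \<exists>k\<le>n. x \<otimes> rw G \<omega> k \<in> B} \<le> 2 * emeasure (measure_pmf (W n)) {h\<in>carrier G. x \<otimes> h \<in> B'}"
      by (rule ottaviani[OF B x])
    also have "\<dots> = ennreal (2 * measure_pmf.prob (W n) {h\<in>carrier G. x \<otimes> h \<in> B'})"
      by (simp add: measure_pmf.emeasure_eq_measure ennreal_mult)
    also have "\<dots> \<le> ennreal (2 * e)" using e[of n] by (intro ennreal_leI) simp
    finally show ?thesis .
  qed
  ultimately show ?thesis by (metis (mono_tags, lifting) SUP_least)
qed

lemma gprod_orbit:
  assumes "y \<in> carrier G" "h \<in> carrier G"
  shows "gprod (\<phi> y x0) z (\<phi> (y \<otimes> h) x0) = gprod x0 (\<phi> (inv y) z) (\<phi> h x0)"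
  using gprod_act_inv[of y x0 z "\<phi> (y \<otimes> h) x0"] assms by (simp add: act_mult act_inv1)

text \<open>From a point of the shadow of depth \<open>D\<close> the walk backtracks by less than
  \<open>D1\<close> with probability at least 1/2, and is then still in the shadow of depth
  \<open>D2\<close>; so by the maximal inequality the bound at fixed times covers all times.\<close>

lemma shadow_hit:
  assumes eps: "\<epsilon> > 0"
  shows "\<exists>D. \<forall>z. emeasure M {\<omega>. \<exists>k. D \<le> gprod x0 z (\<phi> (rw G \<omega> k) x0)} \<le> ennreal \<epsilon>"
proof -
  obtain D1 where D1: "\<And>n z. measure_pmf.prob (W n) {h\<in>carrier G. D1 \<le> gprod x0 z (\<phi> h x0)} \<le> 1 / 2"
    using fwd.shadow_small[of "1/2"] by auto
  obtain D2 where D2: "\<And>n z. measure_pmf.prob (W n) {h\<in>carrier G. D2 \<le> gprod x0 z (\<phi> h x0)} \<le> \<epsilon> / 2"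
    using fwd.shadow_small[of "\<epsilon> / 2"] eps by auto
  define D where "D = \<bar>D1\<bar> + \<bar>D2\<bar> + \<delta>"
  have "emeasure M {\<omega>. \<exists>k. D \<le> gprod x0 z (\<phi> (rw G \<omega> k) x0)} \<le> ennreal \<epsilon>" for z
  proof -
    define B where "B = {y\<in>carrier G. D \<le> gprod x0 z (\<phi> y x0)}"
    define B' where "B' = {y\<in>carrier G. D2 \<le> gprod x0 z (\<phi> y x0)}"
    have half: "1 / 2 \<le> measure_pmf.prob (W k) {h\<in>carrier G. y \<otimes> h \<in> B'}" if y: "y \<in> carrier G" "y \<in> B" for y k
    proof -
      have "1 / 2 \<le> measure_pmf.prob (W k) {h\<in>carrier G. \<not> D1 \<le> gprod x0 (\<phi> (inv y) x0) (\<phi> h x0)}"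
        using prob_compl_carrier[OF D1[of k "\<phi> (inv y) x0"]] by simp
      also have "\<dots> \<le> measure_pmf.prob (W k) {h\<in>carrier G. y \<otimes> h \<in> B'}"
      proof (rule measure_pmf.finite_measure_mono, safe)
        fix h assume h: "h \<in> carrier G" "\<not> D1 \<le> gprod x0 (\<phi> (inv y) x0) (\<phi> h x0)"
        let ?p = "\<phi> y x0" and ?v = "\<phi> (y \<otimes> h) x0"
        have "gprod ?p x0 ?v < D1" using gprod_orbit[OF y(1) h(1), of x0] h(2) by simp
        then have "D - D1 \<le> gprod x0 ?p ?v"
          using gprod_swap[of x0 ?p ?v] gprod_le_dist2[of x0 z ?p] y(2) by (simp add: B_def)
        moreover have "gprod x0 z ?p - \<delta> \<le> gprod x0 z ?v \<or> gprod x0 ?p ?v - \<delta> \<le> gprod x0 z ?v"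
          using hyp[of x0 z ?p ?v] by linarith
        moreover have "D \<le> gprod x0 z ?p" using y(2) by (simp add: B_def)
        ultimately have "D2 \<le> gprod x0 z ?v" unfolding D_def by linarith
        then show "y \<otimes> h \<in> B'" using y h by (simp add: B'_def)
      qed simp
      finally show ?thesis .
    qed
    have e: "measure_pmf.prob (W n) {h\<in>carrier G. \<one> \<otimes> h \<in> B'} \<le> \<epsilon> / 2" for n
    proof -
      have "{h\<in>carrier G. \<one> \<otimes> h \<in> B'} = {h\<in>carrier G. D2 \<le> gprod x0 z (\<phi> h x0)}" by (auto simp: B'_def)
      then show ?thesis using D2[of n z] by simp
    qed
    have ms1: "{\<omega>. \<exists>k. D \<le> gprod x0 z (\<phi> (rw G \<omega> k) x0)} \<in> sets M"
    proof -
      have "Measurable.pred M (\<lambda>\<omega>. \<exists>k. D \<le> gprod x0 z (\<phi> (rw G \<omega> k) x0))"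
        by (rule pred_intros_countable) (rule pred_rw)
      then show ?thesis by (simp add: pred_def)
    qed
    have ms2: "{\<omega>. \<exists>k. \<one> \<otimes> rw G \<omega> k \<in> B} \<in> sets M"
    proof -
      have "Measurable.pred M (\<lambda>\<omega>. \<exists>k. \<one> \<otimes> rw G \<omega> k \<in> B)"
        by (rule pred_intros_countable) (rule pred_rw)
      then show ?thesis by (simp add: pred_def)
    qed
    have "AE \<omega> in M. \<omega> \<in> {\<omega>. \<exists>k. D \<le> gprod x0 z (\<phi> (rw G \<omega> k) x0)} \<longleftrightarrow> \<omega> \<in> {\<omega>. \<exists>k. \<one> \<otimes> rw G \<omega> k \<in> B}"
      using AE_inC by eventually_elim (simp add: B_def)
    then have "emeasure M {\<omega>. \<exists>k. D \<le> gprod x0 z (\<phi> (rw G \<omega> k) x0)} = emeasure M {\<omega>. \<exists>k. \<one> \<otimes> rw G \<omega> k \<in> B}"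
      using ms1 ms2 by (rule emeasure_eq_AE)
    then show ?thesis using ottaviani_infinite[of B B' \<one> "\<epsilon> / 2", OF half _ e] by simp
  qed
  then show ?thesis by blast
qed

text \<open>By \<open>ball_small\<close> the position at a late time \<open>m\<close> is far from
  \<open>x0\<close>. A later small product with it requires a long way back, that is, entering a
  deep shadow of \<open>x0\<close> as seen from there; the maximal inequality reduces this to a
  fixed time.\<close>

lemma return_small:
  fixes R :: real
  assumes eps: "\<epsilon> > 0"
  shows "\<exists>N. \<forall>m\<ge>N. emeasure M {\<omega>. \<exists>k. gprod x0 (\<phi> (rw G \<omega> m) x0) (\<phi> (rw G \<omega> (m + k)) x0) < R} \<le> ennreal \<epsilon>"
proof -
  obtain D0 where D0: "\<And>n z. measure_pmf.prob (W n) {h\<in>carrier G. D0 \<le> gprod x0 z (\<phi> h x0)} \<le> 1 / 4"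
    using fwd.shadow_small[of "1/4"] by auto
  define D where "D = \<bar>D0\<bar>"
  have D: "measure_pmf.prob (W n) {h\<in>carrier G. D \<le> gprod x0 z (\<phi> h x0)} \<le> 1 / 4" for n z
  proof -
    have "measure_pmf.prob (W n) {h\<in>carrier G. D \<le> gprod x0 z (\<phi> h x0)} \<le> measure_pmf.prob (W n) {h\<in>carrier G. D0 \<le> gprod x0 z (\<phi> h x0)}"
      by (rule measure_pmf.finite_measure_mono) (auto simp: D_def)
    then show ?thesis using D0[of n z] by simp
  qed
  obtain D2 where D2: "\<And>n z. measure_pmf.prob (W n) {h\<in>carrier G. D2 \<le> gprod x0 z (\<phi> h x0)} \<le> \<epsilon> / 4"
    using fwd.shadow_small[of "\<epsilon> / 4"] eps by auto
  \<comment> \<open>If the walk at \<open>v\<close> has product below \<open>R\<close> with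
    \<open>y\<close>, and then backtracks by less than \<open>D\<close> both towards
    \<open>y\<close> and towards \<open>x0\<close>, its product with \<open>y\<close> stays below
    \<open>R'\<close>. Two shadows of mass at most 1/4 leave probability 1/2 for that.\<close>
  define R' where "R' = R + 2 * D + \<delta>"
  obtain N where N: "\<And>n z. n \<ge> N \<Longrightarrow> measure_pmf.prob (W n) {h\<in>carrier G. dist z (\<phi> h x0) \<le> R' + D2} \<le> \<epsilon> / 2"
    using fwd.ball_small[of "\<epsilon> / 2" "R' + D2"] eps by auto
  have far: "emeasure M {\<omega>. \<exists>k. gprod x0 (\<phi> y x0) (\<phi> (y \<otimes> rw G \<omega> k) x0) < R} \<le> ennreal (\<epsilon> / 2)"
    if y: "y \<in> carrier G" and yd: "R' + D2 < dist x0 (\<phi> y x0)" for y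
  proof -
    let ?y = "\<phi> y x0"
    define B where "B = {v. gprod x0 ?y (\<phi> v x0) < R}"
    define B' where "B' = {v. gprod x0 ?y (\<phi> v x0) < R'}"
    have half: "1 / 2 \<le> measure_pmf.prob (W k) {h\<in>carrier G. v \<otimes> h \<in> B'}" if v: "v \<in> carrier G" "v \<in> B" for v k
    proof -
      let ?b = "\<lambda>z. {h\<in>carrier G. D \<le> gprod x0 (\<phi> (inv v) z) (\<phi> h x0)}"
      have "measure_pmf.prob (W k) (?b ?y \<union> ?b x0) \<le> 1/4 + 1/4"
        using measure_Un_le[of "?b ?y" "measure_pmf (W k)" "?b x0"] D[of k "\<phi> (inv v) ?y"] D[of k "\<phi> (inv v) x0"] by simp
      moreover have "?b ?y \<union> ?b x0 = {h\<in>carrier G. D \<le> gprod x0 (\<phi> (inv v) ?y) (\<phi> h x0) \<or> D \<le> gprod x0 (\<phi> (inv v) x0) (\<phi> h x0)}"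
        by auto
      ultimately have "1 / 2 \<le> measure_pmf.prob (W k) {h\<in>carrier G. \<not> (D \<le> gprod x0 (\<phi> (inv v) ?y) (\<phi> h x0) \<or> D \<le> gprod x0 (\<phi> (inv v) x0) (\<phi> h x0))}"
        using prob_compl_carrier[of k "\<lambda>h. D \<le> gprod x0 (\<phi> (inv v) ?y) (\<phi> h x0) \<or> D \<le> gprod x0 (\<phi> (inv v) x0) (\<phi> h x0)" "1/2"] by simp
      also have "\<dots> \<le> measure_pmf.prob (W k) {h\<in>carrier G. v \<otimes> h \<in> B'}"
      proof (rule measure_pmf.finite_measure_mono, rule subsetI)
        fix h assume "h \<in> {h\<in>carrier G. \<not> (D \<le> gprod x0 (\<phi> (inv v) ?y) (\<phi> h x0) \<or> D \<le> gprod x0 (\<phi> (inv v) x0) (\<phi> h x0))}"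
        then have h: "h \<in> carrier G" 
          and n: "\<not> (D \<le> gprod x0 (\<phi> (inv v) ?y) (\<phi> h x0) \<or> D \<le> gprod x0 (\<phi> (inv v) x0) (\<phi> h x0))" by auto
        let ?x = "\<phi> v x0" and ?v = "\<phi> (v \<otimes> h) x0"
        have 1: "gprod ?x ?y ?v < D" "gprod ?x x0 ?v < D"
          using n gprod_orbit[OF v(1) h] by auto
        have 2: "gprod x0 ?y ?x < R" using v(2) by (simp add: B_def)
        have 3: "gprod x0 ?y ?v - \<delta> \<le> gprod x0 ?y ?x \<or> gprod x0 ?v ?x - \<delta> \<le> gprod x0 ?y ?x"
          using hyp[of x0 ?y ?v ?x] by linarith
        have 4: "gprod x0 ?v ?x = dist x0 ?x - gprod ?x x0 ?v"
          using gprod_swap[of x0 ?x ?v] by (simp add: gprod_commute)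
        have 5: "gprod x0 ?y ?v \<le> gprod ?x ?y ?v + dist x0 ?x" by (rule gprod_base_change)
        have "0 \<le> D" by (simp add: D_def)
        then have "gprod x0 ?y ?v < R'" using 1 2 3 4 5 delta_nonneg unfolding R'_def by linarith
        then show "h \<in> {h\<in>carrier G. v \<otimes> h \<in> B'}" using h by (simp add: B'_def)
      qed simp
      finally show ?thesis .
    qed
    have e: "measure_pmf.prob (W n) {h\<in>carrier G. y \<otimes> h \<in> B'} \<le> \<epsilon> / 4" for n
    proof -
      have "{h\<in>carrier G. y \<otimes> h \<in> B'} \<subseteq> {h\<in>carrier G. D2 \<le> gprod x0 (\<phi> (inv y) x0) (\<phi> h x0)}"
      proof safe
        fix h assume h: "h \<in> carrier G" "y \<otimes> h \<in> B'"
        show "D2 \<le> gprod x0 (\<phi> (inv y) x0) (\<phi> h x0)"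
          using gprod_orbit[OF y h(1), of x0] gprod_swap[of x0 ?y "\<phi> (y \<otimes> h) x0"] h(2) yd by (simp add: B'_def)
      qed
      then have "measure_pmf.prob (W n) {h\<in>carrier G. y \<otimes> h \<in> B'} \<le> measure_pmf.prob (W n) {h\<in>carrier G. D2 \<le> gprod x0 (\<phi> (inv y) x0) (\<phi> h x0)}"
        by (intro measure_pmf.finite_measure_mono) auto
      then show ?thesis using D2[of n "\<phi> (inv y) x0"] by simp
    qed
    show ?thesis using ottaviani_infinite[of B B' y "\<epsilon> / 4", OF half y e] by (simp add: B_def)
  qed
  interpret P: prob_space M by (rule prob_space_M)
  have ms: "{\<omega>. \<exists>k. gprod x0 (\<phi> y x0) (\<phi> (y \<otimes> rw G \<omega> k) x0) < R} \<in> sets M" for y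
  proof -
    have "Measurable.pred M (\<lambda>\<omega>. \<exists>k. gprod x0 (\<phi> y x0) (\<phi> (y \<otimes> rw G \<omega> k) x0) < R)"
      by (rule pred_intros_countable) (rule pred_rw)
    then show ?thesis by (simp add: pred_def)
  qed
  have "emeasure M {\<omega>. \<exists>k. gprod x0 (\<phi> (rw G \<omega> m) x0) (\<phi> (rw G \<omega> (m + k)) x0) < R} \<le> ennreal \<epsilon>" if m: "m \<ge> N" for m
  proof -
    have ms0: "{\<omega>. \<exists>k. gprod x0 (\<phi> (rw G \<omega> m) x0) (\<phi> (rw G \<omega> (m + k)) x0) < R} \<in> sets M"
    proof -
      have "Measurable.pred M (\<lambda>\<omega>. \<exists>k. gprod x0 (\<phi> (rw G \<omega> m) x0) (\<phi> (rw G \<omega> (m + k)) x0) < R)"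
        by (rule pred_intros_countable) (rule pred_rw2)
      then show ?thesis by (simp add: pred_def)
    qed
    have "emeasure M {\<omega>. \<exists>k. gprod x0 (\<phi> (rw G \<omega> m) x0) (\<phi> (rw G \<omega> (m + k)) x0) < R}
       = (\<integral>\<^sup>+\<omega>. indicator {\<omega>. \<exists>k. gprod x0 (\<phi> (rw G \<omega> m) x0) (\<phi> (rw G \<omega> (m + k)) x0) < R} \<omega> \<partial>M)"
      using ms0 by simp
    also have "\<dots> = (\<integral>\<^sup>+\<omega>. indicator {\<omega>'. \<exists>k. gprod x0 (\<phi> (rw G \<omega> m) x0) (\<phi> (rw G \<omega> m \<otimes> rw G \<omega>' k) x0) < R} (shift m \<omega>) \<partial>M)"
      by (rule nn_integral_cong_AE, use AE_inC in eventually_elim) (simp add: indicator_def rw_add)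
    also have "\<dots> = (\<integral>\<^sup>+\<omega>. \<integral>\<^sup>+\<omega>'. indicator {\<omega>'. \<exists>k. gprod x0 (\<phi> (rw G \<omega> m) x0) (\<phi> (rw G \<omega> m \<otimes> rw G \<omega>' k) x0) < R} \<omega>' \<partial>M \<partial>M)"
      by (rule markov[where X = "\<lambda>\<omega>. rw G \<omega> m" and F = "\<lambda>y. indicator {\<omega>'. \<exists>k. gprod x0 (\<phi> y x0) (\<phi> (y \<otimes> rw G \<omega>' k) x0) < R}"])
         (use ms in \<open>auto intro: rw_cong\<close>)
    also have "\<dots> = (\<integral>\<^sup>+\<omega>. emeasure M {\<omega>'. \<exists>k. gprod x0 (\<phi> (rw G \<omega> m) x0) (\<phi> (rw G \<omega> m \<otimes> rw G \<omega>' k) x0) < R} \<partial>M)"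
      using ms by simp
    also have "\<dots> \<le> (\<integral>\<^sup>+\<omega>. indicator {h\<in>carrier G. dist x0 (\<phi> h x0) \<le> R' + D2} (rw G \<omega> m) + ennreal (\<epsilon> / 2) \<partial>M)"
    proof (rule nn_integral_mono_AE, use AE_inC in eventually_elim)
      fix \<omega> assume w: "inC \<omega>"
      show "emeasure M {\<omega>'. \<exists>k. gprod x0 (\<phi> (rw G \<omega> m) x0) (\<phi> (rw G \<omega> m \<otimes> rw G \<omega>' k) x0) < R}
         \<le> indicator {h\<in>carrier G. dist x0 (\<phi> h x0) \<le> R' + D2} (rw G \<omega> m) + ennreal (\<epsilon> / 2)"
      proof (cases "dist x0 (\<phi> (rw G \<omega> m) x0) \<le> R' + D2")
        case True
        then show ?thesis using w P.emeasure_le_1 by (simp add: indicator_def add_increasing2)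
      next
        case False
        then show ?thesis using far[of "rw G \<omega> m"] w by (simp add: indicator_def)
      qed
    qed
    also have "\<dots> = emeasure (measure_pmf (W m)) {h\<in>carrier G. dist x0 (\<phi> h x0) \<le> R' + D2} + ennreal (\<epsilon> / 2)"
      using P.emeasure_space_1 by (subst nn_integral_add) (auto simp: nn_integral_rw intro: measurable_compose[OF measurable_rw])
    also have "\<dots> \<le> ennreal (\<epsilon> / 2) + ennreal (\<epsilon> / 2)"
      using N[OF m, of x0] by (intro add_mono order_refl) (simp add: measure_pmf.emeasure_eq_measure ennreal_leI)
    also have "\<dots> = ennreal \<epsilon>" using eps by (subst ennreal_plus[symmetric]) auto
    finally show ?thesis .
  qed
  then show ?thesis by blast
qed

text \<open>The events that the later path has product below \<open>r\<close> with the position at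
  time \<open>m\<close> have arbitrarily small probability for suitable \<open>m\<close>, so their
  intersection over \<open>m\<close> is null. One good \<open>m\<close> for each \<open>r\<close>
  gives convergence, comparing any two later positions with the one at \<open>m\<close> by
  \<open>hyp\<close>.\<close>

theorem AE_conv_inf: "AE \<omega> in M. conv_inf x0 (\<lambda>n. \<phi> (rw G \<omega> n) x0)"
proof -
  have "AE \<omega> in M. \<exists>m. \<forall>k. real r \<le> gprod x0 (\<phi> (rw G \<omega> m) x0) (\<phi> (rw G \<omega> (m + k)) x0)" for r :: nat
  proof -
    define E where "E m = {\<omega>. \<exists>k. gprod x0 (\<phi> (rw G \<omega> m) x0) (\<phi> (rw G \<omega> (m + k)) x0) < real r}" for m
    have ms: "E m \<in> sets M" for m
    proof -
      have "Measurable.pred M (\<lambda>\<omega>. \<exists>k. gprod x0 (\<phi> (rw G \<omega> m) x0) (\<phi> (rw G \<omega> (m + k)) x0) < real r)"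
        by (rule pred_intros_countable) (rule pred_rw2)
      then show ?thesis by (simp add: pred_def E_def)
    qed
    have "emeasure M (\<Inter>m. E m) \<le> ennreal e" if e: "e > 0" for e
    proof -
      obtain N where "emeasure M (E N) \<le> ennreal e" using return_small[OF e, of "real r"] by (auto simp: E_def)
      moreover have "emeasure M (\<Inter>m. E m) \<le> emeasure M (E N)" using ms by (intro emeasure_mono) auto
      ultimately show ?thesis by simp
    qed
    then have "emeasure M (\<Inter>m. E m) \<le> 0"
      using ennreal_le_epsilon[of 0 "emeasure M (\<Inter>m. E m)"] by (simp only: add_0_left)
    then have "emeasure M (\<Inter>m. E m) = 0" by simp
    then have "AE \<omega> in M. \<omega> \<notin> (\<Inter>m. E m)" using ms by (intro AE_not_in) (auto simp: null_sets_def)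
    then show ?thesis
    proof eventually_elim
      fix \<omega> assume "\<omega> \<notin> (\<Inter>m. E m)"
      then obtain m where "\<omega> \<notin> E m" by blast
      then show "\<exists>m. \<forall>k. real r \<le> gprod x0 (\<phi> (rw G \<omega> m) x0) (\<phi> (rw G \<omega> (m + k)) x0)"
        by (intro exI[of _ m]) (simp add: E_def not_less)
    qed
  qed
  then have "AE \<omega> in M. \<forall>r::nat. \<exists>m. \<forall>k. real r \<le> gprod x0 (\<phi> (rw G \<omega> m) x0) (\<phi> (rw G \<omega> (m + k)) x0)"
    by (simp add: AE_all_countable)
  then show ?thesis
  proof eventually_elim
    fix \<omega> assume a: "\<forall>r::nat. \<exists>m. \<forall>k. real r \<le> gprod x0 (\<phi> (rw G \<omega> m) x0) (\<phi> (rw G \<omega> (m + k)) x0)"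
    show "conv_inf x0 (\<lambda>n. \<phi> (rw G \<omega> n) x0)" unfolding conv_inf_def
    proof
      fix R :: real
      obtain r :: nat where r: "R + \<delta> \<le> real r" using real_arch_simple by blast
      obtain m where m: "\<And>k. real r \<le> gprod x0 (\<phi> (rw G \<omega> m) x0) (\<phi> (rw G \<omega> (m + k)) x0)" using a by blast
      have "R \<le> gprod x0 (\<phi> (rw G \<omega> i) x0) (\<phi> (rw G \<omega> j) x0)" if "i \<ge> m" "j \<ge> m" for i j
        using m[of "i - m"] m[of "j - m"] that r hyp[of x0 "\<phi> (rw G \<omega> i) x0" "\<phi> (rw G \<omega> m) x0" "\<phi> (rw G \<omega> j) x0"]
        by (simp add: gprod_commute[of x0 "\<phi> (rw G \<omega> i) x0" "\<phi> (rw G \<omega> m) x0"])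
      then show "\<exists>N. \<forall>i\<ge>N. \<forall>j\<ge>N. R \<le> gprod x0 (\<phi> (rw G \<omega> i) x0) (\<phi> (rw G \<omega> j) x0)" by blast
    qed
  qed
qed

section \<open>Finiteness of coarse stabilizers along the walk\<close>

lemma three_blocks:
  fixes F :: "'g \<Rightarrow> 'g \<Rightarrow> 'g \<Rightarrow> ennreal"
  shows "(\<integral>\<^sup>+\<omega>. F (rw G \<omega> a) (rw G (shift a \<omega>) l) (rw G (shift (a + l) \<omega>) r) \<partial>M)
    = (\<integral>\<^sup>+x. \<integral>\<^sup>+u. \<integral>\<^sup>+y. F x u y \<partial>measure_pmf (W r) \<partial>measure_pmf (W l) \<partial>measure_pmf (W a))"
proof -
  have m1: "(\<lambda>\<omega>. H (rw G \<omega> n)) \<in> borel_measurable M" for H :: "'g \<Rightarrow> ennreal" and n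
    by (rule measurable_compose[OF measurable_rw]) simp
  have sh: "shift (a + l) \<omega> = shift l (shift a \<omega>)" for \<omega> :: "nat \<Rightarrow> 'g"
    by (simp add: shift_def add.assoc)
  have two: "(\<integral>\<^sup>+\<omega>. H (rw G \<omega> l) (rw G (shift l \<omega>) r) \<partial>M) = (\<integral>\<^sup>+u. \<integral>\<^sup>+y. H u y \<partial>measure_pmf (W r) \<partial>measure_pmf (W l))" for H :: "'g \<Rightarrow> 'g \<Rightarrow> ennreal"
  proof -
    have "(\<integral>\<^sup>+\<omega>. H (rw G \<omega> l) (rw G (shift l \<omega>) r) \<partial>M) = (\<integral>\<^sup>+\<omega>. \<integral>\<^sup>+\<omega>'. H (rw G \<omega> l) (rw G \<omega>' r) \<partial>M \<partial>M)"
      by (rule markov[where X = "\<lambda>\<omega>. rw G \<omega> l" and F = "\<lambda>u \<omega>'. H u (rw G \<omega>' r)"]) (auto intro: rw_cong m1)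
    then show ?thesis by (simp add: nn_integral_rw nn_integral_rw[where h = "\<lambda>u. \<integral>\<^sup>+y. H u y \<partial>measure_pmf (W r)"])
  qed
  have m2: "(\<lambda>\<omega>. H (rw G \<omega> l) (rw G (shift l \<omega>) r)) \<in> borel_measurable M" for H :: "'g \<Rightarrow> 'g \<Rightarrow> ennreal"
    by (rule measurable_finite_coords[of "l + r"])
       (auto intro!: arg_cong2[of _ _ _ _ H] rw_cong simp: shift_def)
  have "(\<integral>\<^sup>+\<omega>. F (rw G \<omega> a) (rw G (shift a \<omega>) l) (rw G (shift (a + l) \<omega>) r) \<partial>M)
     = (\<integral>\<^sup>+\<omega>. \<integral>\<^sup>+\<omega>'. F (rw G \<omega> a) (rw G \<omega>' l) (rw G (shift l \<omega>') r) \<partial>M \<partial>M)"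
    unfolding sh
    by (rule markov[where X = "\<lambda>\<omega>. rw G \<omega> a" and F = "\<lambda>x \<omega>'. F x (rw G \<omega>' l) (rw G (shift l \<omega>') r)"])
       (auto intro: rw_cong m2)
  also have "\<dots> = (\<integral>\<^sup>+\<omega>. \<integral>\<^sup>+u. \<integral>\<^sup>+y. F (rw G \<omega> a) u y \<partial>measure_pmf (W r) \<partial>measure_pmf (W l) \<partial>M)"
    using two by simp
  also have "\<dots> = (\<integral>\<^sup>+x. \<integral>\<^sup>+u. \<integral>\<^sup>+y. F x u y \<partial>measure_pmf (W r) \<partial>measure_pmf (W l) \<partial>measure_pmf (W a))"
    by (rule nn_integral_rw)
  finally show ?thesis .
qed

text \<open>A loxodromic segment traversed by the walk, with no backtracking before or after it, transfers
  the finiteness of the coarse stabilizer of the segment to that of the whole path.\<close>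

lemma finite_stab_transfer:
  assumes h: "h1 \<in> carrier G" "u \<in> carrier G" "h2 \<in> carrier G"
    and fin: "finite (stabK G \<phi> (3 * K + 2 * D + 2 * \<delta>) x0 (\<phi> u x0))"
    and c1: "gprod x0 (\<phi> (inv h1) x0) (\<phi> (u \<otimes> h2) x0) \<le> D"
    and c2: "gprod x0 (\<phi> (inv u) (\<phi> (inv h1) x0)) (\<phi> h2 x0) \<le> D"
  shows "finite (stabK G \<phi> K x0 (\<phi> (h1 \<otimes> u \<otimes> h2) x0))"
proof -
  let ?K = "3 * K + 2 * D + 2 * \<delta>" and ?v = "\<phi> (h1 \<otimes> u \<otimes> h2) x0"
  \<comment> \<open>An \<open>f\<close> that moves both ends of the path by at most \<open>K\<close>
    moves the intermediate points \<open>\<phi> h1 x0\<close> and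
    \<open>\<phi> (h1 \<otimes> u) x0\<close> by at most \<open>?K\<close>, by
    \<open>gprod_displacement\<close>; conjugating by \<open>h1\<close> brings these two points to
    \<open>x0\<close> and \<open>\<phi> u x0\<close>.\<close>
  have "stabK G \<phi> K x0 ?v \<subseteq> (\<lambda>s. h1 \<otimes> s \<otimes> inv h1) ` stabK G \<phi> ?K x0 (\<phi> u x0)"
  proof
    fix f assume "f \<in> stabK G \<phi> K x0 ?v"
    then have f: "f \<in> carrier G" "dist x0 (\<phi> f x0) \<le> K" "dist ?v (\<phi> f ?v) \<le> K" by (auto simp: stabK_def)
    have 1: "gprod (\<phi> h1 x0) x0 ?v \<le> D"
      using c1 gprod_orbit[of h1 "u \<otimes> h2" x0] h by (simp add: m_assoc)
    have 2: "gprod (\<phi> (h1 \<otimes> u) x0) x0 ?v \<le> D"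
      using c2 gprod_orbit[of "h1 \<otimes> u" h2 x0] h by (simp add: inv_mult_group act_mult)
    have d1: "dist (\<phi> h1 x0) (\<phi> f (\<phi> h1 x0)) \<le> ?K"
      by (rule gprod_displacement[OF act_isometry[OF f(1)] f(2,3) 1])
    have d2: "dist (\<phi> (h1 \<otimes> u) x0) (\<phi> f (\<phi> (h1 \<otimes> u) x0)) \<le> ?K"
      by (rule gprod_displacement[OF act_isometry[OF f(1)] f(2,3) 2])
    define s where "s = inv h1 \<otimes> f \<otimes> h1"
    have s: "s \<in> carrier G" "f = h1 \<otimes> s \<otimes> inv h1"
      using h f by (simp_all add: s_def m_assoc) (simp add: m_assoc[symmetric])
    have "dist x0 (\<phi> s x0) \<le> ?K"
      using d1 dist_act_inv[of h1 x0 "\<phi> f (\<phi> h1 x0)"] h f by (simp add: s_def act_mult)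
    moreover have "dist (\<phi> u x0) (\<phi> s (\<phi> u x0)) \<le> ?K"
      using d2 dist_act_inv[of h1 "\<phi> u x0" "\<phi> f (\<phi> h1 (\<phi> u x0))"] h f by (simp add: s_def act_mult)
    ultimately show "f \<in> (\<lambda>s. h1 \<otimes> s \<otimes> inv h1) ` stabK G \<phi> ?K x0 (\<phi> u x0)"
      using s by (auto simp: stabK_def)
  qed
  then show ?thesis using fin finite_surj by blast
qed

text \<open>The WPD element supplies a \<open>u\<close> with finite coarse stabilizer, and the walk
  runs through \<open>u\<close> within \<open>l\<close> steps with positive probability
  \<open>p\<close>. Among \<open>J\<close> disjoint time slots one is likely to do so without
  backtracking before or after it, and \<open>finite_stab_transfer\<close> applies to it.\<close>

lemma stab_finite_likely:
  assumes wpd: "\<exists>g\<in>carrier G. WPD G \<phi> g" and eps: "\<epsilon> > 0" and K: "K \<ge> 0"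
  shows "\<exists>m. measure_pmf.prob (W m) {v. infinite (stabK G \<phi> K x0 (\<phi> v x0))} \<le> \<epsilon>"
proof -
  interpret P: prob_space M by (rule prob_space_M)
  have e8: "\<epsilon> / 8 > 0" using eps by simp
  obtain D1 where D1: "\<And>n z. measure_pmf.prob (W n) {h\<in>carrier G. D1 \<le> gprod x0 z (\<phi> h x0)} \<le> \<epsilon> / 8"
    using fwd.shadow_small[OF e8] by auto
  obtain D2 where D2: "\<And>n z. measure_pmf.prob (map_pmf (m_inv G) (W n)) {h\<in>carrier G. D2 \<le> gprod x0 z (\<phi> h x0)} \<le> \<epsilon> / 8"
    using bwd.shadow_small[OF e8] by auto
  define D where "D = \<bar>D1\<bar> + \<bar>D2\<bar>"
  have F1: "emeasure (measure_pmf (W n)) {h\<in>carrier G. D \<le> gprod x0 z (\<phi> h x0)} \<le> ennreal (\<epsilon> / 8)" for n z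
  proof -
    have "measure_pmf.prob (W n) {h\<in>carrier G. D \<le> gprod x0 z (\<phi> h x0)} \<le> measure_pmf.prob (W n) {h\<in>carrier G. D1 \<le> gprod x0 z (\<phi> h x0)}"
      by (rule measure_pmf.finite_measure_mono) (auto simp: D_def)
    then show ?thesis using D1[of n z] by (simp add: measure_pmf.emeasure_eq_measure ennreal_leI)
  qed
  have F2: "emeasure (measure_pmf (W n)) {h\<in>carrier G. D \<le> gprod x0 z (\<phi> (inv h) x0)} \<le> ennreal (\<epsilon> / 8)" for n z
  proof -
    have "measure_pmf.prob (W n) {h\<in>carrier G. D \<le> gprod x0 z (\<phi> (inv h) x0)} \<le> measure_pmf.prob (W n) (m_inv G -` {h\<in>carrier G. D2 \<le> gprod x0 z (\<phi> h x0)})"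
      by (rule measure_pmf.finite_measure_mono) (auto simp: D_def)
    then show ?thesis using D2[of n z] by (simp add: measure_pmf.emeasure_eq_measure ennreal_leI)
  qed
  \<comment> \<open>The constant required by \<open>finite_stab_transfer\<close>. It depends only on
    \<open>K\<close>, \<open>\<delta>\<close> and \<open>D\<close>, and the power of
    \<open>g\<close> is chosen after it.\<close>
  define K' where "K' = 3 * K + 2 * D + 2 * \<delta>"
  have "K' \<ge> 0" using K delta_nonneg by (simp add: K'_def D_def)
  then obtain g P where g: "g \<in> carrier G" and fin: "finite (stabK G \<phi> K' x0 (\<phi> (g [^] (P::nat)) x0))"
    using wpd unfolding WPD_def by blast
  define u where "u = g [^] P"
  have u: "u \<in> carrier G" using g by (simp add: u_def)
  obtain l where l: "l \<ge> 1" "u \<in> set_pmf (W l)" using W_reach[OF u] by blast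
  define p where "p = pmf (W l) u"
  have p: "p > 0" using l by (simp add: p_def pmf_positive)
  \<comment> \<open>Makes \<open>1 / (real J * p)\<close> at most \<open>\<epsilon> / 2\<close>; the
    other half of \<open>\<epsilon>\<close> is the term \<open>2 * (\<epsilon> / 4)\<close> from
    backtracking.\<close>
  obtain J :: nat where J: "2 / (\<epsilon> * p) \<le> real J" "J > 0"
  proof -
    obtain J :: nat where "2 / (\<epsilon> * p) \<le> real J" using real_arch_simple by blast
    then show ?thesis using that[of "max J 1"] by (simp add: max_def)
  qed
  define m where "m = J * l"
  define a where "a j = j * l" for j
  define r where "r j = m - (a j + l)" for j
  have am: "a j + l + r j = m" if "j < J" for j
  proof -
    have "Suc j * l \<le> J * l" using that by (intro mult_le_mono1) simp
    then show ?thesis by (simp add: r_def m_def a_def)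
  qed
  define C1 where "C1 x y \<longleftrightarrow> D \<le> gprod x0 (\<phi> (inv x) x0) (\<phi> (u \<otimes> y) x0)" for x y
  define C2 where "C2 x y \<longleftrightarrow> D \<le> gprod x0 (\<phi> (inv u) (\<phi> (inv x) x0)) (\<phi> y x0)" for x y
  \<comment> \<open>\<open>Wd j\<close> is the event of running through \<open>u\<close> in slot
    \<open>j\<close>, independent for distinct slots; \<open>Bad j\<close> is backtracking around
    that slot, of conditional probability at most \<open>\<epsilon> / 4\<close>. For pairs of the
    sets \<open>A j\<close> the bound from \<open>Wd\<close> is enough.\<close>
  define Wd where "Wd j = {\<omega>. rw G (shift (a j) \<omega>) l = u}" for j
  define Bad where "Bad j = {\<omega>. rw G (shift (a j) \<omega>) l = u \<and> (C1 (rw G \<omega> (a j)) (rw G (shift (a j + l) \<omega>) (r j)) \<or> C2 (rw G \<omega> (a j)) (rw G (shift (a j + l) \<omega>) (r j)))}" for j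
  define A where "A j = Wd j - Bad j" for j
  have meas: "Measurable.pred M (\<lambda>\<omega>. Q (rw G \<omega> (a j)) (rw G (shift (a j) \<omega>) l) (rw G (shift (a j + l) \<omega>) (r j)))" for Q j
  proof (rule measurable_finite_coords[of "a j + l + r j"])
    fix \<omega> \<omega>' :: "nat \<Rightarrow> 'g" assume "\<And>i. i < a j + l + r j \<Longrightarrow> \<omega> i = \<omega>' i"
    then have "rw G \<omega> (a j) = rw G \<omega>' (a j)" "rw G (shift (a j) \<omega>) l = rw G (shift (a j) \<omega>') l"
       "rw G (shift (a j + l) \<omega>) (r j) = rw G (shift (a j + l) \<omega>') (r j)"
      by (auto intro!: rw_cong simp: shift_def)
    then show "Q (rw G \<omega> (a j)) (rw G (shift (a j) \<omega>) l) (rw G (shift (a j + l) \<omega>) (r j))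
        = Q (rw G \<omega>' (a j)) (rw G (shift (a j) \<omega>') l) (rw G (shift (a j + l) \<omega>') (r j))" by simp
  qed simp
  have sets: "Wd j \<in> sets M" "Bad j \<in> sets M" "A j \<in> sets M" for j
  proof -
    show 1: "Wd j \<in> sets M" unfolding Wd_def using meas[of "\<lambda>x v y. v = u" j] by (simp add: pred_def)
    show 2: "Bad j \<in> sets M" unfolding Bad_def
      using meas[of "\<lambda>x v y. v = u \<and> (C1 x y \<or> C2 x y)" j] by (simp add: pred_def)
    show "A j \<in> sets M" unfolding A_def using 1 2 by auto
  qed
  have law: "emeasure M {\<omega>. Q (rw G \<omega> (a j)) (rw G (shift (a j) \<omega>) l) (rw G (shift (a j + l) \<omega>) (r j))}
     = (\<integral>\<^sup>+x. \<integral>\<^sup>+v. \<integral>\<^sup>+y. (if Q x v y then 1 else 0) \<partial>measure_pmf (W (r j)) \<partial>measure_pmf (W l) \<partial>measure_pmf (W (a j)))" for Q j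
  proof -
    have "emeasure M {\<omega>. Q (rw G \<omega> (a j)) (rw G (shift (a j) \<omega>) l) (rw G (shift (a j + l) \<omega>) (r j))}
       = (\<integral>\<^sup>+\<omega>. indicator {\<omega>. Q (rw G \<omega> (a j)) (rw G (shift (a j) \<omega>) l) (rw G (shift (a j + l) \<omega>) (r j))} \<omega> \<partial>M)"
      using meas[of Q j] by (simp add: pred_def)
    also have "\<dots> = (\<integral>\<^sup>+\<omega>. (if Q (rw G \<omega> (a j)) (rw G (shift (a j) \<omega>) l) (rw G (shift (a j + l) \<omega>) (r j)) then 1 else 0) \<partial>M)"
      by (intro nn_integral_cong) (simp add: indicator_def)
    finally show ?thesis by (simp add: three_blocks[where F = "\<lambda>x v y. if Q x v y then 1 else 0"])
  qed
  have pWd: "P.prob (Wd j) = p" for j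
  proof -
    have "emeasure M (Wd j) = (\<integral>\<^sup>+v. (if v = u then 1 else 0) \<partial>measure_pmf (W l))"
      unfolding Wd_def by (subst law[of "\<lambda>x v y. v = u"]) simp
    also have "\<dots> = (\<integral>\<^sup>+v. indicator {u} v \<partial>measure_pmf (W l))"
      by (intro nn_integral_cong) (simp add: indicator_def)
    also have "\<dots> = ennreal p" by (simp add: emeasure_pmf_single p_def)
    finally show ?thesis using p by (simp add: measure_def)
  qed
  have single: "(\<integral>\<^sup>+v. (if v = u then c v else 0) \<partial>measure_pmf (W l)) = ennreal p * c u" for c :: "'g \<Rightarrow> ennreal"
  proof -
    have "(\<integral>\<^sup>+v. (if v = u then c v else 0) \<partial>measure_pmf (W l)) = (\<integral>\<^sup>+v. c u * indicator {u} v \<partial>measure_pmf (W l))"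
      by (intro nn_integral_cong) (simp add: indicator_def)
    also have "\<dots> = c u * ennreal p" by (simp add: nn_integral_cmult emeasure_pmf_single p_def)
    finally show ?thesis by (simp add: mult.commute)
  qed
  \<comment> \<open>For \<open>C1\<close> the future is frozen and the past \<open>x\<close> enters
    through its inverse, so the bound \<open>F2\<close> for the inverse laws applies; for
    \<open>C2\<close> the past is frozen and \<open>F1\<close> applies to the future.\<close>
  have b1: "emeasure M {\<omega>. rw G (shift (a j) \<omega>) l = u \<and> C1 (rw G \<omega> (a j)) (rw G (shift (a j + l) \<omega>) (r j))} \<le> ennreal p * ennreal (\<epsilon> / 8)" for j
  proof -
    have "emeasure M {\<omega>. rw G (shift (a j) \<omega>) l = u \<and> C1 (rw G \<omega> (a j)) (rw G (shift (a j + l) \<omega>) (r j))}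
        = (\<integral>\<^sup>+x. \<integral>\<^sup>+v. (if v = u then (\<integral>\<^sup>+y. (if C1 x y then 1 else 0) \<partial>measure_pmf (W (r j))) else 0) \<partial>measure_pmf (W l) \<partial>measure_pmf (W (a j)))"
      by (subst law[of "\<lambda>x v y. v = u \<and> C1 x y"]) (auto intro!: nn_integral_cong)
    also have "\<dots> = ennreal p * (\<integral>\<^sup>+x. \<integral>\<^sup>+y. (if C1 x y then 1 else 0) \<partial>measure_pmf (W (r j)) \<partial>measure_pmf (W (a j)))"
      unfolding single by (rule nn_integral_cmult) simp
    also have "(\<integral>\<^sup>+x. \<integral>\<^sup>+y. (if C1 x y then 1 else 0) \<partial>measure_pmf (W (r j)) \<partial>measure_pmf (W (a j)))
       = (\<integral>\<^sup>+y. \<integral>\<^sup>+x. (if C1 x y then 1 else 0) \<partial>measure_pmf (W (a j)) \<partial>measure_pmf (W (r j)))"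
      by (rule nn_integral_pmf_commute)
    also have "\<dots> \<le> (\<integral>\<^sup>+y. ennreal (\<epsilon> / 8) \<partial>measure_pmf (W (r j)))"
    proof (rule nn_integral_mono)
      fix y
      have "(\<integral>\<^sup>+x. (if C1 x y then 1 else 0) \<partial>measure_pmf (W (a j))) = (\<integral>\<^sup>+x. indicator {h\<in>carrier G. D \<le> gprod x0 (\<phi> (u \<otimes> y) x0) (\<phi> (inv h) x0)} x \<partial>measure_pmf (W (a j)))"
        by (rule nn_integral_cong_AE, rule AE_pmfI)
           (use W_carrier[of "a j"] in \<open>auto simp: C1_def indicator_def gprod_commute\<close>)
      also have "\<dots> \<le> ennreal (\<epsilon> / 8)" using F2 by simp
      finally show "(\<integral>\<^sup>+x. (if C1 x y then 1 else 0) \<partial>measure_pmf (W (a j))) \<le> ennreal (\<epsilon> / 8)" .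
    qed
    also have "\<dots> = ennreal (\<epsilon> / 8)" by simp
    finally show ?thesis by (simp add: mult_left_mono)
  qed
  have b2: "emeasure M {\<omega>. rw G (shift (a j) \<omega>) l = u \<and> C2 (rw G \<omega> (a j)) (rw G (shift (a j + l) \<omega>) (r j))} \<le> ennreal p * ennreal (\<epsilon> / 8)" for j
  proof -
    have "emeasure M {\<omega>. rw G (shift (a j) \<omega>) l = u \<and> C2 (rw G \<omega> (a j)) (rw G (shift (a j + l) \<omega>) (r j))}
        = (\<integral>\<^sup>+x. \<integral>\<^sup>+v. (if v = u then (\<integral>\<^sup>+y. (if C2 x y then 1 else 0) \<partial>measure_pmf (W (r j))) else 0) \<partial>measure_pmf (W l) \<partial>measure_pmf (W (a j)))"
      by (subst law[of "\<lambda>x v y. v = u \<and> C2 x y"]) (auto intro!: nn_integral_cong)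
    also have "\<dots> = ennreal p * (\<integral>\<^sup>+x. \<integral>\<^sup>+y. (if C2 x y then 1 else 0) \<partial>measure_pmf (W (r j)) \<partial>measure_pmf (W (a j)))"
      unfolding single by (rule nn_integral_cmult) simp
    also have "(\<integral>\<^sup>+x. \<integral>\<^sup>+y. (if C2 x y then 1 else 0) \<partial>measure_pmf (W (r j)) \<partial>measure_pmf (W (a j)))
       \<le> (\<integral>\<^sup>+x. ennreal (\<epsilon> / 8) \<partial>measure_pmf (W (a j)))"
    proof (rule nn_integral_mono)
      fix x
      have "(\<integral>\<^sup>+y. (if C2 x y then 1 else 0) \<partial>measure_pmf (W (r j))) = (\<integral>\<^sup>+y. indicator {h\<in>carrier G. D \<le> gprod x0 (\<phi> (inv u) (\<phi> (inv x) x0)) (\<phi> h x0)} y \<partial>measure_pmf (W (r j)))"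
        by (rule nn_integral_cong_AE, rule AE_pmfI)
           (use W_carrier[of "r j"] in \<open>auto simp: C2_def indicator_def\<close>)
      also have "\<dots> \<le> ennreal (\<epsilon> / 8)" using F1 by simp
      finally show "(\<integral>\<^sup>+y. (if C2 x y then 1 else 0) \<partial>measure_pmf (W (r j))) \<le> ennreal (\<epsilon> / 8)" .
    qed
    also have "\<dots> = ennreal (\<epsilon> / 8)" by simp
    finally show ?thesis by (simp add: mult_left_mono)
  qed
  have pBad: "P.prob (Bad j) \<le> p * (\<epsilon> / 4)" for j
  proof -
    let ?B1 = "{\<omega>. rw G (shift (a j) \<omega>) l = u \<and> C1 (rw G \<omega> (a j)) (rw G (shift (a j + l) \<omega>) (r j))}"
    let ?B2 = "{\<omega>. rw G (shift (a j) \<omega>) l = u \<and> C2 (rw G \<omega> (a j)) (rw G (shift (a j + l) \<omega>) (r j))}"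
    have s: "?B1 \<in> sets M" "?B2 \<in> sets M"
      using meas[of "\<lambda>x v y. v = u \<and> C1 x y" j] meas[of "\<lambda>x v y. v = u \<and> C2 x y" j] by (simp_all add: pred_def)
    have "Bad j = ?B1 \<union> ?B2" by (auto simp: Bad_def)
    then have "P.prob (Bad j) \<le> P.prob ?B1 + P.prob ?B2" using s by (simp add: measure_Un_le)
    moreover have "P.prob ?B1 \<le> p * (\<epsilon> / 8)" "P.prob ?B2 \<le> p * (\<epsilon> / 8)"
      using b1[of j] b2[of j] p eps
      by (simp_all add: P.emeasure_eq_measure flip: ennreal_mult)
    ultimately show ?thesis by simp
  qed
  have BW: "Bad j \<subseteq> Wd j" for j by (auto simp: Bad_def Wd_def)
  have pA: "P.prob (A j) = p - P.prob (Bad j)" for j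
    unfolding A_def using sets BW pWd by (simp add: P.finite_measure_Diff)
  have pair: "P.prob (A i \<inter> A j) \<le> p\<^sup>2" if ij: "i < j" for i j
  proof -
    have il: "a i + l \<le> a j" using ij mult_le_mono1[of "Suc i" j l] by (simp add: a_def)
    define d where "d = a j - (a i + l)"
    have sh: "shift (a j) \<omega> = shift d (shift (a i + l) \<omega>)" for \<omega> :: "nat \<Rightarrow> 'g"
      using il by (simp add: shift_def d_def fun_eq_iff)
    have mp: "(\<lambda>\<omega>. (if rw G (shift d \<omega>) l = u then 1 else 0 :: ennreal)) \<in> borel_measurable M"
      by (rule measurable_finite_coords[of "d + l"])
         (auto intro!: arg_cong[of _ _ "\<lambda>v. if v = u then 1 else 0"] rw_cong simp: shift_def)
    have pd: "(\<integral>\<^sup>+\<omega>. (if rw G (shift d \<omega>) l = u then 1 else 0) \<partial>M) = ennreal p"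
    proof -
      have "(\<integral>\<^sup>+\<omega>. (if rw G (shift d \<omega>) l = u then 1 else 0) \<partial>M) = (\<integral>\<^sup>+x. \<integral>\<^sup>+v. \<integral>\<^sup>+y. (if v = u then 1 else 0) \<partial>measure_pmf (W 0) \<partial>measure_pmf (W l) \<partial>measure_pmf (W d))"
        by (rule three_blocks[where F = "\<lambda>x v y. if v = u then 1 else 0"])
      then show ?thesis using single[of "\<lambda>_. 1"] by simp
    qed
    have "P.prob (A i \<inter> A j) \<le> P.prob (Wd i \<inter> Wd j)"
      using sets by (intro P.finite_measure_mono) (auto simp: A_def)
    moreover have "emeasure M (Wd i \<inter> Wd j) = ennreal p * ennreal p"
    proof -
      have "emeasure M (Wd i \<inter> Wd j) = (\<integral>\<^sup>+\<omega>. indicator (Wd i \<inter> Wd j) \<omega> \<partial>M)" using sets by simp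
      also have "\<dots> = (\<integral>\<^sup>+\<omega>. (if rw G (shift (a i) \<omega>) l = u then 1 else 0) * (if rw G (shift d (shift (a i + l) \<omega>)) l = u then 1 else 0) \<partial>M)"
        by (intro nn_integral_cong) (simp add: indicator_def Wd_def sh[symmetric])
      also have "\<dots> = (\<integral>\<^sup>+\<omega>. \<integral>\<^sup>+\<omega>'. (if rw G (shift (a i) \<omega>) l = u then 1 else 0) * (if rw G (shift d \<omega>') l = u then 1 else 0) \<partial>M \<partial>M)"
        by (rule markov[where X = "\<lambda>\<omega>. rw G (shift (a i) \<omega>) l" and F = "\<lambda>v \<omega>'. (if v = u then 1 else 0) * (if rw G (shift d \<omega>') l = u then 1 else 0)"])
           (auto intro!: rw_cong borel_measurable_times_ennreal mp simp: shift_def[of "a i"])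
      also have "\<dots> = (\<integral>\<^sup>+\<omega>. (if rw G (shift (a i) \<omega>) l = u then 1 else 0) * ennreal p \<partial>M)"
        using mp pd by (simp add: nn_integral_cmult)
      also have "\<dots> = (\<integral>\<^sup>+\<omega>. indicator (Wd i) \<omega> * ennreal p \<partial>M)"
        by (intro nn_integral_cong) (simp add: indicator_def Wd_def)
      also have "\<dots> = ennreal p * ennreal p"
        using sets pWd[of i] by (simp add: nn_integral_multc P.emeasure_eq_measure)
      finally show ?thesis .
    qed
    ultimately show ?thesis using p by (simp add: P.emeasure_eq_measure power2_eq_square flip: ennreal_mult)
  qed
  have "P.prob (space M - (\<Union>i<J. A i)) \<le> 1 / (real J * p) + 2 * (\<epsilon> / 4)"
  proof (rule P.second_moment_hit[OF sets(3) p J(2)])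
    fix i assume "i < J"
    show "p * (1 - \<epsilon> / 4) \<le> P.prob (A i)" using pA[of i] pBad[of i] by (simp add: algebra_simps)
    show "P.prob (A i) \<le> p" using pA[of i] by simp
  qed (rule pair)
  also have "1 / (real J * p) \<le> \<epsilon> / 2" using J p eps by (simp add: field_simps)
  finally have hit: "P.prob (space M - (\<Union>i<J. A i)) \<le> \<epsilon>" by simp
  have "P.prob {\<omega>. rw G \<omega> m \<in> {v. infinite (stabK G \<phi> K x0 (\<phi> v x0))}} \<le> P.prob (space M - (\<Union>i<J. A i))"
  proof (rule P.finite_measure_mono_AE)
    show "AE \<omega> in M. \<omega> \<in> {\<omega>. rw G \<omega> m \<in> {v. infinite (stabK G \<phi> K x0 (\<phi> v x0))}} \<longrightarrow> \<omega> \<in> space M - (\<Union>i<J. A i)"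
      using AE_inC
    proof eventually_elim
      fix \<omega> assume w: "inC \<omega>"
      have "finite (stabK G \<phi> K x0 (\<phi> (rw G \<omega> m) x0))" if j: "j < J" "\<omega> \<in> A j" for j
      proof -
        let ?x = "rw G \<omega> (a j)" and ?y = "rw G (shift (a j + l) \<omega>) (r j)"
        have c: "rw G (shift (a j) \<omega>) l = u" "\<not> C1 ?x ?y" "\<not> C2 ?x ?y"
          using j(2) by (auto simp: A_def Wd_def Bad_def)
        have "rw G \<omega> m = ?x \<otimes> u \<otimes> ?y"
          using am[OF j(1)] rw_add[OF w, of "a j + l" "r j"] rw_add[OF w, of "a j" l] c(1) by simp
        moreover have "finite (stabK G \<phi> K x0 (\<phi> (?x \<otimes> u \<otimes> ?y) x0))"
          by (rule finite_stab_transfer[where D = D])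
             (use w u inC_shift[OF w] c fin in \<open>auto simp: C1_def C2_def K'_def u_def\<close>)
        ultimately show ?thesis by simp
      qed
      then show "\<omega> \<in> {\<omega>. rw G \<omega> m \<in> {v. infinite (stabK G \<phi> K x0 (\<phi> v x0))}} \<longrightarrow> \<omega> \<in> space M - (\<Union>i<J. A i)"
        by auto
    qed
    show "space M - (\<Union>i<J. A i) \<in> sets M"
      by (intro sets.Diff sets.top sets.finite_UN) (use sets in auto)
  qed
  then show ?thesis using hit prob_rw[of m "{v. infinite (stabK G \<phi> K x0 (\<phi> v x0))}"] by (intro exI[of _ m]) linarith
qed

end

section \<open>The entropy criterion\<close>

lemma nn_integral_prefix:
  fixes f :: "'a::countable list \<Rightarrow> (nat \<Rightarrow> 'a) \<Rightarrow> ennreal"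
  assumes m [measurable]: "\<And>\<gamma>. f \<gamma> \<in> borel_measurable (iid \<mu>)"
  shows "(\<integral>\<^sup>+\<omega>. f (prefix n \<omega>) \<omega> \<partial>iid \<mu>)
     = (\<integral>\<^sup>+\<gamma>. (\<integral>\<^sup>+\<omega>. (if prefix n \<omega> = \<gamma> then f \<gamma> \<omega> else 0) \<partial>iid \<mu>) \<partial>count_space {\<gamma>. length \<gamma> = n})"
proof -
  have "(\<integral>\<^sup>+\<gamma>. (if prefix n \<omega> = \<gamma> then f \<gamma> \<omega> else 0) \<partial>count_space {\<gamma>. length \<gamma> = n}) = f (prefix n \<omega>) \<omega>" for \<omega>
  proof -
    have "(\<integral>\<^sup>+\<gamma>. (if prefix n \<omega> = \<gamma> then f \<gamma> \<omega> else 0) \<partial>count_space {\<gamma>. length \<gamma> = n})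
       = (\<integral>\<^sup>+\<gamma>. f (prefix n \<omega>) \<omega> * indicator {prefix n \<omega>} \<gamma> \<partial>count_space {\<gamma>. length \<gamma> = n})"
      by (intro nn_integral_cong) (auto simp: indicator_def)
    also have "\<dots> = f (prefix n \<omega>) \<omega>"
      by (subst nn_integral_cmult_indicator) (auto simp: prefix_def)
    finally show ?thesis .
  qed
  then have "(\<integral>\<^sup>+\<omega>. f (prefix n \<omega>) \<omega> \<partial>iid \<mu>)
     = (\<integral>\<^sup>+\<omega>. \<integral>\<^sup>+\<gamma>. (if prefix n \<omega> = \<gamma> then f \<gamma> \<omega> else 0) \<partial>count_space {\<gamma>. length \<gamma> = n} \<partial>iid \<mu>)" by simp
  also have "\<dots> = (\<integral>\<^sup>+\<gamma>. (\<integral>\<^sup>+\<omega>. (if prefix n \<omega> = \<gamma> then f \<gamma> \<omega> else 0) \<partial>iid \<mu>) \<partial>count_space {\<gamma>. length \<gamma> = n})"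
    by (rule nn_integral_count_space_nn_integral) (auto intro!: measurable_If)
  finally show ?thesis .
qed

lemma nn_integral_lists_Suc:
  fixes f :: "'a list \<Rightarrow> ennreal"
  shows "(\<integral>\<^sup>+\<gamma>. f \<gamma> \<partial>count_space {\<gamma>. length \<gamma> = Suc n})
    = (\<integral>\<^sup>+a. \<integral>\<^sup>+\<gamma>. f (a # \<gamma>) \<partial>count_space {\<gamma>. length \<gamma> = n} \<partial>count_space UNIV)"
proof -
  define g where "g z = f (fst z # snd z) * indicator {\<gamma>. length \<gamma> = n} (snd z)" for z :: "'a \<times> 'a list"
  have bij: "bij_betw (\<lambda>z. fst z # snd z) (UNIV \<times> {\<gamma>::'a list. length \<gamma> = n}) {\<gamma>. length \<gamma> = Suc n}"
    by (rule bij_betw_byWitness[where f' = "\<lambda>l. (hd l, tl l)"]) (auto simp: length_Suc_conv)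
  have "(\<integral>\<^sup>+a. \<integral>\<^sup>+\<gamma>. f (a # \<gamma>) \<partial>count_space {\<gamma>. length \<gamma> = n} \<partial>count_space UNIV)
     = (\<integral>\<^sup>+a. \<integral>\<^sup>+\<gamma>. g (a, \<gamma>) \<partial>count_space UNIV \<partial>count_space UNIV)"
    by (subst (2) nn_integral_count_space_indicator) (auto simp: g_def)
  also have "\<dots> = (\<integral>\<^sup>+z. g z \<partial>count_space UNIV)"
    by (rule nn_integral_fst_count_space)
  also have "\<dots> = (\<integral>\<^sup>+z. f (fst z # snd z) * indicator (UNIV \<times> {\<gamma>. length \<gamma> = n}) z \<partial>count_space UNIV)"
    by (intro nn_integral_cong) (auto simp: g_def indicator_def)
  also have "\<dots> = (\<integral>\<^sup>+z. f (fst z # snd z) \<partial>count_space (UNIV \<times> {\<gamma>. length \<gamma> = n}))"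
    by (rule nn_integral_count_space_indicator[symmetric]) simp
  also have "\<dots> = (\<integral>\<^sup>+\<gamma>. f \<gamma> \<partial>count_space {\<gamma>. length \<gamma> = Suc n})"
    by (rule nn_integral_bij_count_space[OF bij])
  finally show ?thesis by simp
qed

text \<open>Information content; the value \<open>\<top>\<close> at 0 makes it additive on \<open>[0, 1]\<close>.\<close>

definition info :: "ennreal \<Rightarrow> ennreal" where
  "info x = (if x = 0 then \<top> else ennreal (- ln (enn2real x)))"

lemma measurable_info [measurable]: "info \<in> borel_measurable borel"
  unfolding info_def by measurable

lemma info_mult:
  assumes "x \<le> 1" "y \<le> 1"
  shows "info (x * y) = info x + info y"
proof (cases "x = 0 \<or> y = 0")
  case True
  then show ?thesis by (auto simp: info_def)
next
  case False
  have f: "x < \<top>" "y < \<top>" using assms ennreal_one_less_top order_le_less_trans by blast+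
  obtain a b where ab: "x = ennreal a" "y = ennreal b" "0 \<le> a" "0 \<le> b"
    using f by (metis ennreal_enn2real enn2real_nonneg)
  have ab1: "a \<le> 1" "b \<le> 1" "0 < a" "0 < b" using assms ab False by (auto simp: ennreal_eq_0_iff less_le)
  have "x * y = ennreal (a * b)" using ab by (simp add: ennreal_mult)
  then show ?thesis using ab ab1 ln_le_zero_iff
    by (simp add: info_def ln_mult ennreal_plus[symmetric] del: ennreal_plus)
qed

text \<open>The inequality ln t <= t - 1 at t = r/p, arranged without subtraction so that it makes
  sense in \<open>ennreal\<close>, including an infinite \<open>info r\<close>; equality forces t =
  1.\<close>

lemma info_gibbs:
  assumes "p \<le> 1" "r \<le> 1" "p \<noteq> 0"
  shows "info p + 1 \<le> info r + r / p" and "info p + 1 = info r + r / p \<Longrightarrow> p = r"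
proof -
  have f: "p < \<top>" "r < \<top>" using assms ennreal_one_less_top order_le_less_trans by blast+
  obtain a b where ab: "p = ennreal a" "r = ennreal b" "0 \<le> a" "0 \<le> b"
    using f by (metis ennreal_enn2real enn2real_nonneg)
  have a: "0 < a" "a \<le> 1" "b \<le> 1" using assms ab by (auto simp: ennreal_eq_0_iff less_le)
  have ip: "info p = ennreal (- ln a)" "- ln a \<ge> 0" using ab a by (auto simp: info_def)
  have rp: "r / p = ennreal (b / a)" using ab a by (simp add: divide_ennreal)
  have L: "info p + 1 = ennreal (1 - ln a)" using ip by (simp flip: ennreal_1 ennreal_plus)
  have "info p + 1 \<le> info r + r / p \<and> (info p + 1 = info r + r / p \<longrightarrow> p = r)"
  proof (cases "b = 0")
    case True
    then have "info r = \<top>" using ab by (simp add: info_def)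
    then show ?thesis using L by simp
  next
    case False
    then have b: "0 < b" using ab by simp
    have ir: "info r = ennreal (- ln b)" "- ln b \<ge> 0" using ab a b by (auto simp: info_def)
    have R: "info r + r / p = ennreal (b / a - ln b)"
      using ir rp a b by (simp flip: ennreal_plus)
    have "0 \<le> b / a" using a b by simp
    then have nn: "0 \<le> 1 - ln a" "0 \<le> b / a - ln b" using ip(2) ir(2) by linarith+
    have lr: "ln (b / a) = ln b - ln a" using a b by (simp add: ln_div)
    have 1: "1 - ln a \<le> b / a - ln b" using ln_le_minus_one[of "b / a"] a b lr by simp
    have 2: "a = b" if "1 - ln a = b / a - ln b"
    proof -
      have "ln (b / a) = b / a - 1" using that lr by simp
      then have "b / a = 1" using a b by (intro ln_eq_minus_one) auto
      then show ?thesis using a by simp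
    qed
    show ?thesis unfolding L R using nn 1 2 ab by (auto simp: ennreal_leI)
  qed
  then show "info p + 1 \<le> info r + r / p" "info p + 1 = info r + r / p \<Longrightarrow> p = r" by auto
qed

text \<open>Integrates \<open>info_gibbs\<close>. When \<open>p\<close> is the true conditional law
  of the outcome, \<open>ratio\<close> expresses that \<open>r\<close> is a subprobability;
  finiteness allows the integrals to be subtracted in the equality case.\<close>

lemma (in prob_space) gibbs:
  assumes [measurable]: "p \<in> borel_measurable M" "r \<in> borel_measurable M"
    and p: "AE x in M. p x \<noteq> 0" "\<And>x. p x \<le> 1" and r: "\<And>x. r x \<le> 1"
    and ratio: "(\<integral>\<^sup>+x. r x / p x \<partial>M) \<le> 1"
  shows "(\<integral>\<^sup>+x. info (p x) \<partial>M) \<le> (\<integral>\<^sup>+x. info (r x) \<partial>M)"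
    and "(\<integral>\<^sup>+x. info (r x) \<partial>M) \<le> (\<integral>\<^sup>+x. info (p x) \<partial>M) \<Longrightarrow> (\<integral>\<^sup>+x. info (p x) \<partial>M) < \<top> \<Longrightarrow> AE x in M. p x = r x"
proof -
  let ?I = "\<lambda>f. \<integral>\<^sup>+x. info (f x) \<partial>M"
  have s1: "?I p + 1 = (\<integral>\<^sup>+x. info (p x) + 1 \<partial>M)"
    by (subst nn_integral_add) (auto simp: emeasure_space_1)
  have s2: "(\<integral>\<^sup>+x. info (r x) + r x / p x \<partial>M) = ?I r + (\<integral>\<^sup>+x. r x / p x \<partial>M)"
    by (rule nn_integral_add) auto
  have pt: "AE x in M. info (p x) + 1 \<le> info (r x) + r x / p x"
    using p(1) by eventually_elim (use p(2) r info_gibbs(1) in blast)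
  have "?I p + 1 \<le> ?I r + (\<integral>\<^sup>+x. r x / p x \<partial>M)"
    unfolding s1 s2[symmetric] by (rule nn_integral_mono_AE[OF pt])
  also have "\<dots> \<le> ?I r + 1" by (intro add_left_mono ratio)
  finally have "1 + ?I p \<le> 1 + ?I r" by (simp add: add.commute)
  then show "?I p \<le> ?I r" by (subst (asm) ennreal_add_left_cancel_le) simp
  assume le: "?I r \<le> ?I p" and fin: "?I p < \<top>"
  have up: "(\<integral>\<^sup>+x. info (r x) + r x / p x \<partial>M) \<le> (\<integral>\<^sup>+x. info (p x) + 1 \<partial>M)"
    unfolding s2 s1[symmetric] by (intro add_mono le ratio)
  have fin1: "(\<integral>\<^sup>+x. info (p x) + 1 \<partial>M) \<noteq> \<infinity>"
    unfolding s1[symmetric] using fin by (auto simp: less_top)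
  have "(\<integral>\<^sup>+x. (info (r x) + r x / p x) - (info (p x) + 1) \<partial>M)
      = (\<integral>\<^sup>+x. info (r x) + r x / p x \<partial>M) - (\<integral>\<^sup>+x. info (p x) + 1 \<partial>M)"
    by (rule nn_integral_diff) (use fin1 pt in auto)
  also have "\<dots> = 0" using up fin1 le_less_trans[OF up] by (intro diff_eq_0_ennreal) (auto simp: less_top)
  finally have z: "AE x in M. (info (r x) + r x / p x) - (info (p x) + 1) = 0"
    by (subst (asm) nn_integral_0_iff_AE) auto
  have "AE x in M. info (p x) + 1 \<noteq> \<infinity>"
    by (rule nn_integral_PInf_AE[OF _ fin1]) auto
  then show "AE x in M. p x = r x"
    using z pt p(1)
  proof eventually_elim
    fix x assume a: "info (p x) + 1 \<noteq> \<infinity>" "info (r x) + r x / p x - (info (p x) + 1) = 0"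
      "info (p x) + 1 \<le> info (r x) + r x / p x" "p x \<noteq> 0"
    have "info (r x) + r x / p x \<le> info (p x) + 1"
      using a(1,2) by (metis diff_eq_0_iff_ennreal ennreal_minus_eq_0 infinity_ennreal_def)
    then have "info (p x) + 1 = info (r x) + r x / p x" using a(3) by simp
    then show "p x = r x" using info_gibbs(2)[OF p(2) r a(4)] by blast
  qed
qed

lemma finite_entropy_info:
  assumes "finite_entropy \<mu>"
  shows "(\<integral>\<^sup>+g. info (ennreal (pmf \<mu> g)) \<partial>measure_pmf \<mu>) < \<top>"
proof -
  let ?h = "\<lambda>g. - (pmf \<mu> g * ln (pmf \<mu> g))"
  have nn: "0 \<le> ?h g" for g
    using pmf_le_1[of \<mu> g] pmf_nonneg[of \<mu> g]
    by (cases "pmf \<mu> g = 0") (auto simp: mult_nonneg_nonpos less_le)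
  have "?h summable_on UNIV" using assms by (simp add: finite_entropy_def)
  then have "(\<lambda>g. norm (?h g)) summable_on UNIV" by (simp only: real_norm_def abs_of_nonneg[OF nn])
  from abs_summable_equivalent[THEN iffD1, OF this]
  have "integrable (count_space UNIV) ?h" by (simp only: Infinite_Set_Sum.abs_summable_on_def)
  then have fin: "(\<integral>\<^sup>+g. ennreal (?h g) \<partial>count_space UNIV) < \<infinity>"
    using nn by (simp add: integrable_iff_bounded)
  have "(\<integral>\<^sup>+g. info (ennreal (pmf \<mu> g)) \<partial>measure_pmf \<mu>) = (\<integral>\<^sup>+g. ennreal (pmf \<mu> g) * info (ennreal (pmf \<mu> g)) \<partial>count_space UNIV)"
    by (rule nn_integral_measure_pmf)
  also have "\<dots> = (\<integral>\<^sup>+g. ennreal (?h g) \<partial>count_space UNIV)"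
  proof (rule nn_integral_cong)
    fix g
    show "ennreal (pmf \<mu> g) * info (ennreal (pmf \<mu> g)) = ennreal (?h g)"
      using pmf_le_1[of \<mu> g] pmf_nonneg[of \<mu> g]
      by (cases "pmf \<mu> g = 0") (auto simp: info_def ennreal_mult'[symmetric])
  qed
  finally show ?thesis using fin by simp
qed

lemma borel_measurable_nn_integral_count:
  fixes f :: "'i::countable \<Rightarrow> 'a \<Rightarrow> ennreal"
  assumes "\<And>i. f i \<in> borel_measurable M"
  shows "(\<lambda>x. \<integral>\<^sup>+i. f i x \<partial>count_space A) \<in> borel_measurable M"
proof -
  interpret sigma_finite_measure "count_space A"
    by (rule sigma_finite_measure_count_space_countable) simp
  have "(\<lambda>z. f (snd z) (fst z)) \<in> borel_measurable (M \<Otimes>\<^sub>M count_space A)"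
    by (rule measurable_compose_countable[where f = "\<lambda>i z. f i (fst z)" and g = snd])
       (auto intro: measurable_compose[OF measurable_fst assms] measurable_compose[OF measurable_snd])
  then show ?thesis by (intro borel_measurable_nn_integral) (simp add: case_prod_beta')
qed

section \<open>Conditional laws of the increments given invariant events\<close>

context rand_walk
begin

abbreviation "N \<equiv> PiM (UNIV :: nat set) (\<lambda>_. count_space (UNIV :: 'g set))"

definition good :: "(nat \<Rightarrow> 'g) \<Rightarrow> bool" where "good w \<longleftrightarrow> (\<forall>n. w n \<in> carrier G)"

text \<open>On paths leaving the carrier left multiplication need not be an action; making
  \<open>tr\<close> the identity there lets the laws of an action hold for all paths.\<close>

definition tr :: "'g \<Rightarrow> (nat \<Rightarrow> 'g) \<Rightarrow> nat \<Rightarrow> 'g" where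
  "tr x w = (if good w then (\<lambda>n. x \<otimes> w n) else w)"

text \<open>Common frame for the events determined by the limit point and for all invariant events.
  Invariance is asked on \<open>good\<close> paths, which are almost all, and translates of members
  are members, so that conditioning can be repeated after each step.\<close>

definition inv_alg :: "(nat \<Rightarrow> 'g) measure \<Rightarrow> bool" where
  "inv_alg F \<longleftrightarrow> space F = UNIV \<and> sets F \<subseteq> sets N \<and>
     (\<forall>E\<in>sets F. \<forall>w. good w \<longrightarrow> (w \<in> E \<longleftrightarrow> w \<circ> Suc \<in> E)) \<and>
     (\<forall>E\<in>sets F. \<forall>x\<in>carrier G. tr x -` E \<in> sets F)"

lemma space_N [simp]: "space N = UNIV" by (simp add: space_PiM PiE_def)

lemma measurable_rw_N [measurable]: "rw G \<in> M \<rightarrow>\<^sub>M N"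
  by (rule measurable_PiM_single') (auto simp: PiE_def)

lemma path_measure_eq: "path_measure G \<mu> = distr M N (rw G)"
  by (simp add: path_measure_def iid_def)

lemma nn_integral_path:
  "f \<in> borel_measurable N \<Longrightarrow> (\<integral>\<^sup>+w. f w \<partial>path_measure G \<mu>) = (\<integral>\<^sup>+\<omega>. f (rw G \<omega>) \<partial>M)"
  by (simp add: path_measure_eq nn_integral_distr)

lemma prob_space_path: "prob_space (path_measure G \<mu>)"
  unfolding path_measure_eq by (rule prob_space.prob_space_distr[OF prob_space_M]) simp

lemma sets_path: "sets (path_measure G \<mu>) = sets N" and space_path: "space (path_measure G \<mu>) = UNIV"
  by (simp_all add: path_measure_eq)

lemma inC_good: "inC \<omega> \<Longrightarrow> good (rw G \<omega>)" by (simp add: good_def)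

lemma good_tr: "x \<in> carrier G \<Longrightarrow> good w \<Longrightarrow> good (tr x w)" by (simp add: good_def tr_def)

lemma tr_tr: "x \<in> carrier G \<Longrightarrow> y \<in> carrier G \<Longrightarrow> tr x (tr y w) = tr (x \<otimes> y) w"
  by (auto simp: tr_def good_def fun_eq_iff m_assoc)

lemma tr_one: "tr \<one> w = w"
  by (auto simp: tr_def good_def fun_eq_iff)

lemma tr_inv: "x \<in> carrier G \<Longrightarrow> tr (inv x) (tr x w) = w"
  by (simp add: tr_tr tr_one)

lemma rw_comp_Suc:
  assumes "inC \<omega>"
  shows "rw G \<omega> \<circ> Suc = tr (\<omega> 0) (rw G (shift 1 \<omega>))"
proof
  fix n
  show "(rw G \<omega> \<circ> Suc) n = tr (\<omega> 0) (rw G (shift 1 \<omega>)) n"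
    by (simp only: comp_apply rw_Suc_shift[OF assms] tr_def inC_good[OF inC_shift[OF assms]] if_True)
qed

lemma tr_comp_Suc: "good w \<Longrightarrow> tr x w \<circ> Suc = tr x (w \<circ> Suc)"
  by (auto simp: tr_def good_def)

lemma inv_alg_N: "inv_alg F \<Longrightarrow> f \<in> F \<rightarrow>\<^sub>M K \<Longrightarrow> f \<in> N \<rightarrow>\<^sub>M K"
  unfolding inv_alg_def measurable_def by auto

lemma inv_alg_rw: "inv_alg F \<Longrightarrow> f \<in> F \<rightarrow>\<^sub>M K \<Longrightarrow> (\<lambda>\<omega>. f (rw G \<omega>)) \<in> M \<rightarrow>\<^sub>M K"
  by (rule measurable_compose[OF measurable_rw_N inv_alg_N])

lemma inv_alg_tr: "inv_alg F \<Longrightarrow> x \<in> carrier G \<Longrightarrow> f \<in> F \<rightarrow>\<^sub>M K \<Longrightarrow> (\<lambda>w. f (tr x w)) \<in> F \<rightarrow>\<^sub>M K"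
  by (rule measurable_compose[of "tr x" F F]) (auto simp: inv_alg_def measurable_def)

lemma inv_alg_shift:
  fixes f :: "(nat \<Rightarrow> 'g) \<Rightarrow> ennreal"
  assumes F: "inv_alg F" and f: "f \<in> borel_measurable F" and w: "good w"
  shows "f (w \<circ> Suc) = f w"
proof -
  have "f -` {f w} \<inter> space F \<in> sets F" using f by (rule measurable_sets) simp
  then have "f -` {f w} \<in> sets F" using F by (simp add: inv_alg_def)
  moreover have "\<forall>E\<in>sets F. \<forall>w. good w \<longrightarrow> (w \<in> E \<longleftrightarrow> w \<circ> Suc \<in> E)"
    using F unfolding inv_alg_def by blast
  ultimately have "w \<in> f -` {f w} \<longleftrightarrow> w \<circ> Suc \<in> f -` {f w}" using w by blast
  then show ?thesis by simp
qed

text \<open>The path from time 1 on is the walk driven by the shifted increments, translated by the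
  first one, and an invariant function does not see the loss of the first position.\<close>

lemma inv_alg_step:
  fixes f :: "(nat \<Rightarrow> 'g) \<Rightarrow> ennreal"
  assumes F: "inv_alg F" and f: "f \<in> borel_measurable F" and w: "inC \<omega>"
  shows "f (rw G \<omega>) = f (tr (\<omega> 0) (rw G (shift 1 \<omega>)))" "f (tr (inv (\<omega> 0)) (rw G \<omega>)) = f (rw G (shift 1 \<omega>))"
proof -
  have c: "\<omega> 0 \<in> carrier G" using w by (simp add: inC_def)
  show "f (rw G \<omega>) = f (tr (\<omega> 0) (rw G (shift 1 \<omega>)))"
    using inv_alg_shift[OF F f inC_good[OF w]] rw_comp_Suc[OF w] by simp
  have "f (tr (inv (\<omega> 0)) (rw G \<omega>)) = f (tr (inv (\<omega> 0)) (rw G \<omega> \<circ> Suc))"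
    using inv_alg_shift[OF F inv_alg_tr[OF F _ f], of "inv (\<omega> 0)" "rw G \<omega>"] inC_good[OF w] c by simp
  then show "f (tr (inv (\<omega> 0)) (rw G \<omega>)) = f (rw G (shift 1 \<omega>))"
    using rw_comp_Suc[OF w] c by (simp add: tr_inv)
qed

lemma inv_alg_steps:
  fixes f :: "(nat \<Rightarrow> 'g) \<Rightarrow> ennreal"
  assumes F: "inv_alg F" and w: "inC \<omega>"
  shows "f \<in> borel_measurable F \<Longrightarrow> f (rw G \<omega>) = f (tr (rw G \<omega> n) (rw G (shift n \<omega>)))"
proof (induction n arbitrary: f)
  case 0
  have "shift 0 \<omega> = \<omega>" by (simp add: shift_def)
  then show ?case by (simp add: tr_one)
next
  case (Suc n)
  have ci: "rw G \<omega> n \<in> carrier G" "\<omega> n \<in> carrier G" using w by (auto simp: inC_def)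
  have sh: "shift 1 (shift n \<omega>) = shift (Suc n) \<omega>" "shift n \<omega> 0 = \<omega> n" by (simp_all add: shift_def)
  have "f (rw G \<omega>) = f (tr (rw G \<omega> n) (rw G (shift n \<omega>)))" by (rule Suc.IH[OF Suc.prems])
  also have "\<dots> = f (tr (rw G \<omega> n) (tr (shift n \<omega> 0) (rw G (shift 1 (shift n \<omega>)))))"
    by (rule inv_alg_step(1)[OF F inv_alg_tr[OF F ci(1) Suc.prems] inC_shift[OF w]])
  finally show ?case using ci unfolding sh by (simp add: tr_tr)
qed

text \<open>A version of the conditional law of the first increment given \<open>F\<close>,
  characterized by testing against \<open>F\<close>-measurable functions. The total mass is at most
  1 at every path, not merely almost surely, since translates of paths will be inserted.\<close>

definition kern :: "(nat \<Rightarrow> 'g) measure \<Rightarrow> ('g \<Rightarrow> (nat \<Rightarrow> 'g) \<Rightarrow> ennreal) \<Rightarrow> bool" where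
  "kern F p \<longleftrightarrow> (\<forall>g. p g \<in> borel_measurable F) \<and> (\<forall>g w. g \<notin> carrier G \<longrightarrow> p g w = 0) \<and>
     (\<forall>w. (\<integral>\<^sup>+g. p g w \<partial>count_space UNIV) \<le> 1) \<and>
     (\<forall>g. \<forall>f\<in>borel_measurable F. (\<integral>\<^sup>+\<omega>. (if \<omega> 0 = g then f (rw G \<omega>) else 0) \<partial>M)
        = (\<integral>\<^sup>+\<omega>. p g (rw G \<omega>) * f (rw G \<omega>) \<partial>M))"

lemma kernel_exists:
  assumes F: "inv_alg F"
  shows "\<exists>p. kern F p"
proof -
  let ?P = "path_measure G \<mu>"
  interpret P: prob_space ?P by (rule prob_space_path)
  have sub: "subalgebra ?P F"
    using F by (simp add: subalgebra_def inv_alg_def sets_path space_path)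
  interpret finite_measure_subalgebra ?P F by standard (rule sub)
  \<comment> \<open>The walk starts at the identity, so its position at time 1 is the first
    increment.\<close>
  define h where "h g = (indicator {w. w 1 = g} :: (nat \<Rightarrow> 'g) \<Rightarrow> ennreal)" for g
  have hN: "h g \<in> borel_measurable N" for g unfolding h_def by measurable
  have hP: "h g \<in> borel_measurable ?P" for g using hN by (simp add: measurable_cong_sets[OF sets_path refl])
  define pe where "pe g = nn_cond_exp ?P F (h g)" for g
  have pF: "pe g \<in> borel_measurable F" for g unfolding pe_def by simp
  have pP: "pe g \<in> borel_measurable ?P" for g unfolding pe_def by simp
  define S where "S w = (\<integral>\<^sup>+g. pe g w \<partial>count_space UNIV)" for w
  have SF: "S \<in> borel_measurable F" unfolding S_def by (rule borel_measurable_nn_integral_count[OF pF])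
  have fP: "f \<in> borel_measurable ?P" if "f \<in> borel_measurable F" for f :: "(nat \<Rightarrow> 'g) \<Rightarrow> ennreal"
    using that by (rule measurable_from_subalg[OF sub])
  have "(\<integral>\<^sup>+w\<in>A. 1 \<partial>?P) = (\<integral>\<^sup>+w\<in>A. S w \<partial>?P)" if A: "A \<in> sets F" for A
  proof -
    have iF: "(indicator A :: _ \<Rightarrow> ennreal) \<in> borel_measurable F" using A by simp
    have "(\<integral>\<^sup>+w\<in>A. S w \<partial>?P) = (\<integral>\<^sup>+w. (\<integral>\<^sup>+g. indicator A w * pe g w \<partial>count_space UNIV) \<partial>?P)"
      unfolding S_def by (intro nn_integral_cong) (simp add: nn_integral_cmult mult.commute)
    also have "\<dots> = (\<integral>\<^sup>+g. (\<integral>\<^sup>+w. indicator A w * pe g w \<partial>?P) \<partial>count_space UNIV)"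
      by (rule nn_integral_count_space_nn_integral) (simp, intro borel_measurable_times_ennreal fP[OF iF] pP)
    also have "\<dots> = (\<integral>\<^sup>+g. (\<integral>\<^sup>+w. indicator A w * h g w \<partial>?P) \<partial>count_space UNIV)"
      unfolding pe_def by (intro nn_integral_cong nn_cond_exp_intg iF hP)
    also have "\<dots> = (\<integral>\<^sup>+w. (\<integral>\<^sup>+g. indicator A w * h g w \<partial>count_space UNIV) \<partial>?P)"
      by (rule nn_integral_count_space_nn_integral[symmetric]) (simp, intro borel_measurable_times_ennreal fP[OF iF] hP)
    also have "\<dots> = (\<integral>\<^sup>+w\<in>A. 1 \<partial>?P)"
    proof (rule nn_integral_cong)
      fix w
      have "(\<integral>\<^sup>+g. h g w \<partial>count_space UNIV) = (\<integral>\<^sup>+g. indicator {w 1} g \<partial>count_space UNIV)"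
        by (intro nn_integral_cong) (simp add: h_def indicator_def)
      then show "(\<integral>\<^sup>+g. indicator A w * h g w \<partial>count_space UNIV) = 1 * indicator A w"
        by (simp add: nn_integral_cmult)
    qed
    finally show ?thesis by simp
  qed
  then have "AE w in ?P. S w = nn_cond_exp ?P F (\<lambda>_. 1) w" using SF by (intro nn_cond_exp_charact) auto
  moreover have "AE w in ?P. 1 = nn_cond_exp ?P F (\<lambda>_. 1) w" by (intro nn_cond_exp_charact) auto
  ultimately have S1: "AE w in ?P. S w = 1" by eventually_elim simp
  have S1M: "AE \<omega> in M. S (rw G \<omega>) = 1"
  proof -
    have [measurable]: "S \<in> borel_measurable N" by (rule inv_alg_N[OF F SF])
    have "{w \<in> space N. S w = 1} \<in> sets N" by measurable
    then show ?thesis using S1 unfolding path_measure_eq by (subst (asm) AE_distr_iff) auto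
  qed
  \<comment> \<open>Where the chosen versions have total mass above 1, a null event, they are
    replaced by 0 to make the bound hold everywhere.\<close>
  define p where "p g w = (if S w \<le> 1 \<and> g \<in> carrier G then pe g w else 0)" for g w
  have mp: "p g \<in> borel_measurable F" for g
    unfolding p_def using pF[of g] SF by (intro measurable_If) auto
  have "(\<integral>\<^sup>+g. p g w \<partial>count_space UNIV) \<le> 1" for w
  proof (cases "S w \<le> 1")
    case True
    have "(\<integral>\<^sup>+g. p g w \<partial>count_space UNIV) \<le> S w" unfolding S_def by (intro nn_integral_mono) (simp add: p_def)
    then show ?thesis using True by simp
  qed (simp add: p_def)
  moreover have "(\<integral>\<^sup>+\<omega>. (if \<omega> 0 = g then f (rw G \<omega>) else 0) \<partial>M) = (\<integral>\<^sup>+\<omega>. p g (rw G \<omega>) * f (rw G \<omega>) \<partial>M)"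
    if f: "f \<in> borel_measurable F" for g f
  proof (cases "g \<in> carrier G")
    case True
    have "(\<integral>\<^sup>+\<omega>. (if \<omega> 0 = g then f (rw G \<omega>) else 0) \<partial>M) = (\<integral>\<^sup>+\<omega>. f (rw G \<omega>) * h g (rw G \<omega>) \<partial>M)"
      by (rule nn_integral_cong_AE, use AE_inC in eventually_elim) (auto simp: h_def indicator_def inC_def)
    also have "\<dots> = (\<integral>\<^sup>+w. f w * h g w \<partial>?P)"
      by (rule nn_integral_path[symmetric]) (intro borel_measurable_times_ennreal inv_alg_N[OF F f] hN)
    also have "\<dots> = (\<integral>\<^sup>+w. f w * pe g w \<partial>?P)"
      unfolding pe_def by (rule nn_cond_exp_intg[symmetric, OF f hP])
    also have "\<dots> = (\<integral>\<^sup>+\<omega>. f (rw G \<omega>) * pe g (rw G \<omega>) \<partial>M)"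
      by (rule nn_integral_path) (intro borel_measurable_times_ennreal inv_alg_N[OF F f] inv_alg_N[OF F pF])
    also have "\<dots> = (\<integral>\<^sup>+\<omega>. p g (rw G \<omega>) * f (rw G \<omega>) \<partial>M)"
      by (rule nn_integral_cong_AE, use S1M in eventually_elim) (simp add: p_def True mult.commute)
    finally show ?thesis .
  next
    case False
    have "(\<integral>\<^sup>+\<omega>. (if \<omega> 0 = g then f (rw G \<omega>) else 0) \<partial>M) = (\<integral>\<^sup>+\<omega>. 0 \<partial>M)"
      by (rule nn_integral_cong_AE, use AE_inC in eventually_elim) (use False in \<open>auto simp: inC_def\<close>)
    then show ?thesis using False by (simp add: p_def)
  qed
  ultimately have "kern F p" unfolding kern_def using mp by (auto simp: p_def)
  then show ?thesis by blast
qed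

text \<open>A Doob transform: after the step \<open>a\<close> the rest is a fresh walk conditioned
  on the same invariant data as seen from \<open>a\<close>, hence the translation by
  \<open>inv a\<close>.\<close>

fun pn :: "('g \<Rightarrow> (nat \<Rightarrow> 'g) \<Rightarrow> ennreal) \<Rightarrow> 'g list \<Rightarrow> (nat \<Rightarrow> 'g) \<Rightarrow> ennreal" where
  "pn p [] w = 1"
| "pn p (a # \<gamma>) w = p a w * pn p \<gamma> (tr (inv a) w)"

lemma kern_le_1: "kern F p \<Longrightarrow> p g w \<le> 1"
proof -
  assume k: "kern F p"
  have "p g w = (\<integral>\<^sup>+h. p h w * indicator {g} h \<partial>count_space UNIV)" by simp
  also have "\<dots> \<le> (\<integral>\<^sup>+h. p h w \<partial>count_space UNIV)" by (intro nn_integral_mono) (simp add: indicator_def)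
  also have "\<dots> \<le> 1" using k by (simp add: kern_def)
  finally show ?thesis .
qed

lemma pn_le_1: "kern F p \<Longrightarrow> pn p \<gamma> w \<le> 1"
proof (induction \<gamma> arbitrary: w)
  case (Cons a \<gamma>)
  have "p a w * pn p \<gamma> (tr (inv a) w) \<le> 1 * 1" using Cons kern_le_1 by (intro mult_mono) auto
  then show ?case by simp
qed simp

lemma pn_measurable:
  assumes F: "inv_alg F" and k: "kern F p"
  shows "pn p \<gamma> \<in> borel_measurable F"
proof (induction \<gamma>)
  case Nil
  then show ?case by (simp add: fun_eq_iff[symmetric])
next
  case (Cons a \<gamma>)
  show ?case
  proof (cases "a \<in> carrier G")
    case True
    have "p a \<in> borel_measurable F" using k by (simp add: kern_def)
    moreover have "(\<lambda>w. pn p \<gamma> (tr (inv a) w)) \<in> borel_measurable F"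
      using True by (intro inv_alg_tr[OF F _ Cons]) simp
    ultimately have "(\<lambda>w. p a w * pn p \<gamma> (tr (inv a) w)) \<in> borel_measurable F" by simp
    moreover have "pn p (a # \<gamma>) = (\<lambda>w. p a w * pn p \<gamma> (tr (inv a) w))" by (simp add: fun_eq_iff)
    ultimately show ?thesis by simp
  next
    case False
    then have "pn p (a # \<gamma>) = (\<lambda>_. 0)" using k by (auto simp: kern_def fun_eq_iff)
    then show ?thesis by simp
  qed
qed

lemma pn_sum:
  assumes k: "kern F p"
  shows "(\<integral>\<^sup>+\<gamma>. pn p \<gamma> w \<partial>count_space {\<gamma>. length \<gamma> = n}) \<le> 1"
proof (induction n arbitrary: w)
  case 0
  have "{\<gamma>::'g list. length \<gamma> = 0} = {[]}" by auto
  then show ?case by (simp add: nn_integral_count_space_finite)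
next
  case (Suc n)
  have "(\<integral>\<^sup>+\<gamma>. pn p \<gamma> w \<partial>count_space {\<gamma>. length \<gamma> = Suc n})
     = (\<integral>\<^sup>+a. p a w * (\<integral>\<^sup>+\<gamma>. pn p \<gamma> (tr (inv a) w) \<partial>count_space {\<gamma>. length \<gamma> = n}) \<partial>count_space UNIV)"
    by (subst nn_integral_lists_Suc) (simp add: nn_integral_cmult)
  also have "\<dots> \<le> (\<integral>\<^sup>+a. p a w * 1 \<partial>count_space UNIV)"
    by (intro nn_integral_mono mult_left_mono Suc) simp
  also have "\<dots> \<le> 1" using k by (simp add: kern_def)
  finally show ?case .
qed

lemma prefix_Suc: "prefix (Suc n) \<omega> = \<omega> 0 # prefix n (shift 1 \<omega>)"
  by (simp add: prefix_def shift_def upt_conv_Cons map_Suc_upt[symmetric] comp_def del: upt_Suc)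

lemma measurable_prefix_eq: "f \<in> borel_measurable M \<Longrightarrow> (\<lambda>\<omega>. if prefix n \<omega> = \<gamma> then f \<omega> else (0::ennreal)) \<in> borel_measurable M"
  using measurable_sets[OF measurable_prefix, of "{\<gamma>}" n \<mu>] by (intro measurable_If) (auto simp: vimage_def)

text \<open>The product of the one-step conditional laws is the conditional law of the first increments:
  an invariant event seen from the second position is its translate.\<close>

lemma pn_conditional:
  assumes F: "inv_alg F" and k: "kern F p"
  shows "f \<in> borel_measurable F \<Longrightarrow> (\<integral>\<^sup>+\<omega>. (if prefix (length \<gamma>) \<omega> = \<gamma> then f (rw G \<omega>) else 0) \<partial>M)
     = (\<integral>\<^sup>+\<omega>. pn p \<gamma> (rw G \<omega>) * f (rw G \<omega>) \<partial>M)"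
proof (induction \<gamma> arbitrary: f)
  case Nil
  then show ?case by (simp add: prefix_def)
next
  case (Cons a \<gamma>)
  note fF = Cons.prems
  show ?case
  proof (cases "a \<in> carrier G")
    case False
    have "(\<integral>\<^sup>+\<omega>. (if prefix (length (a # \<gamma>)) \<omega> = a # \<gamma> then f (rw G \<omega>) else 0) \<partial>M) = (\<integral>\<^sup>+\<omega>. 0 \<partial>M)"
      by (rule nn_integral_cong_AE, use AE_inC in eventually_elim) (use False in \<open>auto simp: inC_def prefix_Suc\<close>)
    then show ?thesis using False k by (simp add: kern_def)
  next
    case a: True
    have ia: "inv a \<in> carrier G" using a by simp
    have gF: "(\<lambda>w. f (tr a w)) \<in> borel_measurable F" by (rule inv_alg_tr[OF F a fF])
    have pF: "pn p \<gamma> \<in> borel_measurable F" by (rule pn_measurable[OF F k])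
    have hF: "(\<lambda>w. pn p \<gamma> (tr (inv a) w) * f w) \<in> borel_measurable F"
      using inv_alg_tr[OF F ia pF] fF by simp
    have mk: "(\<integral>\<^sup>+\<omega>. (if \<omega> 0 = a then H (shift 1 \<omega>) else 0) \<partial>M) = (\<integral>\<^sup>+\<omega>. (if \<omega> 0 = a then (\<integral>\<^sup>+\<omega>'. H \<omega>' \<partial>M) else 0) \<partial>M)"
      if "H \<in> borel_measurable M" for H
    proof -
      have "(\<integral>\<^sup>+\<omega>. (if \<omega> 0 = a then H (shift 1 \<omega>) else 0) \<partial>M) = (\<integral>\<^sup>+\<omega>. \<integral>\<^sup>+\<omega>'. (if \<omega> 0 = a then H \<omega>' else 0) \<partial>M \<partial>M)"
        by (rule markov[where X = "\<lambda>\<omega>. \<omega> 0" and F = "\<lambda>x \<omega>'. if x = a then H \<omega>' else 0"]) (use that in auto)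
      also have "\<dots> = (\<integral>\<^sup>+\<omega>. (if \<omega> 0 = a then (\<integral>\<^sup>+\<omega>'. H \<omega>' \<partial>M) else 0) \<partial>M)"
        by (intro nn_integral_cong) simp
      finally show ?thesis .
    qed
    have "(\<integral>\<^sup>+\<omega>. (if prefix (length (a # \<gamma>)) \<omega> = a # \<gamma> then f (rw G \<omega>) else 0) \<partial>M)
       = (\<integral>\<^sup>+\<omega>. (if \<omega> 0 = a then (if prefix (length \<gamma>) (shift 1 \<omega>) = \<gamma> then f (tr a (rw G (shift 1 \<omega>))) else 0) else 0) \<partial>M)"
      by (rule nn_integral_cong_AE, use AE_inC in eventually_elim) (use inv_alg_step(1)[OF F fF] in \<open>auto simp: prefix_Suc\<close>)
    also have "\<dots> = (\<integral>\<^sup>+\<omega>. (if \<omega> 0 = a then (\<integral>\<^sup>+\<omega>'. (if prefix (length \<gamma>) \<omega>' = \<gamma> then f (tr a (rw G \<omega>')) else 0) \<partial>M) else 0) \<partial>M)"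
      by (rule mk[of "\<lambda>\<omega>'. if prefix (length \<gamma>) \<omega>' = \<gamma> then f (tr a (rw G \<omega>')) else 0"])
         (intro measurable_prefix_eq inv_alg_rw[OF F gF])
    also have "\<dots> = (\<integral>\<^sup>+\<omega>. (if \<omega> 0 = a then (\<integral>\<^sup>+\<omega>'. pn p \<gamma> (rw G \<omega>') * f (tr a (rw G \<omega>')) \<partial>M) else 0) \<partial>M)"
      by (simp only: Cons.IH[OF gF])
    \<comment> \<open>The independence is now undone: on the event of first step \<open>a\<close>
      the fresh path becomes the shifted original one, and \<open>inv_alg_step\<close> turns the
      integrand into an \<open>F\<close>-measurable function of the original path, to which
      \<open>kern\<close> applies.\<close>
    also have "\<dots> = (\<integral>\<^sup>+\<omega>. (if \<omega> 0 = a then pn p \<gamma> (rw G (shift 1 \<omega>)) * f (tr a (rw G (shift 1 \<omega>))) else 0) \<partial>M)"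
      by (rule mk[symmetric, of "\<lambda>\<omega>'. pn p \<gamma> (rw G \<omega>') * f (tr a (rw G \<omega>'))"])
         (intro borel_measurable_times_ennreal inv_alg_rw[OF F gF] inv_alg_rw[OF F pF])
    also have "\<dots> = (\<integral>\<^sup>+\<omega>. (if \<omega> 0 = a then pn p \<gamma> (tr (inv a) (rw G \<omega>)) * f (rw G \<omega>) else 0) \<partial>M)"
      by (rule nn_integral_cong_AE, use AE_inC in eventually_elim)
         (use inv_alg_step(1)[OF F fF] inv_alg_step(2)[OF F pF] in auto)
    also have "\<dots> = (\<integral>\<^sup>+\<omega>. p a (rw G \<omega>) * (pn p \<gamma> (tr (inv a) (rw G \<omega>)) * f (rw G \<omega>)) \<partial>M)"
      using k hF unfolding kern_def by auto
    finally show ?thesis by (simp add: mult.assoc)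
  qed
qed

lemma measurable_prefix_app:
  "(\<And>\<gamma>. f \<gamma> \<in> borel_measurable M) \<Longrightarrow> (\<lambda>\<omega>. f (prefix n \<omega>) \<omega> :: ennreal) \<in> borel_measurable M"
  by (rule measurable_compose_countable[where f = f and g = "prefix n"]) auto

lemma kern_rw_measurable: "inv_alg F \<Longrightarrow> kern F p \<Longrightarrow> (\<lambda>\<omega>. p g (rw G \<omega>)) \<in> borel_measurable M"
  by (rule inv_alg_rw) (auto simp: kern_def)

text \<open>\<open>info\<close> turns the product into a sum, and by \<open>inv_alg_step\<close> the
  factor after the first step is the same functional of the shifted increments, which have the same
  law.\<close>

lemma info_pn:
  assumes F: "inv_alg F" and k: "kern F p"
  shows "(\<integral>\<^sup>+\<omega>. info (pn p (prefix n \<omega>) (rw G \<omega>)) \<partial>M) = of_nat n * (\<integral>\<^sup>+\<omega>. info (p (\<omega> 0) (rw G \<omega>)) \<partial>M)"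
proof (induction n)
  case 0
  show ?case by (simp add: prefix_def info_def)
next
  case (Suc n)
  have m1: "(\<lambda>\<omega>. info (p (\<omega> 0) (rw G \<omega>))) \<in> borel_measurable M"
    by (rule measurable_compose_countable[where f = "\<lambda>g \<omega>. info (p g (rw G \<omega>))" and g = "\<lambda>\<omega>. \<omega> 0"])
       (auto intro: measurable_compose[OF kern_rw_measurable[OF F k] measurable_info])
  have m2: "(\<lambda>\<omega>. info (pn p (prefix n \<omega>) (rw G \<omega>))) \<in> borel_measurable M"
    by (rule measurable_prefix_app[where f = "\<lambda>\<gamma> \<omega>. info (pn p \<gamma> (rw G \<omega>))"])
       (rule measurable_compose[OF inv_alg_rw[OF F pn_measurable[OF F k]] measurable_info])
  have "(\<integral>\<^sup>+\<omega>. info (pn p (prefix (Suc n) \<omega>) (rw G \<omega>)) \<partial>M)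
     = (\<integral>\<^sup>+\<omega>. info (p (\<omega> 0) (rw G \<omega>)) + info (pn p (prefix n (shift 1 \<omega>)) (rw G (shift 1 \<omega>))) \<partial>M)"
  proof (rule nn_integral_cong_AE, use AE_inC in eventually_elim)
    fix \<omega> assume w: "inC \<omega>"
    show "info (pn p (prefix (Suc n) \<omega>) (rw G \<omega>)) = info (p (\<omega> 0) (rw G \<omega>)) + info (pn p (prefix n (shift 1 \<omega>)) (rw G (shift 1 \<omega>)))"
      using inv_alg_step(2)[OF F pn_measurable[OF F k] w, of "prefix n (shift 1 \<omega>)"]
      by (simp add: prefix_Suc info_mult[OF kern_le_1[OF k] pn_le_1[OF k]])
  qed
  also have "\<dots> = (\<integral>\<^sup>+\<omega>. info (p (\<omega> 0) (rw G \<omega>)) \<partial>M) + (\<integral>\<^sup>+\<omega>. info (pn p (prefix n (shift 1 \<omega>)) (rw G (shift 1 \<omega>))) \<partial>M)"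
    by (rule nn_integral_add[OF m1 measurable_compose[OF measurable_shift m2]])
  also have "(\<integral>\<^sup>+\<omega>. info (pn p (prefix n (shift 1 \<omega>)) (rw G (shift 1 \<omega>))) \<partial>M) = (\<integral>\<^sup>+\<omega>. info (pn p (prefix n \<omega>) (rw G \<omega>)) \<partial>M)"
    by (subst (2) distr_shift[of \<mu> 1, symmetric]) (rule nn_integral_distr[symmetric, OF measurable_shift], simp add: m2)
  finally show ?case using Suc by (simp add: algebra_simps)
qed

text \<open>The least mean length of a code for the first \<open>n\<close> increments given
  \<open>F\<close> is that of their conditional law, which is the only optimal code if that length
  is finite. This bounds entropies from above by exhibiting codes and recognizes when two
  conditional laws agree.\<close>

lemma kernel_gibbs:
  assumes F: "inv_alg F" and k: "kern F p"
    and r: "\<And>\<gamma>. r \<gamma> \<in> borel_measurable F" "\<And>\<gamma> w. r \<gamma> w \<le> 1"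
      "\<And>w. (\<integral>\<^sup>+\<gamma>. r \<gamma> w \<partial>count_space {\<gamma>. length \<gamma> = n}) \<le> 1"
  shows "(\<integral>\<^sup>+\<omega>. info (pn p (prefix n \<omega>) (rw G \<omega>)) \<partial>M) \<le> (\<integral>\<^sup>+\<omega>. info (r (prefix n \<omega>) (rw G \<omega>)) \<partial>M)"
    and "(\<integral>\<^sup>+\<omega>. info (r (prefix n \<omega>) (rw G \<omega>)) \<partial>M) \<le> (\<integral>\<^sup>+\<omega>. info (pn p (prefix n \<omega>) (rw G \<omega>)) \<partial>M) \<Longrightarrow>
      (\<integral>\<^sup>+\<omega>. info (pn p (prefix n \<omega>) (rw G \<omega>)) \<partial>M) < top_class.top \<Longrightarrow>
      AE \<omega> in M. pn p (prefix n \<omega>) (rw G \<omega>) = r (prefix n \<omega>) (rw G \<omega>)"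
proof -
  interpret P: prob_space M by (rule prob_space_M)
  have pF: "pn p \<gamma> \<in> borel_measurable F" for \<gamma> by (rule pn_measurable[OF F k])
  have mp: "(\<lambda>\<omega>. pn p (prefix n \<omega>) (rw G \<omega>)) \<in> borel_measurable M"
    by (rule measurable_prefix_app[where f = "\<lambda>\<gamma> \<omega>. pn p \<gamma> (rw G \<omega>)"]) (rule inv_alg_rw[OF F pF])
  have mr: "(\<lambda>\<omega>. r (prefix n \<omega>) (rw G \<omega>)) \<in> borel_measurable M"
    by (rule measurable_prefix_app[where f = "\<lambda>\<gamma> \<omega>. r \<gamma> (rw G \<omega>)"]) (rule inv_alg_rw[OF F r(1)])
  have cond: "(\<integral>\<^sup>+\<omega>. f (prefix n \<omega>) (rw G \<omega>) \<partial>M)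
      = (\<integral>\<^sup>+\<gamma>. (\<integral>\<^sup>+\<omega>. pn p \<gamma> (rw G \<omega>) * f \<gamma> (rw G \<omega>) \<partial>M) \<partial>count_space {\<gamma>. length \<gamma> = n})"
    if f: "\<And>\<gamma>. f \<gamma> \<in> borel_measurable F" for f :: "'g list \<Rightarrow> (nat \<Rightarrow> 'g) \<Rightarrow> ennreal"
  proof -
    have "(\<integral>\<^sup>+\<omega>. f (prefix n \<omega>) (rw G \<omega>) \<partial>M)
       = (\<integral>\<^sup>+\<gamma>. (\<integral>\<^sup>+\<omega>. (if prefix n \<omega> = \<gamma> then f \<gamma> (rw G \<omega>) else 0) \<partial>M) \<partial>count_space {\<gamma>. length \<gamma> = n})"
      by (rule nn_integral_prefix[where f = "\<lambda>\<gamma> \<omega>. f \<gamma> (rw G \<omega>)"]) (rule inv_alg_rw[OF F f])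
    also have "\<dots> = (\<integral>\<^sup>+\<gamma>. (\<integral>\<^sup>+\<omega>. pn p \<gamma> (rw G \<omega>) * f \<gamma> (rw G \<omega>) \<partial>M) \<partial>count_space {\<gamma>. length \<gamma> = n})"
      by (rule nn_integral_cong) (use pn_conditional[OF F k f] in auto)
    finally show ?thesis .
  qed
  \<comment> \<open>The word actually followed has conditional probability 0 only on a null event,
    so \<open>pn\<close> can be divided by.\<close>
  have "(\<integral>\<^sup>+\<omega>. (if pn p (prefix n \<omega>) (rw G \<omega>) = 0 then 1 else 0) \<partial>M)
     = (\<integral>\<^sup>+\<gamma>. (\<integral>\<^sup>+\<omega>. pn p \<gamma> (rw G \<omega>) * (if pn p \<gamma> (rw G \<omega>) = 0 then 1 else 0) \<partial>M) \<partial>count_space {\<gamma>. length \<gamma> = n})"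
    by (rule cond[of "\<lambda>\<gamma> w. if pn p \<gamma> w = 0 then 1 else 0"])
       (use pF in \<open>intro measurable_If; simp\<close>)
  also have "\<dots> = (\<integral>\<^sup>+\<gamma>. 0 \<partial>count_space {\<gamma>::'g list. length \<gamma> = n})"
  proof (rule nn_integral_cong)
    fix \<gamma>
    have "pn p \<gamma> (rw G \<omega>) * (if pn p \<gamma> (rw G \<omega>) = 0 then 1 else 0) = 0" for \<omega> by simp
    then show "(\<integral>\<^sup>+\<omega>. pn p \<gamma> (rw G \<omega>) * (if pn p \<gamma> (rw G \<omega>) = 0 then 1 else 0) \<partial>M) = 0"
      by (simp only:) simp
  qed
  finally have "(\<integral>\<^sup>+\<omega>. (if pn p (prefix n \<omega>) (rw G \<omega>) = 0 then 1 else 0) \<partial>M) = 0" by simp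
  then have pos: "AE \<omega> in M. pn p (prefix n \<omega>) (rw G \<omega>) \<noteq> 0"
    using mp by (subst (asm) nn_integral_0_iff_AE) (auto simp del: One_nat_def split: if_splits)
  have "(\<integral>\<^sup>+\<omega>. r (prefix n \<omega>) (rw G \<omega>) / pn p (prefix n \<omega>) (rw G \<omega>) \<partial>M)
     = (\<integral>\<^sup>+\<gamma>. (\<integral>\<^sup>+\<omega>. pn p \<gamma> (rw G \<omega>) * (r \<gamma> (rw G \<omega>) / pn p \<gamma> (rw G \<omega>)) \<partial>M) \<partial>count_space {\<gamma>. length \<gamma> = n})"
    by (rule cond[of "\<lambda>\<gamma> w. r \<gamma> w / pn p \<gamma> w"]) (intro borel_measurable_divide_ennreal r(1) pF)
  also have "\<dots> \<le> (\<integral>\<^sup>+\<gamma>. (\<integral>\<^sup>+\<omega>. r \<gamma> (rw G \<omega>) \<partial>M) \<partial>count_space {\<gamma>. length \<gamma> = n})"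
  proof (intro nn_integral_mono)
    fix \<gamma> \<omega>
    have "pn p \<gamma> (rw G \<omega>) < top_class.top" using pn_le_1[OF k] ennreal_one_less_top order_le_less_trans by blast
    then show "pn p \<gamma> (rw G \<omega>) * (r \<gamma> (rw G \<omega>) / pn p \<gamma> (rw G \<omega>)) \<le> r \<gamma> (rw G \<omega>)"
      by (cases "pn p \<gamma> (rw G \<omega>) = 0")
         (auto simp: ennreal_times_divide mult.commute[of "pn p \<gamma> (rw G \<omega>)"] ennreal_mult_divide_eq)
  qed
  also have "\<dots> = (\<integral>\<^sup>+\<omega>. (\<integral>\<^sup>+\<gamma>. r \<gamma> (rw G \<omega>) \<partial>count_space {\<gamma>. length \<gamma> = n}) \<partial>M)"
    by (rule nn_integral_count_space_nn_integral[symmetric]) (simp, rule inv_alg_rw[OF F r(1)])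
  also have "\<dots> \<le> (\<integral>\<^sup>+\<omega>. 1 \<partial>M)" by (intro nn_integral_mono r(3))
  finally have ratio: "(\<integral>\<^sup>+\<omega>. r (prefix n \<omega>) (rw G \<omega>) / pn p (prefix n \<omega>) (rw G \<omega>) \<partial>M) \<le> 1"
    using P.emeasure_space_1 by simp
  show "(\<integral>\<^sup>+\<omega>. info (pn p (prefix n \<omega>) (rw G \<omega>)) \<partial>M) \<le> (\<integral>\<^sup>+\<omega>. info (r (prefix n \<omega>) (rw G \<omega>)) \<partial>M)"
    by (rule P.gibbs(1)[OF mp mr pos pn_le_1[OF k] r(2) ratio])
  show "AE \<omega> in M. pn p (prefix n \<omega>) (rw G \<omega>) = r (prefix n \<omega>) (rw G \<omega>)"
    if "(\<integral>\<^sup>+\<omega>. info (r (prefix n \<omega>) (rw G \<omega>)) \<partial>M) \<le> (\<integral>\<^sup>+\<omega>. info (pn p (prefix n \<omega>) (rw G \<omega>)) \<partial>M)"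
      "(\<integral>\<^sup>+\<omega>. info (pn p (prefix n \<omega>) (rw G \<omega>)) \<partial>M) < top_class.top"
    by (rule P.gibbs(2)[OF mp mr pos pn_le_1[OF k] r(2) ratio that])
qed

section \<open>The law of the increments given the end point\<close>

definition lp :: "'g list \<Rightarrow> 'g" where "lp \<gamma> = foldr (\<lambda>g h. g \<otimes> h) \<gamma> \<one>"

lemma lp_prefix: "inC \<omega> \<Longrightarrow> lp (prefix n \<omega>) = rw G \<omega> n"
proof (induction n arbitrary: \<omega>)
  case 0
  then show ?case by (simp add: prefix_def lp_def)
next
  case (Suc n)
  have "lp (prefix (Suc n) \<omega>) = \<omega> 0 \<otimes> lp (prefix n (shift 1 \<omega>))" by (simp only: prefix_Suc lp_def foldr.simps comp_apply)
  also have "\<dots> = \<omega> 0 \<otimes> rw G (shift 1 \<omega>) n" by (simp only: Suc.IH[OF inC_shift[OF Suc.prems]])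
  also have "\<dots> = rw G \<omega> (Suc n)" by (simp only: rw_Suc_shift[OF Suc.prems])
  finally show ?case .
qed

lemma sets_prefix: "{\<omega>. prefix n \<omega> = \<gamma>} \<in> sets M"
  using measurable_sets[OF measurable_prefix, of "{\<gamma>}" n \<mu>] by (simp add: vimage_def)

text \<open>The conditional law of the first \<open>n\<close> increments given the position at time
  \<open>n\<close>. Where the denominator vanishes so does the numerator, and the quotient is
  0.\<close>

definition kap :: "nat \<Rightarrow> 'g list \<Rightarrow> ennreal" where
  "kap n \<gamma> = emeasure M {\<omega>. prefix n \<omega> = \<gamma>} / emeasure (measure_pmf (W n)) {lp \<gamma>}"

lemma prefix_mass_sum:
  "(\<integral>\<^sup>+\<gamma>. emeasure M {\<omega>. prefix n \<omega> = \<gamma>} * indicator {\<gamma>. lp \<gamma> = x} \<gamma> \<partial>count_space {\<gamma>. length \<gamma> = n})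
     = emeasure (measure_pmf (W n)) {x}"
proof -
  have ind: "(\<lambda>\<omega>. indicator {\<gamma>. lp \<gamma> = x} \<gamma> :: ennreal) \<in> borel_measurable M" for \<gamma> by simp
  have "emeasure (measure_pmf (W n)) {x} = (\<integral>\<^sup>+\<omega>. indicator {x} (rw G \<omega> n) \<partial>M)"
    by (simp add: nn_integral_rw)
  also have "\<dots> = (\<integral>\<^sup>+\<omega>. indicator {\<gamma>. lp \<gamma> = x} (prefix n \<omega>) \<partial>M)"
    by (rule nn_integral_cong_AE, use AE_inC in eventually_elim) (auto simp: lp_prefix indicator_def)
  also have "\<dots> = (\<integral>\<^sup>+\<gamma>. (\<integral>\<^sup>+\<omega>. (if prefix n \<omega> = \<gamma> then indicator {\<gamma>. lp \<gamma> = x} \<gamma> else 0) \<partial>M) \<partial>count_space {\<gamma>. length \<gamma> = n})"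
    by (rule nn_integral_prefix[where f = "\<lambda>\<gamma> \<omega>. indicator {\<gamma>. lp \<gamma> = x} \<gamma>"]) simp
  also have "\<dots> = (\<integral>\<^sup>+\<gamma>. emeasure M {\<omega>. prefix n \<omega> = \<gamma>} * indicator {\<gamma>. lp \<gamma> = x} \<gamma> \<partial>count_space {\<gamma>. length \<gamma> = n})"
  proof (rule nn_integral_cong)
    fix \<gamma>
    have "(\<integral>\<^sup>+\<omega>. (if prefix n \<omega> = \<gamma> then indicator {\<gamma>. lp \<gamma> = x} \<gamma> else 0) \<partial>M)
       = (\<integral>\<^sup>+\<omega>. indicator {\<gamma>. lp \<gamma> = x} \<gamma> * indicator {\<omega>. prefix n \<omega> = \<gamma>} \<omega> \<partial>M)"
      by (intro nn_integral_cong) (simp add: indicator_def)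
    also have "\<dots> = indicator {\<gamma>. lp \<gamma> = x} \<gamma> * emeasure M {\<omega>. prefix n \<omega> = \<gamma>}"
      by (rule nn_integral_cmult_indicator[OF sets_prefix])
    finally show "(\<integral>\<^sup>+\<omega>. (if prefix n \<omega> = \<gamma> then indicator {\<gamma>. lp \<gamma> = x} \<gamma> else 0) \<partial>M)
       = emeasure M {\<omega>. prefix n \<omega> = \<gamma>} * indicator {\<gamma>. lp \<gamma> = x} \<gamma>" by (simp only: mult.commute)
  qed
  finally show ?thesis by simp
qed

lemma prefix_mass_le: 
  assumes "length \<gamma> = n"
  shows "emeasure M {\<omega>. prefix n \<omega> = \<gamma>} \<le> emeasure (measure_pmf (W n)) {lp \<gamma>}"
proof -
  have "emeasure M {\<omega>. prefix n \<omega> = \<gamma>} = (\<integral>\<^sup>+\<gamma>'. emeasure M {\<omega>. prefix n \<omega> = \<gamma>} * indicator {\<gamma>} \<gamma>' \<partial>count_space {\<gamma>. length \<gamma> = n})"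
    using assms by (subst nn_integral_cmult_indicator) auto
  also have "\<dots> \<le> (\<integral>\<^sup>+\<gamma>'. emeasure M {\<omega>. prefix n \<omega> = \<gamma>'} * indicator {\<gamma>'. lp \<gamma>' = lp \<gamma>} \<gamma>' \<partial>count_space {\<gamma>. length \<gamma> = n})"
    by (intro nn_integral_mono) (auto simp: indicator_def)
  also have "\<dots> = emeasure (measure_pmf (W n)) {lp \<gamma>}" by (rule prefix_mass_sum)
  finally show ?thesis .
qed

lemma W_mass_finite: "emeasure (measure_pmf (W n)) {x} \<noteq> top_class.top"
  using measure_pmf.emeasure_le_1[of "W n" "{x}"] by (auto simp: top_unique)

lemma prefix_mass_length: "length \<gamma> \<noteq> n \<Longrightarrow> emeasure M {\<omega>. prefix n \<omega> = \<gamma>} = 0"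
proof -
  assume "length \<gamma> \<noteq> n"
  then have "{\<omega>. prefix n \<omega> = \<gamma>} = {}" by (auto simp: prefix_def)
  then show ?thesis by simp
qed

lemma W_mass_divide_self: "emeasure (measure_pmf (W n)) {x} / emeasure (measure_pmf (W n)) {x} \<le> 1"
proof (cases "emeasure (measure_pmf (W n)) {x} = 0")
  case False
  then have "emeasure (measure_pmf (W n)) {x} / emeasure (measure_pmf (W n)) {x} = 1"
    by (intro ennreal_divide_self) (simp_all add: measure_pmf.emeasure_eq_measure)
  then show ?thesis by (simp only: order_refl)
qed simp

lemma kap_le_1: "kap n \<gamma> \<le> 1"
proof (cases "length \<gamma> = n")
  case True
  have "kap n \<gamma> \<le> emeasure (measure_pmf (W n)) {lp \<gamma>} / emeasure (measure_pmf (W n)) {lp \<gamma>}"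
    unfolding kap_def by (rule divide_right_mono_ennreal[OF prefix_mass_le[OF True]])
  then show ?thesis using W_mass_divide_self order_trans by blast
qed (simp add: kap_def prefix_mass_length)

lemma kap_sum:
  "(\<integral>\<^sup>+\<gamma>. kap n \<gamma> * indicator {\<gamma>. lp \<gamma> = x} \<gamma> \<partial>count_space {\<gamma>. length \<gamma> = n}) \<le> 1"
proof -
  let ?m = "emeasure (measure_pmf (W n)) {x}"
  have "(\<integral>\<^sup>+\<gamma>. kap n \<gamma> * indicator {\<gamma>. lp \<gamma> = x} \<gamma> \<partial>count_space {\<gamma>. length \<gamma> = n})
     = (\<integral>\<^sup>+\<gamma>. (emeasure M {\<omega>. prefix n \<omega> = \<gamma>} * indicator {\<gamma>. lp \<gamma> = x} \<gamma>) / ?m \<partial>count_space {\<gamma>. length \<gamma> = n})"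
    by (intro nn_integral_cong) (auto simp: kap_def indicator_def)
  also have "\<dots> = ?m / ?m" by (simp add: nn_integral_divide prefix_mass_sum)
  also have "\<dots> \<le> 1" by (rule W_mass_divide_self)
  finally show ?thesis .
qed

lemma kap_pos: "AE \<omega> in M. kap n (prefix n \<omega>) \<noteq> 0"
proof -
  have "AE \<omega> in M. emeasure M {\<omega>'. prefix n \<omega>' = prefix n \<omega>} \<noteq> 0"
  proof -
    have "(\<Union>\<gamma>\<in>{\<gamma>. emeasure M {\<omega>'. prefix n \<omega>' = \<gamma>} = 0}. {\<omega>'. prefix n \<omega>' = \<gamma>}) \<in> null_sets M"
      by (rule null_sets_UN') (auto simp: null_sets_def sets_prefix)
    then have "AE \<omega> in M. \<omega> \<notin> (\<Union>\<gamma>\<in>{\<gamma>. emeasure M {\<omega>'. prefix n \<omega>' = \<gamma>} = 0}. {\<omega>'. prefix n \<omega>' = \<gamma>})"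
      by (rule AE_not_in)
    then show ?thesis by eventually_elim auto
  qed
  then show ?thesis
    by eventually_elim (auto simp: kap_def W_mass_finite ennreal_divide_eq_0_iff)
qed

text \<open>Given the position at time \<open>n\<close>, the future is irrelevant for the first \<open>n\<close> increments, so
  the entropy of the conditional laws given the invariant events is at least that of \<open>kap\<close>.\<close>

lemma kap_gibbs:
  assumes F: "inv_alg F" and k: "kern F q"
  shows "(\<integral>\<^sup>+\<omega>. info (kap n (prefix n \<omega>)) \<partial>M) \<le> (\<integral>\<^sup>+\<omega>. info (pn q (prefix n \<omega>) (rw G \<omega>)) \<partial>M)"
proof -
  interpret P: prob_space M by (rule prob_space_M)
  have qF: "pn q \<gamma> \<in> borel_measurable F" for \<gamma> by (rule pn_measurable[OF F k])
  have mq: "(\<lambda>\<omega>. pn q (prefix n \<omega>) (rw G \<omega>)) \<in> borel_measurable M"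
    by (rule measurable_prefix_app[where f = "\<lambda>\<gamma> \<omega>. pn q \<gamma> (rw G \<omega>)"]) (rule inv_alg_rw[OF F qF])
  have mk: "(\<lambda>\<omega>. kap n (prefix n \<omega>)) \<in> borel_measurable M"
    by (rule measurable_prefix_app[where f = "\<lambda>\<gamma> \<omega>. kap n \<gamma>"]) simp
  \<comment> \<open>The conditional probability of \<open>\<gamma>\<close> as a function of the path
    driven by the increments after time \<open>n\<close>, which is independent of the first
    \<open>n\<close> increments.\<close>
  define T where "T \<gamma> w = (if lp \<gamma> \<in> carrier G then pn q \<gamma> (tr (lp \<gamma>) w) else 0)" for \<gamma> w
  have TF: "T \<gamma> \<in> borel_measurable F" for \<gamma>
    using inv_alg_tr[OF F _ qF] by (cases "lp \<gamma> \<in> carrier G") (simp_all add: T_def[abs_def])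
  have Tm: "(\<lambda>\<omega>. T \<gamma> (rw G \<omega>)) \<in> borel_measurable M" for \<gamma> by (rule inv_alg_rw[OF F TF])
  have "(\<integral>\<^sup>+\<omega>. pn q (prefix n \<omega>) (rw G \<omega>) / kap n (prefix n \<omega>) \<partial>M)
     = (\<integral>\<^sup>+\<omega>. T (prefix n \<omega>) (rw G (shift n \<omega>)) / kap n (prefix n \<omega>) \<partial>M)"
    by (rule nn_integral_cong_AE, use AE_inC in eventually_elim)
       (use inv_alg_steps[OF F _ qF] in \<open>auto simp: T_def lp_prefix\<close>)
  also have "\<dots> = (\<integral>\<^sup>+\<omega>. \<integral>\<^sup>+\<omega>'. T (prefix n \<omega>) (rw G \<omega>') / kap n (prefix n \<omega>) \<partial>M \<partial>M)"
    by (rule markov[where X = "prefix n" and F = "\<lambda>\<gamma> \<omega>'. T \<gamma> (rw G \<omega>') / kap n \<gamma>"])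
       (auto simp: prefix_eq_iff intro!: borel_measurable_divide_ennreal Tm)
  also have "\<dots> = (\<integral>\<^sup>+\<gamma>. (\<integral>\<^sup>+\<omega>. (if prefix n \<omega> = \<gamma> then (\<integral>\<^sup>+\<omega>'. T \<gamma> (rw G \<omega>') / kap n \<gamma> \<partial>M) else 0) \<partial>M) \<partial>count_space {\<gamma>. length \<gamma> = n})"
    by (rule nn_integral_prefix[where f = "\<lambda>\<gamma> \<omega>. \<integral>\<^sup>+\<omega>'. T \<gamma> (rw G \<omega>') / kap n \<gamma> \<partial>M"]) simp
  also have "\<dots> = (\<integral>\<^sup>+\<gamma>. (\<integral>\<^sup>+\<omega>'. emeasure M {\<omega>. prefix n \<omega> = \<gamma>} * (T \<gamma> (rw G \<omega>') / kap n \<gamma>) \<partial>M) \<partial>count_space {\<gamma>. length \<gamma> = n})"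
  proof (rule nn_integral_cong)
    fix \<gamma>
    have "(\<integral>\<^sup>+\<omega>. (if prefix n \<omega> = \<gamma> then (\<integral>\<^sup>+\<omega>'. T \<gamma> (rw G \<omega>') / kap n \<gamma> \<partial>M) else 0) \<partial>M)
       = (\<integral>\<^sup>+\<omega>. (\<integral>\<^sup>+\<omega>'. T \<gamma> (rw G \<omega>') / kap n \<gamma> \<partial>M) * indicator {\<omega>. prefix n \<omega> = \<gamma>} \<omega> \<partial>M)"
      by (intro nn_integral_cong) (simp add: indicator_def)
    also have "\<dots> = (\<integral>\<^sup>+\<omega>'. T \<gamma> (rw G \<omega>') / kap n \<gamma> \<partial>M) * emeasure M {\<omega>. prefix n \<omega> = \<gamma>}"
      by (rule nn_integral_cmult_indicator) (rule sets_prefix)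
    also have "\<dots> = (\<integral>\<^sup>+\<omega>'. emeasure M {\<omega>. prefix n \<omega> = \<gamma>} * (T \<gamma> (rw G \<omega>') / kap n \<gamma>) \<partial>M)"
      by (subst nn_integral_cmult) (auto simp: mult.commute intro!: borel_measurable_divide_ennreal Tm)
    finally show "(\<integral>\<^sup>+\<omega>. (if prefix n \<omega> = \<gamma> then (\<integral>\<^sup>+\<omega>'. T \<gamma> (rw G \<omega>') / kap n \<gamma> \<partial>M) else 0) \<partial>M)
       = (\<integral>\<^sup>+\<omega>'. emeasure M {\<omega>. prefix n \<omega> = \<gamma>} * (T \<gamma> (rw G \<omega>') / kap n \<gamma>) \<partial>M)" .
  qed
  also have "\<dots> \<le> (\<integral>\<^sup>+\<gamma>. (\<integral>\<^sup>+\<omega>'. emeasure (measure_pmf (W n)) {lp \<gamma>} * T \<gamma> (rw G \<omega>') \<partial>M) \<partial>count_space {\<gamma>. length \<gamma> = n})"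
  proof (intro nn_integral_mono)
    fix \<gamma> :: "'g list" and \<omega>' assume "\<gamma> \<in> space (count_space {\<gamma>. length \<gamma> = n})"
    then have len: "length \<gamma> = n" by simp
    let ?a = "emeasure M {\<omega>. prefix n \<omega> = \<gamma>}" and ?b = "emeasure (measure_pmf (W n)) {lp \<gamma>}" and ?t = "T \<gamma> (rw G \<omega>')"
    have fin: "?a \<noteq> top_class.top" "?b \<noteq> top_class.top" using P.emeasure_finite W_mass_finite by auto
    show "?a * (?t / kap n \<gamma>) \<le> ?b * ?t"
    proof (cases "?a = 0")
      case False
      then have b0: "?b \<noteq> 0" using prefix_mass_le[OF len] by auto
      obtain a b where ab: "?a = ennreal a" "?b = ennreal b" "0 < a" "0 < b"
        using fin False b0 by (metis ennreal_cases ennreal_0 less_eq_real_def)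
      have "kap n \<gamma> = ennreal (a / b)" using ab by (simp add: kap_def divide_ennreal)
      then have "?a * (?t / kap n \<gamma>) = ?t * (ennreal a / ennreal (a / b))"
        using ab(1) by (simp add: ennreal_times_divide mult.commute)
      also have "ennreal a / ennreal (a / b) = ennreal b" using ab by (simp add: divide_ennreal)
      finally show ?thesis using ab(2) by (simp add: mult.commute)
    qed simp
  qed
  also have "\<dots> = (\<integral>\<^sup>+\<omega>'. (\<integral>\<^sup>+\<gamma>. emeasure (measure_pmf (W n)) {lp \<gamma>} * T \<gamma> (rw G \<omega>') \<partial>count_space {\<gamma>. length \<gamma> = n}) \<partial>M)"
    by (rule nn_integral_count_space_nn_integral[symmetric]) (simp, intro borel_measurable_times_ennreal Tm, simp)
  also have "\<dots> \<le> (\<integral>\<^sup>+\<omega>'. 1 \<partial>M)"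
  proof (intro nn_integral_mono)
    fix \<omega>'
    let ?w = "rw G \<omega>'"
    \<comment> \<open>Words are grouped by their end point \<open>x\<close>; for each
      \<open>x\<close> the conditional masses at the path \<open>tr x ?w\<close> sum to at most 1 by
      \<open>pn_sum\<close>.\<close>
    have "(\<integral>\<^sup>+\<gamma>. emeasure (measure_pmf (W n)) {lp \<gamma>} * T \<gamma> ?w \<partial>count_space {\<gamma>. length \<gamma> = n})
       = (\<integral>\<^sup>+\<gamma>. (\<integral>\<^sup>+x. indicator {lp \<gamma>} x * T \<gamma> ?w \<partial>measure_pmf (W n)) \<partial>count_space {\<gamma>. length \<gamma> = n})"
      by (intro nn_integral_cong) (simp add: nn_integral_multc)
    also have "\<dots> = (\<integral>\<^sup>+x. (\<integral>\<^sup>+\<gamma>. indicator {lp \<gamma>} x * T \<gamma> ?w \<partial>count_space {\<gamma>. length \<gamma> = n}) \<partial>measure_pmf (W n))"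
      by (rule nn_integral_count_space_nn_integral[symmetric]) simp_all
    also have "\<dots> \<le> (\<integral>\<^sup>+x. 1 \<partial>measure_pmf (W n))"
    proof (intro nn_integral_mono)
      fix x
      have "(\<integral>\<^sup>+\<gamma>. indicator {lp \<gamma>} x * T \<gamma> ?w \<partial>count_space {\<gamma>. length \<gamma> = n})
         \<le> (\<integral>\<^sup>+\<gamma>. pn q \<gamma> (tr x ?w) \<partial>count_space {\<gamma>. length \<gamma> = n})"
        by (intro nn_integral_mono) (auto simp: indicator_def T_def)
      also have "\<dots> \<le> 1" by (rule pn_sum[OF k])
      finally show "(\<integral>\<^sup>+\<gamma>. indicator {lp \<gamma>} x * T \<gamma> ?w \<partial>count_space {\<gamma>. length \<gamma> = n}) \<le> 1" .
    qed
    also have "\<dots> = 1" by simp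
    finally show "(\<integral>\<^sup>+\<gamma>. emeasure (measure_pmf (W n)) {lp \<gamma>} * T \<gamma> ?w \<partial>count_space {\<gamma>. length \<gamma> = n}) \<le> 1" .
  qed
  finally have "(\<integral>\<^sup>+\<omega>. pn q (prefix n \<omega>) (rw G \<omega>) / kap n (prefix n \<omega>) \<partial>M) \<le> 1"
    using P.emeasure_space_1 by simp
  from P.gibbs(1)[OF mk mq kap_pos kap_le_1 pn_le_1[OF k] this] show ?thesis .
qed

text \<open>Cylinders generate the sigma-algebra and are closed under intersection, so two densities
  with equal integrals over words define the same finite measure.\<close>

lemma path_density_unique:
  assumes f: "f \<in> borel_measurable M" "g \<in> borel_measurable M" and fin: "(\<integral>\<^sup>+\<omega>. f \<omega> \<partial>M) < \<infinity>"
    and eq: "\<And>n \<gamma>. (\<integral>\<^sup>+\<omega>. (if prefix n \<omega> = \<gamma> then f \<omega> else 0) \<partial>M) = (\<integral>\<^sup>+\<omega>. (if prefix n \<omega> = \<gamma> then g \<omega> else 0) \<partial>M)"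
  shows "AE \<omega> in M. f \<omega> = g \<omega>"
proof -
  interpret P: prob_space M by (rule prob_space_M)
  have cyl: "(\<integral>\<^sup>+\<omega>. c (prefix n \<omega>) * f \<omega> \<partial>M) = (\<integral>\<^sup>+\<omega>. c (prefix n \<omega>) * g \<omega> \<partial>M)" for c :: "'g list \<Rightarrow> ennreal" and n
  proof -
    have one: "(\<integral>\<^sup>+\<omega>. c (prefix n \<omega>) * h \<omega> \<partial>M)
       = (\<integral>\<^sup>+\<gamma>. c \<gamma> * (\<integral>\<^sup>+\<omega>. (if prefix n \<omega> = \<gamma> then h \<omega> else 0) \<partial>M) \<partial>count_space {\<gamma>. length \<gamma> = n})"
      if h: "h \<in> borel_measurable M" for h
    proof -
      have "(\<integral>\<^sup>+\<omega>. c (prefix n \<omega>) * h \<omega> \<partial>M)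
         = (\<integral>\<^sup>+\<gamma>. (\<integral>\<^sup>+\<omega>. (if prefix n \<omega> = \<gamma> then c \<gamma> * h \<omega> else 0) \<partial>M) \<partial>count_space {\<gamma>. length \<gamma> = n})"
        by (rule nn_integral_prefix[where f = "\<lambda>\<gamma> \<omega>. c \<gamma> * h \<omega>"]) (use h in simp)
      also have "\<dots> = (\<integral>\<^sup>+\<gamma>. c \<gamma> * (\<integral>\<^sup>+\<omega>. (if prefix n \<omega> = \<gamma> then h \<omega> else 0) \<partial>M) \<partial>count_space {\<gamma>. length \<gamma> = n})"
      proof (rule nn_integral_cong)
        fix \<gamma>
        have "(if prefix n \<omega> = \<gamma> then c \<gamma> * h \<omega> else 0) = c \<gamma> * (if prefix n \<omega> = \<gamma> then h \<omega> else 0)" for \<omega> by simp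
        then show "(\<integral>\<^sup>+\<omega>. (if prefix n \<omega> = \<gamma> then c \<gamma> * h \<omega> else 0) \<partial>M) = c \<gamma> * (\<integral>\<^sup>+\<omega>. (if prefix n \<omega> = \<gamma> then h \<omega> else 0) \<partial>M)"
          using nn_integral_cmult[OF measurable_prefix_eq[OF h, of n \<gamma>], of "c \<gamma>"] by (simp only:)
      qed
      finally show ?thesis .
    qed
    show ?thesis unfolding one[OF f(1)] one[OF f(2)] eq ..
  qed
  have "density M f = density M g"
  proof (rule measure_eqI_PiM_infinite[where I = UNIV and M = "\<lambda>_. count_space UNIV"])
    show "sets (density M f) = sets N" "sets (density M g) = sets N" by (simp_all add: sets_iid)
    show "finite_measure (density M f)"
    proof (rule finite_measureI)
      have "UNIV \<in> sets M" using sets.top[of M] by simp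
      then show "emeasure (density M f) (space (density M f)) \<noteq> \<infinity>"
        using fin f by (simp add: emeasure_density)
    qed
    fix A :: "nat \<Rightarrow> 'g set" and J :: "nat set" assume J: "finite J"
    define n where "n = Suc (Max (insert 0 J))"
    have Jn: "j < n" if "j \<in> J" for j using J that by (simp add: n_def less_Suc_eq_le)
    define C where "C = prod_emb UNIV (\<lambda>_. count_space UNIV) J (Pi\<^sub>E J A)"
    define c where "c \<gamma> = (indicator {\<gamma>. \<forall>j\<in>J. \<gamma> ! j \<in> A j} \<gamma> :: ennreal)" for \<gamma>
    have CM: "C \<in> sets M" unfolding C_def sets_iid by (rule sets_PiM_I) (use J in auto)
    have "c (prefix n \<omega>) = indicator C \<omega>" for \<omega>
      using Jn by (auto simp: c_def C_def prod_emb_def indicator_def prefix_def PiE_iff)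
    then show "emeasure (density M f) (prod_emb UNIV (\<lambda>_. count_space UNIV) J (Pi\<^sub>E J A))
        = emeasure (density M g) (prod_emb UNIV (\<lambda>_. count_space UNIV) J (Pi\<^sub>E J A))"
      using cyl[of c n] CM f unfolding C_def[symmetric] by (simp add: emeasure_density mult.commute)
  qed
  then show ?thesis using f by (simp add: P.density_unique_iff)
qed

text \<open>Kaimanovich's entropy criterion, phrased for codes: if the position at time \<open>n\<close> can be encoded, given
  the boundary data \<open>B\<close>, with \<open>o(n)\<close> nats on average, then \<open>B\<close> contains all invariant events mod 0.\<close>

theorem entropy_criterion:
  assumes B: "inv_alg B" and I: "inv_alg I" and BI: "sets B \<subseteq> sets I"
    and ent: "finite_entropy \<mu>"
    and code: "\<And>c::real. c > 0 \<Longrightarrow> \<exists>n q. n \<ge> 1 \<and> (\<forall>x. q x \<in> borel_measurable B) \<and>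
       (\<forall>w. (\<integral>\<^sup>+x. q x w \<partial>count_space UNIV) \<le> 1) \<and>
       (\<integral>\<^sup>+\<omega>. info (q (rw G \<omega> n) (rw G \<omega>)) \<partial>M) \<le> ennreal (c * real n)"
    and A: "A \<in> sets I"
  shows "\<exists>E\<in>sets B. AE \<omega> in M. rw G \<omega> \<in> A \<longleftrightarrow> rw G \<omega> \<in> E"
proof -
  interpret P: prob_space M by (rule prob_space_M)
  obtain p where p: "kern B p" using kernel_exists[OF B] by blast
  obtain q where q: "kern I q" using kernel_exists[OF I] by blast
  \<comment> \<open>The one-step conditional entropies given \<open>B\<close> and given
    \<open>I\<close>; the aim is to show that they are finite and equal.\<close>
  define h1 where "h1 = (\<integral>\<^sup>+\<omega>. info (p (\<omega> 0) (rw G \<omega>)) \<partial>M)"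
  define h2 where "h2 = (\<integral>\<^sup>+\<omega>. info (q (\<omega> 0) (rw G \<omega>)) \<partial>M)"
  have I1: "(\<integral>\<^sup>+\<omega>. info (pn p (prefix n \<omega>) (rw G \<omega>)) \<partial>M) = of_nat n * h1" for n
    unfolding h1_def by (rule info_pn[OF B p])
  have I2: "(\<integral>\<^sup>+\<omega>. info (pn q (prefix n \<omega>) (rw G \<omega>)) \<partial>M) = of_nat n * h2" for n
    unfolding h2_def by (rule info_pn[OF I q])
  have h1fin: "h1 < \<infinity>"
  proof -
    \<comment> \<open>Encoding the first increment by its unconditional law bounds \<open>h1\<close>
      by the entropy of \<open>\<mu>\<close>.\<close>
    define r where "r \<gamma> w = ennreal (pmf \<mu> (hd \<gamma>))" for \<gamma> :: "'g list" and w :: "nat \<Rightarrow> 'g"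
    have "(\<integral>\<^sup>+\<gamma>. r \<gamma> w \<partial>count_space {\<gamma>. length \<gamma> = 1}) \<le> 1" for w
    proof -
      have "{\<gamma>::'g list. length \<gamma> = 0} = {[]}" by auto
      then have "(\<integral>\<^sup>+\<gamma>. r \<gamma> w \<partial>count_space {\<gamma>. length \<gamma> = Suc 0}) = (\<integral>\<^sup>+g. ennreal (pmf \<mu> g) \<partial>count_space UNIV)"
        by (simp add: nn_integral_lists_Suc r_def nn_integral_count_space_finite)
      then show ?thesis by (simp add: nn_integral_pmf)
    qed
    then have "(\<integral>\<^sup>+\<omega>. info (pn p (prefix 1 \<omega>) (rw G \<omega>)) \<partial>M) \<le> (\<integral>\<^sup>+\<omega>. info (r (prefix 1 \<omega>) (rw G \<omega>)) \<partial>M)"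
      by (intro kernel_gibbs(1)[OF B p]) (auto simp: r_def pmf_le_1)
    also have "\<dots> = (\<integral>\<^sup>+\<omega>. info (ennreal (pmf \<mu> (\<omega> 0))) \<partial>M)" by (simp add: r_def prefix_def)
    also have "\<dots> = (\<integral>\<^sup>+g. info (ennreal (pmf \<mu> g)) \<partial>measure_pmf \<mu>)" by (rule nn_integral_coord)
    also have "\<dots> < \<infinity>" using finite_entropy_info[OF ent] by simp
    finally show ?thesis using I1[of 1] by simp
  qed
  have "h1 \<le> h2 + ennreal c" if c: "c > 0" for c
  proof -
    obtain n u where n: "n \<ge> 1" and uB: "\<And>x. u x \<in> borel_measurable B"
      and us: "\<And>w. (\<integral>\<^sup>+x. u x w \<partial>count_space UNIV) \<le> 1"
      and ui: "(\<integral>\<^sup>+\<omega>. info (u (rw G \<omega> n) (rw G \<omega>)) \<partial>M) \<le> ennreal (c * real n)"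
      using code[OF c] by blast
    have u1: "u x w \<le> 1" for x w
    proof -
      have "u x w = (\<integral>\<^sup>+h. u h w * indicator {x} h \<partial>count_space UNIV)" by simp
      also have "\<dots> \<le> (\<integral>\<^sup>+h. u h w \<partial>count_space UNIV)" by (intro nn_integral_mono) (simp add: indicator_def)
      finally show ?thesis using us[of w] by simp
    qed
    \<comment> \<open>A code in two stages: the position through \<open>u\<close>, then the word
      given its position through \<open>kap\<close>. By \<open>kap_gibbs\<close> the second stage
      costs at most n times \<open>h2\<close>.\<close>
    define r where "r \<gamma> w = kap n \<gamma> * u (lp \<gamma>) w" for \<gamma> w
    have rB: "r \<gamma> \<in> borel_measurable B" for \<gamma>
      unfolding r_def[abs_def] using uB[of "lp \<gamma>"] by (intro borel_measurable_times_ennreal) auto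
    have r1: "r \<gamma> w \<le> 1" for \<gamma> w
    proof -
      have "r \<gamma> w \<le> 1 * 1" unfolding r_def by (intro mult_mono kap_le_1 u1) auto
      then show ?thesis by simp
    qed
    have rs: "(\<integral>\<^sup>+\<gamma>. r \<gamma> w \<partial>count_space {\<gamma>. length \<gamma> = n}) \<le> 1" for w
    proof -
      have "(\<integral>\<^sup>+\<gamma>. r \<gamma> w \<partial>count_space {\<gamma>. length \<gamma> = n})
         = (\<integral>\<^sup>+\<gamma>. (\<integral>\<^sup>+x. (kap n \<gamma> * indicator {\<gamma>. lp \<gamma> = x} \<gamma>) * u x w \<partial>count_space UNIV) \<partial>count_space {\<gamma>. length \<gamma> = n})"
      proof (rule nn_integral_cong)
        fix \<gamma> :: "'g list"
        have "(\<integral>\<^sup>+x. (kap n \<gamma> * indicator {\<gamma>. lp \<gamma> = x} \<gamma>) * u x w \<partial>count_space UNIV)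
           = (\<integral>\<^sup>+x. r \<gamma> w * indicator {lp \<gamma>} x \<partial>count_space UNIV)"
          by (intro nn_integral_cong) (auto simp: r_def indicator_def)
        then show "r \<gamma> w = (\<integral>\<^sup>+x. (kap n \<gamma> * indicator {\<gamma>. lp \<gamma> = x} \<gamma>) * u x w \<partial>count_space UNIV)"
          by (simp add: nn_integral_cmult)
      qed
      also have "\<dots> = (\<integral>\<^sup>+x. (\<integral>\<^sup>+\<gamma>. (kap n \<gamma> * indicator {\<gamma>. lp \<gamma> = x} \<gamma>) * u x w \<partial>count_space {\<gamma>. length \<gamma> = n}) \<partial>count_space UNIV)"
        by (rule nn_integral_count_space_nn_integral[symmetric]) simp_all
      also have "\<dots> = (\<integral>\<^sup>+x. (\<integral>\<^sup>+\<gamma>. kap n \<gamma> * indicator {\<gamma>. lp \<gamma> = x} \<gamma> \<partial>count_space {\<gamma>. length \<gamma> = n}) * u x w \<partial>count_space UNIV)"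
        by (intro nn_integral_cong nn_integral_multc) simp
      also have "\<dots> \<le> (\<integral>\<^sup>+x. 1 * u x w \<partial>count_space UNIV)"
        by (intro nn_integral_mono mult_right_mono kap_sum) simp
      finally show ?thesis using us[of w] by simp
    qed
    have mk: "(\<lambda>\<omega>. info (kap n (prefix n \<omega>))) \<in> borel_measurable M"
      by (rule measurable_prefix_app[where f = "\<lambda>\<gamma> \<omega>. info (kap n \<gamma>)"]) simp
    have mu': "(\<lambda>\<omega>. info (u (rw G \<omega> n) (rw G \<omega>))) \<in> borel_measurable M"
      by (rule measurable_compose_countable[where f = "\<lambda>x \<omega>. info (u x (rw G \<omega>))" and g = "\<lambda>\<omega>. rw G \<omega> n"])
         (auto intro: measurable_compose[OF inv_alg_rw[OF B uB] measurable_info])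
    have "of_nat n * h1 \<le> (\<integral>\<^sup>+\<omega>. info (r (prefix n \<omega>) (rw G \<omega>)) \<partial>M)"
      unfolding I1[symmetric] by (rule kernel_gibbs(1)[OF B p rB r1 rs])
    also have "\<dots> = (\<integral>\<^sup>+\<omega>. info (kap n (prefix n \<omega>)) + info (u (rw G \<omega> n) (rw G \<omega>)) \<partial>M)"
      by (rule nn_integral_cong_AE, use AE_inC in eventually_elim)
         (simp add: r_def lp_prefix info_mult[OF kap_le_1 u1])
    also have "\<dots> = (\<integral>\<^sup>+\<omega>. info (kap n (prefix n \<omega>)) \<partial>M) + (\<integral>\<^sup>+\<omega>. info (u (rw G \<omega> n) (rw G \<omega>)) \<partial>M)"
      by (rule nn_integral_add[OF mk mu'])
    also have "\<dots> \<le> of_nat n * h2 + ennreal (c * real n)"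
      unfolding I2[symmetric] by (intro add_mono ui kap_gibbs[OF I q])
    also have "ennreal (c * real n) = of_nat n * ennreal c"
      using c by (simp add: ennreal_mult ennreal_of_nat_eq_real_of_nat mult.commute)
    finally have "of_nat n * h1 \<le> of_nat n * (h2 + ennreal c)" by (simp add: distrib_left)
    moreover have "of_nat n \<noteq> (0::ennreal)" using n by simp
    ultimately show ?thesis
      by (rule ennreal_mult_le_mult_iff[THEN iffD1, rotated 2]) (rule ennreal_of_nat_neq_top)
  qed
  note hc = this
  have h12: "h1 \<le> h2"
  proof (rule ennreal_le_epsilon)
    fix e :: real assume "0 < e"
    then show "h1 \<le> h2 + ennreal e" by (rule hc)
  qed
  have qpI: "pn p \<gamma> \<in> borel_measurable I" for \<gamma>
    using pn_measurable[OF B p, of \<gamma>] B I BI unfolding inv_alg_def measurable_def by auto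
  have psum: "(\<integral>\<^sup>+\<gamma>. pn p \<gamma> w \<partial>count_space {\<gamma>. length \<gamma> = n}) \<le> 1" for n w by (rule pn_sum[OF p])
  \<comment> \<open>Events of \<open>B\<close> are events of \<open>I\<close>, so the law given
    \<open>B\<close> competes with the optimal one given \<open>I\<close>.\<close>
  have "h2 \<le> h1"
    using kernel_gibbs(1)[OF I q qpI pn_le_1[OF p] psum, of 1] unfolding I1 I2 by simp
  with h12 have heq: "h1 = h2" by simp
  have agree: "AE \<omega> in M. pn q (prefix n \<omega>) (rw G \<omega>) = pn p (prefix n \<omega>) (rw G \<omega>)" for n
    by (rule kernel_gibbs(2)[OF I q qpI pn_le_1[OF p] psum])
       (use h1fin in \<open>auto simp: I1 I2 heq ennreal_mult_less_top of_nat_less_top\<close>)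
  \<comment> \<open>\<open>agree\<close> speaks only of the word actually followed. For a fixed word
    it gives equality wherever \<open>pn q\<close> is positive, hence \<open>pn q\<close> is at most
    \<open>pn p\<close>; both integrate to the probability of the word, so they agree almost
    surely.\<close>
  have eqk: "AE \<omega> in M. pn q \<gamma> (rw G \<omega>) = pn p \<gamma> (rw G \<omega>)" for \<gamma>
  proof -
    let ?n = "length \<gamma>"
    let ?d = "\<lambda>w. if pn q \<gamma> w = pn p \<gamma> w then 0 else 1 :: ennreal"
    have qI: "pn q \<gamma> \<in> borel_measurable I" by (rule pn_measurable[OF I q])
    have mq: "(\<lambda>\<omega>. pn q \<gamma> (rw G \<omega>)) \<in> borel_measurable M" "(\<lambda>\<omega>. pn p \<gamma> (rw G \<omega>)) \<in> borel_measurable M"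
      by (rule inv_alg_rw[OF I qI], rule inv_alg_rw[OF I qpI])
    have dI: "?d \<in> borel_measurable I"
    proof -
      have "{w \<in> space I. pn q \<gamma> w = pn p \<gamma> w} \<in> sets I" using qI qpI by measurable
      then show ?thesis by (intro measurable_If) auto
    qed
    have "(\<integral>\<^sup>+\<omega>. pn q \<gamma> (rw G \<omega>) * ?d (rw G \<omega>) \<partial>M) = (\<integral>\<^sup>+\<omega>. (if prefix ?n \<omega> = \<gamma> then ?d (rw G \<omega>) else 0) \<partial>M)"
      by (rule pn_conditional[OF I q dI, symmetric])
    also have "\<dots> = (\<integral>\<^sup>+\<omega>. 0 \<partial>M)"
      by (rule nn_integral_cong_AE, use agree[of ?n] in eventually_elim) auto
    finally have z: "(\<integral>\<^sup>+\<omega>. pn q \<gamma> (rw G \<omega>) * ?d (rw G \<omega>) \<partial>M) = 0" by simp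
    have "(\<lambda>\<omega>. pn q \<gamma> (rw G \<omega>) * ?d (rw G \<omega>)) \<in> borel_measurable M"
      by (rule borel_measurable_times_ennreal[OF mq(1) inv_alg_rw[OF I dI]])
    from nn_integral_0_iff_AE[OF this, THEN iffD1, OF z]
    have "AE \<omega> in M. pn q \<gamma> (rw G \<omega>) * ?d (rw G \<omega>) = 0" .
    then have le: "AE \<omega> in M. pn q \<gamma> (rw G \<omega>) \<le> pn p \<gamma> (rw G \<omega>)"
      by eventually_elim (auto split: if_splits)
    have tot: "(\<integral>\<^sup>+\<omega>. pn q \<gamma> (rw G \<omega>) \<partial>M) = (\<integral>\<^sup>+\<omega>. pn p \<gamma> (rw G \<omega>) \<partial>M)"
      using pn_conditional[OF I q, of "\<lambda>_. 1" \<gamma>] pn_conditional[OF B p, of "\<lambda>_. 1" \<gamma>] by simp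
    have fin: "(\<integral>\<^sup>+\<omega>. pn q \<gamma> (rw G \<omega>) \<partial>M) \<noteq> \<infinity>"
    proof -
      have "(\<integral>\<^sup>+\<omega>. pn q \<gamma> (rw G \<omega>) \<partial>M) \<le> (\<integral>\<^sup>+\<omega>. 1 \<partial>M)" by (intro nn_integral_mono pn_le_1[OF q])
      then show ?thesis using P.emeasure_space_1 by (auto simp: top_unique)
    qed
    have "(\<integral>\<^sup>+\<omega>. pn p \<gamma> (rw G \<omega>) - pn q \<gamma> (rw G \<omega>) \<partial>M) = 0"
      by (subst nn_integral_diff[OF mq(2,1) fin le]) (use tot fin in simp)
    then have "AE \<omega> in M. pn p \<gamma> (rw G \<omega>) - pn q \<gamma> (rw G \<omega>) = 0"
      using mq by (subst (asm) nn_integral_0_iff_AE) simp_all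
    then show ?thesis using le
    proof eventually_elim
      fix \<omega> assume "pn p \<gamma> (rw G \<omega>) - pn q \<gamma> (rw G \<omega>) = 0" and l: "pn q \<gamma> (rw G \<omega>) \<le> pn p \<gamma> (rw G \<omega>)"
      then have "pn p \<gamma> (rw G \<omega>) \<le> pn q \<gamma> (rw G \<omega>)" by (simp add: ennreal_minus_eq_0)
      then show "pn q \<gamma> (rw G \<omega>) = pn p \<gamma> (rw G \<omega>)" using l by simp
    qed
  qed
  let ?P = "path_measure G \<mu>"
  interpret PP: prob_space ?P by (rule prob_space_path)
  have sub: "subalgebra ?P B"
    using B by (simp add: subalgebra_def inv_alg_def sets_path space_path)
  interpret finite_measure_subalgebra ?P B by standard (rule sub)
  \<comment> \<open>The candidate for \<open>A\<close> within \<open>B\<close>. On each cylinder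
    \<open>A\<close> and \<open>\<psi>\<close> have equal integrals, because the conditional law of
    the word given \<open>I\<close> is already \<open>B\<close>-measurable; hence
    \<open>\<psi>\<close> is almost surely the indicator of \<open>A\<close>.\<close>
  define \<psi> where "\<psi> = nn_cond_exp ?P B (indicator A)"
  have psiB: "\<psi> \<in> borel_measurable B" unfolding \<psi>_def by simp
  have AN: "(indicator A :: _ \<Rightarrow> ennreal) \<in> borel_measurable N"
    using A I unfolding inv_alg_def by auto
  have AI: "(indicator A :: _ \<Rightarrow> ennreal) \<in> borel_measurable I" using A by simp
  have AP: "(indicator A :: _ \<Rightarrow> ennreal) \<in> borel_measurable ?P" using AN by (simp add: measurable_cong_sets[OF sets_path refl])
  have mA: "(\<lambda>\<omega>. indicator A (rw G \<omega>) :: ennreal) \<in> borel_measurable M" by (rule inv_alg_rw[OF I AI])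
  have mpsi: "(\<lambda>\<omega>. \<psi> (rw G \<omega>)) \<in> borel_measurable M" by (rule inv_alg_rw[OF B psiB])
  have "AE \<omega> in M. indicator A (rw G \<omega>) = \<psi> (rw G \<omega>)"
  proof (rule path_density_unique[OF mA mpsi])
    have "(\<integral>\<^sup>+\<omega>. indicator A (rw G \<omega>) \<partial>M) \<le> (\<integral>\<^sup>+\<omega>. 1 \<partial>M)" by (intro nn_integral_mono) (simp add: indicator_def)
    then show "(\<integral>\<^sup>+\<omega>. indicator A (rw G \<omega>) \<partial>M) < \<infinity>"
      using P.emeasure_space_1 order_le_less_trans by fastforce
    fix n \<gamma>
    show "(\<integral>\<^sup>+\<omega>. (if prefix n \<omega> = \<gamma> then indicator A (rw G \<omega>) else 0) \<partial>M) = (\<integral>\<^sup>+\<omega>. (if prefix n \<omega> = \<gamma> then \<psi> (rw G \<omega>) else 0) \<partial>M)"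
    proof (cases "length \<gamma> = n")
      case False
      then have "prefix n \<omega> \<noteq> \<gamma>" for \<omega> by (auto simp: prefix_def)
      then show ?thesis by simp
    next
      case True
      have pB: "pn p \<gamma> \<in> borel_measurable B" by (rule pn_measurable[OF B p])
      have "(\<integral>\<^sup>+\<omega>. (if prefix n \<omega> = \<gamma> then indicator A (rw G \<omega>) else 0) \<partial>M) = (\<integral>\<^sup>+\<omega>. pn q \<gamma> (rw G \<omega>) * indicator A (rw G \<omega>) \<partial>M)"
        using pn_conditional[OF I q AI, of \<gamma>] True by simp
      also have "\<dots> = (\<integral>\<^sup>+\<omega>. pn p \<gamma> (rw G \<omega>) * indicator A (rw G \<omega>) \<partial>M)"
        by (rule nn_integral_cong_AE, use eqk[of \<gamma>] in eventually_elim) simp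
      also have "\<dots> = (\<integral>\<^sup>+w. pn p \<gamma> w * indicator A w \<partial>?P)"
        by (rule nn_integral_path[symmetric]) (intro borel_measurable_times_ennreal AN inv_alg_N[OF B pB])
      also have "\<dots> = (\<integral>\<^sup>+w. pn p \<gamma> w * \<psi> w \<partial>?P)"
        unfolding \<psi>_def by (rule nn_cond_exp_intg[symmetric, OF pB AP])
      also have "\<dots> = (\<integral>\<^sup>+\<omega>. pn p \<gamma> (rw G \<omega>) * \<psi> (rw G \<omega>) \<partial>M)"
        by (rule nn_integral_path) (intro borel_measurable_times_ennreal inv_alg_N[OF B psiB] inv_alg_N[OF B pB])
      also have "\<dots> = (\<integral>\<^sup>+\<omega>. (if prefix n \<omega> = \<gamma> then \<psi> (rw G \<omega>) else 0) \<partial>M)"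
        using pn_conditional[OF B p psiB, of \<gamma>] True by simp
      finally show ?thesis .
    qed
  qed
  moreover have "\<psi> -` {1} \<in> sets B"
    using measurable_sets[OF psiB, of "{1}"] B by (simp add: inv_alg_def)
  ultimately show ?thesis
    by (intro bexI[of _ "\<psi> -` {1}"]) (auto elim!: eventually_mono simp: indicator_def split: if_splits)
qed

end

section \<open>Boundary events\<close>

context hyp_space
begin

lemma converges_to_equiv:
  assumes "converges_to x0 xs \<xi>" "converges_to x0 ys \<xi>"
  shows "equiv_inf x0 xs ys"
  using assms bclass_eq_iff[of xs ys] by (auto simp: converges_to_def)

lemma gbd_converges: "\<xi> \<in> gbd x0 \<Longrightarrow> \<exists>xs. converges_to x0 xs \<xi>"
  by (auto simp: gbd_def converges_to_def)

lemma converges_to_gbd: "converges_to x0 xs \<xi> \<Longrightarrow> \<xi> \<in> gbd x0"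
  by (auto simp: gbd_def converges_to_def)

text \<open>\<open>bnbhd\<close> asks for some representing sequences; passing to prescribed ones
  costs two applications of \<open>hyp\<close>.\<close>

lemma bnbhd_gprod:
  assumes e: "\<eta> \<in> bnbhd x0 \<xi> r" and xs: "converges_to x0 xs \<xi>" and ys: "converges_to x0 ys \<eta>"
  shows "\<exists>N. \<forall>i\<ge>N. \<forall>j\<ge>N. r - 2 * \<delta> \<le> gprod x0 (xs i) (ys j)"
proof -
  obtain xs' ys' N1 where c: "converges_to x0 xs' \<xi>" "converges_to x0 ys' \<eta>"
    and N1: "\<And>i j. i \<ge> N1 \<Longrightarrow> j \<ge> N1 \<Longrightarrow> r \<le> gprod x0 (xs' i) (ys' j)"
    using e unfolding bnbhd_def by blast
  obtain N2 where N2: "\<And>i j. i \<ge> N2 \<Longrightarrow> j \<ge> N2 \<Longrightarrow> r \<le> gprod x0 (xs i) (xs' j)"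
    using converges_to_equiv[OF xs c(1)] unfolding equiv_inf_def by blast
  obtain N3 where N3: "\<And>i j. i \<ge> N3 \<Longrightarrow> j \<ge> N3 \<Longrightarrow> r \<le> gprod x0 (ys' i) (ys j)"
    using converges_to_equiv[OF c(2) ys] unfolding equiv_inf_def by blast
  define n where "n = max N1 (max N2 N3)"
  have "r - 2 * \<delta> \<le> gprod x0 (xs i) (ys j)" if "i \<ge> n" "j \<ge> n" for i j
  proof -
    have "r \<le> gprod x0 (xs i) (xs' n)" "r \<le> gprod x0 (xs' n) (ys' n)" "r \<le> gprod x0 (ys' n) (ys j)"
      using N1[of n n] N2[of i n] N3[of n j] that by (auto simp: n_def)
    then show ?thesis using hyp3[of x0 "xs i" "xs' n" "ys' n" "ys j"] by linarith
  qed
  then show ?thesis by blast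
qed

lemma bnbhd_self: "\<xi> \<in> gbd x0 \<Longrightarrow> \<xi> \<in> bnbhd x0 \<xi> r"
proof -
  assume x: "\<xi> \<in> gbd x0"
  then obtain xs where xs: "converges_to x0 xs \<xi>" using gbd_converges by blast
  then have "\<exists>N. \<forall>i\<ge>N. \<forall>j\<ge>N. gprod x0 (xs i) (xs j) \<ge> r" by (simp add: converges_to_def conv_inf_def)
  then show ?thesis using x xs unfolding bnbhd_def by blast
qed

definition bshadow :: "'x \<Rightarrow> real \<Rightarrow> (nat \<Rightarrow> 'x) set set" where
  "bshadow y R = {\<xi>. \<exists>ys. converges_to x0 ys \<xi> \<and> (\<exists>N. \<forall>j\<ge>N. R \<le> gprod x0 y (ys j))}"

text \<open>The interior of the shadow for the coarse neighbourhoods. Shadows themselves need not be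
  open; \<open>oshadow\<close> lies between the shadows of depth \<open>R + \<delta>\<close> and
  \<open>R\<close>.\<close>

definition oshadow :: "'x \<Rightarrow> real \<Rightarrow> (nat \<Rightarrow> 'x) set set" where
  "oshadow y R = {\<xi> \<in> gbd x0. \<exists>r. bnbhd x0 \<xi> r \<subseteq> bshadow y R}"

lemma bopen_oshadow: "bopen x0 (oshadow y R)"
  unfolding bopen_def
proof (intro conjI ballI)
  show "oshadow y R \<subseteq> gbd x0" by (auto simp: oshadow_def)
  fix \<xi> assume "\<xi> \<in> oshadow y R"
  then obtain r where r: "\<xi> \<in> gbd x0" "bnbhd x0 \<xi> r \<subseteq> bshadow y R" by (auto simp: oshadow_def)
  obtain xs where xs: "converges_to x0 xs \<xi>" using gbd_converges[OF r(1)] by blast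
  \<comment> \<open>The extra \<open>3 * \<delta>\<close> pays \<open>2 * \<delta>\<close> for
    changing representatives and \<open>\<delta>\<close> for one use of \<open>hyp\<close> in
    composing two neighbourhoods.\<close>
  have "\<eta> \<in> oshadow y R" if e: "\<eta> \<in> bnbhd x0 \<xi> (r + 3 * \<delta>)" for \<eta>
  proof -
    have eg: "\<eta> \<in> gbd x0" using e by (simp add: bnbhd_def)
    obtain ys where ys: "converges_to x0 ys \<eta>" using gbd_converges[OF eg] by blast
    obtain N1 where N1: "\<And>i j. i \<ge> N1 \<Longrightarrow> j \<ge> N1 \<Longrightarrow> r + 3 * \<delta> - 2 * \<delta> \<le> gprod x0 (xs i) (ys j)"
      using bnbhd_gprod[OF e xs ys] by blast
    have "\<zeta> \<in> bnbhd x0 \<xi> r" if z: "\<zeta> \<in> bnbhd x0 \<eta> (r + 3 * \<delta>)" for \<zeta>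
    proof -
      have zg: "\<zeta> \<in> gbd x0" using z by (simp add: bnbhd_def)
      obtain zs where zs: "converges_to x0 zs \<zeta>" using gbd_converges[OF zg] by blast
      obtain N2 where N2: "\<And>i j. i \<ge> N2 \<Longrightarrow> j \<ge> N2 \<Longrightarrow> r + 3 * \<delta> - 2 * \<delta> \<le> gprod x0 (ys i) (zs j)"
        using bnbhd_gprod[OF z ys zs] by blast
      define n where "n = max N1 N2"
      have "r \<le> gprod x0 (xs i) (zs j)" if "i \<ge> n" "j \<ge> n" for i j
        using N1[of i n] N2[of n j] that hyp[of x0 "xs i" "ys n" "zs j"] by (auto simp: n_def)
      then show ?thesis using zg xs zs unfolding bnbhd_def by blast
    qed
    then show ?thesis using r(2) eg unfolding oshadow_def by blast
  qed
  then show "\<exists>r. bnbhd x0 \<xi> r \<subseteq> oshadow y R" by blast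
qed

lemma oshadow_subset: "oshadow y R \<subseteq> bshadow y R"
  using bnbhd_self by (auto simp: oshadow_def)

lemma bshadow_subset_oshadow: "bshadow y (R + \<delta>) \<subseteq> oshadow y R"
proof
  fix \<xi> assume "\<xi> \<in> bshadow y (R + \<delta>)"
  then obtain xs N1 where xs: "converges_to x0 xs \<xi>" and N1: "\<And>j. j \<ge> N1 \<Longrightarrow> R + \<delta> \<le> gprod x0 y (xs j)"
    by (auto simp: bshadow_def)
  have "\<eta> \<in> bshadow y R" if e: "\<eta> \<in> bnbhd x0 \<xi> (R + 3 * \<delta>)" for \<eta>
  proof -
    have eg: "\<eta> \<in> gbd x0" using e by (simp add: bnbhd_def)
    obtain ys where ys: "converges_to x0 ys \<eta>" using gbd_converges[OF eg] by blast
    obtain N2 where N2: "\<And>i j. i \<ge> N2 \<Longrightarrow> j \<ge> N2 \<Longrightarrow> R + 3 * \<delta> - 2 * \<delta> \<le> gprod x0 (xs i) (ys j)"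
      using bnbhd_gprod[OF e xs ys] by blast
    have "R \<le> gprod x0 y (ys j)" if "j \<ge> max N1 N2" for j
      using N1[of "max N1 N2"] N2[of "max N1 N2" j] that hyp[of x0 y "xs (max N1 N2)" "ys j"] by auto
    then show ?thesis using ys unfolding bshadow_def by blast
  qed
  then show "\<xi> \<in> oshadow y R" using converges_to_gbd[OF xs] unfolding oshadow_def by blast
qed

lemma bshadow_eventually:
  assumes "\<xi> \<in> bshadow y R" and xs: "converges_to x0 xs \<xi>"
  shows "\<exists>N. \<forall>j\<ge>N. R - \<delta> \<le> gprod x0 y (xs j)"
proof -
  obtain ys N1 where ys: "converges_to x0 ys \<xi>" and N1: "\<And>j. j \<ge> N1 \<Longrightarrow> R \<le> gprod x0 y (ys j)"
    using assms(1) by (auto simp: bshadow_def)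
  obtain N2 where N2: "\<And>i j. i \<ge> N2 \<Longrightarrow> j \<ge> N2 \<Longrightarrow> R \<le> gprod x0 (ys i) (xs j)"
    using converges_to_equiv[OF ys xs] unfolding equiv_inf_def by blast
  have "R - \<delta> \<le> gprod x0 y (xs j)" if "j \<ge> max N1 N2" for j
    using N1[of "max N1 N2"] N2[of "max N1 N2" j] that hyp[of x0 y "ys (max N1 N2)" "xs j"] by auto
  then show ?thesis by blast
qed

lemma space_bborel: "space (bborel x0) = gbd x0"
  and sets_bborel: "sets (bborel x0) = sigma_sets (gbd x0) {U. bopen x0 U}"
proof -
  have "{U. bopen x0 U} \<subseteq> Pow (gbd x0)" by (auto simp: bopen_def)
  then show "space (bborel x0) = gbd x0" "sets (bborel x0) = sigma_sets (gbd x0) {U. bopen x0 U}"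
    by (simp_all add: bborel_def)
qed

lemma bopen_bborel: "bopen x0 U \<Longrightarrow> U \<in> sets (bborel x0)"
  by (simp add: sets_bborel)

lemma conv_inf_Suc: "conv_inf x0 (x \<circ> Suc) \<longleftrightarrow> conv_inf x0 x"
proof
  assume l: "conv_inf x0 (x \<circ> Suc)"
  show "conv_inf x0 x" unfolding conv_inf_def
  proof
    fix R
    obtain N where N: "\<And>i j. i \<ge> N \<Longrightarrow> j \<ge> N \<Longrightarrow> R \<le> gprod x0 (x (Suc i)) (x (Suc j))"
      using l unfolding conv_inf_def comp_def by blast
    have "R \<le> gprod x0 (x i) (x j)" if "i \<ge> Suc N" "j \<ge> Suc N" for i j
      using N[of "i - 1" "j - 1"] that by simp
    then show "\<exists>N. \<forall>i\<ge>N. \<forall>j\<ge>N. R \<le> gprod x0 (x i) (x j)" by blast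
  qed
next
  assume r: "conv_inf x0 x"
  show "conv_inf x0 (x \<circ> Suc)" unfolding conv_inf_def comp_def
  proof
    fix R
    obtain N where "\<And>i j. i \<ge> N \<Longrightarrow> j \<ge> N \<Longrightarrow> R \<le> gprod x0 (x i) (x j)"
      using r unfolding conv_inf_def by blast
    then have "\<forall>i\<ge>N. \<forall>j\<ge>N. R \<le> gprod x0 (x (Suc i)) (x (Suc j))" by simp
    then show "\<exists>N. \<forall>i\<ge>N. \<forall>j\<ge>N. R \<le> gprod x0 (x (Suc i)) (x (Suc j))" by blast
  qed
qed

lemma bclass_Suc:
  assumes c: "conv_inf x0 x"
  shows "bclass x0 (x \<circ> Suc) = bclass x0 x"
proof -
  have "equiv_inf x0 x (x \<circ> Suc)" unfolding equiv_inf_def comp_def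
  proof
    fix R
    obtain N where "\<And>i j. i \<ge> N \<Longrightarrow> j \<ge> N \<Longrightarrow> R \<le> gprod x0 (x i) (x j)"
      using c unfolding conv_inf_def by blast
    then have "\<forall>i\<ge>N. \<forall>j\<ge>N. R \<le> gprod x0 (x i) (x (Suc j))" by simp
    then show "\<exists>N. \<forall>i\<ge>N. \<forall>j\<ge>N. R \<le> gprod x0 (x i) (x (Suc j))" by blast
  qed
  then show ?thesis using bclass_eq_iff[of x "x \<circ> Suc"] c conv_inf_Suc[of x] by simp
qed

end

section \<open>The limit map and the sigma-algebras of boundary events and of invariant
  events\<close>

context rand_walk
begin

definition orb :: "(nat \<Rightarrow> 'g) \<Rightarrow> nat \<Rightarrow> 'x" where "orb w = (\<lambda>n. \<phi> (w n) x0)"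

definition Conv :: "(nat \<Rightarrow> 'g) \<Rightarrow> bool" where "Conv w \<longleftrightarrow> conv_inf x0 (orb w)"

lemma Conv_converges: "Conv w \<Longrightarrow> converges_to x0 (orb w) (bclass x0 (orb w))"
  by (simp add: Conv_def converges_to_def)

lemma orb_Suc: "orb (w \<circ> Suc) = orb w \<circ> Suc" by (simp add: orb_def comp_def)

lemma orb_tr: "good w \<Longrightarrow> x \<in> carrier G \<Longrightarrow> orb (tr x w) = \<phi> x \<circ> orb w"
  by (simp add: orb_def tr_def good_def act_mult comp_def)

lemma Conv_tr: "good w \<Longrightarrow> x \<in> carrier G \<Longrightarrow> Conv (tr x w) \<longleftrightarrow> Conv w"
proof -
  assume w: "good w" and x: "x \<in> carrier G"
  have 1: "Conv w \<Longrightarrow> Conv (tr x w)" if "good w" "x \<in> carrier G" for w x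
    unfolding Conv_def orb_tr[OF that] by (rule conv_inf_isometry[OF act_isometry[OF that(2)]])
  show ?thesis
    using 1[OF w x] 1[OF good_tr[OF x w], of "inv x"] x by (auto simp: tr_inv)
qed

lemma predN2: "{w. P (w i) (w j)} \<in> sets N"
proof -
  have "(\<lambda>w. P (w i) (w j)) \<in> N \<rightarrow>\<^sub>M count_space UNIV"
    by (rule measurable_compose_countable[where f = "\<lambda>a w. P a (w j)" and g = "\<lambda>w. w i"])
       (auto intro: measurable_compose[OF measurable_component_singleton])
  then show ?thesis using measurable_sets[of "\<lambda>w. P (w i) (w j)" N "count_space UNIV" "{True}"] by (simp add: vimage_def)
qed

lemma good_sets: "{w. good w} \<in> sets N"
proof -
  have "{w. good w} = (\<Inter>i. {w. w i \<in> carrier G \<and> w i = w i})" by (auto simp: good_def)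
  also have "\<dots> \<in> sets N" by (intro sets.countable_INT) (use predN2[of "\<lambda>a b. a \<in> carrier G \<and> a = b" i i for i] in auto)
  finally show ?thesis .
qed

lemma Conv_sets: "{w. Conv w} \<in> sets N"
proof -
  \<comment> \<open>Integer thresholds leave only countable unions and intersections.\<close>
  have real_nat: "conv_inf x0 x \<longleftrightarrow> (\<forall>r::nat. \<exists>N. \<forall>i\<in>{N..}. \<forall>j\<in>{N..}. real r \<le> gprod x0 (x i) (x j))" for x
  proof
    assume c: "conv_inf x0 x"
    show "\<forall>r::nat. \<exists>N. \<forall>i\<in>{N..}. \<forall>j\<in>{N..}. real r \<le> gprod x0 (x i) (x j)"
    proof
      fix r :: nat
      obtain n where "\<forall>i\<ge>n. \<forall>j\<ge>n. real r \<le> gprod x0 (x i) (x j)"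
        using c unfolding conv_inf_def by blast
      then show "\<exists>N. \<forall>i\<in>{N..}. \<forall>j\<in>{N..}. real r \<le> gprod x0 (x i) (x j)"
        by (intro exI[of _ n]) simp
    qed
  next
    assume a: "\<forall>r::nat. \<exists>N. \<forall>i\<in>{N..}. \<forall>j\<in>{N..}. real r \<le> gprod x0 (x i) (x j)"
    show "conv_inf x0 x" unfolding conv_inf_def
    proof
      fix R :: real
      obtain r :: nat where r: "R \<le> real r" using real_arch_simple by blast
      obtain n where "\<forall>i\<in>{n..}. \<forall>j\<in>{n..}. real r \<le> gprod x0 (x i) (x j)" using a by blast
      then have "\<forall>i\<ge>n. \<forall>j\<ge>n. R \<le> gprod x0 (x i) (x j)" using r by (auto intro: order_trans)
      then show "\<exists>N. \<forall>i\<ge>N. \<forall>j\<ge>N. R \<le> gprod x0 (x i) (x j)" by blast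
    qed
  qed
  have "{w. Conv w} = (\<Inter>r::nat. \<Union>n::nat. \<Inter>i\<in>{n..}. \<Inter>j\<in>{n..}. {w. real r \<le> gprod x0 (\<phi> (w i) x0) (\<phi> (w j) x0)})"
    unfolding Conv_def real_nat orb_def by (rule Set.set_eqI) simp
  also have "\<dots> \<in> sets N"
    by (intro sets.countable_INT sets.countable_UN sets.countable_INT' countableI_type image_subsetI predN2) auto
  finally show ?thesis .
qed

text \<open>The boundary need not have a countable base. But if a path converges to a point of
  \<open>U\<close>, then some shadow of one of its own positions, of integer depth, lies in
  \<open>U\<close> and contains that limit; there are only countably many such shadows.\<close>

lemma class_open_sets:
  assumes U: "bopen x0 U"
  shows "{w. Conv w \<and> bclass x0 (orb w) \<in> U} \<in> sets N"
proof -
  define S where "S = {(g :: 'g, r :: nat). bshadow (\<phi> g x0) (real r) \<subseteq> U}"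
  define E where "E z = {w. Conv w} \<inter> (\<Union>n::nat. \<Inter>k\<in>{n..}. {w. real (snd z) \<le> gprod x0 (\<phi> (fst z) x0) (\<phi> (w k) x0)})" for z :: "'g \<times> nat"
  have Es: "E z \<in> sets N" for z
    unfolding E_def
    by (intro sets.Int Conv_sets sets.countable_UN sets.countable_INT' countableI_type image_subsetI)
       (auto intro: predN2[of "\<lambda>a b. real (snd z) \<le> gprod x0 (\<phi> (fst z) x0) (\<phi> a x0)"])
  have "{w. Conv w \<and> bclass x0 (orb w) \<in> U} = (\<Union>z\<in>S. E z)"
  proof (intro equalityI subsetI)
    fix w assume w: "w \<in> {w. Conv w \<and> bclass x0 (orb w) \<in> U}"
    then have c: "Conv w" and u: "bclass x0 (orb w) \<in> U" by auto
    obtain r where r: "bnbhd x0 (bclass x0 (orb w)) r \<subseteq> U" using U u unfolding bopen_def by blast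
    obtain q :: nat where q: "r + \<delta> \<le> real q" using real_arch_simple by blast
    obtain m where m: "\<And>i j. i \<ge> m \<Longrightarrow> j \<ge> m \<Longrightarrow> real q \<le> gprod x0 (orb w i) (orb w j)"
      using c unfolding Conv_def conv_inf_def by blast
    have "\<eta> \<in> U" if e: "\<eta> \<in> bshadow (\<phi> (w m) x0) (real q)" for \<eta>
    proof -
      obtain ys N1 where ys: "converges_to x0 ys \<eta>" and N1: "\<And>j. j \<ge> N1 \<Longrightarrow> real q \<le> gprod x0 (orb w m) (ys j)"
        using e by (auto simp: bshadow_def orb_def)
      have "r \<le> gprod x0 (orb w i) (ys j)" if "i \<ge> max m N1" "j \<ge> max m N1" for i j
        using m[of i m] N1[of j] that q hyp[of x0 "orb w i" "orb w m" "ys j"] by auto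
      then have "\<eta> \<in> bnbhd x0 (bclass x0 (orb w)) r"
        using ys Conv_converges[OF c] converges_to_gbd[OF ys] unfolding bnbhd_def by blast
      then show ?thesis using r by blast
    qed
    then have "(w m, q) \<in> S" by (auto simp: S_def)
    moreover have "w \<in> E (w m, q)" using c m[of m] by (auto simp: E_def orb_def)
    ultimately show "w \<in> (\<Union>z\<in>S. E z)" by blast
  next
    fix w assume "w \<in> (\<Union>z\<in>S. E z)"
    then obtain z where z: "z \<in> S" "w \<in> E z" by blast
    define g where "g = fst z"
    define r where "r = snd z"
    have s: "bshadow (\<phi> g x0) (real r) \<subseteq> U" using z(1) by (auto simp: S_def g_def r_def)
    obtain n where c: "Conv w" and k: "\<forall>k\<ge>n. real r \<le> gprod x0 (\<phi> g x0) (\<phi> (w k) x0)"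
      using z(2) by (auto simp: E_def g_def r_def)
    have "bclass x0 (orb w) \<in> bshadow (\<phi> g x0) (real r)"
      using Conv_converges[OF c] k unfolding bshadow_def orb_def by blast
    then show "w \<in> {w. Conv w \<and> bclass x0 (orb w) \<in> U}" using s c by blast
  qed
  also have "\<dots> \<in> sets N" by (intro sets.countable_UN') (use Es in auto)
  finally show ?thesis .
qed

lemma AE_Conv: "AE \<omega> in M. Conv (rw G \<omega>)"
  using AE_conv_inf by (simp add: Conv_def orb_def)

definition bdefault :: "(nat \<Rightarrow> 'x) set" where "bdefault = (SOME \<xi>. \<xi> \<in> gbd x0)"

text \<open>Paths without a limit form a null set; the default value lies in \<open>gbd x0\<close>,
  as measurability into the boundary requires.\<close>

definition bnd :: "(nat \<Rightarrow> 'g) \<Rightarrow> (nat \<Rightarrow> 'x) set" where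
  "bnd w = (if Conv w then bclass x0 (orb w) else bdefault)"

lemma bclass_gbd: "Conv w \<Longrightarrow> bclass x0 (orb w) \<in> gbd x0"
  using converges_to_gbd[OF Conv_converges] .

lemma gbd_nonempty: "bdefault \<in> gbd x0"
proof -
  interpret P: prob_space M by (rule prob_space_M)
  have "\<exists>\<omega>. Conv (rw G \<omega>)"
  proof (rule ccontr)
    assume "\<not> ?thesis"
    then have "AE \<omega> in M. False" using AE_Conv by auto
    then show False using P.AE_False by simp
  qed
  then obtain \<xi> where "\<xi> \<in> gbd x0" using bclass_gbd by blast
  then show ?thesis unfolding bdefault_def by (rule someI)
qed

lemma bnd_measurable: "bnd \<in> N \<rightarrow>\<^sub>M bborel x0"
  unfolding bborel_def
proof (rule measurable_sigma_sets[OF sets_measure_of])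
  show "{U. bopen x0 U} \<subseteq> Pow (gbd x0)" "{U. bopen x0 U} \<subseteq> Pow (gbd x0)" by (auto simp: bopen_def)
  show "bnd \<in> space N \<rightarrow> gbd x0" using bclass_gbd gbd_nonempty by (auto simp: bnd_def)
  fix U assume "U \<in> {U. bopen x0 U}"
  then have U: "bopen x0 U" by simp
  have "bnd -` U \<inter> space N = {w. Conv w \<and> bclass x0 (orb w) \<in> U} \<union> (if bdefault \<in> U then UNIV - {w. Conv w} else {})"
    by (rule Set.set_eqI) (simp add: bnd_def)
  also have "\<dots> \<in> sets N"
    using class_open_sets[OF U] sets.compl_sets[OF Conv_sets] by auto
  finally show "bnd -` U \<inter> space N \<in> sets N" .
qed

definition cls :: "(nat \<Rightarrow> 'x) set set \<Rightarrow> (nat \<Rightarrow> 'g) set" where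
  "cls U = {w. good w \<and> Conv w \<and> bclass x0 (orb w) \<in> U}"

definition Bsig :: "(nat \<Rightarrow> 'g) measure" where
  "Bsig = sigma UNIV {cls U | U. bopen x0 U}"

lemma sets_Bsig: "sets Bsig = sigma_sets UNIV {cls U | U. bopen x0 U}"
  by (simp add: Bsig_def)

lemma cls_Bsig: "bopen x0 U \<Longrightarrow> cls U \<in> sets Bsig"
  unfolding sets_Bsig by (rule sigma_sets.Basic) blast

text \<open>Moving by \<open>x\<close> changes products at \<open>x0\<close> by at most the
  displacement of \<open>x0\<close>, so the radius is enlarged by that amount.\<close>

lemma bopen_translate:
  assumes U: "bopen x0 U" and x: "x \<in> carrier G"
  shows "bopen x0 {\<xi>\<in>gbd x0. bact \<phi> x \<xi> \<in> U}"
  unfolding bopen_def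
proof (intro conjI ballI)
  fix \<xi> assume xi: "\<xi> \<in> {\<xi>\<in>gbd x0. bact \<phi> x \<xi> \<in> U}"
  then obtain r where r: "bnbhd x0 (bact \<phi> x \<xi>) r \<subseteq> U" using U unfolding bopen_def by blast
  have tc: "converges_to x0 (\<phi> x \<circ> ys) (bact \<phi> x \<eta>)" if "converges_to x0 ys \<eta>" for ys \<eta>
    using that bact_bclass[OF x, of ys] conv_inf_isometry[OF act_isometry[OF x], of ys]
    by (auto simp: converges_to_def)
  have "\<eta> \<in> {\<xi>\<in>gbd x0. bact \<phi> x \<xi> \<in> U}" if e: "\<eta> \<in> bnbhd x0 \<xi> (r + dist x0 (\<phi> x x0))" for \<eta>
  proof -
    obtain xs ys n where c: "converges_to x0 xs \<xi>" "converges_to x0 ys \<eta>" and eg: "\<eta> \<in> gbd x0"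
      and n: "\<And>i j. i \<ge> n \<Longrightarrow> j \<ge> n \<Longrightarrow> r + dist x0 (\<phi> x x0) \<le> gprod x0 (xs i) (ys j)"
      using e unfolding bnbhd_def by blast
    have "r \<le> gprod x0 ((\<phi> x \<circ> xs) i) ((\<phi> x \<circ> ys) j)" if "i \<ge> n" "j \<ge> n" for i j
      using n[OF that] gprod_isometry_base[OF act_isometry[OF x], of x0 "xs i" "ys j"] by (simp add: abs_le_iff)
    then have "bact \<phi> x \<eta> \<in> bnbhd x0 (bact \<phi> x \<xi>) r"
      using tc[OF c(1)] tc[OF c(2)] converges_to_gbd unfolding bnbhd_def by blast
    then show ?thesis using r eg by blast
  qed
  then show "\<exists>r. bnbhd x0 \<xi> r \<subseteq> {\<xi>\<in>gbd x0. bact \<phi> x \<xi> \<in> U}" by blast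
qed auto

lemma cls_translate:
  assumes x: "x \<in> carrier G"
  shows "tr x -` cls U = cls {\<xi>\<in>gbd x0. bact \<phi> x \<xi> \<in> U}"
proof -
  have "tr x w \<in> cls U \<longleftrightarrow> w \<in> cls {\<xi>\<in>gbd x0. bact \<phi> x \<xi> \<in> U}" for w
  proof (cases "good w")
    case True
    then show ?thesis
      using good_tr[OF x True] Conv_tr[OF True x] bact_bclass[OF x, of "orb w"] bclass_gbd[of w]
      by (auto simp: cls_def orb_tr[OF True x] Conv_def)
  next
    case False
    then have "tr x w = w" by (simp add: tr_def)
    then show ?thesis using False by (simp add: cls_def)
  qed
  then show ?thesis by auto
qed

lemma inv_alg_Bsig: "inv_alg Bsig"
  unfolding inv_alg_def
proof (intro conjI ballI allI impI)
  show "space Bsig = UNIV" by (simp add: Bsig_def)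
  have "cls U \<in> sets N" if "bopen x0 U" for U
  proof -
    have "cls U = {w. good w} \<inter> {w. Conv w \<and> bclass x0 (orb w) \<in> U}" by (auto simp: cls_def)
    then show ?thesis using good_sets class_open_sets[OF that] by auto
  qed
  then have "{cls U | U. bopen x0 U} \<subseteq> sets N" by auto
  from sets.sigma_sets_subset[OF this] show "sets Bsig \<subseteq> sets N" by (simp add: sets_Bsig)
next
  fix E w assume "E \<in> sets Bsig" and w: "good w"
  then have "E \<in> sigma_sets UNIV {cls U | U. bopen x0 U}" by (simp add: sets_Bsig)
  then show "w \<in> E \<longleftrightarrow> w \<circ> Suc \<in> E"
  proof induction
    case (Basic a)
    then obtain U where a: "a = cls U" by blast
    have "good (w \<circ> Suc)" using w by (simp add: good_def)
    moreover have "w \<circ> Suc \<in> cls U \<longleftrightarrow> good (w \<circ> Suc) \<and> conv_inf x0 (orb w) \<and> bclass x0 (orb w \<circ> Suc) \<in> U"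
      unfolding cls_def mem_Collect_eq Conv_def orb_Suc conv_inf_Suc ..
    moreover have "w \<in> cls U \<longleftrightarrow> good w \<and> conv_inf x0 (orb w) \<and> bclass x0 (orb w) \<in> U"
      unfolding cls_def mem_Collect_eq Conv_def ..
    ultimately show ?case using w bclass_Suc[of "orb w"] unfolding a by metis
  qed auto
next
  fix E x assume "E \<in> sets Bsig" and x: "x \<in> carrier G"
  then have "E \<in> sigma_sets UNIV {cls U | U. bopen x0 U}" by (simp add: sets_Bsig)
  then show "tr x -` E \<in> sets Bsig"
  proof induction
    case (Basic a)
    then obtain U where a: "a = cls U" "bopen x0 U" by blast
    then show ?case using cls_Bsig[OF bopen_translate[OF a(2) x]] by (simp add: cls_translate[OF x])
  next
    case Empty
    then show ?case by simp
  next
    case (Compl a)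
    have "tr x -` (UNIV - a) = space Bsig - tr x -` a" by (auto simp: Bsig_def)
    then show ?case using Compl by (simp add: sets.compl_sets)
  next
    case (Union a)
    have "tr x -` (\<Union>i. a i) = (\<Union>i. tr x -` a i)" by auto
    then show ?case using Union by auto
  qed
qed

text \<open>Passing to preimages respects complements and countable unions, so the claim for open
  sets extends along the generation of \<open>Bsig\<close>; on convergent good paths the limit lies
  in \<open>gbd x0\<close>, as complements demand.\<close>

lemma Bsig_boundary:
  assumes "E \<in> sets Bsig"
  shows "\<exists>B\<in>sets (bborel x0). \<forall>w. good w \<longrightarrow> Conv w \<longrightarrow> (w \<in> E \<longleftrightarrow> bclass x0 (orb w) \<in> B)"
proof -
  have "E \<in> sigma_sets UNIV {cls U | U. bopen x0 U}" using assms by (simp add: sets_Bsig)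
  then show ?thesis
  proof induction
    case (Basic a)
    then obtain U where a: "a = cls U" "bopen x0 U" by blast
    show ?case by (rule bexI[OF _ bopen_bborel[OF a(2)]]) (simp add: a cls_def)
  next
    case Empty
    show ?case by (rule bexI[of _ "{}"]) auto
  next
    case (Compl a)
    then obtain B where B: "B \<in> sets (bborel x0)" "\<forall>w. good w \<longrightarrow> Conv w \<longrightarrow> (w \<in> a \<longleftrightarrow> bclass x0 (orb w) \<in> B)" by blast
    show ?case
      by (rule bexI[of _ "space (bborel x0) - B"]) (use B bclass_gbd sets.compl_sets[OF B(1)] in \<open>auto simp: space_bborel\<close>)
  next
    case (Union a)
    then have "\<forall>i. \<exists>B. B \<in> sets (bborel x0) \<and> (\<forall>w. good w \<longrightarrow> Conv w \<longrightarrow> (w \<in> a i \<longleftrightarrow> bclass x0 (orb w) \<in> B))" by blast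
    then obtain B where B: "\<And>i. B i \<in> sets (bborel x0)" "\<And>i w. good w \<Longrightarrow> Conv w \<Longrightarrow> (w \<in> a i \<longleftrightarrow> bclass x0 (orb w) \<in> B i)"
      by metis
    show ?case by (rule bexI[of _ "\<Union>i. B i"]) (use B in auto)
  qed
qed

text \<open>Invariance is tested on \<open>good\<close> paths, where \<open>tr\<close> commutes with
  the shift, so that the algebra is stable under translation; it contains all strictly invariant
  events.\<close>

definition Isig :: "(nat \<Rightarrow> 'g) measure" where
  "Isig = sigma UNIV {E\<in>sets N. \<forall>w. good w \<longrightarrow> (w \<in> E \<longleftrightarrow> w \<circ> Suc \<in> E)}"

lemma sets_Isig: "sets Isig = {E\<in>sets N. \<forall>w. good w \<longrightarrow> (w \<in> E \<longleftrightarrow> w \<circ> Suc \<in> E)}"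
proof -
  have "sigma_algebra UNIV {E\<in>sets N. \<forall>w. good w \<longrightarrow> (w \<in> E \<longleftrightarrow> w \<circ> Suc \<in> E)}"
    unfolding sigma_algebra_iff2
  proof (intro conjI ballI allI impI)
    fix s assume "s \<in> {E\<in>sets N. \<forall>w. good w \<longrightarrow> (w \<in> E \<longleftrightarrow> w \<circ> Suc \<in> E)}"
    then show "UNIV - s \<in> {E\<in>sets N. \<forall>w. good w \<longrightarrow> (w \<in> E \<longleftrightarrow> w \<circ> Suc \<in> E)}"
      using sets.compl_sets[of s N] by auto
  qed auto
  then show ?thesis unfolding Isig_def by (subst sets_measure_of) (auto simp: sigma_algebra.sigma_sets_eq)
qed

lemma tr_measurable: "x \<in> carrier G \<Longrightarrow> tr x \<in> N \<rightarrow>\<^sub>M N"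
proof -
  have "(\<lambda>w. (\<lambda>n. x \<otimes> w n)) \<in> N \<rightarrow>\<^sub>M N"
    by (rule measurable_PiM_single') (auto simp: PiE_def intro: measurable_compose[OF measurable_component_singleton])
  then have "(\<lambda>w. if good w then (\<lambda>n. x \<otimes> w n) else w) \<in> N \<rightarrow>\<^sub>M N"
    using good_sets by (intro measurable_If) auto
  then show ?thesis by (simp add: tr_def[abs_def])
qed

lemma inv_alg_Isig: "inv_alg Isig"
  unfolding inv_alg_def
proof (intro conjI ballI allI impI)
  show "space Isig = UNIV" by (simp add: Isig_def)
  show "sets Isig \<subseteq> sets N" by (auto simp: sets_Isig)
  fix E w assume "E \<in> sets Isig" "good w"
  then show "w \<in> E \<longleftrightarrow> w \<circ> Suc \<in> E" by (auto simp: sets_Isig)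
next
  fix E x assume E: "E \<in> sets Isig" and x: "x \<in> carrier G"
  have "tr x -` E \<in> sets N"
    using measurable_sets[OF tr_measurable[OF x], of E] E by (auto simp: sets_Isig)
  moreover have "tr x w \<in> E \<longleftrightarrow> tr x (w \<circ> Suc) \<in> E" if "good w" for w
    using E good_tr[OF x that] tr_comp_Suc[OF that, of x] by (auto simp: sets_Isig)
  ultimately show "tr x -` E \<in> sets Isig" by (auto simp: sets_Isig)
qed

lemma Bsig_Isig: "sets Bsig \<subseteq> sets Isig"
  using inv_alg_Bsig unfolding sets_Isig inv_alg_def by auto

end

section \<open>Pivotal times and the code\<close>

lemma info_antimono:
  assumes "x \<le> y" "y \<le> 1"
  shows "info y \<le> info x"
proof (cases "x = 0")
  case False
  have f: "x < \<top>" "y < \<top>" using assms ennreal_one_less_top order_le_less_trans by (blast, blast)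
  obtain a b where ab: "x = ennreal a" "y = ennreal b" "0 \<le> a" "0 \<le> b"
    using f by (metis ennreal_enn2real enn2real_nonneg)
  have "0 < a" "a \<le> b" using ab False assms by (auto simp: ennreal_eq_0_iff less_le)
  then show ?thesis using ab by (auto simp: info_def intro!: ennreal_leI)
qed (simp add: info_def)

lemma info_ennreal: "0 < r \<Longrightarrow> info (ennreal r) = ennreal (- ln r)"
  by (simp add: info_def)

lemma info_prod_list:
  assumes "\<And>x. x \<in> set l \<Longrightarrow> x \<le> 1"
  shows "prod_list l \<le> 1 \<and> info (prod_list l) = sum_list (map info l)"
  using assms
proof (induction l)
  case Nil
  then show ?case by (simp add: info_def)
next
  case (Cons x l)
  then have p: "x \<le> 1" "prod_list l \<le> 1" "info (prod_list l) = sum_list (map info l)" by auto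
  have "x * prod_list l \<le> 1 * 1" by (intro mult_mono p) auto
  then show ?case using p by (simp add: info_mult)
qed

lemma pmf_finite_approx:
  fixes p :: "'a::countable pmf"
  assumes "\<eta> > 0"
  shows "\<exists>F. finite F \<and> measure_pmf.prob p (- F) \<le> \<eta>"
proof -
  obtain r where r: "measure_pmf.prob p {g. real (to_nat g) > r} \<le> \<eta>"
    using pmf_tail[OF assms, of 0 p "\<lambda>g. real (to_nat g)"] by blast
  define F where "F = {g::'a. real (to_nat g) \<le> r}"
  have "to_nat ` F \<subseteq> {..nat \<lceil>r\<rceil>}" by (auto simp: F_def) linarith
  then have "finite (to_nat ` F)" using finite_subset by blast
  then have "finite F" by (rule finite_imageD) (auto simp: inj_on_def)
  moreover have "- F = {g. real (to_nat g) > r}" by (auto simp: F_def)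
  ultimately show ?thesis using r by auto
qed

text \<open>All coordinates have the same law, so one truncation level serves every time
  \<open>t\<close>, however \<open>E\<close> depends on the increments. Applied to the information
  of an increment, it makes rarely recorded increments cheap.\<close>

lemma iid_uniformly_integrable:
  fixes X :: "'a::countable \<Rightarrow> ennreal"
  assumes fin: "(\<integral>\<^sup>+g. X g \<partial>measure_pmf \<mu>) < \<top>" and c: "(c::real) > 0"
  shows "\<exists>e>0. \<forall>t E. E \<in> sets (iid \<mu>) \<longrightarrow> emeasure (iid \<mu>) E \<le> ennreal e \<longrightarrow>
     (\<integral>\<^sup>+\<omega>. X (\<omega> t) * indicator E \<omega> \<partial>iid \<mu>) \<le> ennreal c"
proof -
  define f where "f i g = min (X g) (ennreal (real i))" for i :: nat and g
  have sup: "(SUP i. f i g) = X g" for g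
  proof (rule antisym)
    show "(SUP i. f i g) \<le> X g" by (intro SUP_least) (simp add: f_def)
    show "X g \<le> (SUP i. f i g)"
    proof (cases "X g")
      case (real r)
      obtain i :: nat where "r \<le> real i" using real_arch_simple by blast
      then have "f i g = X g" using real by (simp add: f_def min_def ennreal_leI)
      then show ?thesis by (metis SUP_upper UNIV_I)
    next
      case top
      have "f i g = ennreal (real i)" for i using top by (simp add: f_def)
      then have "(SUP i. f i g) = (SUP i. of_nat i)" by (simp add: ennreal_of_nat_eq_real_of_nat)
      then have "(SUP i. f i g) = \<top>" by (simp only: ennreal_SUP_of_nat_eq_top)
      then show ?thesis by (simp only: top_greatest)
    qed
  qed
  let ?I = "\<lambda>h. \<integral>\<^sup>+g. h g \<partial>measure_pmf \<mu>"
  have "incseq f"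
    unfolding incseq_def f_def le_fun_def by (intro allI impI min.mono ennreal_leI) auto
  then have mono: "?I X = (SUP i. ?I (f i))"
    using nn_integral_monotone_convergence_SUP[of f "measure_pmf \<mu>"] by (simp add: sup)
  have "\<exists>i. ?I X \<le> ?I (f i) + ennreal (c / 2)"
  proof (rule ccontr)
    assume "\<not> ?thesis"
    then have lt: "?I (f i) + ennreal (c / 2) \<le> ?I X" for i by (meson linear)
    have "(SUP i. ?I (f i)) + ennreal (c / 2) \<le> ?I X"
      by (subst ennreal_SUP_add_left[symmetric]) (auto intro!: SUP_least lt)
    then have "?I X + ennreal (c / 2) \<le> ?I X + 0" unfolding mono[symmetric] by simp
    then have "ennreal (c / 2) \<le> 0" using fin by (subst (asm) ennreal_add_left_cancel_le) (auto simp: less_top)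
    then show False using c by simp
  qed
  then obtain i where i: "?I X \<le> ?I (f i) + ennreal (c / 2)" by blast
  have fX: "f i g \<le> X g" for g by (simp add: f_def)
  have fle: "?I (f i) \<le> ?I X" by (intro nn_integral_mono fX)
  have rest: "?I (\<lambda>g. X g - f i g) \<le> ennreal (c / 2)"
  proof -
    have "?I (\<lambda>g. X g - f i g) = ?I X - ?I (f i)"
      by (rule nn_integral_diff) (use fX fle fin in \<open>auto simp: top_unique\<close>)
    also have "\<dots> \<le> ennreal (c / 2)" using i fin fle by (auto simp: ennreal_minus_le_iff add.commute)
    finally show ?thesis .
  qed
  \<comment> \<open>The part of \<open>X\<close> below the level \<open>i\<close> contributes at
    most \<open>real i * e\<close>, which is at most \<open>c / 2\<close>; the added 1 keeps the
    denominator positive. The part above the level contributes the other half.\<close>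
  define e where "e = c / (2 * (real i + 1))"
  have e: "e > 0" using c by (simp add: e_def)
  have "(\<integral>\<^sup>+\<omega>. X (\<omega> t) * indicator E \<omega> \<partial>iid \<mu>) \<le> ennreal c"
    if E: "E \<in> sets (iid \<mu>)" and Ee: "emeasure (iid \<mu>) E \<le> ennreal e" for t E
  proof -
    have m: "(\<lambda>\<omega>. X (\<omega> t) - f i (\<omega> t)) \<in> borel_measurable (iid \<mu>)"
      by (rule measurable_compose[OF measurable_iid_coord]) simp
    have "(\<integral>\<^sup>+\<omega>. X (\<omega> t) * indicator E \<omega> \<partial>iid \<mu>)
       \<le> (\<integral>\<^sup>+\<omega>. ennreal (real i) * indicator E \<omega> + (X (\<omega> t) - f i (\<omega> t)) \<partial>iid \<mu>)"
    proof (intro nn_integral_mono)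
      fix \<omega>
      have "X (\<omega> t) = f i (\<omega> t) + (X (\<omega> t) - f i (\<omega> t))" using fX[of "\<omega> t"] by (simp add: add_diff_inverse_ennreal)
      also have "\<dots> \<le> ennreal (real i) + (X (\<omega> t) - f i (\<omega> t))" by (intro add_right_mono) (simp add: f_def)
      finally show "X (\<omega> t) * indicator E \<omega> \<le> ennreal (real i) * indicator E \<omega> + (X (\<omega> t) - f i (\<omega> t))"
        by (simp add: indicator_def)
    qed
    also have "\<dots> = (\<integral>\<^sup>+\<omega>. ennreal (real i) * indicator E \<omega> \<partial>iid \<mu>) + (\<integral>\<^sup>+\<omega>. X (\<omega> t) - f i (\<omega> t) \<partial>iid \<mu>)"
      by (rule nn_integral_add[OF _ m]) (use E in simp)
    also have "\<dots> = ennreal (real i) * emeasure (iid \<mu>) E + ?I (\<lambda>g. X g - f i g)"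
      using E nn_integral_coord[where h = "\<lambda>g. X g - f i g" and i = t and \<mu> = \<mu>] by (simp add: nn_integral_cmult_indicator)
    also have "\<dots> \<le> ennreal (real i) * ennreal e + ennreal (c / 2)"
      by (intro add_mono rest mult_left_mono Ee) simp
    also have "\<dots> = ennreal (real i * e + c / 2)" using c e by (simp add: ennreal_mult)
    also have "\<dots> \<le> ennreal c"
    proof (rule ennreal_leI)
      have "real i * e \<le> (real i + 1) * e" using e by simp
      also have "\<dots> = c / 2" by (simp add: e_def field_simps)
      finally show "real i * e + c / 2 \<le> c" by simp
    qed
    finally show ?thesis .
  qed
  then show ?thesis using e by blast
qed

section \<open>Pivotal times, the record and the candidates\<close>

context rand_walk
begin

text \<open>Times from which the walk does not backtrack along the way from the base point.\<close>

definition piv :: "real \<Rightarrow> (nat \<Rightarrow> 'g) \<Rightarrow> nat \<Rightarrow> bool" where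
  "piv D \<omega> t \<longleftrightarrow> (\<forall>k. gprod (\<phi> (rw G \<omega> t) x0) x0 (\<phi> (rw G \<omega> (t + k)) x0) < D)"

lemma piv_sets: "{\<omega>. piv D \<omega> t} \<in> sets M"
proof -
  have "Measurable.pred M (\<lambda>\<omega>. \<forall>k. gprod (\<phi> (rw G \<omega> t) x0) x0 (\<phi> (rw G \<omega> (t + k)) x0) < D)"
    by (rule pred_intros_countable) (rule pred_rw2)
  then show ?thesis by (simp add: pred_def piv_def)
qed

lemma not_piv_sets: "{\<omega>. \<not> piv D \<omega> t} \<in> sets M"
proof -
  have "{\<omega>. \<not> piv D \<omega> t} = space M - {\<omega>. piv D \<omega> t}" by auto
  then show ?thesis using sets.compl_sets[OF piv_sets] by simp
qed

text \<open>Seen from the position at time \<open>t\<close>, a failure means that the fresh walk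
  enters a deep shadow of \<open>\<phi> (inv (rw G \<omega> t)) x0\<close>;
  \<open>shadow_hit\<close> is uniform in that point.\<close>

lemma piv_likely:
  assumes eps: "\<epsilon> > 0"
  shows "\<exists>D>0. \<forall>t. emeasure M {\<omega>. \<not> piv D \<omega> t} \<le> ennreal \<epsilon>"
proof -
  interpret P: prob_space M by (rule prob_space_M)
  obtain D0 where D0: "\<And>z. emeasure M {\<omega>. \<exists>k. D0 \<le> gprod x0 z (\<phi> (rw G \<omega> k) x0)} \<le> ennreal \<epsilon>"
    using shadow_hit[OF eps] by blast
  define D where "D = \<bar>D0\<bar> + 1"
  have ms: "{\<omega>. \<exists>k. D0 \<le> gprod x0 z (\<phi> (rw G \<omega> k) x0)} \<in> sets M" for z
  proof -
    have "Measurable.pred M (\<lambda>\<omega>. \<exists>k. D0 \<le> gprod x0 z (\<phi> (rw G \<omega> k) x0))"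
      by (rule pred_intros_countable) (rule pred_rw)
    then show ?thesis by (simp add: pred_def)
  qed
  have "emeasure M {\<omega>. \<not> piv D \<omega> t} \<le> ennreal \<epsilon>" for t
  proof -
    have "emeasure M {\<omega>. \<not> piv D \<omega> t} = (\<integral>\<^sup>+\<omega>. indicator {\<omega>. \<not> piv D \<omega> t} \<omega> \<partial>M)"
      using not_piv_sets by simp
    also have "\<dots> \<le> (\<integral>\<^sup>+\<omega>. indicator {\<omega>'. \<exists>k. D0 \<le> gprod x0 (\<phi> (inv (rw G \<omega> t)) x0) (\<phi> (rw G \<omega>' k) x0)} (shift t \<omega>) \<partial>M)"
    proof (rule nn_integral_mono_AE, use AE_inC in eventually_elim)
      fix \<omega> assume w: "inC \<omega>"
      have "\<exists>k. D0 \<le> gprod x0 (\<phi> (inv (rw G \<omega> t)) x0) (\<phi> (rw G (shift t \<omega>) k) x0)" if "\<not> piv D \<omega> t"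
      proof -
        obtain k where "D \<le> gprod (\<phi> (rw G \<omega> t) x0) x0 (\<phi> (rw G \<omega> (t + k)) x0)"
          using \<open>\<not> piv D \<omega> t\<close> by (auto simp: piv_def not_less)
        then have "D \<le> gprod x0 (\<phi> (inv (rw G \<omega> t)) x0) (\<phi> (rw G (shift t \<omega>) k) x0)"
          using gprod_orbit[of "rw G \<omega> t" "rw G (shift t \<omega>) k" x0] w inC_shift[OF w] by (simp add: rw_add)
        then show ?thesis by (intro exI[of _ k]) (simp add: D_def)
      qed
      then show "indicator {\<omega>. \<not> piv D \<omega> t} \<omega> \<le> (indicator {\<omega>'. \<exists>k. D0 \<le> gprod x0 (\<phi> (inv (rw G \<omega> t)) x0) (\<phi> (rw G \<omega>' k) x0)} (shift t \<omega>) :: ennreal)"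
        by (simp add: indicator_def)
    qed
    also have "\<dots> = (\<integral>\<^sup>+\<omega>. \<integral>\<^sup>+\<omega>'. indicator {\<omega>'. \<exists>k. D0 \<le> gprod x0 (\<phi> (inv (rw G \<omega> t)) x0) (\<phi> (rw G \<omega>' k) x0)} \<omega>' \<partial>M \<partial>M)"
      by (rule markov[where X = "\<lambda>\<omega>. rw G \<omega> t" and F = "\<lambda>x. indicator {\<omega>'. \<exists>k. D0 \<le> gprod x0 (\<phi> (inv x) x0) (\<phi> (rw G \<omega>' k) x0)}"])
         (use ms in \<open>auto intro: rw_cong\<close>)
    also have "\<dots> = (\<integral>\<^sup>+\<omega>. emeasure M {\<omega>'. \<exists>k. D0 \<le> gprod x0 (\<phi> (inv (rw G \<omega> t)) x0) (\<phi> (rw G \<omega>' k) x0)} \<partial>M)"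
      using ms by simp
    also have "\<dots> \<le> (\<integral>\<^sup>+\<omega>. ennreal \<epsilon> \<partial>M)" by (intro nn_integral_mono D0)
    finally show ?thesis using P.emeasure_space_1 by simp
  qed
  moreover have "D > 0" by (simp add: D_def)
  ultimately show ?thesis by blast
qed

text \<open>The increment at \<open>t\<close> leads to time \<open>Suc t\<close>, so it is the end
  of the step that must be pivotal; an unrecorded step is short and ends at a pivotal position, from
  which \<open>dr\<close> starts anew.\<close>

definition bad :: "real \<Rightarrow> real \<Rightarrow> (nat \<Rightarrow> 'g) \<Rightarrow> nat \<Rightarrow> bool" where
  "bad D R \<omega> t \<longleftrightarrow> \<not> piv D \<omega> (Suc t) \<or> R < dist x0 (\<phi> (\<omega> t) x0)"

definition recd :: "real \<Rightarrow> real \<Rightarrow> (nat \<Rightarrow> 'g) \<Rightarrow> nat \<Rightarrow> nat \<Rightarrow> 'g option list" where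
  "recd D R \<omega> t n = map (\<lambda>t. if bad D R \<omega> t then Some (\<omega> t) else None) [t..<n]"

text \<open>The total displacement of the maximal runs of recorded increments; the accumulator is the product of the
  current run.\<close>

fun dr :: "'g \<Rightarrow> 'g option list \<Rightarrow> real" where
  "dr a [] = dist x0 (\<phi> a x0)"
| "dr a (None # l) = dist x0 (\<phi> a x0) + dr \<one> l"
| "dr a (Some g # l) = dr (a \<otimes> g) l"

lemma recd_Suc: "t < n \<Longrightarrow> recd D R \<omega> t n = (if bad D R \<omega> t then Some (\<omega> t) else None) # recd D R \<omega> (Suc t) n"
  by (simp add: recd_def upt_conv_Cons)

text \<open>The accumulator holds the displacement since the pivotal time \<open>a\<close>. From a
  pivotal position distances to \<open>x0\<close> add up with an error of at most
  \<open>2 * D\<close>, and an unrecorded step changes them by at most \<open>R\<close>; both errors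
  arise at most once per step, and \<open>2 * D\<close> once more at the end.\<close>

lemma dr_bound:
  assumes w: "inC \<omega>" and D: "0 < D" and R: "0 \<le> R"
  shows "a \<le> t \<Longrightarrow> t \<le> n \<Longrightarrow> piv D \<omega> a \<Longrightarrow>
    \<bar>dist x0 (\<phi> (rw G \<omega> n) x0) - dist x0 (\<phi> (rw G \<omega> a) x0) - dr (inv (rw G \<omega> a) \<otimes> rw G \<omega> t) (recd D R \<omega> t n)\<bar>
      \<le> 2 * D + real (n - t) * (2 * D + R)"
proof (induction "n - t" arbitrary: t a)
  have c: "rw G \<omega> k \<in> carrier G" for k using w by simp
  have step: "\<bar>dist x0 (\<phi> (rw G \<omega> t) x0) - dist x0 (\<phi> (rw G \<omega> a) x0) - dist x0 (\<phi> (inv (rw G \<omega> a) \<otimes> rw G \<omega> t) x0)\<bar> \<le> 2 * D"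
    if "a \<le> t" "piv D \<omega> a" for a t
  proof -
    have "gprod (\<phi> (rw G \<omega> a) x0) x0 (\<phi> (rw G \<omega> (a + (t - a))) x0) < D" using that(2) by (simp only: piv_def)
    then have "gprod (\<phi> (rw G \<omega> a) x0) x0 (\<phi> (rw G \<omega> t) x0) < D" using that(1) by simp
    moreover have "0 \<le> gprod (\<phi> (rw G \<omega> a) x0) x0 (\<phi> (rw G \<omega> t) x0)" by (rule gprod_nonneg)
    moreover have "dist x0 (\<phi> (inv (rw G \<omega> a) \<otimes> rw G \<omega> t) x0) = dist (\<phi> (rw G \<omega> a) x0) (\<phi> (rw G \<omega> t) x0)"
      using dist_act_inv[of "rw G \<omega> a" x0 "\<phi> (rw G \<omega> t) x0"] c by (simp add: act_mult)
    ultimately show ?thesis by (simp add: gprod_def dist_commute abs_le_iff)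
  qed
  {
    case 0
    then have "t = n" by simp
    then show ?case using step[of a n] 0 by (simp add: recd_def)
  next
    case (Suc d)
    then have tn: "t < n" "d = n - Suc t" by auto
    have ws: "rw G \<omega> (Suc t) = rw G \<omega> t \<otimes> \<omega> t" "\<omega> t \<in> carrier G" using w by (auto simp: inC_def)
    have nt: "real (n - t) = real (n - Suc t) + 1" using tn by simp
    show ?case
    proof (cases "bad D R \<omega> t")
      case True
      have "inv (rw G \<omega> a) \<otimes> rw G \<omega> t \<otimes> \<omega> t = inv (rw G \<omega> a) \<otimes> rw G \<omega> (Suc t)"
        using c ws by (simp add: m_assoc)
      then have "\<bar>dist x0 (\<phi> (rw G \<omega> n) x0) - dist x0 (\<phi> (rw G \<omega> a) x0) - dr (inv (rw G \<omega> a) \<otimes> rw G \<omega> t) (recd D R \<omega> t n)\<bar>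
          \<le> 2 * D + real (n - Suc t) * (2 * D + R)"
        using Suc.hyps(1)[OF tn(2), of a] Suc.prems tn True by (simp add: recd_Suc del: rw.simps)
      then show ?thesis using D R by (simp add: nt algebra_simps)
    next
      case False
      then have pv: "piv D \<omega> (Suc t)" and small: "dist x0 (\<phi> (\<omega> t) x0) \<le> R" by (auto simp: bad_def)
      have "inv (rw G \<omega> (Suc t)) \<otimes> rw G \<omega> (Suc t) = \<one>" using c[of "Suc t"] by (rule l_inv)
      then have ih: "\<bar>dist x0 (\<phi> (rw G \<omega> n) x0) - dist x0 (\<phi> (rw G \<omega> (Suc t)) x0) - dr \<one> (recd D R \<omega> (Suc t) n)\<bar>
          \<le> 2 * D + real (n - Suc t) * (2 * D + R)"
        using Suc.hyps(1)[OF tn(2), of "Suc t"] pv tn by (simp del: rw.simps)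
      have "dist (\<phi> (rw G \<omega> t) x0) (\<phi> (rw G \<omega> (Suc t)) x0) \<le> R"
        using small act_isometry[OF c[of t], of x0 "\<phi> (\<omega> t) x0"] ws c by (simp add: act_mult)
      then have d: "\<bar>dist x0 (\<phi> (rw G \<omega> (Suc t)) x0) - dist x0 (\<phi> (rw G \<omega> t) x0)\<bar> \<le> R"
        using dist_triangle[of x0 "\<phi> (rw G \<omega> (Suc t)) x0" "\<phi> (rw G \<omega> t) x0"]
          dist_triangle[of x0 "\<phi> (rw G \<omega> t) x0" "\<phi> (rw G \<omega> (Suc t)) x0"]
        by (simp add: dist_commute abs_le_iff del: rw.simps)
      have r: "dr (inv (rw G \<omega> a) \<otimes> rw G \<omega> t) (recd D R \<omega> t n) = dist x0 (\<phi> (inv (rw G \<omega> a) \<otimes> rw G \<omega> t) x0) + dr \<one> (recd D R \<omega> (Suc t) n)"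
        using tn False by (simp add: recd_Suc)
      have "2 * D + real (n - t) * (2 * D + R) = (2 * D + real (n - Suc t) * (2 * D + R)) + 2 * D + R"
        by (simp add: nt algebra_simps)
      then show ?thesis using ih d step[of a t] Suc.prems unfolding r by linarith
    qed
  }
qed

lemma dr_recd:
  assumes w: "inC \<omega>" and D: "0 < D" and R: "0 \<le> R"
  shows "\<bar>dist x0 (\<phi> (rw G \<omega> n) x0) - dr \<one> (recd D R \<omega> 0 n)\<bar> \<le> (real n + 1) * (2 * D + R)"
proof -
  \<comment> \<open>At time 0 the product is taken at \<open>x0\<close> with \<open>x0\<close>
    itself, hence is 0.\<close>
  have "piv D \<omega> 0" using D by (simp add: piv_def act_one gprod_def)
  then have "\<bar>dist x0 (\<phi> (rw G \<omega> n) x0) - dist x0 (\<phi> (rw G \<omega> 0) x0) - dr (inv (rw G \<omega> 0) \<otimes> rw G \<omega> 0) (recd D R \<omega> 0 n)\<bar>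
      \<le> 2 * D + real (n - 0) * (2 * D + R)"
    by (intro dr_bound[OF w D R]) auto
  then show ?thesis using R by (simp add: act_one algebra_simps)
qed

text \<open>Says that \<open>\<phi> x x0\<close> lies within about \<open>D\<close> of the way from
  \<open>x0\<close> to the limit of \<open>w\<close>. Using the open version of the shadow makes it
  an event of \<open>Bsig\<close>.\<close>

definition near :: "real \<Rightarrow> 'g \<Rightarrow> (nat \<Rightarrow> 'g) \<Rightarrow> bool" where
  "near D x w \<longleftrightarrow> w \<in> cls (oshadow (\<phi> x x0) (dist x0 (\<phi> x x0) - D))"

lemma near_sets: "{w. near D x w} \<in> sets Bsig"
  using cls_Bsig[OF bopen_oshadow] by (simp add: near_def)

lemma near_gprod:
  assumes "near D x w"
  shows "\<exists>N. \<forall>j\<ge>N. gprod (\<phi> x x0) x0 (orb w j) \<le> D + \<delta>"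
proof -
  have c: "Conv w" and s: "bclass x0 (orb w) \<in> bshadow (\<phi> x x0) (dist x0 (\<phi> x x0) - D)"
    using assms oshadow_subset by (auto simp: near_def cls_def)
  obtain N where "\<And>j. j \<ge> N \<Longrightarrow> dist x0 (\<phi> x x0) - D - \<delta> \<le> gprod x0 (\<phi> x x0) (orb w j)"
    using bshadow_eventually[OF s Conv_converges[OF c]] by blast
  then have "gprod (\<phi> x x0) x0 (orb w j) \<le> D + \<delta>" if "j \<ge> N" for j
    using that gprod_swap[of x0 "\<phi> x x0" "orb w j"] by fastforce
  then show ?thesis by blast
qed

text \<open>Not backtracking after time \<open>t\<close> puts all later positions, hence the limit,
  into the shadow of the position at \<open>t\<close>; the loss of \<open>\<delta>\<close> comes
  from passing to the open shadow.\<close>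

lemma piv_near:
  assumes w: "inC \<omega>" and c: "Conv (rw G \<omega>)" and p: "piv D \<omega> t"
  shows "near (D + \<delta>) (rw G \<omega> t) (rw G \<omega>)"
proof -
  let ?x = "\<phi> (rw G \<omega> t) x0"
  have "dist x0 ?x - D \<le> gprod x0 ?x (orb (rw G \<omega>) j)" if "j \<ge> t" for j
  proof -
    have "gprod ?x x0 (\<phi> (rw G \<omega> (t + (j - t))) x0) < D" using p by (simp only: piv_def)
    then show ?thesis using that gprod_swap[of x0 ?x "orb (rw G \<omega>) j"] by (simp add: orb_def)
  qed
  then have "bclass x0 (orb (rw G \<omega>)) \<in> bshadow ?x (dist x0 ?x - D)"
    using Conv_converges[OF c] unfolding bshadow_def by blast
  then have "bclass x0 (orb (rw G \<omega>)) \<in> oshadow ?x (dist x0 ?x - (D + \<delta>))"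
    using bshadow_subset_oshadow[of ?x "dist x0 ?x - (D + \<delta>)"] by (auto simp: algebra_simps)
  then show ?thesis using c inC_good[OF w] by (simp add: near_def cls_def)
qed

text \<open>The elements \<open>x\<close> and \<open>x \<otimes> v\<close> stand for the positions
  at times n and n + m; the increment \<open>v\<close> between them is not encoded, only confined to
  the set \<open>\<Phi>\<close>.\<close>

definition cand :: "real \<Rightarrow> 'g set \<Rightarrow> 'g \<Rightarrow> (nat \<Rightarrow> 'g) \<Rightarrow> bool" where
  "cand D \<Phi> x w \<longleftrightarrow> x \<in> carrier G \<and> (\<exists>v\<in>\<Phi>. near D x w \<and> near D (x \<otimes> v) w)"

lemma cand_sets:
  assumes "finite \<Phi>"
  shows "{w. cand D \<Phi> x w} \<in> sets Bsig"
proof (cases "x \<in> carrier G")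
  case True
  then have "{w. cand D \<Phi> x w} = (\<Union>v\<in>\<Phi>. {w. near D x w} \<inter> {w. near D (x \<otimes> v) w})" by (auto simp: cand_def)
  also have "\<dots> \<in> sets Bsig" using assms by (intro sets.finite_UN sets.Int near_sets) auto
  finally show ?thesis .
qed (simp add: cand_def)

text \<open>Two candidates at the same distances from the base point differ by an element of a coarse stabilizer,
  so the WPD property bounds their number.\<close>

lemma card_cand:
  assumes Phi: "finite \<Phi>" "\<Phi> \<subseteq> carrier G"
    and st: "\<And>v. v \<in> \<Phi> \<Longrightarrow> finite (stabK G \<phi> (1 + 2 * (D + \<delta>) + 2 * \<delta>) x0 (\<phi> v x0))"
  shows "\<exists>c s. 0 \<le> c \<and> 0 \<le> s \<and> (\<forall>w y L. 0 \<le> L \<longrightarrow>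
     finite {x. cand D \<Phi> x w \<and> \<bar>dist x0 (\<phi> x x0) - y\<bar> \<le> L} \<and>
     real (card {x. cand D \<Phi> x w \<and> \<bar>dist x0 (\<phi> x x0) - y\<bar> \<le> L}) \<le> c * (2 * (L + s) + 3)\<^sup>2)"
proof -
  define K where "K = 1 + 2 * (D + \<delta>) + 2 * \<delta>"
  define m where "m = (\<Sum>v\<in>\<Phi>. card (stabK G \<phi> K x0 (\<phi> v x0)))"
  define s where "s = (\<Sum>v\<in>\<Phi>. dist x0 (\<phi> v x0))"
  have m: "card (stabK G \<phi> K x0 (\<phi> v x0)) \<le> m" if "v \<in> \<Phi>" for v
    unfolding m_def by (intro member_le_sum that Phi) auto
  have s: "dist x0 (\<phi> v x0) \<le> s" if "v \<in> \<Phi>" for v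
    unfolding s_def by (intro member_le_sum that Phi) auto
  have s0: "0 \<le> s" unfolding s_def by (intro sum_nonneg) simp
  \<comment> \<open>Buckets by the integer parts of both distances. Within a bucket,
    \<open>close\<close> puts the two points of one candidate within \<open>K\<close> of those of
    another; in \<open>K\<close> the 1 is the rounding error, the rest comes from
    \<open>dist_near_geodesic\<close>.\<close>
  define bk where "bk w v i j = {x\<in>carrier G. near D x w \<and> near D (x \<otimes> v) w \<and> \<lfloor>dist x0 (\<phi> x x0)\<rfloor> = i \<and> \<lfloor>dist x0 (\<phi> (x \<otimes> v) x0)\<rfloor> = j}" for w v and i j :: int
  have bk: "finite (bk w v i j) \<and> card (bk w v i j) \<le> m" if v: "v \<in> \<Phi>" for w v i j
  proof (cases "bk w v i j = {}")
    case False
    then obtain x where x: "x \<in> bk w v i j" by blast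
    have vc: "v \<in> carrier G" using v Phi by blast
    have close: "dist (\<phi> a x0) (\<phi> b x0) \<le> K"
      if "near D a w" "near D b w" "\<lfloor>dist x0 (\<phi> a x0)\<rfloor> = \<lfloor>dist x0 (\<phi> b x0)\<rfloor>" for a b
    proof -
      obtain N1 where N1: "\<And>j. j \<ge> N1 \<Longrightarrow> gprod (\<phi> a x0) x0 (orb w j) \<le> D + \<delta>" using near_gprod[OF \<open>near D a w\<close>] by blast
      obtain N2 where N2: "\<And>j. j \<ge> N2 \<Longrightarrow> gprod (\<phi> b x0) x0 (orb w j) \<le> D + \<delta>" using near_gprod[OF \<open>near D b w\<close>] by blast
      have "\<bar>dist x0 (\<phi> a x0) - dist x0 (\<phi> b x0)\<bar> \<le> 1" using that(3) by linarith
      then have "dist (\<phi> a x0) (\<phi> b x0) \<le> 1 + 2 * (D + \<delta>) + 2 * \<delta>"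
        by (intro dist_near_geodesic[where x = x0 and y = "orb w (max N1 N2)"] N1 N2) auto
      then show ?thesis by (simp add: K_def)
    qed
    have sub: "bk w v i j \<subseteq> (\<lambda>z. x \<otimes> z) ` stabK G \<phi> K x0 (\<phi> v x0)"
    proof
      fix y assume y: "y \<in> bk w v i j"
      have xy: "x \<in> carrier G" "y \<in> carrier G" using x y by (auto simp: bk_def)
      have "dist (\<phi> x x0) (\<phi> y x0) \<le> K" using close[of x y] x y by (auto simp: bk_def)
      then have 1: "dist x0 (\<phi> (inv x \<otimes> y) x0) \<le> K"
        using dist_act_inv[OF xy(1), of x0 "\<phi> y x0"] xy by (simp add: act_mult)
      have "dist (\<phi> (x \<otimes> v) x0) (\<phi> (y \<otimes> v) x0) \<le> K" using close[of "x \<otimes> v" "y \<otimes> v"] x y by (auto simp: bk_def)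
      then have 2: "dist (\<phi> v x0) (\<phi> (inv x \<otimes> y) (\<phi> v x0)) \<le> K"
        using dist_act_inv[OF xy(1), of "\<phi> v x0" "\<phi> (y \<otimes> v) x0"] xy vc by (simp add: act_mult)
      have "inv x \<otimes> y \<in> stabK G \<phi> K x0 (\<phi> v x0)" using 1 2 xy by (simp add: stabK_def)
      moreover have "y = x \<otimes> (inv x \<otimes> y)" using xy by (simp add: m_assoc[symmetric])
      ultimately show "y \<in> (\<lambda>z. x \<otimes> z) ` stabK G \<phi> K x0 (\<phi> v x0)" by blast
    qed
    have fs: "finite (stabK G \<phi> K x0 (\<phi> v x0))" using st[OF v] by (simp add: K_def)
    have "card (bk w v i j) \<le> card (stabK G \<phi> K x0 (\<phi> v x0))"
      using card_mono[OF finite_imageI[OF fs] sub] card_image_le[OF fs, of "\<lambda>z. x \<otimes> z"] by linarith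
    then show ?thesis using finite_subset[OF sub finite_imageI[OF fs]] m[OF v] by simp
  qed simp
  have "finite {x. cand D \<Phi> x w \<and> \<bar>dist x0 (\<phi> x x0) - y\<bar> \<le> L} \<and>
     real (card {x. cand D \<Phi> x w \<and> \<bar>dist x0 (\<phi> x x0) - y\<bar> \<le> L}) \<le> real (card \<Phi> * m) * (2 * (L + s) + 3)\<^sup>2"
    if L: "0 \<le> L" for w y L
  proof -
    \<comment> \<open>Possible integer parts of both distances; \<open>s\<close> allows for the step
      from \<open>x\<close> to \<open>x \<otimes> v\<close>, and rounding is covered by the 3 in the
      count.\<close>
    define T where "T = {\<lfloor>y - (L + s)\<rfloor>..\<lfloor>y + (L + s)\<rfloor>}"
    have fT: "finite T" by (simp add: T_def)
    have cT: "real (card T) \<le> 2 * (L + s) + 3"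
    proof -
      have "real (card T) = real_of_int (\<lfloor>y + (L + s)\<rfloor> - \<lfloor>y - (L + s)\<rfloor> + 1)"
      proof -
        have "\<lfloor>y - (L + s)\<rfloor> \<le> \<lfloor>y + (L + s)\<rfloor>" using L s0 by (intro floor_mono) simp
        then show ?thesis by (simp add: T_def)
      qed
      moreover have "real_of_int \<lfloor>y + (L + s)\<rfloor> \<le> y + (L + s)" "y - (L + s) < real_of_int \<lfloor>y - (L + s)\<rfloor> + 1"
        using of_int_floor_le real_of_int_floor_add_one_gt by blast+
      ultimately show ?thesis unfolding of_int_add of_int_diff of_int_1 by argo
    qed
    have sub: "{x. cand D \<Phi> x w \<and> \<bar>dist x0 (\<phi> x x0) - y\<bar> \<le> L} \<subseteq> (\<Union>z\<in>\<Phi> \<times> T \<times> T. bk w (fst z) (fst (snd z)) (snd (snd z)))"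
    proof
      fix x assume "x \<in> {x. cand D \<Phi> x w \<and> \<bar>dist x0 (\<phi> x x0) - y\<bar> \<le> L}"
      then obtain v where v: "v \<in> \<Phi>" "near D x w" "near D (x \<otimes> v) w" and x: "x \<in> carrier G" "\<bar>dist x0 (\<phi> x x0) - y\<bar> \<le> L"
        by (auto simp: cand_def)
      have "dist (\<phi> x x0) (\<phi> (x \<otimes> v) x0) \<le> s"
        using s[OF v(1)] act_isometry[OF x(1), of x0 "\<phi> v x0"] v(1) Phi x(1) by (auto simp: act_mult)
      then have xv: "\<bar>dist x0 (\<phi> (x \<otimes> v) x0) - y\<bar> \<le> L + s"
        using x(2) dist_triangle[of x0 "\<phi> (x \<otimes> v) x0" "\<phi> x x0"] dist_triangle[of x0 "\<phi> x x0" "\<phi> (x \<otimes> v) x0"]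
        by (simp add: dist_commute abs_le_iff)
      have T: "\<lfloor>d\<rfloor> \<in> T" if "\<bar>d - y\<bar> \<le> L + s" for d
        unfolding T_def using that by (auto simp: abs_le_iff intro!: floor_mono)
      have "(v, \<lfloor>dist x0 (\<phi> x x0)\<rfloor>, \<lfloor>dist x0 (\<phi> (x \<otimes> v) x0)\<rfloor>) \<in> \<Phi> \<times> T \<times> T"
        using v(1) T[of "dist x0 (\<phi> x x0)"] T[OF xv] x(2) s0 by simp
      moreover have "x \<in> bk w v \<lfloor>dist x0 (\<phi> x x0)\<rfloor> \<lfloor>dist x0 (\<phi> (x \<otimes> v) x0)\<rfloor>" using x v by (simp add: bk_def)
      ultimately show "x \<in> (\<Union>z\<in>\<Phi> \<times> T \<times> T. bk w (fst z) (fst (snd z)) (snd (snd z)))" by force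
    qed
    have fU: "finite (\<Union>z\<in>\<Phi> \<times> T \<times> T. bk w (fst z) (fst (snd z)) (snd (snd z)))"
      using Phi fT bk by (intro finite_UN_I) auto
    have "card {x. cand D \<Phi> x w \<and> \<bar>dist x0 (\<phi> x x0) - y\<bar> \<le> L} \<le> card (\<Union>z\<in>\<Phi> \<times> T \<times> T. bk w (fst z) (fst (snd z)) (snd (snd z)))"
      by (rule card_mono[OF fU sub])
    also have "\<dots> \<le> (\<Sum>z\<in>\<Phi> \<times> T \<times> T. card (bk w (fst z) (fst (snd z)) (snd (snd z))))"
      using Phi fT by (intro card_UN_le) auto
    also have "\<dots> \<le> (\<Sum>z\<in>\<Phi> \<times> T \<times> T. m)" using bk by (intro sum_mono) auto
    also have "\<dots> = card \<Phi> * m * (card T)\<^sup>2" by (simp add: card_cartesian_product power2_eq_square)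
    finally have "real (card {x. cand D \<Phi> x w \<and> \<bar>dist x0 (\<phi> x x0) - y\<bar> \<le> L}) \<le> real (card \<Phi> * m * (card T)\<^sup>2)"
      by (rule of_nat_mono)
    also have "\<dots> = real (card \<Phi> * m) * (real (card T))\<^sup>2" by simp
    also have "\<dots> \<le> real (card \<Phi> * m) * (2 * (L + s) + 3)\<^sup>2"
      using cT by (intro mult_left_mono power_mono) auto
    finally show ?thesis using finite_subset[OF sub fU] by simp
  qed
  then show ?thesis using s0 by (intro exI[of _ "real (card \<Phi> * m)"] exI[of _ s]) auto
qed

end

section \<open>Total masses and lengths of codes\<close>

lemma nn_integral_prod_lists:
  assumes "(\<integral>\<^sup>+a. f a \<partial>count_space UNIV) \<le> 1"
  shows "(\<integral>\<^sup>+l. prod_list (map f l) \<partial>count_space {l. length l = n}) \<le> (1 :: ennreal)"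
proof (induction n)
  case 0
  have "{l :: 'a list. length l = 0} = {[]}" by auto
  then show ?case by (simp add: nn_integral_count_space_finite)
next
  case (Suc n)
  have "(\<integral>\<^sup>+l. prod_list (map f l) \<partial>count_space {l. length l = Suc n})
     = (\<integral>\<^sup>+a. f a * (\<integral>\<^sup>+l. prod_list (map f l) \<partial>count_space {l. length l = n}) \<partial>count_space UNIV)"
    by (simp add: nn_integral_lists_Suc nn_integral_cmult)
  also have "\<dots> \<le> (\<integral>\<^sup>+a. f a * 1 \<partial>count_space UNIV)"
    by (intro nn_integral_mono mult_left_mono Suc) simp
  finally show ?case using assms by simp
qed

lemma nn_integral_option:
  fixes f :: "'a option \<Rightarrow> ennreal"
  shows "(\<integral>\<^sup>+z. f z \<partial>count_space UNIV) = f None + (\<integral>\<^sup>+a. f (Some a) \<partial>count_space UNIV)"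
proof -
  have "(\<integral>\<^sup>+z. f z \<partial>count_space UNIV) = (\<integral>\<^sup>+z. f z * indicator {None} z + f z * indicator (range Some) z \<partial>count_space UNIV)"
  proof (intro nn_integral_cong)
    fix z show "f z = f z * indicator {None} z + f z * indicator (range Some) z" by (cases z) auto
  qed
  also have "\<dots> = (\<integral>\<^sup>+z. f z * indicator {None} z \<partial>count_space UNIV) + (\<integral>\<^sup>+z. f z * indicator (range Some) z \<partial>count_space UNIV)"
    by (rule nn_integral_add) auto
  also have "(\<integral>\<^sup>+z. f z * indicator {None} z \<partial>count_space UNIV) = f None" by simp
  also have "(\<integral>\<^sup>+z. f z * indicator (range Some) z \<partial>count_space UNIV) = (\<integral>\<^sup>+z. f z \<partial>count_space (range Some))"
    by (rule nn_integral_count_space_indicator[symmetric]) simp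
  also have "\<dots> = (\<integral>\<^sup>+a. f (Some a) \<partial>count_space UNIV)"
    by (rule nn_integral_bij_count_space[symmetric]) (auto simp: bij_betw_def)
  finally show ?thesis .
qed

text \<open>An equal mixture of a fixed law and of a choice in two stages: a record according to
  \<open>r\<close>, then weight \<open>1 / k\<close> for each of the at most \<open>k\<close>
  compatible values.\<close>

lemma code_mass:
  fixes p :: "'a::countable \<Rightarrow> ennreal" and r :: "'l::countable \<Rightarrow> ennreal"
  assumes p: "(\<integral>\<^sup>+x. p x \<partial>count_space UNIV) \<le> 1" and r: "(\<integral>\<^sup>+l. r l \<partial>count_space A) \<le> 1"
    and k: "0 < k" "\<And>l. finite {x. P l x}" "\<And>l. real (card {x. P l x}) \<le> k"
  shows "(\<integral>\<^sup>+x. ennreal (1/2) * p x + ennreal (1/2) * (\<integral>\<^sup>+l. r l * (if P l x then ennreal (1/k) else 0) \<partial>count_space A) \<partial>count_space UNIV) \<le> 1"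
proof -
  have "(\<integral>\<^sup>+x. \<integral>\<^sup>+l. r l * (if P l x then ennreal (1/k) else 0) \<partial>count_space A \<partial>count_space UNIV)
     = (\<integral>\<^sup>+l. \<integral>\<^sup>+x. r l * (if P l x then ennreal (1/k) else 0) \<partial>count_space UNIV \<partial>count_space A)"
    by (rule nn_integral_count_space_nn_integral) auto
  also have "\<dots> \<le> (\<integral>\<^sup>+l. r l * 1 \<partial>count_space A)"
  proof (rule nn_integral_mono)
    fix l
    have "(\<integral>\<^sup>+x. (if P l x then ennreal (1/k) else 0) \<partial>count_space UNIV) = (\<integral>\<^sup>+x. ennreal (1/k) * indicator {x. P l x} x \<partial>count_space UNIV)"
      by (intro nn_integral_cong) (simp add: indicator_def)
    also have "\<dots> = ennreal (1/k) * of_nat (card {x. P l x})"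
      using k(2) by (simp add: nn_integral_cmult_indicator)
    also have "\<dots> = ennreal (real (card {x. P l x}) / k)"
      using k(1) by (simp add: ennreal_of_nat_eq_real_of_nat ennreal_mult[symmetric])
    also have "\<dots> \<le> 1" using k(1) k(3)[of l] by simp
    finally have "(\<integral>\<^sup>+x. (if P l x then ennreal (1/k) else 0) \<partial>count_space UNIV) \<le> 1" .
    then have "r l * (\<integral>\<^sup>+x. (if P l x then ennreal (1/k) else 0) \<partial>count_space UNIV) \<le> r l * 1"
      by (rule mult_left_mono) simp
    then show "(\<integral>\<^sup>+x. r l * (if P l x then ennreal (1/k) else 0) \<partial>count_space UNIV) \<le> r l * 1"
      by (subst nn_integral_cmult) simp_all
  qed
  also have "\<dots> \<le> 1" using r by simp
  finally have b: "(\<integral>\<^sup>+x. \<integral>\<^sup>+l. r l * (if P l x then ennreal (1/k) else 0) \<partial>count_space A \<partial>count_space UNIV) \<le> 1" .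
  have "(\<integral>\<^sup>+x. ennreal (1/2) * p x + ennreal (1/2) * (\<integral>\<^sup>+l. r l * (if P l x then ennreal (1/k) else 0) \<partial>count_space A) \<partial>count_space UNIV)
     = ennreal (1/2) * (\<integral>\<^sup>+x. p x \<partial>count_space UNIV)
       + ennreal (1/2) * (\<integral>\<^sup>+x. \<integral>\<^sup>+l. r l * (if P l x then ennreal (1/k) else 0) \<partial>count_space A \<partial>count_space UNIV)"
    by (simp add: nn_integral_add nn_integral_cmult)
  also have "\<dots> \<le> ennreal (1/2) * 1 + ennreal (1/2) * 1" by (intro add_mono mult_left_mono p b) auto
  also have "\<dots> = ennreal (1/2 + 1/2)" by (subst ennreal_plus) auto
  also have "\<dots> = 1" by simp
  finally show ?thesis .
qed

text \<open>The argument of the logarithm is at most a constant times the square of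
  \<open>n\<close>, so the logarithm is o(n).\<close>

lemma log_bound_eventually:
  assumes c: "(c::real) > 0" and k: "0 \<le> a" "0 \<le> b" "0 \<le> s"
  shows "\<exists>n\<ge>1. ln 2 + ln (b * (2 * ((real n + 1) * a + s) + 3)\<^sup>2 + 1) \<le> c * real n"
proof -
  define C where "C = b * (2 * (a + s) + 3)\<^sup>2 + 1"
  have C: "C \<ge> 1" using k by (simp add: C_def)
  have "(\<lambda>n. (ln 2 + ln C + 2 * ln 2) / real n + 2 * (ln (real n) / real n)) \<longlonglongrightarrow> 0 + 2 * 0"
    by (intro tendsto_intros lim_const_over_n lim_ln_over_n)
  then have "\<forall>\<^sub>F n in sequentially. (ln 2 + ln C + 2 * ln 2) / real n + 2 * (ln (real n) / real n) < c"
    using c by (intro order_tendstoD) auto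
  then obtain n0 where n0: "\<And>n. n \<ge> n0 \<Longrightarrow> (ln 2 + ln C + 2 * ln 2) / real n + 2 * (ln (real n) / real n) < c"
    by (auto simp: eventually_sequentially)
  define n where "n = max 1 n0"
  have n: "n \<ge> 1" by (simp add: n_def)
  have "(ln 2 + ln C + 2 * ln 2 + 2 * ln (real n)) / real n < c"
    using n0[of n] by (simp add: n_def add_divide_distrib)
  then have up: "ln 2 + ln C + 2 * ln 2 + 2 * ln (real n) < c * real n" using n by (simp add: divide_less_eq)
  have "2 * ((real n + 1) * a + s) + 3 \<le> (real n + 1) * (2 * (a + s) + 3)"
    using k by (simp add: algebra_simps)
  then have "b * (2 * ((real n + 1) * a + s) + 3)\<^sup>2 + 1 \<le> b * ((real n + 1) * (2 * (a + s) + 3))\<^sup>2 + (real n + 1)\<^sup>2"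
    using k by (intro add_mono mult_left_mono power_mono) auto
  also have "\<dots> = C * (real n + 1)\<^sup>2" unfolding C_def power_mult_distrib by algebra
  also have "\<dots> \<le> C * (2 * real n)\<^sup>2" using C n by (intro mult_left_mono power_mono) auto
  finally have le: "b * (2 * ((real n + 1) * a + s) + 3)\<^sup>2 + 1 \<le> C * (2 * real n)\<^sup>2" .
  have "0 < b * (2 * ((real n + 1) * a + s) + 3)\<^sup>2 + 1" using k by (intro add_nonneg_pos) auto
  then have "ln (b * (2 * ((real n + 1) * a + s) + 3)\<^sup>2 + 1) \<le> ln (C * (2 * real n)\<^sup>2)"
    using le by (subst ln_le_cancel_iff) auto
  also have "\<dots> = ln C + 2 * ln 2 + 2 * ln (real n)"
    using C n ln_realpow[of "2 * real n" 2] by (simp only: ln_mult zero_less_power) (simp add: ln_mult)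
  finally show ?thesis using up n by (intro exI[of _ n]) simp
qed

section \<open>The code for the position and its mean cost\<close>

context rand_walk
begin

lemma W_mass_ge:
  "prod_list (map (\<lambda>g. ennreal (pmf \<mu> g)) (prefix n \<omega>)) \<le> emeasure (measure_pmf (W n)) {rw G \<omega> n}"
proof (induction n)
  case 0
  then show ?case by (simp add: prefix_def)
next
  case (Suc n)
  have "prod_list (map (\<lambda>g. ennreal (pmf \<mu> g)) (prefix (Suc n) \<omega>))
     = prod_list (map (\<lambda>g. ennreal (pmf \<mu> g)) (prefix n \<omega>)) * ennreal (pmf \<mu> (\<omega> n))"
    by (simp add: prefix_def)
  also have "\<dots> \<le> emeasure (measure_pmf (W n)) {rw G \<omega> n} * ennreal (pmf \<mu> (\<omega> n))"
    by (intro mult_right_mono Suc) simp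
  also have "\<dots> = (\<integral>\<^sup>+x. ennreal (pmf \<mu> (\<omega> n)) * indicator {rw G \<omega> n} x \<partial>measure_pmf (W n))"
    by (simp add: nn_integral_cmult_indicator mult.commute)
  also have "\<dots> \<le> (\<integral>\<^sup>+x. emeasure (measure_pmf (map_pmf (\<lambda>h. x \<otimes> h) \<mu>)) {rw G \<omega> (Suc n)} \<partial>measure_pmf (W n))"
  proof (rule nn_integral_mono)
    fix x
    have "emeasure (measure_pmf \<mu>) {\<omega> n} \<le> emeasure (measure_pmf \<mu>) ((\<lambda>h. rw G \<omega> n \<otimes> h) -` {rw G \<omega> (Suc n)})"
      by (intro emeasure_mono) auto
    moreover have "emeasure (measure_pmf (map_pmf (\<lambda>h. rw G \<omega> n \<otimes> h) \<mu>)) {rw G \<omega> (Suc n)}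
        = emeasure (measure_pmf \<mu>) ((\<lambda>h. rw G \<omega> n \<otimes> h) -` {rw G \<omega> (Suc n)})"
      by (rule emeasure_map_pmf)
    moreover have "emeasure (measure_pmf \<mu>) {\<omega> n} = ennreal (pmf \<mu> (\<omega> n))" by (rule emeasure_pmf_single)
    ultimately have "ennreal (pmf \<mu> (\<omega> n)) \<le> emeasure (measure_pmf (map_pmf (\<lambda>h. rw G \<omega> n \<otimes> h) \<mu>)) {rw G \<omega> (Suc n)}"
      by (simp only:)
    then show "ennreal (pmf \<mu> (\<omega> n)) * indicator {rw G \<omega> n} x \<le> emeasure (measure_pmf (map_pmf (\<lambda>h. x \<otimes> h) \<mu>)) {rw G \<omega> (Suc n)}"
      by (cases "x = rw G \<omega> n") (simp_all only: indicator_simps singleton_iff mult_1_right mult_zero_right zero_le if_True refl simp_thms)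
  qed
  also have "\<dots> = emeasure (measure_pmf (W (n + 1))) {rw G \<omega> (Suc n)}"
    unfolding W_add W_1 by (simp add: emeasure_bind_pmf)
  finally show ?case by simp
qed

text \<open>One path already contributes its probability to the mass of its end point. On the
  exceptional event this bounds the cost of the position by the information of the increments, to
  which uniform integrability applies.\<close>

lemma info_W_le:
  "info (emeasure (measure_pmf (W n)) {rw G \<omega> n}) \<le> (\<Sum>t<n. info (ennreal (pmf \<mu> (\<omega> t))))"
proof -
  have "info (emeasure (measure_pmf (W n)) {rw G \<omega> n}) \<le> info (prod_list (map (\<lambda>g. ennreal (pmf \<mu> g)) (prefix n \<omega>)))"
    by (intro info_antimono W_mass_ge measure_pmf.emeasure_le_1)
  also have "\<dots> = sum_list (map info (map (\<lambda>g. ennreal (pmf \<mu> g)) (prefix n \<omega>)))"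
    by (rule conjunct2[OF info_prod_list]) (auto simp: pmf_le_1)
  also have "\<dots> = (\<Sum>t<n. info (ennreal (pmf \<mu> (\<omega> t))))"
    by (simp add: prefix_def comp_def interv_sum_list_conv_sum_set_nat atLeast0LessThan)
  finally show ?thesis .
qed

text \<open>The law of one record entry: an increment is recorded with probability
  \<open>\<rho>\<close> and then follows \<open>\<mu>\<close>. A small \<open>\<rho>\<close> makes
  unrecorded steps cheap.\<close>

definition qs :: "real \<Rightarrow> 'g option \<Rightarrow> ennreal" where
  "qs \<rho> z = (case z of None \<Rightarrow> ennreal (1 - \<rho>) | Some g \<Rightarrow> ennreal \<rho> * ennreal (pmf \<mu> g))"

lemma qs_mass:
  assumes "0 \<le> \<rho>" "\<rho> \<le> 1"
  shows "(\<integral>\<^sup>+z. qs \<rho> z \<partial>count_space UNIV) \<le> 1" and "qs \<rho> z \<le> 1"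
proof -
  have "(\<integral>\<^sup>+g. ennreal (pmf \<mu> g) \<partial>count_space UNIV) = 1"
    by (simp add: nn_integral_pmf measure_pmf.emeasure_space_1)
  then show le: "(\<integral>\<^sup>+z. qs \<rho> z \<partial>count_space UNIV) \<le> 1"
    using assms by (simp add: nn_integral_option qs_def nn_integral_cmult flip: ennreal_plus)
  show "qs \<rho> z \<le> 1"
    using nn_integral_ge_point[of z UNIV "qs \<rho>"] le by (auto intro: order_trans)
qed

lemma info_recd:
  assumes r: "0 \<le> \<rho>" "\<rho> \<le> 1"
  shows "info (prod_list (map (qs \<rho>) (recd D R \<omega> 0 n)))
     \<le> (\<Sum>t<n. info (ennreal (1 - \<rho>)) + (if bad D R \<omega> t then info (ennreal \<rho>) + info (ennreal (pmf \<mu> (\<omega> t))) else 0))"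
proof -
  have "info (prod_list (map (qs \<rho>) (recd D R \<omega> 0 n))) = sum_list (map info (map (qs \<rho>) (recd D R \<omega> 0 n)))"
    by (rule conjunct2[OF info_prod_list]) (auto intro: qs_mass(2)[OF r])
  also have "\<dots> = (\<Sum>t<n. info (qs \<rho> (if bad D R \<omega> t then Some (\<omega> t) else None)))"
    by (simp add: recd_def comp_def interv_sum_list_conv_sum_set_nat atLeast0LessThan)
  also have "\<dots> \<le> (\<Sum>t<n. info (ennreal (1 - \<rho>)) + (if bad D R \<omega> t then info (ennreal \<rho>) + info (ennreal (pmf \<mu> (\<omega> t))) else 0))"
    by (intro sum_mono) (use r in \<open>auto simp: qs_def info_mult pmf_le_1\<close>)
  finally show ?thesis .
qed

lemma coord_sets: "{\<omega>. \<omega> t \<in> A} \<in> sets M"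
  using measurable_sets[OF measurable_iid_coord, of A t \<mu>] by (simp add: vimage_def)

lemma bad_sets: "{\<omega>. bad D R \<omega> t} \<in> sets M"
proof -
  have "{\<omega>. \<not> piv D \<omega> (Suc t)} \<union> {\<omega>. R < dist x0 (\<phi> (\<omega> t) x0)} \<in> sets M"
    using coord_sets[of t "{g. R < dist x0 (\<phi> g x0)}"] by (intro sets.Un not_piv_sets) simp
  moreover have "{\<omega>. bad D R \<omega> t} = {\<omega>. \<not> piv D \<omega> (Suc t)} \<union> {\<omega>. R < dist x0 (\<phi> (\<omega> t) x0)}"
    by (auto simp: bad_def)
  ultimately show ?thesis by simp
qed

lemma emeasure_coord: "emeasure M {\<omega>. \<omega> t \<in> A} = emeasure (measure_pmf \<mu>) A"
proof -
  have "emeasure M {\<omega>. \<omega> t \<in> A} = emeasure (distr M (count_space UNIV) (\<lambda>\<omega>. \<omega> t)) A"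
    by (subst emeasure_distr) (auto simp: vimage_def)
  then show ?thesis by (simp only: distr_coord)
qed

lemma shift_rw_sets: "{\<omega>. rw G (shift n \<omega>) m \<in> A} \<in> sets M"
proof -
  have "{\<omega>. rw G \<omega> m \<in> A} \<in> sets M" using pred_rw[of "\<lambda>x. x \<in> A" m] by (simp add: pred_def)
  from measurable_sets[OF measurable_shift this, of n] show ?thesis by (simp add: vimage_def)
qed

lemma emeasure_shift_rw: "emeasure M {\<omega>. rw G (shift n \<omega>) m \<in> A} = emeasure (measure_pmf (W m)) A"
proof -
  have s: "{\<omega>. rw G \<omega> m \<in> A} \<in> sets M" using pred_rw[of "\<lambda>x. x \<in> A" m] by (simp add: pred_def)
  have "emeasure M {\<omega>. rw G (shift n \<omega>) m \<in> A} = emeasure (distr M M (shift n)) {\<omega>. rw G \<omega> m \<in> A}"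
    by (subst emeasure_distr[OF measurable_shift s]) (simp add: vimage_def)
  then show ?thesis by (simp only: distr_shift emeasure_rw)
qed

text \<open>The first half encodes the position by its law and serves when the limit point does not
  locate it; the second half sums over all records, each sharing its weight among the compatible
  candidates. The path enters only through \<open>cand\<close>, an event of
  \<open>Bsig\<close>.\<close>

definition code :: "real \<Rightarrow> real \<Rightarrow> real \<Rightarrow> real \<Rightarrow> 'g set \<Rightarrow> nat \<Rightarrow> 'g \<Rightarrow> (nat \<Rightarrow> 'g) \<Rightarrow> ennreal" where
  "code D \<rho> L k \<Phi> n x w = ennreal (1/2) * emeasure (measure_pmf (W n)) {x} + ennreal (1/2) *
     (\<integral>\<^sup>+l. prod_list (map (qs \<rho>) l) * (if cand D \<Phi> x w \<and> \<bar>dist x0 (\<phi> x x0) - dr \<one> l\<bar> \<le> L then ennreal (1/k) else 0)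
        \<partial>count_space {l. length l = n})"

lemma code_measurable:
  assumes "finite \<Phi>"
  shows "code D \<rho> L k \<Phi> n x \<in> borel_measurable Bsig"
proof -
  have "(\<lambda>w. prod_list (map (qs \<rho>) l) * (if cand D \<Phi> x w \<and> \<bar>dist x0 (\<phi> x x0) - dr \<one> l\<bar> \<le> L then ennreal (1/k) else 0)) \<in> borel_measurable Bsig" for l
  proof (cases "\<bar>dist x0 (\<phi> x x0) - dr \<one> l\<bar> \<le> L")
    case True
    have "(\<lambda>w. if cand D \<Phi> x w then ennreal (1/k) else 0) \<in> borel_measurable Bsig"
      using cand_sets[OF assms] inv_alg_Bsig by (intro measurable_If) (auto simp: inv_alg_def)
    then show ?thesis using True by simp
  qed simp
  then have "(\<lambda>w. \<integral>\<^sup>+l. prod_list (map (qs \<rho>) l) * (if cand D \<Phi> x w \<and> \<bar>dist x0 (\<phi> x x0) - dr \<one> l\<bar> \<le> L then ennreal (1/k) else 0)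
        \<partial>count_space {l. length l = n}) \<in> borel_measurable Bsig"
    by (rule borel_measurable_nn_integral_count)
  then show ?thesis unfolding code_def[abs_def]
    by (rule borel_measurable_add[OF borel_measurable_const borel_measurable_times_ennreal[OF borel_measurable_const]])
qed

lemma code_mass_le:
  assumes r: "0 \<le> \<rho>" "\<rho> \<le> 1" and k: "0 < k"
    and fin: "\<And>y. finite {x. cand D \<Phi> x w \<and> \<bar>dist x0 (\<phi> x x0) - y\<bar> \<le> L}"
      "\<And>y. real (card {x. cand D \<Phi> x w \<and> \<bar>dist x0 (\<phi> x x0) - y\<bar> \<le> L}) \<le> k"
  shows "(\<integral>\<^sup>+x. code D \<rho> L k \<Phi> n x w \<partial>count_space UNIV) \<le> 1"
  unfolding code_def
proof (rule code_mass[where P = "\<lambda>l x. cand D \<Phi> x w \<and> \<bar>dist x0 (\<phi> x x0) - dr \<one> l\<bar> \<le> L"])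
  show "(\<integral>\<^sup>+x. emeasure (measure_pmf (W n)) {x} \<partial>count_space UNIV) \<le> 1"
    by (simp add: emeasure_pmf_single nn_integral_pmf measure_pmf.emeasure_space_1)
  show "(\<integral>\<^sup>+l. prod_list (map (qs \<rho>) l) \<partial>count_space {l. length l = n}) \<le> 1"
    by (rule nn_integral_prod_lists[OF qs_mass(1)[OF r]])
qed (use k fin in auto)

text \<open>Off this event the actual position is among the candidates for almost every
  path.\<close>

definition fail :: "real \<Rightarrow> 'g set \<Rightarrow> nat \<Rightarrow> nat \<Rightarrow> (nat \<Rightarrow> 'g) set" where
  "fail D \<Phi> m n = {\<omega>. \<not> piv D \<omega> n} \<union> {\<omega>. \<not> piv D \<omega> (n + m)} \<union> {\<omega>. rw G (shift n \<omega>) m \<in> - \<Phi>}"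

lemma fail_sets: "fail D \<Phi> m n \<in> sets M"
  unfolding fail_def by (intro sets.Un not_piv_sets shift_rw_sets)

text \<open>On \<open>fail\<close> the first half of the code is used, elsewhere the second half
  with the actual record. The bound is split by time steps so that each term can be integrated
  separately.\<close>

lemma info_code_le:
  fixes n :: nat
  assumes w: "inC \<omega>" "Conv (rw G \<omega>)" and D: "0 < D" and R: "0 \<le> R" and r: "0 \<le> \<rho>" "\<rho> \<le> 1" and k: "1 \<le> k"
    and L: "L = (real n + 1) * (2 * D + R)"
    and mass: "code (D + \<delta>) \<rho> L k \<Phi> n (rw G \<omega> n) (rw G \<omega>) \<le> 1"
  defines "X \<equiv> \<lambda>t. info (ennreal (pmf \<mu> (\<omega> t)))"
  shows "info (code (D + \<delta>) \<rho> L k \<Phi> n (rw G \<omega> n) (rw G \<omega>)) \<le> ennreal (ln 2 + ln k) +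
     (\<Sum>t<n. info (ennreal (1 - \<rho>)) + info (ennreal \<rho>) * indicator {\<omega>. bad D R \<omega> t} \<omega>
        + X t * indicator {\<omega>. bad D R \<omega> t} \<omega> + X t * indicator (fail D \<Phi> m n) \<omega>)"
proof -
  let ?q = "code (D + \<delta>) \<rho> L k \<Phi> n (rw G \<omega> n) (rw G \<omega>)"
  have half: "info (ennreal (1/2)) = ennreal (ln 2)" using info_ennreal[of "1/2"] by (simp add: ln_div)
  have h1: "ennreal (1/2) \<le> 1" by (simp only: ennreal_le_1)
  have lk: "ennreal (ln 2 + ln k) = ennreal (ln 2) + ennreal (ln k)" using k by (intro ennreal_plus) auto
  show ?thesis
  proof (cases "\<omega> \<in> fail D \<Phi> m n")
    case True
    let ?p = "emeasure (measure_pmf (W n)) {rw G \<omega> n}"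
    have p1: "?p \<le> 1" by (rule measure_pmf.emeasure_le_1)
    have "ennreal (1/2) * ?p \<le> ?q" by (simp add: code_def)
    then have "info ?q \<le> info (ennreal (1/2) * ?p)" by (rule info_antimono[OF _ mass])
    also have "\<dots> = ennreal (ln 2) + info ?p" by (simp only: info_mult[OF h1 p1] half)
    also have "\<dots> \<le> ennreal (ln 2 + ln k) + (\<Sum>t<n. X t)"
      unfolding X_def using k by (intro add_mono info_W_le ennreal_leI) auto
    also have "\<dots> \<le> ennreal (ln 2 + ln k) + (\<Sum>t<n. info (ennreal (1 - \<rho>)) + info (ennreal \<rho>) * indicator {\<omega>. bad D R \<omega> t} \<omega>
        + X t * indicator {\<omega>. bad D R \<omega> t} \<omega> + X t * indicator (fail D \<Phi> m n) \<omega>)"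
      using True by (intro add_left_mono sum_mono) simp
    finally show ?thesis .
  next
    case False
    define x where "x = rw G \<omega> n"
    define v where "v = rw G (shift n \<omega>) m"
    define l where "l = recd D R \<omega> 0 n"
    let ?r = "prod_list (map (qs \<rho>) l)"
    have pv: "piv D \<omega> n" "piv D \<omega> (n + m)" and v: "v \<in> \<Phi>" using False by (auto simp: fail_def v_def)
    have xv: "rw G \<omega> (n + m) = x \<otimes> v" unfolding x_def v_def by (rule rw_add[OF w(1)])
    have "near (D + \<delta>) x (rw G \<omega>)" "near (D + \<delta>) (x \<otimes> v) (rw G \<omega>)"
      using piv_near[OF w pv(1)] piv_near[OF w pv(2)] unfolding xv x_def by auto
    then have c: "cand (D + \<delta>) \<Phi> x (rw G \<omega>)" using v w(1) by (auto simp: cand_def x_def)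
    have d: "\<bar>dist x0 (\<phi> x x0) - dr \<one> l\<bar> \<le> L" unfolding x_def l_def L by (rule dr_recd[OF w(1) D R])
    have len: "length l = n" by (simp add: l_def recd_def)
    have r1: "?r \<le> 1" by (rule conjunct1[OF info_prod_list]) (auto intro: qs_mass(2)[OF r])
    have k1: "ennreal (1/k) \<le> 1" using k by simp
    have rk: "?r * ennreal (1/k) \<le> 1" using mult_mono[OF r1 k1] by simp
    have "?r * ennreal (1/k) \<le> (\<integral>\<^sup>+l. prod_list (map (qs \<rho>) l) * (if cand (D + \<delta>) \<Phi> x (rw G \<omega>) \<and> \<bar>dist x0 (\<phi> x x0) - dr \<one> l\<bar> \<le> L then ennreal (1/k) else 0)
        \<partial>count_space {l. length l = n})"
      using nn_integral_ge_point[of l "{l. length l = n}" "\<lambda>l. prod_list (map (qs \<rho>) l) * (if cand (D + \<delta>) \<Phi> x (rw G \<omega>) \<and> \<bar>dist x0 (\<phi> x x0) - dr \<one> l\<bar> \<le> L then ennreal (1/k) else 0)"]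
        c d len by simp
    then have "ennreal (1/2) * (?r * ennreal (1/k)) \<le> ?q"
      unfolding code_def x_def[symmetric] by (intro add_increasing mult_left_mono) auto
    then have "info ?q \<le> info (ennreal (1/2) * (?r * ennreal (1/k)))" by (rule info_antimono[OF _ mass])
    also have "\<dots> = ennreal (ln 2) + (info ?r + info (ennreal (1/k)))"
      by (simp only: info_mult[OF h1 rk] info_mult[OF r1 k1] half)
    also have "info (ennreal (1/k)) = ennreal (ln k)" using k info_ennreal[of "1/k"] by (simp add: ln_div)
    also have "ennreal (ln 2) + (info ?r + ennreal (ln k)) = ennreal (ln 2 + ln k) + info ?r"
      unfolding lk by (simp add: ac_simps)
    also have "\<dots> \<le> ennreal (ln 2 + ln k) + (\<Sum>t<n. info (ennreal (1 - \<rho>)) + (if bad D R \<omega> t then info (ennreal \<rho>) + X t else 0))"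
      unfolding l_def X_def by (intro add_left_mono info_recd[OF r])
    also have "\<dots> = ennreal (ln 2 + ln k) + (\<Sum>t<n. info (ennreal (1 - \<rho>)) + info (ennreal \<rho>) * indicator {\<omega>. bad D R \<omega> t} \<omega>
        + X t * indicator {\<omega>. bad D R \<omega> t} \<omega> + X t * indicator (fail D \<Phi> m n) \<omega>)"
      using False by (intro arg_cong[where f = "\<lambda>z. ennreal (ln 2 + ln k) + z"] sum.cong refl) (auto simp: indicator_def add.assoc)
    finally show ?thesis .
  qed
qed

lemma fail_likely:
  assumes D: "\<And>t. emeasure M {\<omega>. \<not> piv D \<omega> t} \<le> ennreal (e / 3)" and e: "0 < e"
    and Phi: "measure_pmf.prob (W m) (- \<Phi>) \<le> e / 3"
  shows "emeasure M (fail D \<Phi> m n) \<le> ennreal e"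
proof -
  have "emeasure M (fail D \<Phi> m n) \<le> emeasure M ({\<omega>. \<not> piv D \<omega> n} \<union> {\<omega>. \<not> piv D \<omega> (n + m)}) + emeasure M {\<omega>. rw G (shift n \<omega>) m \<in> - \<Phi>}"
    unfolding fail_def by (intro emeasure_subadditive sets.Un not_piv_sets shift_rw_sets)
  also have "\<dots> \<le> (emeasure M {\<omega>. \<not> piv D \<omega> n} + emeasure M {\<omega>. \<not> piv D \<omega> (n + m)}) + emeasure M {\<omega>. rw G (shift n \<omega>) m \<in> - \<Phi>}"
    by (intro add_right_mono emeasure_subadditive not_piv_sets)
  also have "\<dots> \<le> (ennreal (e / 3) + ennreal (e / 3)) + ennreal (e / 3)"
    unfolding emeasure_shift_rw measure_pmf.emeasure_eq_measure by (intro add_mono D ennreal_leI Phi)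
  also have "\<dots> = ennreal (e / 3 + e / 3 + e / 3)" using e by (simp flip: ennreal_plus)
  finally show ?thesis by simp
qed

lemma bad_likely:
  assumes D: "\<And>t. emeasure M {\<omega>. \<not> piv D \<omega> t} \<le> ennreal (e / 3)" and e: "0 < e"
    and R: "measure_pmf.prob \<mu> {g. dist x0 (\<phi> g x0) > R} \<le> e / 3"
  shows "emeasure M {\<omega>. bad D R \<omega> t} \<le> ennreal e"
proof -
  let ?F = "{\<omega>. \<omega> t \<in> {g. dist x0 (\<phi> g x0) > R}}"
  have "{\<omega>. bad D R \<omega> t} = {\<omega>. \<not> piv D \<omega> (Suc t)} \<union> ?F" by (auto simp: bad_def)
  then have "emeasure M {\<omega>. bad D R \<omega> t} \<le> emeasure M {\<omega>. \<not> piv D \<omega> (Suc t)} + emeasure M ?F"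
    using emeasure_subadditive[OF not_piv_sets[of D "Suc t"] coord_sets[of t "{g. dist x0 (\<phi> g x0) > R}"]] by simp
  also have "\<dots> \<le> ennreal (e / 3) + ennreal (e / 3)"
    unfolding emeasure_coord measure_pmf.emeasure_eq_measure by (intro add_mono D ennreal_leI R)
  also have "\<dots> = ennreal (e / 3 + e / 3)" using e by (simp flip: ennreal_plus)
  also have "\<dots> \<le> ennreal e" using e by (intro ennreal_leI) simp
  finally show ?thesis .
qed

text \<open>The stabilizer condition alone may leave infinitely many increments, while
  \<open>card_cand\<close> counts over a finite set; cutting down to a finite set that carries most
  of the law costs another \<open>e / 2\<close>.\<close>

lemma likely_stable_set:
  assumes wpd: "\<exists>g\<in>carrier G. WPD G \<phi> g" and e: "0 < e" and K: "0 \<le> K"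
  shows "\<exists>m \<Phi>. finite \<Phi> \<and> \<Phi> \<subseteq> carrier G \<and> (\<forall>v\<in>\<Phi>. finite (stabK G \<phi> K x0 (\<phi> v x0))) \<and>
    measure_pmf.prob (W m) (- \<Phi>) \<le> e"
proof -
  have e2: "e / 2 > 0" using e by simp
  obtain m where m: "measure_pmf.prob (W m) {v. infinite (stabK G \<phi> K x0 (\<phi> v x0))} \<le> e / 2"
    using stab_finite_likely[OF wpd e2 K] by blast
  obtain F where F: "finite F" "measure_pmf.prob (W m) (- F) \<le> e / 2"
    using pmf_finite_approx[OF e2, of "W m"] by blast
  define \<Phi> where "\<Phi> = {v\<in>F \<inter> carrier G. finite (stabK G \<phi> K x0 (\<phi> v x0))}"
  have "measure_pmf.prob (W m) (- \<Phi>) = measure_pmf.prob (W m) (- \<Phi> \<inter> set_pmf (W m))"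
    by (rule measure_Int_set_pmf[symmetric])
  also have "\<dots> \<le> measure_pmf.prob (W m) ({v. infinite (stabK G \<phi> K x0 (\<phi> v x0))} \<union> - F)"
    using W_carrier by (intro measure_pmf.finite_measure_mono) (auto simp: \<Phi>_def)
  also have "\<dots> \<le> measure_pmf.prob (W m) {v. infinite (stabK G \<phi> K x0 (\<phi> v x0))} + measure_pmf.prob (W m) (- F)"
    by (rule measure_Un_le) auto
  also have "\<dots> \<le> e" using m F(2) by simp
  finally have "measure_pmf.prob (W m) (- \<Phi>) \<le> e" .
  moreover have "finite \<Phi>" using F(1) by (simp add: \<Phi>_def)
  ultimately show ?thesis by (intro exI[of _ m] exI[of _ \<Phi>]) (auto simp: \<Phi>_def)
qed

text \<open>Order of the choices: \<open>\<rho>\<close> from \<open>c\<close>, then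
  \<open>e\<close>, then \<open>D\<close> and \<open>R\<close>, then \<open>m\<close> and
  \<open>\<Phi>\<close>, and \<open>n\<close> last, since all constants in the count of candidates
  are fixed before it. The four terms of each step cost at most \<open>c / 8\<close> each on
  average, the logarithm at most \<open>c / 4\<close> per step.\<close>

lemma code_exists:
  assumes wpd: "\<exists>g\<in>carrier G. WPD G \<phi> g" and ent: "finite_entropy \<mu>" and c: "(c::real) > 0"
  shows "\<exists>n q. n \<ge> 1 \<and> (\<forall>x. q x \<in> borel_measurable Bsig) \<and>
       (\<forall>w. (\<integral>\<^sup>+x. q x w \<partial>count_space UNIV) \<le> 1) \<and>
       (\<integral>\<^sup>+\<omega>. info (q (rw G \<omega> n) (rw G \<omega>)) \<partial>M) \<le> ennreal (c * real n)"
proof -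
  define X where "X g = info (ennreal (pmf \<mu> g))" for g
  \<comment> \<open>Chosen so that the entry for an unrecorded step costs exactly
    \<open>c / 8\<close>.\<close>
  define \<rho> where "\<rho> = 1 - exp (- (c / 8))"
  have \<rho>: "0 < \<rho>" "\<rho> \<le> 1" "0 \<le> \<rho>" "\<rho> < 1" using c by (auto simp: \<rho>_def)
  have i1: "info (ennreal (1 - \<rho>)) = ennreal (c / 8)" by (simp add: \<rho>_def info_ennreal)
  have i2: "info (ennreal \<rho>) = ennreal (- ln \<rho>)" using \<rho> by (simp add: info_ennreal)
  have ln\<rho>: "0 \<le> - ln \<rho>" using \<rho> by simp
  have c8: "c / 8 > 0" using c by simp
  have finX: "(\<integral>\<^sup>+g. X g \<partial>measure_pmf \<mu>) < top_class.top" using finite_entropy_info[OF ent] by (simp add: X_def)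
  obtain e2 where e2: "e2 > 0" and ui: "\<And>t E. E \<in> sets M \<Longrightarrow> emeasure M E \<le> ennreal e2 \<Longrightarrow>
     (\<integral>\<^sup>+\<omega>. X (\<omega> t) * indicator E \<omega> \<partial>M) \<le> ennreal (c / 8)"
    using iid_uniformly_integrable[OF finX c8] by blast
  \<comment> \<open>Small enough for uniform integrability and for the overhead
    \<open>- ln \<rho>\<close> of recorded steps; the added 1 keeps the denominator
    positive.\<close>
  define e where "e = min e2 (c / 8 / (- ln \<rho> + 1))"
  have e: "e > 0" using e2 c8 ln\<rho> by (simp add: e_def)
  have ee2: "ennreal e \<le> ennreal e2" by (intro ennreal_leI) (simp add: e_def)
  have el: "- ln \<rho> * e \<le> c / 8"
  proof -
    have "- ln \<rho> * e \<le> (- ln \<rho> + 1) * (c / 8 / (- ln \<rho> + 1))"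
      using ln\<rho> e by (intro mult_mono) (auto simp: e_def)
    also have "\<dots> = c / 8" using ln\<rho> by (subst nonzero_mult_div_cancel_left[symmetric, of "- ln \<rho> + 1" "c / 8"]) auto
    finally show ?thesis .
  qed
  have e3: "e / 3 > 0" using e by simp
  obtain D where D: "D > 0" "\<And>t. emeasure M {\<omega>. \<not> piv D \<omega> t} \<le> ennreal (e / 3)"
    using piv_likely[OF e3] by blast
  obtain R where R: "R \<ge> 0" "measure_pmf.prob \<mu> {g. dist x0 (\<phi> g x0) > R} \<le> e / 3"
    using pmf_tail[OF e3, of 0 \<mu> "\<lambda>g. dist x0 (\<phi> g x0)"] by blast
  define D1 where "D1 = D + \<delta>"
  \<comment> \<open>The constant for which \<open>card_cand\<close> asks, with \<open>D1\<close> in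
    place of \<open>D\<close> because \<open>piv_near\<close> loses \<open>\<delta>\<close>.\<close>
  define K where "K = 1 + 2 * (D1 + \<delta>) + 2 * \<delta>"
  have K: "K \<ge> 0" using D(1) delta_nonneg by (simp add: K_def D1_def)
  obtain m \<Phi> where Phi: "finite \<Phi>" "\<Phi> \<subseteq> carrier G" "\<And>v. v \<in> \<Phi> \<Longrightarrow> finite (stabK G \<phi> K x0 (\<phi> v x0))"
    "measure_pmf.prob (W m) (- \<Phi>) \<le> e / 3"
    using likely_stable_set[OF wpd e3 K] by blast
  obtain b s where b: "0 \<le> b" "0 \<le> s" and card: "\<And>w y L. 0 \<le> L \<Longrightarrow>
     finite {x. cand D1 \<Phi> x w \<and> \<bar>dist x0 (\<phi> x x0) - y\<bar> \<le> L} \<and>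
     real (card {x. cand D1 \<Phi> x w \<and> \<bar>dist x0 (\<phi> x x0) - y\<bar> \<le> L}) \<le> b * (2 * (L + s) + 3)\<^sup>2"
    using card_cand[OF Phi(1,2), of D1] Phi(3) unfolding K_def by blast
  define a where "a = 2 * D + R"
  have a: "a \<ge> 0" using D(1) R(1) by (simp add: a_def)
  have c4: "c / 4 > 0" using c by simp
  obtain n where n: "n \<ge> 1" "ln 2 + ln (b * (2 * ((real n + 1) * a + s) + 3)\<^sup>2 + 1) \<le> c / 4 * real n"
    using log_bound_eventually[OF c4 a b] by blast
  define L where "L = (real n + 1) * (2 * D + R)"
  have L: "L \<ge> 0" using a by (simp add: L_def a_def)
  define k where "k = b * (2 * (L + s) + 3)\<^sup>2 + 1"
  have k: "1 \<le> k" "0 < k" using b by (auto simp: k_def intro: add_nonneg_pos)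
  have kn: "ln 2 + ln k \<le> c / 4 * real n" using n(2) by (simp add: k_def L_def a_def)
  define q where "q = code D1 \<rho> L k \<Phi> n"
  have meas: "q x \<in> borel_measurable Bsig" for x unfolding q_def by (rule code_measurable[OF Phi(1)])
  have mass: "(\<integral>\<^sup>+x. q x w \<partial>count_space UNIV) \<le> 1" for w
    unfolding q_def
  proof (rule code_mass_le[OF \<rho>(3,2) k(2)])
    fix y
    show "finite {x. cand D1 \<Phi> x w \<and> \<bar>dist x0 (\<phi> x x0) - y\<bar> \<le> L}" using card[OF L] by blast
    have "real (card {x. cand D1 \<Phi> x w \<and> \<bar>dist x0 (\<phi> x x0) - y\<bar> \<le> L}) \<le> b * (2 * (L + s) + 3)\<^sup>2" using card[OF L] by blast
    then show "real (card {x. cand D1 \<Phi> x w \<and> \<bar>dist x0 (\<phi> x x0) - y\<bar> \<le> L}) \<le> k" by (simp add: k_def)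
  qed
  have q1: "q x w \<le> 1" for x w
    using nn_integral_ge_point[of x UNIV "\<lambda>x. q x w"] mass[of w] by (auto intro: order_trans)
  let ?B = "\<lambda>t. {\<omega>. bad D R \<omega> t}" and ?F = "fail D \<Phi> m n"
  let ?h = "\<lambda>t \<omega>. ennreal (c / 8) + ennreal (- ln \<rho>) * indicator (?B t) \<omega> + X (\<omega> t) * indicator (?B t) \<omega> + X (\<omega> t) * indicator ?F \<omega>"
  have mX [measurable]: "(\<lambda>\<omega>. X (\<omega> t)) \<in> borel_measurable M" for t
    by (rule measurable_compose[OF measurable_iid_coord]) simp
  have [measurable]: "?B t \<in> sets M" for t by (rule bad_sets)
  have [measurable]: "?F \<in> sets M" by (rule fail_sets)
  interpret P: prob_space M by (rule prob_space_M)
  have hb: "(\<integral>\<^sup>+\<omega>. ?h t \<omega> \<partial>M) \<le> ennreal (c / 2)" for t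
  proof -
    have "(\<integral>\<^sup>+\<omega>. ?h t \<omega> \<partial>M) = ennreal (c / 8) + ennreal (- ln \<rho>) * emeasure M (?B t)
        + (\<integral>\<^sup>+\<omega>. X (\<omega> t) * indicator (?B t) \<omega> \<partial>M) + (\<integral>\<^sup>+\<omega>. X (\<omega> t) * indicator ?F \<omega> \<partial>M)"
      using P.emeasure_space_1 by (simp add: nn_integral_add nn_integral_cmult_indicator)
    also have "\<dots> \<le> ennreal (c / 8) + ennreal (- ln \<rho>) * ennreal e + ennreal (c / 8) + ennreal (c / 8)"
    proof (intro add_mono mult_left_mono order_refl ui)
      show "emeasure M (?B t) \<le> ennreal e" by (rule bad_likely[OF D(2) e R(2)])
      then show "emeasure M (?B t) \<le> ennreal e2" using ee2 by (rule order_trans)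
      show "emeasure M ?F \<le> ennreal e2" by (rule order_trans[OF fail_likely[OF D(2) e Phi(4)] ee2])
    qed auto
    also have "\<dots> = ennreal (c / 8 + - ln \<rho> * e + c / 8 + c / 8)"
    proof -
      have "0 \<le> - ln \<rho> * e" using ln\<rho> e by (intro mult_nonneg_nonneg) auto
      then show ?thesis using c8 ln\<rho> e by (subst ennreal_mult[symmetric]) (auto simp flip: ennreal_plus)
    qed
    also have "\<dots> \<le> ennreal (c / 2)" using el by (intro ennreal_leI) simp
    finally show ?thesis .
  qed
  have "(\<integral>\<^sup>+\<omega>. info (q (rw G \<omega> n) (rw G \<omega>)) \<partial>M) \<le> (\<integral>\<^sup>+\<omega>. ennreal (ln 2 + ln k) + (\<Sum>t<n. ?h t \<omega>) \<partial>M)"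
  proof (rule nn_integral_mono_AE, use AE_inC AE_Conv in eventually_elim)
    fix \<omega> assume w: "inC \<omega>" "Conv (rw G \<omega>)"
    show "info (q (rw G \<omega> n) (rw G \<omega>)) \<le> ennreal (ln 2 + ln k) + (\<Sum>t<n. ?h t \<omega>)"
      using info_code_le[OF w D(1) R(1) \<rho>(3,2) k(1) L_def, of \<Phi> m] q1 unfolding q_def D1_def X_def i1 i2 by blast
  qed
  also have "\<dots> = ennreal (ln 2 + ln k) + (\<Sum>t<n. \<integral>\<^sup>+\<omega>. ?h t \<omega> \<partial>M)"
    using P.emeasure_space_1 by (subst nn_integral_add) (auto simp: nn_integral_sum)
  also have "\<dots> \<le> ennreal (ln 2 + ln k) + (\<Sum>t<n. ennreal (c / 2))"
    by (intro add_left_mono sum_mono hb)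
  also have "\<dots> = ennreal (ln 2 + ln k + real n * (c / 2))"
    using k c by (simp add: ennreal_of_nat_eq_real_of_nat ennreal_mult[symmetric])
  also have "\<dots> \<le> ennreal (c * real n)"
  proof (rule ennreal_leI)
    have "0 \<le> c * real n" using c by simp
    then show "ln 2 + ln k + real n * (c / 2) \<le> c * real n" using kn by (simp add: mult.commute)
  qed
  finally show ?thesis using n(1) meas mass by blast
qed

text \<open>An invariant event agrees almost surely with one of \<open>Bsig\<close> by the entropy
  criterion, and \<open>Bsig_boundary\<close> writes the latter as the preimage of a Borel set
  wherever a good path converges; both exceptions are null.\<close>

theorem poisson_limit_map_bnd:
  assumes wpd: "\<exists>g\<in>carrier G. WPD G \<phi> g" and ent: "finite_entropy \<mu>"
  shows "poisson_limit_map G \<phi> \<mu> x0 bnd"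
proof -
  let ?P = "path_measure G \<mu>"
  have P: "?P = distr M N (rw G)" by (rule path_measure_eq)
  have ae: "(AE w in ?P. Q w) \<longleftrightarrow> (AE \<omega> in M. Q (rw G \<omega>))" if "{w. Q w} \<in> sets N" for Q
    unfolding P using that by (subst AE_distr_iff) auto
  have "bnd \<in> ?P \<rightarrow>\<^sub>M bborel x0" using bnd_measurable by (simp add: P)
  then have m: "bnd \<in> completion ?P \<rightarrow>\<^sub>M bborel x0" by (rule measurable_completion)
  have "AE w in ?P. Conv w" using ae[OF Conv_sets] AE_Conv by blast
  then have conv: "AE w in ?P. converges_to x0 (\<lambda>n. \<phi> (w n) x0) (bnd w)"
  proof eventually_elim
    fix w assume "Conv w"
    then show "converges_to x0 (\<lambda>n. \<phi> (w n) x0) (bnd w)"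
      using Conv_converges by (simp add: bnd_def orb_def)
  qed
  have "\<exists>B\<in>sets (bborel x0). emeasure (completion ?P) ((A - bnd -` B) \<union> ((bnd -` B \<inter> space ?P) - A)) = 0"
    if A: "A \<in> sets ?P" and inv: "(\<lambda>w. w \<circ> Suc) -` A = A" for A
  proof -
    have "A \<in> sets Isig" using A inv by (auto simp: sets_Isig sets_path)
    then obtain E where E: "E \<in> sets Bsig" "AE \<omega> in M. rw G \<omega> \<in> A \<longleftrightarrow> rw G \<omega> \<in> E"
      using entropy_criterion[OF inv_alg_Bsig inv_alg_Isig Bsig_Isig ent code_exists[OF wpd ent]] by blast
    obtain B where B: "B \<in> sets (bborel x0)" and BE: "\<forall>w. good w \<longrightarrow> Conv w \<longrightarrow> (w \<in> E \<longleftrightarrow> bclass x0 (orb w) \<in> B)"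
      using Bsig_boundary[OF E(1)] by blast
    define S where "S = (A - bnd -` B) \<union> ((bnd -` B \<inter> space ?P) - A)"
    have mB: "bnd -` B \<inter> space N \<in> sets N" by (rule measurable_sets[OF bnd_measurable B])
    have A': "A \<in> sets N" using A by (simp add: sets_path)
    have "S = (A - (bnd -` B \<inter> space N)) \<union> ((bnd -` B \<inter> space N) - A)" by (auto simp: S_def space_path)
    then have S: "S \<in> sets N" using A' mB by (simp only: sets.Diff sets.Un)
    have "AE \<omega> in M. rw G \<omega> \<notin> S"
      using E(2) AE_Conv AE_inC
    proof eventually_elim
      fix \<omega> assume e: "rw G \<omega> \<in> A \<longleftrightarrow> rw G \<omega> \<in> E" and c: "Conv (rw G \<omega>)" and w: "inC \<omega>"
      have "rw G \<omega> \<in> E \<longleftrightarrow> bnd (rw G \<omega>) \<in> B" using BE inC_good[OF w] c by (simp add: bnd_def)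
      then show "rw G \<omega> \<notin> S" using e by (simp add: S_def)
    qed
    moreover have "{w. w \<notin> S} \<in> sets N" using sets.compl_sets[OF S] by (simp add: set_diff_eq)
    ultimately have "AE w in ?P. w \<notin> S" using ae[of "\<lambda>w. w \<notin> S"] by blast
    then have "S \<in> null_sets ?P" using S by (subst (asm) AE_iff_null_sets[symmetric]) (auto simp: sets_path)
    then have "emeasure (completion ?P) S = 0"
      using null_setsD1[OF null_sets_completionI] by blast
    then show ?thesis using B unfolding S_def by blast
  qed
  then show ?thesis using m conv by (simp add: poisson_limit_map_def Let_def)
qed

end

theorem theorem1p2:
  fixes G :: "('g::countable, 'b) monoid_scheme" (structure)
    and \<phi> :: "'g \<Rightarrow> 'x::metric_space \<Rightarrow> 'x"
    and \<mu> :: "'g pmf"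
    and x0 :: 'x
  assumes "group G"
    and "countable (carrier G)"
    and "geodesic_space (UNIV :: 'x set)"
    and "gromov_hyperbolic (UNIV :: 'x set)"
    and "isometric_action G \<phi>"
    and "non_elementary G \<phi> x0"
    and "\<exists>g\<in>carrier G. WPD G \<phi> g"
    and "set_pmf \<mu> \<subseteq> carrier G"
    and "generating G \<mu>"
    and "finite_entropy \<mu>"
  shows "\<exists>bnd. poisson_limit_map G \<phi> \<mu> x0 bnd"
proof -
  obtain \<delta> where d: "\<delta> \<ge> 0" "\<And>w x y z :: 'x. min (gprod w x y) (gprod w y z) - \<delta> \<le> gprod w x z"
    using assms(4) unfolding gromov_hyperbolic_def by auto
  interpret rand_walk \<delta> x0 G \<phi> \<mu>
    using assms d by (auto intro!: rand_walk.intro hyp_action.intro hyp_space.intro rand_walk_axioms.intro hyp_action_axioms.intro)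
  show ?thesis using poisson_limit_map_bnd[OF assms(7,10)] by blast
qed

end
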